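(* Let $X=\mathbb D^2$ be the closed two-dimensional disk. Then the space $\mathscr M(X)$ is contractible.
   Context: For a smooth Riemannian metric $h$ on $X$, let $R_h$ be the scalar curvature (twice the Gauss curvature), $\eta$ the outward-pointing unit normal along $\partial X$, and $H_h$ the mean curvature of $\partial X$ with respect to $\eta$ (here: the geodesic curvature of the boundary, positive for the Euclidean unit disk). Let $\lambda_1=\lambda_1^{(h)}$ be the principal eigenvalue of $-\Delta_hu+\frac12R_hu=\lambda u$ on $X$, $\partial_\eta u+H_hu=0$ on $\partial X$, i.e. $$\lambda_1=\inf_{u\ne0}\frac{\int_X\big(|\nabla_X u|^2+\frac12R_hu^2\big)\,\mathrm{dvol}_h+\int_{\partial X}H_hu^2\,\mathrm{dvol}^\partial_h}{\int_Xu^2\,\mathrm{dvol}_h},$$ where $\mathrm{dvol}_h$ is the area element of $h$ and $\mathrm{dvol}_h^\partial$ the induced length element on $\partial X$. $\mathscr M(X)$ is the set of smooth Riemannian metrics $h$ on $X$ with $\lambda_1^{(h)}>0$, a topological subspace of the space of all smooth Riemannian metrics on $X$ (with the $C^\infty$ topology). *)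

theory Defs
  imports "HOL-Analysis.Analysis"
begin

section \<open>Smooth functions on the closed disk\<close>

abbreviation disk :: "(real^2) set" where
  "disk \<equiv> cball 0 1"

text \<open>
  All derivatives are Frechet derivatives relative to the closed disk. The disk is convex with
  non-empty interior, so these are unique at every point, boundary points included, and they
  depend only on the values of the function on the disk.
\<close>

definition partial :: "2 \<Rightarrow> (real^2 \<Rightarrow> real) \<Rightarrow> real^2 \<Rightarrow> real" where
  "partial i f x = frechet_derivative f (at x within disk) (axis i 1)"

definition partials :: "2 list \<Rightarrow> (real^2 \<Rightarrow> real) \<Rightarrow> real^2 \<Rightarrow> real" where
  "partials is f = foldr partial is f"

text \<open>
  Smoothness up to the boundary: the iterated partial derivatives of every order exist and are
  differentiable (hence continuous) on the closed disk. By the Whitney extension theorem these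
  are exactly the restrictions to the disk of smooth functions on the plane.
\<close>

definition smooth_on_disk :: "(real^2 \<Rightarrow> real) \<Rightarrow> bool" where
  "smooth_on_disk f \<longleftrightarrow> (\<forall>is. \<forall>x\<in>disk. partials is f differentiable (at x within disk))"

section \<open>Riemannian metrics and the smooth topology\<close>

text \<open>
  A metric is given by its matrix in the standard coordinates of the plane. Values outside the
  disk carry no information and are fixed by \<^const>\<open>extensional\<close>, so that distinct
  elements are distinct metrics.
\<close>

type_synonym metric_field = "real^2 \<Rightarrow> real^2^2"

definition riemannian_metrics :: "metric_field set" where
  "riemannian_metrics = {h \<in> extensional disk.
     (\<forall>i j. smooth_on_disk (\<lambda>x. h x $ i $ j)) \<and>
     (\<forall>x\<in>disk. transpose (h x) = h x \<and> (\<forall>v. v \<noteq> 0 \<longrightarrow> 0 < v \<bullet> (h x *v v)))}"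

definition Ck_close :: "nat \<Rightarrow> real \<Rightarrow> metric_field \<Rightarrow> metric_field \<Rightarrow> bool" where
  "Ck_close k e g h \<longleftrightarrow> (\<forall>is i j. \<forall>x\<in>disk. length is \<le> k \<longrightarrow>
     \<bar>partials is (\<lambda>x. g x $ i $ j) x - partials is (\<lambda>x. h x $ i $ j) x\<bar> < e)"

definition Cinf_open :: "metric_field set \<Rightarrow> bool" where
  "Cinf_open U \<longleftrightarrow> U \<subseteq> riemannian_metrics \<and>
     (\<forall>g\<in>U. \<exists>k. \<exists>e>0. \<forall>h\<in>riemannian_metrics. Ck_close k e g h \<longrightarrow> h \<in> U)"

definition metrics_topology :: "metric_field topology" where
  "metrics_topology = topology Cinf_open"

lemma Ck_close_mono:
  "Ck_close k e g h \<Longrightarrow> k' \<le> k \<Longrightarrow> e \<le> e' \<Longrightarrow> Ck_close k' e' g h"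
  unfolding Ck_close_def by (meson less_le_trans order_trans)

lemma istopology_Cinf_open: "istopology Cinf_open"
  unfolding istopology_def
proof (intro conjI allI impI)
  fix S T assume S: "Cinf_open S" and T: "Cinf_open T"
  show "Cinf_open (S \<inter> T)"
    unfolding Cinf_open_def
  proof (intro conjI ballI)
    show "S \<inter> T \<subseteq> riemannian_metrics" using S by (auto simp: Cinf_open_def)
  next
    fix g assume g: "g \<in> S \<inter> T"
    obtain k e where 1: "e > 0" "\<forall>h\<in>riemannian_metrics. Ck_close k e g h \<longrightarrow> h \<in> S"
      using S g unfolding Cinf_open_def by blast
    obtain k' e' where 2: "e' > 0" "\<forall>h\<in>riemannian_metrics. Ck_close k' e' g h \<longrightarrow> h \<in> T"
      using T g unfolding Cinf_open_def by blast
    have "\<forall>h\<in>riemannian_metrics. Ck_close (max k k') (min e e') g h \<longrightarrow> h \<in> S \<inter> T"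
      using 1 2 Ck_close_mono[of "max k k'" "min e e'" g _ k e]
        Ck_close_mono[of "max k k'" "min e e'" g _ k' e'] by auto
    then show "\<exists>k. \<exists>e>0. \<forall>h\<in>riemannian_metrics. Ck_close k e g h \<longrightarrow> h \<in> S \<inter> T"
      using 1(1) 2(1) by (metis min_less_iff_conj)
  qed
next
  fix K assume K: "\<forall>U\<in>K. Cinf_open U"
  show "Cinf_open (\<Union>K)"
    unfolding Cinf_open_def
  proof (intro conjI ballI)
    show "\<Union>K \<subseteq> riemannian_metrics" using K by (auto simp: Cinf_open_def)
  next
    fix g assume "g \<in> \<Union>K"
    then obtain U where U: "U \<in> K" "g \<in> U" by blast
    then obtain k e where "e > 0" "\<forall>h\<in>riemannian_metrics. Ck_close k e g h \<longrightarrow> h \<in> U"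
      using K unfolding Cinf_open_def by meson
    then show "\<exists>k. \<exists>e>0. \<forall>h\<in>riemannian_metrics. Ck_close k e g h \<longrightarrow> h \<in> \<Union>K"
      using U(1) by blast
  qed
qed

lemma openin_metrics_topology: "openin metrics_topology = Cinf_open"
  by (simp add: metrics_topology_def istopology_Cinf_open)

lemma topspace_metrics_topology: "topspace metrics_topology = riemannian_metrics"
proof -
  have "Cinf_open riemannian_metrics"
    unfolding Cinf_open_def using zero_less_one by blast
  moreover have "U \<subseteq> riemannian_metrics" if "Cinf_open U" for U
    using that by (simp add: Cinf_open_def)
  ultimately show ?thesis
    unfolding topspace_def openin_metrics_topology by blast
qed

section \<open>Curvature\<close>

definition cometric :: "metric_field \<Rightarrow> metric_field" where
  "cometric h x = matrix_inv (h x)"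

text \<open>\<open>christoffel h k i j\<close> is $\Gamma^k_{ij}$.\<close>

definition christoffel :: "metric_field \<Rightarrow> 2 \<Rightarrow> 2 \<Rightarrow> 2 \<Rightarrow> real^2 \<Rightarrow> real" where
  "christoffel h k i j x = (1/2) * (\<Sum>l\<in>UNIV. cometric h x $ k $ l *
     (partial i (\<lambda>y. h y $ j $ l) x + partial j (\<lambda>y. h y $ i $ l) x
      - partial l (\<lambda>y. h y $ i $ j) x))"

definition ricci :: "metric_field \<Rightarrow> 2 \<Rightarrow> 2 \<Rightarrow> real^2 \<Rightarrow> real" where
  "ricci h i j x =
     (\<Sum>l\<in>UNIV. partial l (christoffel h l i j) x)
   - (\<Sum>l\<in>UNIV. partial j (christoffel h l i l) x)
   + (\<Sum>l\<in>UNIV. \<Sum>m\<in>UNIV. christoffel h m i j x * christoffel h l l m x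
                           - christoffel h m i l x * christoffel h l j m x)"

definition scalar_curvature :: "metric_field \<Rightarrow> real^2 \<Rightarrow> real" where
  "scalar_curvature h x = (\<Sum>i\<in>UNIV. \<Sum>j\<in>UNIV. cometric h x $ i $ j * ricci h i j x)"

definition inner_at :: "metric_field \<Rightarrow> real^2 \<Rightarrow> real^2 \<Rightarrow> real^2 \<Rightarrow> real" where
  "inner_at h x v w = v \<bullet> (h x *v w)"

section \<open>The boundary circle\<close>

definition circ :: "real \<Rightarrow> real^2" where
  "circ t = vector [cos t, sin t]"

definition circ' :: "real \<Rightarrow> real^2" where
  "circ' t = vector [- sin t, cos t]"

text \<open>
  At a boundary point \<open>p\<close> the covector with components \<open>p\<close> is the differential of
  $|x|^2/2$. Its \<open>h\<close>-dual is therefore \<open>h\<close>-orthogonal to the boundary and points outward.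
\<close>

definition outward_normal :: "metric_field \<Rightarrow> real^2 \<Rightarrow> real^2" where
  "outward_normal h p = (1 / sqrt (p \<bullet> (cometric h p *v p))) *\<^sub>R (cometric h p *v p)"

text \<open>
  The covariant acceleration of the curve \<^const>\<open>circ\<close>; its second coordinate derivative
  is \<open>- circ t\<close>.
\<close>

definition circ_acceleration :: "metric_field \<Rightarrow> real \<Rightarrow> real^2" where
  "circ_acceleration h t = (\<chi> k. - (circ t $ k) + (\<Sum>i\<in>UNIV. \<Sum>j\<in>UNIV.
     christoffel h k i j (circ t) * circ' t $ i * circ' t $ j))"

text \<open>
  The geodesic curvature of the boundary at \<open>circ t\<close>, that is
  $-h(\nabla_\tau\tau,\eta)$ for the unit tangent $\tau$. It is written in terms of the tangent
  \<^const>\<open>circ'\<close>, which need not have unit length for \<open>h\<close>: hence the division. The sign makes it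
  equal to 1 for the Euclidean metric.
\<close>

definition mean_curvature :: "metric_field \<Rightarrow> real \<Rightarrow> real" where
  "mean_curvature h t =
     - inner_at h (circ t) (circ_acceleration h t) (outward_normal h (circ t))
       / inner_at h (circ t) (circ' t) (circ' t)"

section \<open>The first eigenvalue\<close>

definition grad_norm2 :: "metric_field \<Rightarrow> (real^2 \<Rightarrow> real) \<Rightarrow> real^2 \<Rightarrow> real" where
  "grad_norm2 h u x =
     (\<Sum>i\<in>UNIV. \<Sum>j\<in>UNIV. cometric h x $ i $ j * partial i u x * partial j u x)"

definition area_integral :: "metric_field \<Rightarrow> (real^2 \<Rightarrow> real) \<Rightarrow> real" where
  "area_integral h f = (LINT x:disk|lborel. f x * sqrt (det (h x)))"

text \<open>The integrand is a function of the angle.\<close>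

definition boundary_integral :: "metric_field \<Rightarrow> (real \<Rightarrow> real) \<Rightarrow> real" where
  "boundary_integral h f =
     (LINT t:{0..2*pi}|lborel. f t * sqrt (inner_at h (circ t) (circ' t) (circ' t)))"

definition energy :: "metric_field \<Rightarrow> (real^2 \<Rightarrow> real) \<Rightarrow> real" where
  "energy h u =
     area_integral h (\<lambda>x. grad_norm2 h u x + (1/2) * scalar_curvature h x * (u x)^2)
   + boundary_integral h (\<lambda>t. mean_curvature h t * (u (circ t))^2)"

text \<open>
  The infimum is taken in the extended reals, so no boundedness fact is needed for it to be the
  true infimum. The test functions are the smooth functions up to the boundary, which are dense
  in the Sobolev space $H^1$.
\<close>

definition lambda1 :: "metric_field \<Rightarrow> ereal" where
  "lambda1 h = (INF u \<in> {u. smooth_on_disk u \<and> (\<exists>x\<in>disk. u x \<noteq> 0)}.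
     ereal (energy h u / area_integral h (\<lambda>x. (u x)^2)))"

definition positive_metrics :: "metric_field set" where
  "positive_metrics = {h \<in> riemannian_metrics. 0 < lambda1 h}"

definition positive_metrics_space :: "metric_field topology" where
  "positive_metrics_space = subtopology metrics_topology positive_metrics"

end

(* For a conformal change h = e^(2 phi) g the quadratic form of h is the one of g plus
   2 * integral of u <grad phi, grad u>, so it is affine in phi, and in each conformal class the
   factors with positive first eigenvalue form a convex set. Every class contains such a factor:
   writing K dvol as a divergence and moving to the frame that turns once along the boundary, the
   energy becomes  int A du.du - beta.d(u^2) + int_bdry u^2  with A, beta of first order in the
   metric, and one needs phi with A grad phi - beta = J grad psi, psi = 0 on the boundary. This is a
   Dirichlet problem div(A grad psi) = f. It suffices to solve it up to an L^2-small error, which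
   follows from an a priori H^2 bound (the Hessian determinant of psi has nonnegative integral) and
   the method of continuity, starting from polynomial solutions for the flat Laplacian. As phi may
   be taken in a countable set of polynomials, a locally finite convex combination gives a factor
   depending continuously on the metric. Sliding along conformal classes to the chosen factor and
   then along the segment from the metric to the flat one contracts the space. *)

theory Submission
  imports Defs
begin

text \<open>The obstacle is regularity: solving the Dirichlet problem exactly, with \<psi> smooth up
  to the circle, would take the full elliptic theory. An L2-small residual is enough because in
  dimension two H1 embeds in L4. The residual is cancelled by a rotated gradient whose H1 norm,
  boundary values included, is of the order of the residual; its pairing with u grad u is then a
  small multiple of \<open>H1_sq u\<close>. Density of the range in L2, unlike solvability, passes
  along the continuity method by finite iteration, so no limit of solutions is ever taken. The
  coefficient 1 of the boundary integral is the single turn of the tangent of the circle. It makes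
  the model form int |grad u|^2 + int_bdry u^2 control constants too, and by a Poincare inequality
  the L2 norm. Coercivity of a conformal factor is measured against this form and not against the L2
  norm: a small change of the metric alters the energy by a small multiple of
  \<open>H1_sq u\<close>, uniformly in u. The best coercivity constant, capped at 1, is therefore
  continuous in the metric, without spectral theory.\<close>

declare mem_cball [simp del] mem_cball_0 [simp del] mem_sphere [simp del] mem_sphere_0 [simp del]

section \<open>Differential calculus on the closed disk, for functions and for convergent
  families\<close>

section \<open>Partial derivatives on the disk\<close>

text \<open>By convexity the segment from \<open>x\<close> to any point \<open>y\<close> of the disk
  stays inside, and restricting to it determines the derivative on \<open>y - x\<close>. Differences
  of such vectors reach the basis vectors, which lie in the closed disk, so boundary points are
  covered as well.\<close>

lemma has_derivative_within_disk_unique: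
  fixes f :: "real^2 \<Rightarrow> real"
  assumes x: "x \<in> disk"
    and f': "(f has_derivative f') (at x within disk)"
    and f'': "(f has_derivative f'') (at x within disk)"
  shows "f' = f''"
proof -
  have lin': "linear f'" and lin'': "linear f''"
    using f' f'' has_derivative_linear by auto
  have dir: "f' (y - x) = f'' (y - x)" if y: "y \<in> disk" for y
  proof -
    define p where "p = (\<lambda>t. x + t *\<^sub>R (y - x))"
    have p: "(p has_derivative (\<lambda>t. t *\<^sub>R (y - x))) (at 0 within {0..1})"
      unfolding p_def by (auto intro!: derivative_eq_intros)
    have im: "p ` {0..1} \<subseteq> disk"
    proof clarify
      fix t :: real assume t: "t \<in> {0..1}"
      have "(1 - t) *\<^sub>R x + t *\<^sub>R y \<in> disk"
        using t x y by (intro convexD[OF convex_cball]) auto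
      then show "p t \<in> disk" by (simp add: p_def algebra_simps)
    qed
    have 1: "(f has_derivative g) (at (p 0) within p ` {0..1})"
      if "(f has_derivative g) (at x within disk)" for g
      using has_derivative_subset[OF that im] by (simp add: p_def)
    have "((f \<circ> p) has_vector_derivative f' (y - x)) (at 0 within {0..1})"
      using diff_chain_within[OF p 1[OF f']]
      by (simp add: has_vector_derivative_def o_def linear_scale[OF lin'])
    moreover have "((f \<circ> p) has_vector_derivative f'' (y - x)) (at 0 within {0..1})"
      using diff_chain_within[OF p 1[OF f'']]
      by (simp add: has_vector_derivative_def o_def linear_scale[OF lin''])
    ultimately show ?thesis
      using vector_derivative_unique_within_closed_interval[of 0 1 0 "f \<circ> p"]
      by (simp add: cbox_interval)
  qed
  have "f' y = f'' y" if "y \<in> disk" for y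
    using dir[OF that] dir[of 0] linear_diff[OF lin', of y x] linear_diff[OF lin'', of y x]
      linear_diff[OF lin', of 0 x] linear_diff[OF lin'', of 0 x] linear_0[OF lin'] linear_0[OF lin'']
    by simp
  then have "f' b = f'' b" if "b \<in> Basis" for b
    using that by (simp add: mem_cball)
  then show ?thesis
    using linear_eq_stdbasis[OF lin' lin''] by auto
qed

lemma partial_eq:
  assumes "(f has_derivative f') (at x within disk)" "x \<in> disk"
  shows "partial i f x = f' (axis i 1)"
proof -
  have "(f has_derivative frechet_derivative f (at x within disk)) (at x within disk)"
    using assms(1) frechet_derivative_works differentiable_def by blast
  then show ?thesis
    using has_derivative_within_disk_unique[OF assms(2)] assms(1) unfolding partial_def by metis
qed

lemma linear_real2_eq:
  fixes g :: "real^2 \<Rightarrow> real"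
  assumes "linear g"
  shows "g v = v$1 * g (axis 1 1) + v$2 * g (axis 2 1)"
proof -
  have "v = v$1 *\<^sub>R axis 1 1 + v$2 *\<^sub>R axis 2 1"
    by (simp add: vec_eq_iff forall_2 axis_def)
  then have "g v = g (v$1 *\<^sub>R axis 1 1 + v$2 *\<^sub>R axis 2 1)" by simp
  also have "\<dots> = v$1 * g (axis 1 1) + v$2 * g (axis 2 1)"
    using assms by (simp add: linear_add linear_scale)
  finally show ?thesis .
qed

lemma has_derivative_partial:
  assumes "f differentiable (at x within disk)"
  shows "(f has_derivative (\<lambda>v. v$1 * partial 1 f x + v$2 * partial 2 f x)) (at x within disk)"
proof -
  have 1: "(f has_derivative frechet_derivative f (at x within disk)) (at x within disk)"
    using assms frechet_derivative_works by blast
  have "frechet_derivative f (at x within disk) v = v$1 * partial 1 f x + v$2 * partial 2 f x" for v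
    unfolding partial_def using linear_real2_eq has_derivative_linear[OF 1] by blast
  then have "frechet_derivative f (at x within disk) = (\<lambda>v. v$1 * partial 1 f x + v$2 * partial 2 f x)"
    by blast
  then show ?thesis using 1 by simp
qed

lemma differentiable_disk_cong:
  assumes "\<And>y. y \<in> disk \<Longrightarrow> f y = g y" "x \<in> disk"
  shows "(f differentiable (at x within disk)) = (g differentiable (at x within disk))"
  unfolding differentiable_def
  using has_derivative_transform[OF assms(2), of g f] has_derivative_transform[OF assms(2), of f g] assms(1)
  by auto

lemma partial_cong:
  assumes "\<And>y. y \<in> disk \<Longrightarrow> f y = g y" "x \<in> disk"
  shows "partial i f x = partial i g x"
proof -
  have "(f has_derivative D) (at x within disk) = (g has_derivative D) (at x within disk)" for D
    using has_derivative_transform[OF assms(2), of g f] has_derivative_transform[OF assms(2), of f g] assms(1)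
    by auto
  then show ?thesis by (simp add: partial_def frechet_derivative_def)
qed

lemma partial_add:
  assumes "f differentiable (at x within disk)" "g differentiable (at x within disk)" "x \<in> disk"
  shows "partial i (\<lambda>y. f y + g y) x = partial i f x + partial i g x"
  using partial_eq[OF has_derivative_add[OF has_derivative_partial[OF assms(1)] has_derivative_partial[OF assms(2)]] assms(3)]
  using exhaust_2[of i] by (auto simp: axis_def)

lemma partial_mult:
  assumes "f differentiable (at x within disk)" "g differentiable (at x within disk)" "x \<in> disk"
  shows "partial i (\<lambda>y. f y * g y) x = f x * partial i g x + partial i f x * g x"
  using partial_eq[OF has_derivative_mult[OF has_derivative_partial[OF assms(1)] has_derivative_partial[OF assms(2)]] assms(3)]
  using exhaust_2[of i] by (auto simp: axis_def)

lemma partial_const: "x \<in> disk \<Longrightarrow> partial i (\<lambda>y. c) x = 0"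
  using partial_eq[OF has_derivative_const] by blast

lemma has_derivative_compose_real:
  assumes f: "f differentiable (at x within disk)" and "(G has_real_derivative G') (at (f x))"
  shows "((\<lambda>y. G (f y)) has_derivative (\<lambda>v. G' * (v$1 * partial 1 f x + v$2 * partial 2 f x))) (at x within disk)"
proof -
  have "(G has_derivative (*) G') (at (f x))"
    using assms(2) by (simp add: has_field_derivative_def)
  from has_derivative_compose[OF has_derivative_partial[OF f] this] show ?thesis by simp
qed

lemma partial_compose:
  assumes "f differentiable (at x within disk)" "(G has_real_derivative G') (at (f x))" "x \<in> disk"
  shows "partial i (\<lambda>y. G (f y)) x = G' * partial i f x"
  using partial_eq[OF has_derivative_compose_real[OF assms(1,2)] assms(3)] exhaust_2[of i]
  by (auto simp: axis_def)

section \<open>Smooth convergence\<close>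

text \<open>Differentiability is built in because the rules for \<open>partial\<close> depend on it.
  For the members of the family it is asked only eventually, the most that convergence along a
  filter can give.\<close>

definition C0_limit :: "'a filter \<Rightarrow> ('a \<Rightarrow> real^2 \<Rightarrow> real) \<Rightarrow> (real^2 \<Rightarrow> real) \<Rightarrow> bool" where
  "C0_limit F f f0 \<longleftrightarrow> (\<forall>\<^sub>F a in F. \<forall>x\<in>disk. f a differentiable (at x within disk)) \<and>
     (\<forall>x\<in>disk. f0 differentiable (at x within disk)) \<and> uniform_limit disk f f0 F"

text \<open>The recursion strips the derivative that is taken first, so closure under an operation
  follows from its differentiation rule by induction on the order.\<close>

primrec Ck_limit :: "nat \<Rightarrow> 'a filter \<Rightarrow> ('a \<Rightarrow> real^2 \<Rightarrow> real) \<Rightarrow> (real^2 \<Rightarrow> real) \<Rightarrow> bool" where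
  "Ck_limit 0 F f f0 = C0_limit F f f0"
| "Ck_limit (Suc k) F f f0 =
    (C0_limit F f f0 \<and> (\<forall>i. Ck_limit k F (\<lambda>a. partial i (f a)) (partial i f0)))"

definition smooth_limit :: "'a filter \<Rightarrow> ('a \<Rightarrow> real^2 \<Rightarrow> real) \<Rightarrow> (real^2 \<Rightarrow> real) \<Rightarrow> bool" where
  "smooth_limit F f f0 \<longleftrightarrow> (\<forall>k. Ck_limit k F f f0)"

lemma Ck_limit_C0: "Ck_limit k F f f0 \<Longrightarrow> C0_limit F f f0"
  by (cases k) auto

lemma Ck_limit_Suc: "Ck_limit (Suc k) F f f0 \<Longrightarrow> Ck_limit k F f f0"
  by (induction k arbitrary: f f0) (auto)

lemma C0_limit_cong:
  assumes "\<forall>\<^sub>F a in F. \<forall>x\<in>disk. f a x = g a x" "\<And>x. x \<in> disk \<Longrightarrow> f0 x = g0 x" "C0_limit F f f0"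
  shows "C0_limit F g g0"
proof -
  have "\<forall>\<^sub>F a in F. \<forall>x\<in>disk. g a differentiable (at x within disk)"
    using assms(1) assms(3)[unfolded C0_limit_def, THEN conjunct1]
  proof eventually_elim
    case (elim a)
    then show ?case using differentiable_disk_cong[of "f a" "g a"] by simp
  qed
  moreover have "\<forall>x\<in>disk. g0 differentiable (at x within disk)"
    using assms(2) assms(3)[unfolded C0_limit_def] differentiable_disk_cong[of f0 g0] by simp
  moreover have "uniform_limit disk g g0 F"
    using assms(3)[unfolded C0_limit_def] uniform_limit_cong[OF assms(1,2)] by simp
  ultimately show ?thesis unfolding C0_limit_def by blast
qed

lemma Ck_limit_cong:
  assumes "Ck_limit k F f f0" "\<forall>\<^sub>F a in F. \<forall>x\<in>disk. f a x = g a x" "\<And>x. x \<in> disk \<Longrightarrow> f0 x = g0 x"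
  shows "Ck_limit k F g g0"
  using assms
proof (induction k arbitrary: f f0 g g0)
  case 0
  show ?case using C0_limit_cong[OF 0(2,3)] 0(1) by simp
next
  case (Suc k)
  have "Ck_limit k F (\<lambda>a. partial i (g a)) (partial i g0)" for i
  proof (rule Suc.IH)
    show "Ck_limit k F (\<lambda>a. partial i (f a)) (partial i f0)" using Suc.prems(1) by simp
    show "\<forall>\<^sub>F a in F. \<forall>x\<in>disk. partial i (f a) x = partial i (g a) x"
      using Suc.prems(2)
    proof eventually_elim
      case (elim a)
      then show ?case using partial_cong[of "f a" "g a"] by simp
    qed
    show "partial i f0 x = partial i g0 x" if "x \<in> disk" for x
      by (rule partial_cong[OF Suc.prems(3) that])
  qed
  moreover have "C0_limit F g g0"
    by (rule C0_limit_cong[OF Suc.prems(2,3) Ck_limit_C0[OF Suc.prems(1)]])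
  ultimately show ?case by simp
qed

lemma C0_limit_const: "((c::'a \<Rightarrow> real) \<longlongrightarrow> c0) F \<Longrightarrow> C0_limit F (\<lambda>a x. c a) (\<lambda>x. c0)"
  unfolding C0_limit_def uniform_limit_iff tendsto_iff by auto

lemma Ck_limit_const: "((c::'a \<Rightarrow> real) \<longlongrightarrow> c0) F \<Longrightarrow> Ck_limit k F (\<lambda>a x. c a) (\<lambda>x. c0)"
proof (induction k arbitrary: c c0)
  case 0
  then show ?case using C0_limit_const by simp
next
  case (Suc k)
  have "Ck_limit k F (\<lambda>a. partial i (\<lambda>x. c a)) (partial i (\<lambda>x. c0))" for i
    by (rule Ck_limit_cong[OF Suc.IH[of "\<lambda>_. 0" 0]]) (auto simp: partial_const)
  then show ?case using Suc.prems C0_limit_const by auto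
qed

lemma C0_limit_add:
  assumes "C0_limit F f f0" "C0_limit F g g0"
  shows "C0_limit F (\<lambda>a x. f a x + g a x) (\<lambda>x. f0 x + g0 x)"
proof -
  have "\<forall>\<^sub>F a in F. \<forall>x\<in>disk. (\<lambda>x. f a x + g a x) differentiable (at x within disk)"
    using assms[unfolded C0_limit_def, THEN conjunct1] by eventually_elim auto
  then show ?thesis using assms unfolding C0_limit_def by (auto intro: uniform_limit_add)
qed

lemma Ck_limit_add:
  assumes "Ck_limit k F f f0" "Ck_limit k F g g0"
  shows "Ck_limit k F (\<lambda>a x. f a x + g a x) (\<lambda>x. f0 x + g0 x)"
  using assms
proof (induction k arbitrary: f f0 g g0)
  case 0
  then show ?case using C0_limit_add by simp
next
  case (Suc k)
  have C0: "C0_limit F f f0" "C0_limit F g g0" using Suc.prems by auto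
  have "Ck_limit k F (\<lambda>a. partial i (\<lambda>x. f a x + g a x)) (partial i (\<lambda>x. f0 x + g0 x))" for i
  proof (rule Ck_limit_cong[OF Suc.IH])
    show "Ck_limit k F (\<lambda>a. partial i (f a)) (partial i f0)" using Suc.prems by simp
    show "Ck_limit k F (\<lambda>a. partial i (g a)) (partial i g0)" using Suc.prems by simp
    show "\<forall>\<^sub>F a in F. \<forall>x\<in>disk. partial i (f a) x + partial i (g a) x = partial i (\<lambda>x. f a x + g a x) x"
      using C0[unfolded C0_limit_def, THEN conjunct1] by eventually_elim (simp add: partial_add)
    show "partial i f0 x + partial i g0 x = partial i (\<lambda>x. f0 x + g0 x) x" if "x \<in> disk" for x
      using that C0 by (simp add: partial_add C0_limit_def)
  qed
  then show ?case using C0 C0_limit_add by auto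
qed

lemma C0_limit_continuous: "C0_limit F f f0 \<Longrightarrow> continuous_on disk f0"
  unfolding C0_limit_def continuous_on_eq_continuous_within
  by (auto intro: differentiable_imp_continuous_within)

lemma C0_limit_bounded: "C0_limit F f f0 \<Longrightarrow> bounded (f0 ` disk)"
  by (intro compact_imp_bounded compact_continuous_image compact_cball C0_limit_continuous)

lemma C0_limit_mult:
  assumes "C0_limit F f f0" "C0_limit F g g0"
  shows "C0_limit F (\<lambda>a x. f a x * g a x) (\<lambda>x. f0 x * g0 x)"
proof -
  have "\<forall>\<^sub>F a in F. \<forall>x\<in>disk. (\<lambda>x. f a x * g a x) differentiable (at x within disk)"
    using assms[unfolded C0_limit_def, THEN conjunct1] by eventually_elim auto
  moreover have "uniform_limit disk (\<lambda>a x. f a x * g a x) (\<lambda>x. f0 x * g0 x) F"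
    by (rule uniform_lim_mult[OF _ _ C0_limit_bounded[OF assms(1)] C0_limit_bounded[OF assms(2)]])
      (use assms in \<open>auto simp: C0_limit_def\<close>)
  ultimately show ?thesis using assms unfolding C0_limit_def by auto
qed

lemma Ck_limit_mult:
  assumes "Ck_limit k F f f0" "Ck_limit k F g g0"
  shows "Ck_limit k F (\<lambda>a x. f a x * g a x) (\<lambda>x. f0 x * g0 x)"
  using assms
proof (induction k arbitrary: f f0 g g0)
  case 0
  then show ?case using C0_limit_mult by simp
next
  case (Suc k)
  have C0: "C0_limit F f f0" "C0_limit F g g0" using Suc.prems by auto
  have k: "Ck_limit k F f f0" "Ck_limit k F g g0" using Suc.prems Ck_limit_Suc by blast+
  have p: "Ck_limit k F (\<lambda>a. partial i (f a)) (partial i f0)"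
    "Ck_limit k F (\<lambda>a. partial i (g a)) (partial i g0)" for i
    using Suc.prems by auto
  have "Ck_limit k F (\<lambda>a. partial i (\<lambda>x. f a x * g a x)) (partial i (\<lambda>x. f0 x * g0 x))" for i
  proof (rule Ck_limit_cong[OF Ck_limit_add[OF Suc.IH[OF k(1) p(2)] Suc.IH[OF p(1) k(2)]]])
    show "\<forall>\<^sub>F a in F. \<forall>x\<in>disk. f a x * partial i (g a) x + partial i (f a) x * g a x = partial i (\<lambda>x. f a x * g a x) x"
      using C0[unfolded C0_limit_def, THEN conjunct1] by eventually_elim (simp add: partial_mult)
    show "f0 x * partial i g0 x + partial i f0 x * g0 x = partial i (\<lambda>x. f0 x * g0 x) x" if "x \<in> disk" for x
      using that C0 by (simp add: partial_mult C0_limit_def)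
  qed
  then show ?case using C0 C0_limit_mult by auto
qed

text \<open>The image of the limit is compact, so a closed neighbourhood of it inside
  \<open>S\<close> is compact too. \<open>G\<close> is uniformly continuous there, and eventually
  all members of the family take their values there.\<close>

lemma C0_limit_compose:
  assumes f: "C0_limit F f f0" and S: "open S" "f0 ` disk \<subseteq> S"
    and G: "\<And>y. y \<in> S \<Longrightarrow> (G has_real_derivative G' y) (at y)"
  shows "C0_limit F (\<lambda>a x. G (f a x)) (\<lambda>x. G (f0 x))"
    and "\<forall>\<^sub>F a in F. f a ` disk \<subseteq> S"
proof -
  have "compact (f0 ` disk)"
    by (intro compact_continuous_image compact_cball C0_limit_continuous[OF f])
  moreover have "f0 ` disk \<noteq> {}" by auto
  ultimately obtain e where e: "e > 0" "{x. infdist x (f0 ` disk) \<le> e} \<subseteq> S"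
    using compact_in_open_separated S by metis
  let ?N = "{x. infdist x (f0 ` disk) \<le> e}"
  have cN: "compact ?N"
    using compact_infdist_le[OF \<open>f0 ` disk \<noteq> {}\<close> \<open>compact (f0 ` disk)\<close> e(1)] .
  have ev: "\<forall>\<^sub>F a in F. f a ` disk \<subseteq> ?N"
  proof -
    have "\<forall>\<^sub>F a in F. \<forall>x\<in>disk. dist (f a x) (f0 x) < e"
      using f e unfolding C0_limit_def uniform_limit_iff by blast
    then show ?thesis
    proof eventually_elim
      case (elim a)
      show ?case
      proof clarify
        fix x :: "real^2" assume x: "x \<in> disk"
        have "infdist (f a x) (f0 ` disk) \<le> dist (f a x) (f0 x)" using x by (intro infdist_le) auto
        then show "infdist (f a x) (f0 ` disk) \<le> e" using elim x by fastforce
      qed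
    qed
  qed
  show evS: "\<forall>\<^sub>F a in F. f a ` disk \<subseteq> S"
    using ev by eventually_elim (use e in blast)
  have uc: "uniformly_continuous_on ?N G"
  proof (rule compact_uniformly_continuous[OF _ cN])
    show "continuous_on ?N G"
      using G e(2) by (meson DERIV_isCont continuous_at_imp_continuous_on subsetD)
  qed
  have f0N: "f0 x \<in> ?N" if "x \<in> disk" for x
    using that e by auto
  have lim: "uniform_limit disk (\<lambda>a x. G (f a x)) (\<lambda>x. G (f0 x)) F"
    unfolding uniform_limit_iff
  proof (intro allI impI)
    fix \<epsilon> :: real assume "\<epsilon> > 0"
    then obtain d where d: "d > 0" "\<And>y z. y \<in> ?N \<Longrightarrow> z \<in> ?N \<Longrightarrow> dist z y < d \<Longrightarrow> dist (G z) (G y) < \<epsilon>"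
      using uc unfolding uniformly_continuous_on_def by metis
    have "\<forall>\<^sub>F a in F. \<forall>x\<in>disk. dist (f a x) (f0 x) < d"
      using f d unfolding C0_limit_def uniform_limit_iff by blast
    with ev show "\<forall>\<^sub>F a in F. \<forall>x\<in>disk. dist (G (f a x)) (G (f0 x)) < \<epsilon>"
      by eventually_elim (use d f0N in blast)
  qed
  have dif: "(\<lambda>x. G (h x)) differentiable (at x within disk)"
    if "h differentiable (at x within disk)" "h x \<in> S" for h x
    using has_derivative_compose_real[OF that(1) G[OF that(2)]] differentiableI by blast
  have "\<forall>\<^sub>F a in F. \<forall>x\<in>disk. (\<lambda>x. G (f a x)) differentiable (at x within disk)"
    using f[unfolded C0_limit_def, THEN conjunct1] evS
    by eventually_elim (auto intro: dif)
  then show "C0_limit F (\<lambda>a x. G (f a x)) (\<lambda>x. G (f0 x))"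
    using lim dif f S unfolding C0_limit_def by blast
qed

text \<open>The chain rule trades one order of convergence for the outer derivative
  \<open>G'\<close>. For the inverse, the root and the exponential \<open>G'\<close> is again an
  expression in \<open>G\<close>, so the induction hypothesis about the same function supplies the
  premise \<open>k\<close>.\<close>

lemma Ck_limit_compose_Suc:
  assumes f: "Ck_limit (Suc k) F f f0" and S: "open S" "f0 ` disk \<subseteq> S"
    and G: "\<And>y. y \<in> S \<Longrightarrow> (G has_real_derivative G' y) (at y)"
    and k: "Ck_limit k F (\<lambda>a x. G' (f a x)) (\<lambda>x. G' (f0 x))"
  shows "Ck_limit (Suc k) F (\<lambda>a x. G (f a x)) (\<lambda>x. G (f0 x))"
proof -
  have C0: "C0_limit F f f0" using f by auto
  have comp: "C0_limit F (\<lambda>a x. G (f a x)) (\<lambda>x. G (f0 x))" "\<forall>\<^sub>F a in F. f a ` disk \<subseteq> S"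
    using C0_limit_compose[OF C0 S] G by blast+
  have "Ck_limit k F (\<lambda>a. partial i (\<lambda>x. G (f a x))) (partial i (\<lambda>x. G (f0 x)))" for i
  proof (rule Ck_limit_cong[OF Ck_limit_mult[OF k]])
    show "Ck_limit k F (\<lambda>a. partial i (f a)) (partial i f0)" using f by simp
    show "\<forall>\<^sub>F a in F. \<forall>x\<in>disk. G' (f a x) * partial i (f a) x = partial i (\<lambda>x. G (f a x)) x"
      using C0[unfolded C0_limit_def, THEN conjunct1] comp(2)
    proof eventually_elim
      case (elim a)
      then show ?case using partial_compose[OF _ G, of "f a"] by auto
    qed
    show "G' (f0 x) * partial i f0 x = partial i (\<lambda>x. G (f0 x)) x" if "x \<in> disk" for x
      by (rule partial_compose[symmetric, OF _ G that]) (use that C0 S in \<open>auto simp: C0_limit_def\<close>)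
  qed
  then show ?thesis using comp by simp
qed

lemma Ck_limit_cmult: "Ck_limit k F f f0 \<Longrightarrow> Ck_limit k F (\<lambda>a x. c * f a x) (\<lambda>x. c * f0 x)"
  using Ck_limit_mult[OF Ck_limit_const[OF tendsto_const]] .

lemma Ck_limit_inverse:
  assumes "Ck_limit k F f f0" "\<And>x. x \<in> disk \<Longrightarrow> f0 x \<noteq> 0"
  shows "Ck_limit k F (\<lambda>a x. inverse (f a x)) (\<lambda>x. inverse (f0 x))"
  using assms
proof (induction k)
  case 0
  show ?case
    unfolding Ck_limit.simps
    by (rule C0_limit_compose(1)[of F f f0 "- {0}" inverse "\<lambda>y. - (inverse y * inverse y)"])
      (use 0 in \<open>auto intro!: derivative_eq_intros simp: power2_eq_square\<close>)
next
  case (Suc k)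
  have IH: "Ck_limit k F (\<lambda>a x. inverse (f a x)) (\<lambda>x. inverse (f0 x))"
    using Suc Ck_limit_Suc by blast
  show ?case
  proof (rule Ck_limit_compose_Suc[OF Suc.prems(1)])
    show "open (- {0::real})" "f0 ` disk \<subseteq> - {0}" using Suc.prems by auto
    show "(inverse has_real_derivative -1 * (inverse y * inverse y)) (at y)" if "y \<in> -{0}" for y :: real
      using that by (auto intro!: derivative_eq_intros simp: power2_eq_square)
    show "Ck_limit k F (\<lambda>a x. -1 * (inverse (f a x) * inverse (f a x))) (\<lambda>x. -1 * (inverse (f0 x) * inverse (f0 x)))"
      by (intro Ck_limit_cmult Ck_limit_mult IH)
  qed
qed

lemma Ck_limit_sqrt:
  assumes "Ck_limit k F f f0" "\<And>x. x \<in> disk \<Longrightarrow> f0 x > 0"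
  shows "Ck_limit k F (\<lambda>a x. sqrt (f a x)) (\<lambda>x. sqrt (f0 x))"
  using assms
proof (induction k)
  case 0
  show ?case
    unfolding Ck_limit.simps
    by (rule C0_limit_compose(1)[of F f f0 "{0<..}" sqrt "\<lambda>y. inverse (sqrt y) / 2"])
      (use 0 in \<open>auto intro!: derivative_eq_intros simp: power2_eq_square\<close>)
next
  case (Suc k)
  have IH: "Ck_limit k F (\<lambda>a x. sqrt (f a x)) (\<lambda>x. sqrt (f0 x))"
    using Suc Ck_limit_Suc by blast
  show ?case
  proof (rule Ck_limit_compose_Suc[OF Suc.prems(1)])
    show "open ({0<..}::real set)" "f0 ` disk \<subseteq> {0<..}" using Suc.prems by auto
    show "(sqrt has_real_derivative (1/2) * inverse (sqrt y)) (at y)" if "y \<in> {0<..}" for y :: real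
      using that by (auto intro!: derivative_eq_intros simp: power2_eq_square)
    show "Ck_limit k F (\<lambda>a x. (1/2) * inverse (sqrt (f a x))) (\<lambda>x. (1/2) * inverse (sqrt (f0 x)))"
      by (intro Ck_limit_cmult Ck_limit_inverse IH) (use Suc.prems(2) in force)
  qed
qed

lemma Ck_limit_exp:
  assumes "Ck_limit k F f f0"
  shows "Ck_limit k F (\<lambda>a x. exp (f a x)) (\<lambda>x. exp (f0 x))"
  using assms
proof (induction k)
  case 0
  show ?case
    unfolding Ck_limit.simps
    by (rule C0_limit_compose(1)[of F f f0 UNIV exp exp]) (use 0 in \<open>auto intro!: derivative_eq_intros\<close>)
next
  case (Suc k)
  have "Ck_limit k F (\<lambda>a x. exp (f a x)) (\<lambda>x. exp (f0 x))"
    using Suc Ck_limit_Suc by blast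
  then show ?case
    using Ck_limit_compose_Suc[OF Suc.prems(1) open_UNIV, of exp exp] DERIV_exp by blast
qed

text \<open>The derivative of arctan is rational, so a case distinction on the order takes the place
  of an induction.\<close>

lemma Ck_limit_arctan:
  assumes "Ck_limit k F f f0"
  shows "Ck_limit k F (\<lambda>a x. arctan (f a x)) (\<lambda>x. arctan (f0 x))"
proof (cases k)
  case 0
  show ?thesis
    unfolding 0 Ck_limit.simps
    by (rule C0_limit_compose(1)[of F f f0 UNIV arctan "\<lambda>y. inverse (1 + y\<^sup>2)"])
      (use 0 assms in \<open>auto intro!: derivative_eq_intros\<close>)
next
  case (Suc j)
  have j: "Ck_limit j F f f0" using assms Suc Ck_limit_Suc by blast
  have "Ck_limit (Suc j) F (\<lambda>a x. arctan (f a x)) (\<lambda>x. arctan (f0 x))"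
  proof (rule Ck_limit_compose_Suc[OF assms[unfolded Suc] open_UNIV])
    show "(arctan has_real_derivative inverse (1 + y * y)) (at y)" for y :: real
      by (auto intro!: derivative_eq_intros simp: power2_eq_square)
    show "Ck_limit j F (\<lambda>a x. inverse (1 + f a x * f a x)) (\<lambda>x. inverse (1 + f0 x * f0 x))"
      by (intro Ck_limit_inverse Ck_limit_add Ck_limit_mult j Ck_limit_const tendsto_const)
        (metis add_nonneg_eq_0_iff zero_le_one zero_le_square zero_neq_one)
  qed auto
  then show ?thesis using Suc by simp
qed

named_theorems smooth_intros

lemma smooth_limit_const [smooth_intros]:
  "((c::'a \<Rightarrow> real) \<longlongrightarrow> c0) F \<Longrightarrow> smooth_limit F (\<lambda>a x. c a) (\<lambda>x. c0)"
  by (simp add: smooth_limit_def Ck_limit_const)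

lemma smooth_limit_partial [smooth_intros]:
  "smooth_limit F f f0 \<Longrightarrow> smooth_limit F (\<lambda>a x. partial i (f a) x) (\<lambda>x. partial i f0 x)"
  unfolding smooth_limit_def by (metis Ck_limit.simps(2))

lemma smooth_limit_add [smooth_intros]:
  "smooth_limit F f f0 \<Longrightarrow> smooth_limit F g g0 \<Longrightarrow> smooth_limit F (\<lambda>a x. f a x + g a x) (\<lambda>x. f0 x + g0 x)"
  by (simp add: smooth_limit_def Ck_limit_add)

lemma smooth_limit_mult [smooth_intros]:
  "smooth_limit F f f0 \<Longrightarrow> smooth_limit F g g0 \<Longrightarrow> smooth_limit F (\<lambda>a x. f a x * g a x) (\<lambda>x. f0 x * g0 x)"
  by (simp add: smooth_limit_def Ck_limit_mult)

lemma smooth_limit_minus [smooth_intros]: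
  "smooth_limit F f f0 \<Longrightarrow> smooth_limit F (\<lambda>a x. - f a x) (\<lambda>x. - f0 x)"
  using Ck_limit_cmult[of _ F f f0 "-1"] by (simp add: smooth_limit_def)

lemma smooth_limit_diff [smooth_intros]:
  "smooth_limit F f f0 \<Longrightarrow> smooth_limit F g g0 \<Longrightarrow> smooth_limit F (\<lambda>a x. f a x - g a x) (\<lambda>x. f0 x - g0 x)"
  using smooth_limit_add[OF _ smooth_limit_minus] by fastforce

lemma smooth_limit_power [smooth_intros]:
  "smooth_limit F f f0 \<Longrightarrow> smooth_limit F (\<lambda>a x. f a x ^ n) (\<lambda>x. f0 x ^ n)"
  by (induction n) (auto intro!: smooth_limit_const smooth_limit_mult)

lemma smooth_limit_inverse [smooth_intros]:
  "smooth_limit F f f0 \<Longrightarrow> (\<And>x. x \<in> disk \<Longrightarrow> f0 x \<noteq> 0) \<Longrightarrow>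
   smooth_limit F (\<lambda>a x. inverse (f a x)) (\<lambda>x. inverse (f0 x))"
  by (simp add: smooth_limit_def Ck_limit_inverse)

lemma smooth_limit_divide [smooth_intros]:
  "smooth_limit F f f0 \<Longrightarrow> smooth_limit F g g0 \<Longrightarrow> (\<And>x. x \<in> disk \<Longrightarrow> g0 x \<noteq> 0) \<Longrightarrow>
   smooth_limit F (\<lambda>a x. f a x / g a x) (\<lambda>x. f0 x / g0 x)"
  unfolding divide_inverse by (intro smooth_limit_mult smooth_limit_inverse)

lemma smooth_limit_sqrt [smooth_intros]:
  "smooth_limit F f f0 \<Longrightarrow> (\<And>x. x \<in> disk \<Longrightarrow> f0 x > 0) \<Longrightarrow>
   smooth_limit F (\<lambda>a x. sqrt (f a x)) (\<lambda>x. sqrt (f0 x))"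
  by (simp add: smooth_limit_def Ck_limit_sqrt)

lemma smooth_limit_exp [smooth_intros]:
  "smooth_limit F f f0 \<Longrightarrow> smooth_limit F (\<lambda>a x. exp (f a x)) (\<lambda>x. exp (f0 x))"
  by (simp add: smooth_limit_def Ck_limit_exp)

lemma smooth_limit_arctan [smooth_intros]:
  "smooth_limit F f f0 \<Longrightarrow> smooth_limit F (\<lambda>a x. arctan (f a x)) (\<lambda>x. arctan (f0 x))"
  by (simp add: smooth_limit_def Ck_limit_arctan)

lemma smooth_limit_sum [smooth_intros]:
  "(\<And>j. j \<in> J \<Longrightarrow> smooth_limit F (\<lambda>a x. f j a x) (f0 j)) \<Longrightarrow>
   smooth_limit F (\<lambda>a x. \<Sum>j\<in>J. f j a x) (\<lambda>x. \<Sum>j\<in>J. f0 j x)"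
proof (induction J rule: infinite_finite_induct)
  case (insert j J)
  then show ?case by (auto intro!: smooth_limit_add)
qed (auto intro!: smooth_limit_const)

lemma smooth_limit_cong:
  assumes "smooth_limit F f f0" "\<forall>\<^sub>F a in F. \<forall>x\<in>disk. f a x = g a x" "\<And>x. x \<in> disk \<Longrightarrow> f0 x = g0 x"
  shows "smooth_limit F g g0"
  using assms Ck_limit_cong unfolding smooth_limit_def by blast

lemma partials_snoc: "partials (is @ [i]) f = partials is (partial i f)"
  by (simp add: partials_def)

text \<open>\<open>Ck_limit\<close> strips the innermost derivative, which is the last entry of the
  list; hence the case split from the right.\<close>

lemma Ck_limit_iff:
  "Ck_limit k F f f0 \<longleftrightarrow> (\<forall>is. length is \<le> k \<longrightarrow> C0_limit F (\<lambda>a. partials is (f a)) (partials is f0))"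
proof (induction k arbitrary: f f0)
  case 0
  then show ?case by (simp add: partials_def)
next
  case (Suc k)
  show ?case
  proof
    assume L: "Ck_limit (Suc k) F f f0"
    show "\<forall>is. length is \<le> Suc k \<longrightarrow> C0_limit F (\<lambda>a. partials is (f a)) (partials is f0)"
    proof (intro allI impI)
      fix "is" :: "2 list" assume "length is \<le> Suc k"
      then show "C0_limit F (\<lambda>a. partials is (f a)) (partials is f0)"
        using L Suc.IH by (cases "is" rule: rev_cases) (auto simp: partials_snoc, simp add: partials_def)
    qed
  next
    assume R: "\<forall>is. length is \<le> Suc k \<longrightarrow> C0_limit F (\<lambda>a. partials is (f a)) (partials is f0)"
    have "Ck_limit k F (\<lambda>a. partial i (f a)) (partial i f0)" for i
      unfolding Suc.IH
    proof (intro allI impI)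
      fix "is" :: "2 list" assume "length is \<le> k"
      then show "C0_limit F (\<lambda>a. partials is (partial i (f a))) (partials is (partial i f0))"
        using R[rule_format, of "is @ [i]"] by (simp add: partials_snoc)
    qed
    then show "Ck_limit (Suc k) F f f0"
      using R[rule_format, of "[]"] by (simp add: partials_def)
  qed
qed

lemma smooth_limit_iff:
  "smooth_limit F f f0 \<longleftrightarrow> (\<forall>is. C0_limit F (\<lambda>a. partials is (f a)) (partials is f0))"
  unfolding smooth_limit_def Ck_limit_iff by blast

text \<open>Along the filter \<open>bot\<close> only the limit function matters, so closure properties of smooth
  functions are special cases of those of smooth limits.\<close>

lemma smooth_on_disk_iff: "smooth_on_disk f \<longleftrightarrow> smooth_limit (bot :: unit filter) (\<lambda>a. f) f"
  unfolding smooth_on_disk_def smooth_limit_iff C0_limit_def by (simp add: uniform_limit_iff)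

lemma smooth_limit_imp_smooth: "smooth_limit F f f0 \<Longrightarrow> smooth_on_disk f0"
  unfolding smooth_on_disk_def smooth_limit_iff C0_limit_def by blast

lemma smooth_limit_self: "smooth_on_disk f \<Longrightarrow> smooth_limit F (\<lambda>a. f) f"
  unfolding smooth_on_disk_def smooth_limit_iff C0_limit_def by (simp add: uniform_limit_iff)

lemma smooth_on_disk_const [smooth_intros]: "smooth_on_disk (\<lambda>x. c)"
  unfolding smooth_on_disk_iff by (intro smooth_intros) auto

lemma smooth_on_disk_partial [smooth_intros]: "smooth_on_disk f \<Longrightarrow> smooth_on_disk (\<lambda>x. partial i f x)"
  unfolding smooth_on_disk_iff by (intro smooth_intros) auto

lemma smooth_on_disk_add [smooth_intros]:
  "smooth_on_disk f \<Longrightarrow> smooth_on_disk g \<Longrightarrow> smooth_on_disk (\<lambda>x. f x + g x)"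
  unfolding smooth_on_disk_iff by (intro smooth_intros) auto

lemma smooth_on_disk_mult [smooth_intros]:
  "smooth_on_disk f \<Longrightarrow> smooth_on_disk g \<Longrightarrow> smooth_on_disk (\<lambda>x. f x * g x)"
  unfolding smooth_on_disk_iff by (intro smooth_intros) auto

lemma smooth_on_disk_minus [smooth_intros]: "smooth_on_disk f \<Longrightarrow> smooth_on_disk (\<lambda>x. - f x)"
  unfolding smooth_on_disk_iff by (intro smooth_intros) auto

lemma smooth_on_disk_diff [smooth_intros]:
  "smooth_on_disk f \<Longrightarrow> smooth_on_disk g \<Longrightarrow> smooth_on_disk (\<lambda>x. f x - g x)"
  unfolding smooth_on_disk_iff by (intro smooth_intros) auto

lemma smooth_on_disk_power [smooth_intros]: "smooth_on_disk f \<Longrightarrow> smooth_on_disk (\<lambda>x. f x ^ n)"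
  unfolding smooth_on_disk_iff by (intro smooth_intros) auto

lemma smooth_on_disk_divide [smooth_intros]:
  "smooth_on_disk f \<Longrightarrow> smooth_on_disk g \<Longrightarrow> (\<And>x. x \<in> disk \<Longrightarrow> g x \<noteq> 0) \<Longrightarrow> smooth_on_disk (\<lambda>x. f x / g x)"
  unfolding smooth_on_disk_iff by (intro smooth_intros) auto

lemma smooth_on_disk_sqrt [smooth_intros]:
  "smooth_on_disk f \<Longrightarrow> (\<And>x. x \<in> disk \<Longrightarrow> f x > 0) \<Longrightarrow> smooth_on_disk (\<lambda>x. sqrt (f x))"
  unfolding smooth_on_disk_iff by (intro smooth_intros) auto

lemma smooth_on_disk_exp [smooth_intros]: "smooth_on_disk f \<Longrightarrow> smooth_on_disk (\<lambda>x. exp (f x))"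
  unfolding smooth_on_disk_iff by (intro smooth_intros) auto

lemma smooth_on_disk_arctan [smooth_intros]: "smooth_on_disk f \<Longrightarrow> smooth_on_disk (\<lambda>x. arctan (f x))"
  unfolding smooth_on_disk_iff by (intro smooth_intros) auto

lemma smooth_on_disk_sum [smooth_intros]:
  "(\<And>j. j \<in> J \<Longrightarrow> smooth_on_disk (f j)) \<Longrightarrow> smooth_on_disk (\<lambda>x. \<Sum>j\<in>J. f j x)"
  unfolding smooth_on_disk_iff by (intro smooth_intros) auto

lemma smooth_on_disk_cong: "smooth_on_disk f \<Longrightarrow> (\<And>x. x \<in> disk \<Longrightarrow> f x = g x) \<Longrightarrow> smooth_on_disk g"
  unfolding smooth_on_disk_iff by (erule smooth_limit_cong) auto

lemma smooth_on_disk_differentiable: "smooth_on_disk f \<Longrightarrow> x \<in> disk \<Longrightarrow> f differentiable (at x within disk)"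
  unfolding smooth_on_disk_def by (metis foldr.simps(1) id_apply partials_def)

lemma smooth_on_disk_continuous: "smooth_on_disk f \<Longrightarrow> continuous_on disk f"
  unfolding continuous_on_eq_continuous_within
  by (auto intro: differentiable_imp_continuous_within smooth_on_disk_differentiable)

lemma partial_coord: "x \<in> disk \<Longrightarrow> partial i (\<lambda>y. y $ j) x = (if i = j then 1 else 0)"
  using partial_eq[OF bounded_linear_imp_has_derivative[OF bounded_linear_vec_nth[of j]], of x i]
  by (simp add: axis_def)

lemma smooth_on_disk_coord [smooth_intros]: "smooth_on_disk (\<lambda>x. x $ j)"
proof -
  have C0: "C0_limit bot (\<lambda>a::unit. \<lambda>x. x $ j) (\<lambda>x. x $ j)"
    unfolding C0_limit_def
    by (auto simp: uniform_limit_iff intro!: bounded_linear_imp_differentiable bounded_linear_vec_nth)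
  have "Ck_limit k bot (\<lambda>a::unit. \<lambda>x. x $ j) (\<lambda>x. x $ j)" for k
  proof (cases k)
    case (Suc l)
    have "Ck_limit l bot (\<lambda>a::unit. partial i (\<lambda>x. x $ j)) (partial i (\<lambda>x. x $ j))" for i
      by (rule Ck_limit_cong[OF Ck_limit_const[of "\<lambda>_. if i = j then 1 else 0"]]) (auto simp: partial_coord)
    then show ?thesis using C0 Suc by auto
  qed (use C0 in simp)
  then show ?thesis unfolding smooth_on_disk_iff smooth_limit_def by blast
qed

section \<open>Symmetry of second derivatives\<close>

lemma partial_line:
  assumes f: "\<And>x. x \<in> disk \<Longrightarrow> f differentiable (at x within disk)"
    and x: "x + s *\<^sub>R axis i 1 \<in> ball 0 1"
  shows "((\<lambda>s. f (x + s *\<^sub>R axis i 1)) has_real_derivative partial i f (x + s *\<^sub>R axis i 1)) (at s)"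
proof -
  let ?y = "x + s *\<^sub>R axis i 1"
  have yd: "?y \<in> disk" using x by (meson ball_subset_cball subsetD)
  have "(f has_derivative (\<lambda>v. v$1 * partial 1 f ?y + v$2 * partial 2 f ?y)) (at ?y within disk)"
    using has_derivative_partial[OF f[OF yd]] .
  then have 1: "(f has_derivative (\<lambda>v. v$1 * partial 1 f ?y + v$2 * partial 2 f ?y)) (at ?y)"
    using at_within_interior[of ?y disk] x by (simp add: interior_cball)
  have 2: "((\<lambda>s. x + s *\<^sub>R axis i 1) has_derivative (\<lambda>t. t *\<^sub>R axis i 1)) (at s)"
    by (auto intro!: derivative_eq_intros)
  have "((\<lambda>s. f (x + s *\<^sub>R axis i 1)) has_derivative (\<lambda>t. t * partial i f ?y)) (at s)"
    using has_derivative_compose[OF 2 1] exhaust_2[of i] by (auto simp: axis_def)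
  then show ?thesis by (simp add: has_field_derivative_def mult_commute_abs)
qed

text \<open>The mean value theorem is applied first in direction \<open>i\<close> to a difference
  taken in direction \<open>j\<close>, then in direction \<open>j\<close>. The margin
  \<open>2 * h\<close> keeps the whole parallelogram in the open disk, where relative derivatives
  are ordinary ones.\<close>

lemma second_difference_mvt:
  assumes f: "smooth_on_disk f" and h: "h > 0" and x: "norm x + 2 * h < 1"
  shows "\<exists>s t. 0 < s \<and> s < h \<and> 0 < t \<and> t < h \<and>
    f (x + h *\<^sub>R axis i 1 + h *\<^sub>R axis j 1) - f (x + h *\<^sub>R axis j 1) - f (x + h *\<^sub>R axis i 1) + f x
    = h * h * partial j (partial i f) (x + s *\<^sub>R axis i 1 + t *\<^sub>R axis j 1)"
proof -
  have inb: "x + s *\<^sub>R axis i 1 + t *\<^sub>R axis j 1 \<in> ball 0 1" if "0 \<le> s" "s \<le> h" "0 \<le> t" "t \<le> h" for s t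
  proof -
    have "norm (x + s *\<^sub>R axis i 1 + t *\<^sub>R axis j (1::real)) \<le> norm x + norm (s *\<^sub>R axis i (1::real)) + norm (t *\<^sub>R axis j (1::real))"
      by (meson norm_triangle_le norm_triangle_ineq add_mono order_refl)
    then show ?thesis using that x by (simp add: norm_axis_1)
  qed
  have d: "\<And>x. x \<in> disk \<Longrightarrow> f differentiable (at x within disk)"
    "\<And>x. x \<in> disk \<Longrightarrow> partial i f differentiable (at x within disk)"
    using smooth_on_disk_differentiable f smooth_on_disk_partial[OF f] by blast+
  define g where "g s = f (x + s *\<^sub>R axis i 1 + h *\<^sub>R axis j 1) - f (x + s *\<^sub>R axis i 1)" for s
  have g': "(g has_real_derivative (partial i f (x + s *\<^sub>R axis i 1 + h *\<^sub>R axis j 1) - partial i f (x + s *\<^sub>R axis i 1))) (at s)"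
    if "0 \<le> s" "s \<le> h" for s
  proof -
    have "(x + h *\<^sub>R axis j 1) + s *\<^sub>R axis i 1 \<in> ball 0 1"
      using inb[OF that, of h] h by (simp add: add_ac)
    from partial_line[OF d(1) this] have 1: "((\<lambda>s. f (x + s *\<^sub>R axis i 1 + h *\<^sub>R axis j 1)) has_real_derivative partial i f (x + s *\<^sub>R axis i 1 + h *\<^sub>R axis j 1)) (at s)"
      by (simp add: add_ac)
    have "x + s *\<^sub>R axis i 1 \<in> ball 0 1" using inb[OF that, of 0] h by simp
    from partial_line[OF d(1) this] show ?thesis
      unfolding g_def using 1 by (intro DERIV_diff)
  qed
  obtain s where s: "0 < s" "s < h" "g h - g 0 = (h - 0) * (partial i f (x + s *\<^sub>R axis i 1 + h *\<^sub>R axis j 1) - partial i f (x + s *\<^sub>R axis i 1))"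
    using MVT2[OF h g'] by blast
  define k where "k t = partial i f (x + s *\<^sub>R axis i 1 + t *\<^sub>R axis j 1)" for t
  have k': "(k has_real_derivative (partial j (partial i f) (x + s *\<^sub>R axis i 1 + t *\<^sub>R axis j 1))) (at t)"
    if "0 \<le> t" "t \<le> h" for t
    unfolding k_def by (rule partial_line[OF d(2)]) (use inb that s in auto)
  obtain t where t: "0 < t" "t < h" "k h - k 0 = (h - 0) * partial j (partial i f) (x + s *\<^sub>R axis i 1 + t *\<^sub>R axis j 1)"
    using MVT2[OF h k'] by blast
  show ?thesis
    by (intro exI[of _ s] exI[of _ t] conjI s t) (use s t in \<open>simp_all add: g_def k_def algebra_simps\<close>)
qed

text \<open>The second difference is symmetric in \<open>i\<close> and \<open>j\<close>, so at
  interior points both mixed derivatives take equal values arbitrarily near the point and agree by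
  continuity. The boundary follows by density of the open disk.\<close>

lemma partial_commute:
  assumes f: "smooth_on_disk f" and x: "x \<in> disk"
  shows "partial i (partial j f) x = partial j (partial i f) x"
proof -
  define D where "D x = partial i (partial j f) x - partial j (partial i f) x" for x
  have c: "continuous_on disk (partial i (partial j f))" "continuous_on disk (partial j (partial i f))"
    using smooth_on_disk_continuous smooth_on_disk_partial f by blast+
  have D0: "D x = 0" if x: "x \<in> ball 0 1" for x
  proof (rule ccontr)
    assume "D x \<noteq> 0"
    define e where "e = \<bar>D x\<bar> / 2"
    have e: "e > 0" using \<open>D x \<noteq> 0\<close> by (simp add: e_def)
    have xd: "x \<in> disk" using x by (meson ball_subset_cball subsetD)
    obtain d1 where d1: "d1 > 0" "\<And>y. y \<in> disk \<Longrightarrow> dist y x < d1 \<Longrightarrow> dist (partial i (partial j f) y) (partial i (partial j f) x) < e"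
      using c(1) xd e unfolding continuous_on_iff by meson
    obtain d2 where d2: "d2 > 0" "\<And>y. y \<in> disk \<Longrightarrow> dist y x < d2 \<Longrightarrow> dist (partial j (partial i f) y) (partial j (partial i f) x) < e"
      using c(2) xd e unfolding continuous_on_iff by meson
    \<comment> \<open>The divisor 4 leaves room for two displacements of length \<open>h\<close>,
      both for the two continuity radii and for staying inside the disk.\<close>
    define h where "h = min (min d1 d2) (1 - norm x) / 4"
    have h: "h > 0" "2 * h < d1" "2 * h < d2" "norm x + 2 * h < 1"
      using d1(1) d2(1) x unfolding h_def by (auto simp: min_def field_simps)
    have near: "x + s *\<^sub>R axis k 1 + t *\<^sub>R axis l 1 \<in> disk"
      "dist (x + s *\<^sub>R axis k 1 + t *\<^sub>R axis l 1) x < min d1 d2"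
      if "0 < s" "s < h" "0 < t" "t < h" for s t k l
    proof -
      have n: "norm (s *\<^sub>R axis k 1 + t *\<^sub>R axis l (1::real) :: real^2) \<le> 2 * h"
        using norm_triangle_ineq[of "s *\<^sub>R axis k (1::real)" "t *\<^sub>R axis l (1::real) :: real^2"] that
        by (simp add: norm_axis_1)
      have "norm (x + (s *\<^sub>R axis k 1 + t *\<^sub>R axis l (1::real))) \<le> norm x + norm (s *\<^sub>R axis k 1 + t *\<^sub>R axis l (1::real) :: real^2)"
        by (rule norm_triangle_ineq)
      then show "x + s *\<^sub>R axis k 1 + t *\<^sub>R axis l 1 \<in> disk"
        using h n by (simp add: mem_cball add.assoc)
      have "x + s *\<^sub>R axis k 1 + t *\<^sub>R axis l (1::real) - x = s *\<^sub>R axis k 1 + t *\<^sub>R axis l 1" by simp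
      then show "dist (x + s *\<^sub>R axis k 1 + t *\<^sub>R axis l 1) x < min d1 d2"
        unfolding dist_norm using n h by simp
    qed
    obtain s t where st: "0 < s" "s < h" "0 < t" "t < h"
      "f (x + h *\<^sub>R axis i 1 + h *\<^sub>R axis j 1) - f (x + h *\<^sub>R axis j 1) - f (x + h *\<^sub>R axis i 1) + f x
        = h * h * partial j (partial i f) (x + s *\<^sub>R axis i 1 + t *\<^sub>R axis j 1)"
      using second_difference_mvt[OF f h(1,4)] by blast
    obtain s' t' where st': "0 < s'" "s' < h" "0 < t'" "t' < h"
      "f (x + h *\<^sub>R axis j 1 + h *\<^sub>R axis i 1) - f (x + h *\<^sub>R axis i 1) - f (x + h *\<^sub>R axis j 1) + f x
        = h * h * partial i (partial j f) (x + s' *\<^sub>R axis j 1 + t' *\<^sub>R axis i 1)"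
      using second_difference_mvt[OF f h(1,4)] by blast
    have "x + h *\<^sub>R axis j 1 + h *\<^sub>R axis i 1 = x + h *\<^sub>R axis i 1 + h *\<^sub>R axis j 1"
      by (rule add.assoc[THEN trans, OF arg_cong[OF add.commute, of "(+) x"], THEN trans, OF add.assoc[symmetric]])
    note swap = this
    have "h * h * partial j (partial i f) (x + s *\<^sub>R axis i 1 + t *\<^sub>R axis j 1)
      = h * h * partial i (partial j f) (x + s' *\<^sub>R axis j 1 + t' *\<^sub>R axis i 1)"
      using st(5) st'(5)[unfolded swap] by linarith
    then have "partial j (partial i f) (x + s *\<^sub>R axis i 1 + t *\<^sub>R axis j 1)
      = partial i (partial j f) (x + s' *\<^sub>R axis j 1 + t' *\<^sub>R axis i 1)"
      using h(1) by simp
    moreover have "\<bar>partial i (partial j f) (x + s' *\<^sub>R axis j 1 + t' *\<^sub>R axis i 1) - partial i (partial j f) x\<bar> < e"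
      using d1(2)[OF near(1)[OF st'(1-4)]] near(2)[OF st'(1-4)] by (simp add: dist_real_def)
    moreover have "\<bar>partial j (partial i f) (x + s *\<^sub>R axis i 1 + t *\<^sub>R axis j 1) - partial j (partial i f) x\<bar> < e"
      using d2(2)[OF near(1)[OF st(1-4)]] near(2)[OF st(1-4)] by (simp add: dist_real_def)
    ultimately have "\<bar>D x\<bar> < 2 * e" unfolding D_def by linarith
    then show False by (simp add: e_def)
  qed
  have cl: "closure (ball (0::real^2) 1) = disk" by simp
  have "D x = 0"
    by (rule continuous_constant_on_closure[of "ball 0 1" D])
      (use c x D0 in \<open>auto simp: D_def cl intro!: continuous_intros\<close>)
  then show ?thesis by (simp add: D_def)
qed

section \<open>Integration by parts, Sobolev inequalities and calculus on the boundary
  circle\<close>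

section \<open>Integration over the disk and the circle\<close>

definition disk_int :: "(real^2 \<Rightarrow> real) \<Rightarrow> real" where
  "disk_int f = (LINT x:disk|lborel. f x)"

definition circ_int :: "(real^2 \<Rightarrow> real) \<Rightarrow> real" where
  "circ_int f = integral {0..2*pi} (\<lambda>t. f (circ t))"

abbreviation pt :: "real \<Rightarrow> real \<Rightarrow> real^2" where "pt x y \<equiv> vector [x, y]"

lemma pt_eq: "pt x y = x *\<^sub>R axis 1 1 + y *\<^sub>R axis 2 1"
  by (simp add: vec_eq_iff forall_2 axis_def)

lemma pt_coords: "x = pt (x$1) (x$2)"
  by (simp add: vec_eq_iff forall_2)

lemma pt_in_disk: "pt x y \<in> disk \<longleftrightarrow> x\<^sup>2 + y\<^sup>2 \<le> 1"
  by (simp add: mem_cball norm_vec_def L2_set_def sum_2)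

lemma continuous_on_pt [continuous_intros]:
  "continuous_on S f \<Longrightarrow> continuous_on S g \<Longrightarrow> continuous_on S (\<lambda>s. pt (f s) (g s))"
  unfolding pt_eq by (intro continuous_intros)

lemma circ_pt: "circ t = pt (cos t) (sin t)"
  by (simp add: circ_def)

lemma circ_in_disk [simp]: "circ t \<in> disk"
  by (simp add: circ_pt pt_in_disk)

lemma continuous_on_circ [continuous_intros]: "continuous_on S circ"
  unfolding circ_pt[abs_def] by (intro continuous_intros)

lemma disk_set_integrable: "continuous_on disk f \<Longrightarrow> set_integrable lborel disk (f :: real^2 \<Rightarrow> real)"
  unfolding set_integrable_def by (rule borel_integrable_compact) auto

lemma circ_integrable: "continuous_on disk f \<Longrightarrow> (\<lambda>t. f (circ t)) integrable_on {a..b}" for f :: "real^2 \<Rightarrow> real"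
  by (rule integrable_continuous_interval) (auto intro!: continuous_on_compose2[of disk f] continuous_intros)

lemma measurable_pt: "(\<lambda>(x, y). pt x y) \<in> borel_measurable (lborel \<Otimes>\<^sub>M lborel)"
proof -
  have cont: "continuous_on UNIV (\<lambda>(x, y). pt x y)"
    unfolding case_prod_beta by (intro continuous_intros)
  then show ?thesis
    by (simp add: lborel_prod borel_measurable_continuous_onI)
qed

text \<open>This gives access to Fubini: both measures agree on boxes, and that characterises
  Lebesgue measure.\<close>

lemma lborel_pt: "(lborel :: (real^2) measure) = distr (lborel \<Otimes>\<^sub>M lborel) borel (\<lambda>(x, y). pt x y)"
proof (rule lborel_eqI)
  note m = measurable_pt
  fix l u :: "real^2" assume lu: "\<And>b. b \<in> Basis \<Longrightarrow> l \<bullet> b \<le> u \<bullet> b"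
  have lu': "l $ i \<le> u $ i" for i
    using lu[of "axis i 1"] by (simp add: inner_axis axis_in_Basis_iff)
  have v: "(\<lambda>(x, y). pt x y) -` box l u = box (l$1, l$2) (u$1, u$2)"
    by (auto simp: mem_box_cart forall_2 mem_box Basis_prod_def space_pair_measure)
  have "emeasure (distr (lborel \<Otimes>\<^sub>M lborel) borel (\<lambda>(x, y). pt x y)) (box l u)
     = emeasure lborel (box (l$1, l$2) (u$1, u$2))"
    by (subst emeasure_distr[OF m]) (auto simp: v lborel_prod space_pair_measure)
  also have "\<dots> = (\<Prod>b\<in>Basis. ((u$1, u$2) - (l$1, l$2)) \<bullet> b)"
    by (rule emeasure_lborel_box) (use lu' in \<open>auto simp: Basis_prod_def\<close>)
  also have "(\<Prod>b\<in>Basis. ((u$1, u$2) - (l$1, l$2)) \<bullet> b) = (u$1 - l$1) * (u$2 - l$2)"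
    by (simp add: Basis_prod_def prod.union_disjoint)
  also have "(u$1 - l$1) * (u$2 - l$2) = (\<Prod>b\<in>Basis. (u - l) \<bullet> b)"
  proof -
    have "(\<Prod>b\<in>Basis. (u - l) \<bullet> b) = (\<Prod>i\<in>UNIV. (u - l) $ i)"
      by (rule prod.reindex_cong[of "\<lambda>i. axis i 1"])
        (auto simp: inj_on_def axis_eq_axis Basis_vec_def inner_axis)
    then show ?thesis by (simp add: UNIV_2)
  qed
  finally show "emeasure (distr (lborel \<Otimes>\<^sub>M lborel) borel (\<lambda>(x, y). pt x y)) (box l u) = (\<Prod>b\<in>Basis. (u - l) \<bullet> b)" .
qed simp

text \<open>Both orders are recorded: the divergence theorem integrates the \<open>i\<close>-th
  derivative along chords of direction \<open>i\<close>, and the Sobolev inequality plays the two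
  slicings against each other. Integrability of the chord integrals comes with Fubini, so their
  continuity in the slice parameter never has to be discussed.\<close>

lemma disk_int_iterated:
  assumes f: "continuous_on disk f"
  shows "disk_int f = integral {-1..1} (\<lambda>x. integral {- sqrt (1 - x\<^sup>2)..sqrt (1 - x\<^sup>2)} (\<lambda>y. f (pt x y)))"
    and "(\<lambda>x. integral {- sqrt (1 - x\<^sup>2)..sqrt (1 - x\<^sup>2)} (\<lambda>y. f (pt x y))) integrable_on {-1..1}"
    and "disk_int f = integral {-1..1} (\<lambda>y. integral {- sqrt (1 - y\<^sup>2)..sqrt (1 - y\<^sup>2)} (\<lambda>x. f (pt x y)))"
    and "(\<lambda>y. integral {- sqrt (1 - y\<^sup>2)..sqrt (1 - y\<^sup>2)} (\<lambda>x. f (pt x y))) integrable_on {-1..1}"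
proof -
  define G where "G = (\<lambda>x. indicat_real disk x *\<^sub>R f x)"
  have G: "integrable lborel G"
    using disk_set_integrable[OF f] by (simp add: set_integrable_def G_def)
  note m = measurable_pt
  have Gm: "G \<in> borel_measurable borel" using G by auto
  have Gint: "integrable (lborel \<Otimes>\<^sub>M lborel) (\<lambda>(x, y). G (pt x y))"
    using integrable_distr[OF m, of G] G unfolding lborel_pt[symmetric] by (simp add: case_prod_beta')
  have Geq: "disk_int f = integral\<^sup>L (lborel \<Otimes>\<^sub>M lborel) (\<lambda>(x, y). G (pt x y))"
  proof -
    have "disk_int f = integral\<^sup>L lborel G"
      by (simp add: disk_int_def set_lebesgue_integral_def G_def)
    also have "\<dots> = integral\<^sup>L (distr (lborel \<Otimes>\<^sub>M lborel) borel (\<lambda>(x, y). pt x y)) G"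
      by (simp add: lborel_pt[symmetric])
    also have "\<dots> = integral\<^sup>L (lborel \<Otimes>\<^sub>M lborel) (\<lambda>p. G ((\<lambda>(x, y). pt x y) p))"
      by (rule integral_distr[OF m Gm])
    finally show ?thesis by (simp add: case_prod_beta')
  qed
  have chord: "pt x y \<in> disk \<longleftrightarrow> x \<in> {-1..1} \<and> y \<in> {- sqrt (1 - x\<^sup>2)..sqrt (1 - x\<^sup>2)}" for x y
  proof -
    have "x\<^sup>2 + y\<^sup>2 \<le> 1 \<longleftrightarrow> x\<^sup>2 \<le> 1 \<and> y\<^sup>2 \<le> 1 - x\<^sup>2"
      using zero_le_power2[of y] by linarith
    also have "\<dots> \<longleftrightarrow> \<bar>x\<bar> \<le> 1 \<and> \<bar>y\<bar> \<le> sqrt (1 - x\<^sup>2)"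
      using real_sqrt_le_iff[of "y\<^sup>2" "1 - x\<^sup>2"] by (simp add: abs_square_le_1)
    finally show ?thesis unfolding pt_in_disk by auto
  qed
  have chord': "pt x y \<in> disk \<longleftrightarrow> y \<in> {-1..1} \<and> x \<in> {- sqrt (1 - y\<^sup>2)..sqrt (1 - y\<^sup>2)}" for x y
    using chord[of y x] unfolding pt_in_disk by (simp add: add.commute)
  have inner: "integral\<^sup>L lborel (\<lambda>y. G (p y)) = indicat_real {-1..1} a *\<^sub>R integral {- sqrt (1 - a\<^sup>2)..sqrt (1 - a\<^sup>2)} (\<lambda>y. f (p y))"
    if p: "\<And>y. p y \<in> disk \<longleftrightarrow> a \<in> {-1..1} \<and> y \<in> {- sqrt (1 - a\<^sup>2)..sqrt (1 - a\<^sup>2)}"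
      and cp: "continuous_on UNIV p" for p :: "real \<Rightarrow> real^2" and a
  proof (cases "a \<in> {-1..1}")
    case True
    let ?I = "{- sqrt (1 - a\<^sup>2)..sqrt (1 - a\<^sup>2)}"
    have cI: "continuous_on ?I (\<lambda>y. f (p y))"
      by (rule continuous_on_compose2[OF f]) (rule continuous_on_subset[OF cp subset_UNIV], use p True in blast)
    have "set_integrable lborel ?I (\<lambda>y. f (p y))"
      unfolding set_integrable_def by (rule borel_integrable_compact) (use cI in auto)
    then have "(LINT y:?I|lborel. f (p y)) = integral ?I (\<lambda>y. f (p y))"
      by (rule set_borel_integral_eq_integral)
    moreover have "G (p y) = indicat_real ?I y *\<^sub>R f (p y)" for y
      using p True by (simp add: G_def indicator_def)
    ultimately show ?thesis using True by (simp add: set_lebesgue_integral_def)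
  next
    case False
    then have "p y \<notin> disk" for y using p by blast
    then have "G (p y) = 0" for y by (simp add: G_def)
    then show ?thesis using False by simp
  qed
  have 1: "integral\<^sup>L lborel (\<lambda>y. G (pt x y)) = indicat_real {-1..1} x *\<^sub>R integral {- sqrt (1 - x\<^sup>2)..sqrt (1 - x\<^sup>2)} (\<lambda>y. f (pt x y))" for x
    using inner[of "\<lambda>y. pt x y" x, OF chord] by (simp add: continuous_on_pt)
  have 2: "integral\<^sup>L lborel (\<lambda>x. G (pt x y)) = indicat_real {-1..1} y *\<^sub>R integral {- sqrt (1 - y\<^sup>2)..sqrt (1 - y\<^sup>2)} (\<lambda>x. f (pt x y))" for y
    using inner[of "\<lambda>x. pt x y" y, OF chord'] by (simp add: continuous_on_pt)
  have i1: "set_integrable lborel {-1..1} (\<lambda>x. integral {- sqrt (1 - x\<^sup>2)..sqrt (1 - x\<^sup>2)} (\<lambda>y. f (pt x y)))"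
    using lborel_pair.integrable_fst[OF Gint] by (simp add: 1 set_integrable_def)
  have i2: "set_integrable lborel {-1..1} (\<lambda>y. integral {- sqrt (1 - y\<^sup>2)..sqrt (1 - y\<^sup>2)} (\<lambda>x. f (pt x y)))"
    using lborel_pair.integrable_snd[OF Gint] by (simp add: 2 set_integrable_def)
  show "(\<lambda>x. integral {- sqrt (1 - x\<^sup>2)..sqrt (1 - x\<^sup>2)} (\<lambda>y. f (pt x y))) integrable_on {-1..1}"
    "(\<lambda>y. integral {- sqrt (1 - y\<^sup>2)..sqrt (1 - y\<^sup>2)} (\<lambda>x. f (pt x y))) integrable_on {-1..1}"
    using set_borel_integral_eq_integral(1) i1 i2 by blast+
  show "disk_int f = integral {-1..1} (\<lambda>x. integral {- sqrt (1 - x\<^sup>2)..sqrt (1 - x\<^sup>2)} (\<lambda>y. f (pt x y)))"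
    using lborel_pair.integral_fst[OF Gint] set_borel_integral_eq_integral(2)[OF i1]
    by (simp add: Geq 1 set_lebesgue_integral_def)
  show "disk_int f = integral {-1..1} (\<lambda>y. integral {- sqrt (1 - y\<^sup>2)..sqrt (1 - y\<^sup>2)} (\<lambda>x. f (pt x y)))"
    using lborel_pair.integral_snd[OF Gint] set_borel_integral_eq_integral(2)[OF i2]
    by (simp add: Geq 2 set_lebesgue_integral_def)
qed

text \<open>Unlike \<open>partial_line\<close> this reaches the boundary: the derivative is relative
  to the part of the line inside the disk, so closed chords are allowed.\<close>

lemma has_derivative_disk_line:
  assumes f: "\<And>x. x \<in> disk \<Longrightarrow> f differentiable (at x within disk)"
    and S: "\<And>s. s \<in> S \<Longrightarrow> x + s *\<^sub>R axis i 1 \<in> disk" and s: "s \<in> S"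
  shows "((\<lambda>s. f (x + s *\<^sub>R axis i 1)) has_vector_derivative partial i f (x + s *\<^sub>R axis i 1)) (at s within S)"
proof -
  let ?p = "\<lambda>s. x + s *\<^sub>R axis i (1::real)"
  have 1: "(f has_derivative (\<lambda>v. v$1 * partial 1 f (?p s) + v$2 * partial 2 f (?p s))) (at (?p s) within ?p ` S)"
    by (rule has_derivative_subset[OF has_derivative_partial[OF f]]) (use S s in auto)
  have 2: "(?p has_derivative (\<lambda>t. t *\<^sub>R axis i 1)) (at s within S)"
    by (auto intro!: derivative_eq_intros)
  show ?thesis
    using diff_chain_within[OF 2 1] exhaust_2[of i]
    by (auto simp: has_vector_derivative_def o_def axis_def)
qed

lemma integral_chord_partial2:
  assumes f: "\<And>x. x \<in> disk \<Longrightarrow> f differentiable (at x within disk)" and x: "\<bar>x\<bar> \<le> 1"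
  shows "integral {- sqrt (1 - x\<^sup>2)..sqrt (1 - x\<^sup>2)} (\<lambda>y. partial 2 f (pt x y))
       = f (pt x (sqrt (1 - x\<^sup>2))) - f (pt x (- sqrt (1 - x\<^sup>2)))"
proof (rule integral_unique, rule fundamental_theorem_of_calculus)
  have x2: "x\<^sup>2 \<le> 1" using x by (simp add: abs_square_le_1)
  show "- sqrt (1 - x\<^sup>2) \<le> sqrt (1 - x\<^sup>2)" using x2 by simp
  have e: "pt x y = pt x 0 + y *\<^sub>R axis 2 1" for y by (simp add: pt_eq)
  have ind: "pt x 0 + y *\<^sub>R axis 2 1 \<in> disk" if "y \<in> {- sqrt (1 - x\<^sup>2)..sqrt (1 - x\<^sup>2)}" for y
  proof -
    have "y\<^sup>2 \<le> (sqrt (1 - x\<^sup>2))\<^sup>2" using that by (intro power2_le_iff_abs_le[THEN iffD2]) (use x2 in auto)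
    then show ?thesis using x2 unfolding e[symmetric] pt_in_disk by simp
  qed
  show "((\<lambda>y. f (pt x y)) has_vector_derivative partial 2 f (pt x y)) (at y within {- sqrt (1 - x\<^sup>2)..sqrt (1 - x\<^sup>2)})"
    if "y \<in> {- sqrt (1 - x\<^sup>2)..sqrt (1 - x\<^sup>2)}" for y
    using has_derivative_disk_line[OF f ind that] unfolding e[symmetric] .
qed

lemma integral_chord_partial1:
  assumes f: "\<And>x. x \<in> disk \<Longrightarrow> f differentiable (at x within disk)" and y: "\<bar>y\<bar> \<le> 1"
  shows "integral {- sqrt (1 - y\<^sup>2)..sqrt (1 - y\<^sup>2)} (\<lambda>x. partial 1 f (pt x y))
       = f (pt (sqrt (1 - y\<^sup>2)) y) - f (pt (- sqrt (1 - y\<^sup>2)) y)"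
proof (rule integral_unique, rule fundamental_theorem_of_calculus)
  have y2: "y\<^sup>2 \<le> 1" using y by (simp add: abs_square_le_1)
  show "- sqrt (1 - y\<^sup>2) \<le> sqrt (1 - y\<^sup>2)" using y2 by simp
  have e: "pt x y = pt 0 y + x *\<^sub>R axis 1 1" for x by (simp add: pt_eq)
  have ind: "pt 0 y + x *\<^sub>R axis 1 1 \<in> disk" if "x \<in> {- sqrt (1 - y\<^sup>2)..sqrt (1 - y\<^sup>2)}" for x
  proof -
    have "x\<^sup>2 \<le> (sqrt (1 - y\<^sup>2))\<^sup>2" using that by (intro power2_le_iff_abs_le[THEN iffD2]) (use y2 in auto)
    then show ?thesis using y2 unfolding e[symmetric] pt_in_disk by simp
  qed
  show "((\<lambda>x. f (pt x y)) has_vector_derivative partial 1 f (pt x y)) (at x within {- sqrt (1 - y\<^sup>2)..sqrt (1 - y\<^sup>2)})"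
    if "x \<in> {- sqrt (1 - y\<^sup>2)..sqrt (1 - y\<^sup>2)}" for x
    using has_derivative_disk_line[OF f ind that] unfolding e[symmetric] .
qed

text \<open>These are the substitutions \<open>x = cos t\<close> and \<open>y = sin t\<close> on
  arcs that are graphs over a coordinate axis. The right half circle comes in two pieces because the
  angle 0 lies in its middle.\<close>

lemma circ_arc_integrals:
  fixes f :: "real^2 \<Rightarrow> real"
  assumes f: "continuous_on disk f"
  shows upper_arc: "((\<lambda>t. sin t * f (circ t)) has_integral integral {-1..1} (\<lambda>x. f (pt x (sqrt (1 - x\<^sup>2))))) {0..pi}"
    and lower_arc: "((\<lambda>t. - sin t * f (circ t)) has_integral integral {-1..1} (\<lambda>x. f (pt x (- sqrt (1 - x\<^sup>2))))) {pi..2*pi}"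
    and right_arc1: "((\<lambda>t. cos t * f (circ t)) has_integral integral {0..1} (\<lambda>y. f (pt (sqrt (1 - y\<^sup>2)) y))) {0..pi/2}"
    and left_arc: "((\<lambda>t. - cos t * f (circ t)) has_integral integral {-1..1} (\<lambda>y. f (pt (- sqrt (1 - y\<^sup>2)) y))) {pi/2..3*pi/2}"
    and right_arc2: "((\<lambda>t. cos t * f (circ t)) has_integral integral {-1..0} (\<lambda>y. f (pt (sqrt (1 - y\<^sup>2)) y))) {3*pi/2..2*pi}"
proof -
  have sq: "x\<^sup>2 \<le> 1" if "x \<in> {-1..1}" for x :: real using that by (simp add: abs_square_le_1 abs_le_iff)
  have cF: "continuous_on {-1..1} (\<lambda>x. f (pt x (sqrt (1 - x\<^sup>2))))"
    "continuous_on {-1..1} (\<lambda>x. f (pt x (- sqrt (1 - x\<^sup>2))))"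
    "continuous_on {-1..1} (\<lambda>x. f (pt (sqrt (1 - x\<^sup>2)) x))"
    "continuous_on {-1..1} (\<lambda>x. f (pt (- sqrt (1 - x\<^sup>2)) x))"
    by (rule continuous_on_compose2[OF f], intro continuous_intros, use sq in \<open>force simp: pt_in_disk\<close>)+
  have sc: "sqrt (1 - (cos t)\<^sup>2) = \<bar>sin t\<bar>" "sqrt (1 - (sin t)\<^sup>2) = \<bar>cos t\<bar>" for t :: real
    by (simp_all add: sin_squared_eq[symmetric] cos_squared_eq[symmetric])
  show "((\<lambda>t. sin t * f (circ t)) has_integral integral {-1..1} (\<lambda>x. f (pt x (sqrt (1 - x\<^sup>2))))) {0..pi}"
  proof -
    have "((\<lambda>t. (- sin t) *\<^sub>R f (pt (cos t) (sqrt (1 - (cos t)\<^sup>2)))) has_integral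
        (integral {cos 0..cos pi} (\<lambda>x. f (pt x (sqrt (1 - x\<^sup>2)))) - integral {cos pi..cos 0} (\<lambda>x. f (pt x (sqrt (1 - x\<^sup>2)))))) {0..pi}"
      by (rule has_integral_substitution_general[OF finite.emptyI _ _ cF(1)])
        (auto intro!: derivative_eq_intros continuous_intros)
    then have "((\<lambda>t. - sin t * f (pt (cos t) (sqrt (1 - (cos t)\<^sup>2)))) has_integral
        - integral {-1..1} (\<lambda>x. f (pt x (sqrt (1 - x\<^sup>2))))) {0..pi}" by simp
    from has_integral_neg[OF this] have "((\<lambda>t. sin t * f (pt (cos t) (sqrt (1 - (cos t)\<^sup>2)))) has_integral
        integral {-1..1} (\<lambda>x. f (pt x (sqrt (1 - x\<^sup>2))))) {0..pi}" by simp
    then show ?thesis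
      by (rule has_integral_eq[rotated]) (auto simp: sc circ_pt sin_ge_zero)
  qed
  have sin_le_zero': "sin t \<le> 0" if "pi \<le> t" "t \<le> 2 * pi" for t
    using sin_ge_zero[of "t - pi"] that by (simp add: sin_diff)
  show "((\<lambda>t. - sin t * f (circ t)) has_integral integral {-1..1} (\<lambda>x. f (pt x (- sqrt (1 - x\<^sup>2))))) {pi..2*pi}"
  proof -
    have "((\<lambda>t. (- sin t) *\<^sub>R f (pt (cos t) (- sqrt (1 - (cos t)\<^sup>2)))) has_integral
        (integral {cos pi..cos (2*pi)} (\<lambda>x. f (pt x (- sqrt (1 - x\<^sup>2)))) - integral {cos (2*pi)..cos pi} (\<lambda>x. f (pt x (- sqrt (1 - x\<^sup>2)))))) {pi..2*pi}"
      by (rule has_integral_substitution_general[OF finite.emptyI _ _ cF(2)])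
        (auto intro!: derivative_eq_intros continuous_intros)
    then have "((\<lambda>t. - sin t * f (pt (cos t) (- sqrt (1 - (cos t)\<^sup>2)))) has_integral
        integral {-1..1} (\<lambda>x. f (pt x (- sqrt (1 - x\<^sup>2))))) {pi..2*pi}" by simp
    then show ?thesis
      by (rule has_integral_eq[rotated]) (use sin_le_zero' in \<open>auto simp: sc circ_pt abs_of_nonpos\<close>)
  qed
  have r: "((\<lambda>t. cos t * f (circ t)) has_integral integral {sin a..sin b} (\<lambda>y. f (pt (sqrt (1 - y\<^sup>2)) y))) {a..b}"
    if ab: "a \<le> b" "sin a \<le> sin b" and c: "\<And>t. t \<in> {a..b} \<Longrightarrow> 0 \<le> cos t" for a b
  proof -
    have "((\<lambda>t. (cos t) *\<^sub>R f (pt (sqrt (1 - (sin t)\<^sup>2)) (sin t))) has_integral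
        integral {sin a..sin b} (\<lambda>y. f (pt (sqrt (1 - y\<^sup>2)) y))) {a..b}"
      by (rule has_integral_substitution[OF ab _ cF(3)])
        (auto intro!: derivative_eq_intros)
    then show ?thesis
      by (rule has_integral_eq[rotated]) (auto simp: sc circ_pt c)
  qed
  show "((\<lambda>t. cos t * f (circ t)) has_integral integral {0..1} (\<lambda>y. f (pt (sqrt (1 - y\<^sup>2)) y))) {0..pi/2}"
    using r[of 0 "pi/2"] by (simp add: cos_ge_zero)
  have s32: "sin (3*pi/2) = -1" using sin_periodic_pi[of "pi/2"] by (simp add: field_simps)
  have c32: "0 \<le> cos t" if "t \<in> {3*pi/2..2*pi}" for t
    using cos_ge_zero[of "t - 2*pi"] that by (simp add: cos_diff)
  show "((\<lambda>t. cos t * f (circ t)) has_integral integral {-1..0} (\<lambda>y. f (pt (sqrt (1 - y\<^sup>2)) y))) {3*pi/2..2*pi}"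
    using r[of "3*pi/2" "2*pi", OF _ _ c32] by (simp add: s32)
  show "((\<lambda>t. - cos t * f (circ t)) has_integral integral {-1..1} (\<lambda>y. f (pt (- sqrt (1 - y\<^sup>2)) y))) {pi/2..3*pi/2}"
  proof -
    have c: "cos t \<le> 0" if "t \<in> {pi/2..3*pi/2}" for t
      using cos_ge_zero[of "t - pi"] that by (simp add: cos_diff)
    have "((\<lambda>t. (cos t) *\<^sub>R f (pt (- sqrt (1 - (sin t)\<^sup>2)) (sin t))) has_integral
        (integral {sin (pi/2)..sin (3*pi/2)} (\<lambda>y. f (pt (- sqrt (1 - y\<^sup>2)) y)) - integral {sin (3*pi/2)..sin (pi/2)} (\<lambda>y. f (pt (- sqrt (1 - y\<^sup>2)) y)))) {pi/2..3*pi/2}"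
      by (rule has_integral_substitution_general[OF finite.emptyI _ _ cF(4)])
        (auto intro!: derivative_eq_intros continuous_intros)
    then have "((\<lambda>t. (cos t) * f (pt (- sqrt (1 - (sin t)\<^sup>2)) (sin t))) has_integral
        - integral {-1..1} (\<lambda>y. f (pt (- sqrt (1 - y\<^sup>2)) y))) {pi/2..3*pi/2}" by (simp add: s32)
    from has_integral_neg[OF this] have "((\<lambda>t. - cos t * f (pt (- sqrt (1 - (sin t)\<^sup>2)) (sin t))) has_integral
        integral {-1..1} (\<lambda>y. f (pt (- sqrt (1 - y\<^sup>2)) y))) {pi/2..3*pi/2}" by simp
    then show ?thesis
      by (rule has_integral_eq[rotated]) (auto simp: sc circ_pt c abs_of_nonpos)
  qed
qed

text \<open>Along a chord of direction \<open>i\<close> the fundamental theorem leaves the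
  difference of \<open>f\<close> at the two end points. The arc substitutions turn these differences
  into an integral over the angle, and the Jacobian is the \<open>i\<close>-th component of the
  outward normal.\<close>

theorem divergence_disk:
  assumes f: "\<And>x. x \<in> disk \<Longrightarrow> f differentiable (at x within disk)"
    and c: "continuous_on disk (partial i f)"
  shows "disk_int (partial i f) = circ_int (\<lambda>x. f x * x $ i)"
proof -
  have cf: "continuous_on disk f"
    unfolding continuous_on_eq_continuous_within using f differentiable_imp_continuous_within by blast
  note arc = circ_arc_integrals[OF cf]
  have sq: "x\<^sup>2 \<le> 1" if "x \<in> {-1..1}" for x :: real using that by (simp add: abs_square_le_1 abs_le_iff)
  have int: "(\<lambda>x. f (pt x (sqrt (1 - x\<^sup>2)))) integrable_on {-1..1}"
    "(\<lambda>x. f (pt x (- sqrt (1 - x\<^sup>2)))) integrable_on {-1..1}"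
    "(\<lambda>x. f (pt (sqrt (1 - x\<^sup>2)) x)) integrable_on {-1..1}"
    "(\<lambda>x. f (pt (- sqrt (1 - x\<^sup>2)) x)) integrable_on {-1..1}"
    by (rule integrable_continuous_interval, rule continuous_on_compose2[OF cf], intro continuous_intros,
      use sq in \<open>force simp: pt_in_disk\<close>)+
  consider "i = 1" | "i = 2" using exhaust_2 by blast
  then show ?thesis
  proof cases
    case 2
    have "disk_int (partial 2 f) = integral {-1..1} (\<lambda>x. f (pt x (sqrt (1 - x\<^sup>2))) - f (pt x (- sqrt (1 - x\<^sup>2))))"
      unfolding disk_int_iterated(1)[OF c[unfolded 2]]
      by (rule Henstock_Kurzweil_Integration.integral_cong, rule integral_chord_partial2[OF f]) auto
    also have "\<dots> = integral {-1..1} (\<lambda>x. f (pt x (sqrt (1 - x\<^sup>2)))) - integral {-1..1} (\<lambda>x. f (pt x (- sqrt (1 - x\<^sup>2))))"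
      by (rule Henstock_Kurzweil_Integration.integral_diff[OF int(1,2)])
    also have "\<dots> = integral {0..pi} (\<lambda>t. sin t * f (circ t)) + integral {pi..2*pi} (\<lambda>t. sin t * f (circ t))"
      using integral_unique[OF arc(1)] integral_unique[OF has_integral_neg[OF arc(2)]] by simp
    also have "\<dots> = integral {0..2*pi} (\<lambda>t. sin t * f (circ t))"
      by (rule Henstock_Kurzweil_Integration.integral_combine)
        (auto intro!: integrable_continuous_interval continuous_intros continuous_on_compose2[OF cf])
    finally show ?thesis by (simp add: 2 circ_int_def circ_pt mult.commute)
  next
    case 1
    have "disk_int (partial 1 f) = integral {-1..1} (\<lambda>y. f (pt (sqrt (1 - y\<^sup>2)) y) - f (pt (- sqrt (1 - y\<^sup>2)) y))"
      unfolding disk_int_iterated(3)[OF c[unfolded 1]]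
      by (rule Henstock_Kurzweil_Integration.integral_cong, rule integral_chord_partial1[OF f]) auto
    also have "\<dots> = integral {-1..1} (\<lambda>y. f (pt (sqrt (1 - y\<^sup>2)) y)) - integral {-1..1} (\<lambda>y. f (pt (- sqrt (1 - y\<^sup>2)) y))"
      by (rule Henstock_Kurzweil_Integration.integral_diff[OF int(3,4)])
    also have "integral {-1..1} (\<lambda>y. f (pt (sqrt (1 - y\<^sup>2)) y)) = integral {-1..0} (\<lambda>y. f (pt (sqrt (1 - y\<^sup>2)) y)) + integral {0..1} (\<lambda>y. f (pt (sqrt (1 - y\<^sup>2)) y))"
      by (rule Henstock_Kurzweil_Integration.integral_combine[symmetric]) (use int in auto)
    also have "\<dots> - integral {-1..1} (\<lambda>y. f (pt (- sqrt (1 - y\<^sup>2)) y))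
      = integral {0..pi/2} (\<lambda>t. cos t * f (circ t)) + integral {pi/2..3*pi/2} (\<lambda>t. cos t * f (circ t)) + integral {3*pi/2..2*pi} (\<lambda>t. cos t * f (circ t))"
      using integral_unique[OF arc(3)] integral_unique[OF has_integral_neg[OF arc(4)]] integral_unique[OF arc(5)] by simp
    also have "integral {0..pi/2} (\<lambda>t. cos t * f (circ t)) + integral {pi/2..3*pi/2} (\<lambda>t. cos t * f (circ t)) = integral {0..3*pi/2} (\<lambda>t. cos t * f (circ t))"
      by (rule Henstock_Kurzweil_Integration.integral_combine)
        (auto intro!: integrable_continuous_interval continuous_intros continuous_on_compose2[OF cf])
    also have "\<dots> + integral {3*pi/2..2*pi} (\<lambda>t. cos t * f (circ t)) = integral {0..2*pi} (\<lambda>t. cos t * f (circ t))"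
      by (rule Henstock_Kurzweil_Integration.integral_combine)
        (auto intro!: integrable_continuous_interval continuous_intros continuous_on_compose2[OF cf])
    finally show ?thesis by (simp add: 1 circ_int_def circ_pt mult.commute)
  qed
qed

lemma integral_nonneg_pointwise:
  fixes f :: "real \<Rightarrow> real"
  assumes "\<And>x. x \<in> S \<Longrightarrow> 0 \<le> f x"
  shows "0 \<le> integral S f"
  by (cases "f integrable_on S")
    (use assms in \<open>auto intro: Henstock_Kurzweil_Integration.integral_nonneg simp: not_integrable_integral\<close>)

lemma disk_int_cong: "(\<And>x. x \<in> disk \<Longrightarrow> f x = g x) \<Longrightarrow> disk_int f = disk_int g"
  unfolding disk_int_def by (rule set_lebesgue_integral_cong) auto

lemma disk_int_add:
  "continuous_on disk f \<Longrightarrow> continuous_on disk g \<Longrightarrow> disk_int (\<lambda>x. f x + g x) = disk_int f + disk_int g"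
  unfolding disk_int_def by (intro set_integral_add disk_set_integrable)

lemma disk_int_diff:
  "continuous_on disk f \<Longrightarrow> continuous_on disk g \<Longrightarrow> disk_int (\<lambda>x. f x - g x) = disk_int f - disk_int g"
  unfolding disk_int_def by (intro set_integral_diff disk_set_integrable)

lemma disk_int_cmult: "disk_int (\<lambda>x. c * f x) = c * disk_int f"
  unfolding disk_int_def by simp

lemma disk_int_minus: "disk_int (\<lambda>x. - f x) = - disk_int f"
  using disk_int_cmult[of "-1" f] by simp

lemma disk_int_mono:
  "continuous_on disk f \<Longrightarrow> continuous_on disk g \<Longrightarrow> (\<And>x. x \<in> disk \<Longrightarrow> f x \<le> g x) \<Longrightarrow> disk_int f \<le> disk_int g"
  unfolding disk_int_def by (intro set_integral_mono disk_set_integrable)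

lemma disk_int_0 [simp]: "disk_int (\<lambda>x. 0) = 0"
  by (simp add: disk_int_def)

lemma disk_int_nonneg: "(\<And>x. x \<in> disk \<Longrightarrow> 0 \<le> f x) \<Longrightarrow> 0 \<le> disk_int f"
  unfolding disk_int_def set_lebesgue_integral_def
  by (rule integral_nonneg_AE) (auto simp: indicator_def)

lemma circ_int_cong: "(\<And>x. x \<in> sphere 0 1 \<Longrightarrow> f x = g x) \<Longrightarrow> circ_int f = circ_int g"
  unfolding circ_int_def
  by (rule Henstock_Kurzweil_Integration.integral_cong) (simp add: circ_pt mem_sphere norm_vec_def L2_set_def sum_2)

lemma circ_int_add:
  "continuous_on disk f \<Longrightarrow> continuous_on disk g \<Longrightarrow> circ_int (\<lambda>x. f x + g x) = circ_int f + circ_int g"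
  unfolding circ_int_def by (intro Henstock_Kurzweil_Integration.integral_add circ_integrable)

lemma circ_int_diff:
  "continuous_on disk f \<Longrightarrow> continuous_on disk g \<Longrightarrow> circ_int (\<lambda>x. f x - g x) = circ_int f - circ_int g"
  unfolding circ_int_def by (intro Henstock_Kurzweil_Integration.integral_diff circ_integrable)

lemma circ_int_cmult: "circ_int (\<lambda>x. c * f x) = c * circ_int f"
  unfolding circ_int_def by simp

lemma circ_int_mono:
  "continuous_on disk f \<Longrightarrow> continuous_on disk g \<Longrightarrow> (\<And>x. x \<in> disk \<Longrightarrow> f x \<le> g x) \<Longrightarrow> circ_int f \<le> circ_int g"
  unfolding circ_int_def by (intro Henstock_Kurzweil_Integration.integral_le circ_integrable) auto

lemma circ_int_0 [simp]: "circ_int (\<lambda>x. 0) = 0"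
  by (simp add: circ_int_def)

lemma circ_int_nonneg: "(\<And>x. x \<in> disk \<Longrightarrow> 0 \<le> f x) \<Longrightarrow> 0 \<le> circ_int f"
  unfolding circ_int_def by (rule integral_nonneg_pointwise) auto

definition disk_norm :: "(real^2 \<Rightarrow> real) \<Rightarrow> real" where
  "disk_norm f = sqrt (disk_int (\<lambda>x. (f x)\<^sup>2))"

lemma disk_norm_nonneg [simp]: "0 \<le> disk_norm f"
  by (simp add: disk_norm_def disk_int_nonneg)

lemma disk_norm_sq: "(disk_norm f)\<^sup>2 = disk_int (\<lambda>x. (f x)\<^sup>2)"
  by (simp add: disk_norm_def disk_int_nonneg)

lemma disk_norm_cong: "(\<And>x. x \<in> disk \<Longrightarrow> f x = g x) \<Longrightarrow> disk_norm f = disk_norm g"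
  unfolding disk_norm_def by (simp cong: disk_int_cong)

lemma disk_norm_cmult: "disk_norm (\<lambda>x. c * f x) = \<bar>c\<bar> * disk_norm f"
  by (simp add: disk_norm_def power_mult_distrib disk_int_cmult real_sqrt_mult)

lemma disk_norm_mono:
  assumes "continuous_on disk f" "continuous_on disk g" "\<And>x. x \<in> disk \<Longrightarrow> \<bar>f x\<bar> \<le> \<bar>g x\<bar>"
  shows "disk_norm f \<le> disk_norm g"
  unfolding disk_norm_def using assms
  by (intro real_sqrt_le_mono disk_int_mono continuous_intros) (auto simp: abs_le_square_iff)

lemma disk_cauchy_schwarz:
  assumes f: "continuous_on disk f" and g: "continuous_on disk g"
  shows "\<bar>disk_int (\<lambda>x. f x * g x)\<bar> \<le> disk_norm f * disk_norm g"
proof -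
  have q: "0 \<le> a\<^sup>2 * disk_int (\<lambda>x. (f x)\<^sup>2) + 2 * a * b * disk_int (\<lambda>x. f x * g x) + b\<^sup>2 * disk_int (\<lambda>x. (g x)\<^sup>2)" for a b
  proof -
    have "0 \<le> disk_int (\<lambda>x. (a * f x + b * g x)\<^sup>2)" by (intro disk_int_nonneg) simp
    also have "\<dots> = disk_int (\<lambda>x. a\<^sup>2 * (f x)\<^sup>2 + 2 * a * b * (f x * g x) + b\<^sup>2 * (g x)\<^sup>2)"
      by (intro disk_int_cong) (simp add: power2_eq_square algebra_simps)
    also have "\<dots> = a\<^sup>2 * disk_int (\<lambda>x. (f x)\<^sup>2) + 2 * a * b * disk_int (\<lambda>x. f x * g x) + b\<^sup>2 * disk_int (\<lambda>x. (g x)\<^sup>2)"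
      using f g by (simp add: disk_int_add disk_int_cmult continuous_intros)
    finally show ?thesis .
  qed
  let ?F = "disk_int (\<lambda>x. (f x)\<^sup>2)" and ?G = "disk_int (\<lambda>x. (g x)\<^sup>2)" and ?P = "disk_int (\<lambda>x. f x * g x)"
  have FG: "0 \<le> ?F" "0 \<le> ?G" by (simp_all add: disk_int_nonneg)
  have "?P\<^sup>2 \<le> ?F * ?G"
  proof (cases "?G = 0")
    case True
    have "?P = 0"
    proof (rule ccontr)
      assume P: "?P \<noteq> 0"
      \<comment> \<open>This choice of the second coefficient makes the quadratic form equal to
        -1.\<close>
      have "0 \<le> ?F + 2 * (- (?F + 1) / (2 * ?P)) * ?P" using q[of 1 "- (?F + 1) / (2 * ?P)"] True by simp
      then show False using P by (simp add: field_simps)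
    qed
    then show ?thesis using FG by simp
  next
    case False
    then have G: "?G > 0" using FG by linarith
    have "0 \<le> ?G\<^sup>2 * ?F + 2 * ?G * (- ?P) * ?P + (- ?P)\<^sup>2 * ?G" using q[of ?G "- ?P"] .
    then have "0 \<le> ?G * (?F * ?G - ?P\<^sup>2)" by (simp add: power2_eq_square algebra_simps)
    then show ?thesis using G by (simp add: zero_le_mult_iff)
  qed
  then have "sqrt (?P\<^sup>2) \<le> sqrt (?F * ?G)" by (rule real_sqrt_le_mono)
  then show ?thesis by (simp add: disk_norm_def real_sqrt_mult)
qed

lemma disk_norm_triangle:
  assumes f: "continuous_on disk f" and g: "continuous_on disk g"
  shows "disk_norm (\<lambda>x. f x + g x) \<le> disk_norm f + disk_norm g"
proof (rule power2_le_imp_le)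
  have "(disk_norm (\<lambda>x. f x + g x))\<^sup>2 = disk_int (\<lambda>x. (f x)\<^sup>2 + 2 * (f x * g x) + (g x)\<^sup>2)"
    unfolding disk_norm_sq by (intro disk_int_cong) (simp add: power2_eq_square algebra_simps)
  also have "\<dots> = (disk_norm f)\<^sup>2 + 2 * disk_int (\<lambda>x. f x * g x) + (disk_norm g)\<^sup>2"
    using f g by (simp add: disk_int_add disk_int_cmult continuous_intros disk_norm_sq)
  also have "\<dots> \<le> (disk_norm f + disk_norm g)\<^sup>2"
    using disk_cauchy_schwarz[OF f g] by (simp add: power2_sum)
  finally show "(disk_norm (\<lambda>x. f x + g x))\<^sup>2 \<le> (disk_norm f + disk_norm g)\<^sup>2" .
qed simp

lemma disk_norm_triangle_diff:
  assumes f: "continuous_on disk f" and g: "continuous_on disk g"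
  shows "disk_norm (\<lambda>x. f x - g x) \<le> disk_norm f + disk_norm g"
proof -
  have "disk_norm (\<lambda>x. - g x) = disk_norm g" by (simp add: disk_norm_def)
  then show ?thesis using disk_norm_triangle[OF f, of "\<lambda>x. - g x"] g by (simp add: continuous_intros)
qed

lemma disk_norm_mult_bound:
  assumes "continuous_on disk f" "continuous_on disk g" "\<And>x. x \<in> disk \<Longrightarrow> \<bar>f x\<bar> \<le> M"
  shows "disk_norm (\<lambda>x. f x * g x) \<le> M * disk_norm g"
proof -
  have M: "0 \<le> M" using assms(3)[of 0] by (simp add: mem_cball)
  have "disk_norm (\<lambda>x. f x * g x) \<le> disk_norm (\<lambda>x. M * g x)"
    using assms M by (intro disk_norm_mono continuous_intros) (auto simp: abs_mult intro!: mult_right_mono)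
  then show ?thesis using M by (simp add: disk_norm_cmult)
qed

lemma smooth_on_disk_bounded:
  assumes "smooth_on_disk f"
  obtains M where "M > 0" "\<And>x. x \<in> disk \<Longrightarrow> \<bar>f x\<bar> \<le> M"
proof -
  have "bounded (f ` disk)"
    using smooth_on_disk_continuous[OF assms] by (intro compact_imp_bounded compact_continuous_image compact_cball)
  then obtain M where "M > 0" "\<forall>y\<in>f ` disk. norm y \<le> M" using bounded_pos by blast
  then show ?thesis using that by auto
qed

section \<open>A Sobolev inequality\<close>

text \<open>This is the energy of the flat metric. The boundary integral takes the place of the
  interior L2 term of the usual H1 norm.\<close>

definition H1_sq :: "(real^2 \<Rightarrow> real) \<Rightarrow> real" where
  "H1_sq u = disk_int (\<lambda>x. (partial 1 u x)\<^sup>2 + (partial 2 u x)\<^sup>2) + circ_int (\<lambda>x. (u x)\<^sup>2)"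

lemma chord_bound:
  fixes g g' :: "real \<Rightarrow> real"
  assumes g: "\<And>t. t \<in> {-s..s} \<Longrightarrow> (g has_vector_derivative g' t) (at t within {-s..s})"
    and c: "continuous_on {-s..s} g'" and t: "t \<in> {-s..s}"
  shows "g t \<le> g s + integral {-s..s} (\<lambda>r. \<bar>g' r\<bar>)"
proof -
  have "(g' has_integral (g s - g t)) {t..s}"
  proof (rule fundamental_theorem_of_calculus)
    show "t \<le> s" using t by simp
    show "(g has_vector_derivative g' r) (at r within {t..s})" if "r \<in> {t..s}" for r
      by (rule has_vector_derivative_within_subset[OF g]) (use that t in auto)
  qed
  then have i: "g s - g t = integral {t..s} g'" by (simp add: integral_unique)
  have ci: "(\<lambda>r. \<bar>g' r\<bar>) integrable_on {-s..s}"
    by (intro integrable_continuous_interval continuous_intros c)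
  have sub: "{t..s} \<subseteq> {-s..s}" using t by auto
  have "\<bar>integral {t..s} g'\<bar> \<le> integral {t..s} (\<lambda>r. \<bar>g' r\<bar>)"
    using integral_norm_bound_integral[of g' "{t..s}" "\<lambda>r. \<bar>g' r\<bar>"]
      continuous_on_subset[OF c sub] integrable_subinterval_real[OF ci sub]
    by (auto intro!: integrable_continuous_interval)
  also have "\<dots> \<le> integral {-s..s} (\<lambda>r. \<bar>g' r\<bar>)"
    by (rule integral_subset_le[OF sub]) (use ci integrable_subinterval_real[OF ci sub] in auto)
  finally show ?thesis using i by linarith
qed

lemma chord_in_disk:
  assumes "\<bar>x\<bar> \<le> 1" "y \<in> {- sqrt (1 - x\<^sup>2)..sqrt (1 - x\<^sup>2)}"
  shows "pt x y \<in> disk" "pt y x \<in> disk"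
proof -
  have x2: "x\<^sup>2 \<le> 1" using assms(1) by (simp add: abs_square_le_1)
  have "y\<^sup>2 \<le> (sqrt (1 - x\<^sup>2))\<^sup>2"
    using assms(2) x2 by (intro power2_le_iff_abs_le[THEN iffD2]) auto
  then show "pt x y \<in> disk" "pt y x \<in> disk" using x2 by (simp_all add: pt_in_disk)
qed

text \<open>The argument of Gagliardo and Nirenberg: at height y the square of u is at most its
  value at the right end of the horizontal chord plus the variation along the chord, a function
  \<open>f y\<close>. Vertical chords give a bound \<open>g x\<close> in the same way. Hence u^4 is
  at most the product of \<open>f y\<close> and \<open>g x\<close>, whose integral over the
  enclosing square factors.\<close>

lemma sobolev_aux:
  assumes u: "smooth_on_disk u"
  shows "disk_int (\<lambda>x. (u x)^4) \<le> (circ_int (\<lambda>x. (u x)\<^sup>2) + 2 * (disk_norm u * disk_norm (partial 1 u)))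
           * (circ_int (\<lambda>x. (u x)\<^sup>2) + 2 * (disk_norm u * disk_norm (partial 2 u)))" (is ?Q)
    and "disk_int (\<lambda>x. (u x)\<^sup>2) \<le> 2 * (circ_int (\<lambda>x. (u x)\<^sup>2) + 2 * (disk_norm u * disk_norm (partial 1 u)))" (is ?S)
proof -
  have cu: "continuous_on disk u" and cp: "continuous_on disk (partial i u)" for i
    using u smooth_on_disk_continuous smooth_on_disk_partial by blast+
  have u2: "smooth_on_disk (\<lambda>x. (u x)\<^sup>2)" by (intro smooth_intros u)
  have pu2: "partial i (\<lambda>x. (u x)\<^sup>2) x = 2 * (u x * partial i u x)" if "x \<in> disk" for i x
    using partial_mult[OF smooth_on_disk_differentiable[OF u that] smooth_on_disk_differentiable[OF u that] that]
    by (simp add: power2_eq_square)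
  let ?s = "\<lambda>y::real. sqrt (1 - y\<^sup>2)"
  let ?B = "circ_int (\<lambda>x. (u x)\<^sup>2)"
  have sq: "0 \<le> ?s y" "?s y \<le> 1" if "y \<in> {-1..1}" for y
    using that by (auto simp: abs_square_le_1 abs_le_iff real_sqrt_le_1_iff)
  define h where "h i = (\<lambda>x. \<bar>2 * (u x * partial i u x)\<bar>)" for i
  have ch: "continuous_on disk (h i)" for i
    unfolding h_def by (intro continuous_intros cu cp)
  have dh: "disk_int (h i) \<le> 2 * (disk_norm u * disk_norm (partial i u))" for i
  proof -
    have "disk_int (h i) = disk_int (\<lambda>x. 2 * (\<bar>u x\<bar> * \<bar>partial i u x\<bar>))"
      by (simp add: h_def abs_mult)
    also have "\<dots> = 2 * disk_int (\<lambda>x. \<bar>u x\<bar> * \<bar>partial i u x\<bar>)"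
      by (rule disk_int_cmult)
    also have "disk_int (\<lambda>x. \<bar>u x\<bar> * \<bar>partial i u x\<bar>) \<le> disk_norm (\<lambda>x. \<bar>u x\<bar>) * disk_norm (\<lambda>x. \<bar>partial i u x\<bar>)"
      using disk_cauchy_schwarz[of "\<lambda>x. \<bar>u x\<bar>" "\<lambda>x. \<bar>partial i u x\<bar>"] cu cp
      by (simp add: continuous_intros abs_le_iff)
    finally show ?thesis by (simp add: disk_norm_def)
  qed
  define f where "f y = (u (pt (?s y) y))\<^sup>2 + integral {- ?s y..?s y} (\<lambda>x. h 1 (pt x y))" for y
  define g where "g x = (u (pt x (?s x)))\<^sup>2 + integral {- ?s x..?s x} (\<lambda>y. h 2 (pt x y))" for x
  have hpos: "0 \<le> h i x" for i x by (simp add: h_def)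
  have fg0: "0 \<le> f y" "0 \<le> g y" for y
    unfolding f_def g_def by (auto intro!: add_nonneg_nonneg integral_nonneg_pointwise hpos)
  have line: "continuous_on {- ?s y..?s y} (\<lambda>x. w (pt x y))" "continuous_on {- ?s y..?s y} (\<lambda>x. w (pt y x))"
    if "y \<in> {-1..1}" "continuous_on disk w" for y and w :: "real^2 \<Rightarrow> real"
    by (rule continuous_on_compose2[OF that(2)], intro continuous_intros, use that(1) chord_in_disk[of y] in force)+
  have uf: "(u (pt x y))\<^sup>2 \<le> f y" if y: "y \<in> {-1..1}" and x: "x \<in> {- ?s y..?s y}" for x y
  proof -
    have y1: "\<bar>y\<bar> \<le> 1" using y by auto
    have e: "pt 0 y + x *\<^sub>R axis 1 1 = pt x y" for x by (simp add: pt_eq)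
    have ind: "pt 0 y + x *\<^sub>R axis 1 1 \<in> disk" if "x \<in> {- ?s y..?s y}" for x
      unfolding e using chord_in_disk[OF y1 that] by simp
    have D: "((\<lambda>x. (u (pt x y))\<^sup>2) has_vector_derivative 2 * (u (pt x y) * partial 1 u (pt x y))) (at x within {- ?s y..?s y})"
      if "x \<in> {- ?s y..?s y}" for x
      using has_derivative_disk_line[OF smooth_on_disk_differentiable[OF u2] ind that]
      unfolding e using pu2 chord_in_disk[OF y1 that] by simp
    show ?thesis
      using chord_bound[OF D _ x] line(1)[OF y, of "\<lambda>x. 2 * (u x * partial 1 u x)"] cu cp
      by (simp add: f_def h_def continuous_intros)
  qed
  have ug: "(u (pt x y))\<^sup>2 \<le> g x" if x: "x \<in> {-1..1}" and y: "y \<in> {- ?s x..?s x}" for x y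
  proof -
    have x1: "\<bar>x\<bar> \<le> 1" using x by auto
    have e: "pt x 0 + y *\<^sub>R axis 2 1 = pt x y" for y by (simp add: pt_eq)
    have ind: "pt x 0 + y *\<^sub>R axis 2 1 \<in> disk" if "y \<in> {- ?s x..?s x}" for y
      unfolding e using chord_in_disk[OF x1 that] by simp
    have D: "((\<lambda>y. (u (pt x y))\<^sup>2) has_vector_derivative 2 * (u (pt x y) * partial 2 u (pt x y))) (at y within {- ?s x..?s x})"
      if "y \<in> {- ?s x..?s x}" for y
      using has_derivative_disk_line[OF smooth_on_disk_differentiable[OF u2] ind that]
      unfolding e using pu2 chord_in_disk[OF x1 that] by simp
    show ?thesis
      using chord_bound[OF D _ y] line(2)[OF x, of "\<lambda>x. 2 * (u x * partial 2 u x)"] cu cp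
      by (simp add: g_def h_def continuous_intros)
  qed
  have cu2: "continuous_on disk (\<lambda>x. (u x)\<^sup>2)" by (intro continuous_intros cu)
  have cR: "continuous_on {-1..1} (\<lambda>y. (u (pt (?s y) y))\<^sup>2)" "continuous_on {-1..1} (\<lambda>y. (u (pt y (?s y)))\<^sup>2)"
    by (rule continuous_on_compose2[OF cu2], intro continuous_intros,
      use sq chord_in_disk in \<open>force simp: abs_le_iff\<close>)+
  \<comment> \<open>Integrals over the end points of chords become angular integrals with weights
    cos and sin; the bound 1 on the weights compares them with the full boundary integral.\<close>
  have circ_le: "integral {a..b} (\<lambda>t. w t * (u (circ t))\<^sup>2) \<le> integral {a..b} (\<lambda>t. (u (circ t))\<^sup>2)"
    if w: "\<And>t. w t \<le> 1" "continuous_on {a..b} w" for a b w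
  proof (rule Henstock_Kurzweil_Integration.integral_le)
    show "(\<lambda>t. w t * (u (circ t))\<^sup>2) integrable_on {a..b}"
      by (intro integrable_continuous_interval continuous_intros w continuous_on_compose2[OF cu]) auto
    show "(\<lambda>t. (u (circ t))\<^sup>2) integrable_on {a..b}" by (rule circ_integrable[OF cu2])
    show "w t * (u (circ t))\<^sup>2 \<le> (u (circ t))\<^sup>2" for t
      using w(1)[of t] mult_right_mono[of "w t" 1 "(u (circ t))\<^sup>2"] by simp
  qed
  have circ_split: "integral {0..a} (\<lambda>t. (u (circ t))\<^sup>2) + integral {a..b} (\<lambda>t. (u (circ t))\<^sup>2) + integral {b..2*pi} (\<lambda>t. (u (circ t))\<^sup>2) = ?B"
    if "0 \<le> a" "a \<le> b" "b \<le> 2*pi" for a b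
    unfolding circ_int_def using that circ_integrable[OF cu2]
    by (simp add: Henstock_Kurzweil_Integration.integral_combine)
  have arc0: "0 \<le> integral {a..b} (\<lambda>t. (u (circ t))\<^sup>2)" for a b
    by (rule integral_nonneg_pointwise) auto
  have Rle: "integral {-1..1} (\<lambda>y. (u (pt (?s y) y))\<^sup>2) \<le> ?B"
  proof -
    have "integral {-1..1} (\<lambda>y. (u (pt (?s y) y))\<^sup>2) = integral {-1..0} (\<lambda>y. (u (pt (?s y) y))\<^sup>2) + integral {0..1} (\<lambda>y. (u (pt (?s y) y))\<^sup>2)"
      by (rule Henstock_Kurzweil_Integration.integral_combine[symmetric]) (use cR in \<open>auto intro: integrable_continuous_interval\<close>)
    also have "\<dots> = integral {3*pi/2..2*pi} (\<lambda>t. cos t * (u (circ t))\<^sup>2) + integral {0..pi/2} (\<lambda>t. cos t * (u (circ t))\<^sup>2)"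
      using integral_unique[OF right_arc1[OF cu2]] integral_unique[OF right_arc2[OF cu2]] by simp
    also have "\<dots> \<le> integral {3*pi/2..2*pi} (\<lambda>t. (u (circ t))\<^sup>2) + integral {0..pi/2} (\<lambda>t. (u (circ t))\<^sup>2)"
      by (intro add_mono circ_le continuous_intros) auto
    also have "\<dots> \<le> ?B" using circ_split[of "pi/2" "3*pi/2"] arc0[of "pi/2" "3*pi/2"] by simp
    finally show ?thesis .
  qed
  have Ule: "integral {-1..1} (\<lambda>x. (u (pt x (?s x)))\<^sup>2) \<le> ?B"
  proof -
    have "integral {-1..1} (\<lambda>x. (u (pt x (?s x)))\<^sup>2) = integral {0..pi} (\<lambda>t. sin t * (u (circ t))\<^sup>2)"
      using integral_unique[OF upper_arc[OF cu2]] by simp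
    also have "\<dots> \<le> integral {0..pi} (\<lambda>t. (u (circ t))\<^sup>2)"
      by (intro circ_le continuous_intros) auto
    also have "\<dots> \<le> ?B" using circ_split[of pi pi] arc0[of pi "2*pi"] by simp
    finally show ?thesis .
  qed
  have fi: "f integrable_on {-1..1}" and gi: "g integrable_on {-1..1}"
    unfolding f_def[abs_def] g_def[abs_def]
    by (intro integrable_add integrable_continuous_interval[OF cR(1)] integrable_continuous_interval[OF cR(2)]
        disk_int_iterated(2)[OF ch] disk_int_iterated(4)[OF ch])+
  have fI: "integral {-1..1} f \<le> ?B + 2 * (disk_norm u * disk_norm (partial 1 u))"
    using Rle dh[of 1] unfolding f_def[abs_def]
    by (subst Henstock_Kurzweil_Integration.integral_add)
      (auto intro: integrable_continuous_interval cR disk_int_iterated(4)[OF ch] simp: disk_int_iterated(3)[OF ch, symmetric])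
  have gI: "integral {-1..1} g \<le> ?B + 2 * (disk_norm u * disk_norm (partial 2 u))"
    using Ule dh[of 2] unfolding g_def[abs_def]
    by (subst Henstock_Kurzweil_Integration.integral_add)
      (auto intro: integrable_continuous_interval cR disk_int_iterated(2)[OF ch] simp: disk_int_iterated(1)[OF ch, symmetric])
  have f_pos: "0 \<le> integral {-1..1} f" "0 \<le> integral {-1..1} g"
    by (rule integral_nonneg_pointwise, rule fg0)+
  \<comment> \<open>A chord has length at most 2.\<close>
  have "disk_int (\<lambda>x. (u x)\<^sup>2) \<le> integral {-1..1} (\<lambda>y. 2 * f y)"
    unfolding disk_int_iterated(3)[OF cu2]
  proof (rule Henstock_Kurzweil_Integration.integral_le[OF disk_int_iterated(4)[OF cu2]])
    show "(\<lambda>y. 2 * f y) integrable_on {-1..1}" using integrable_cmul[OF fi, of 2] by simp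
    fix y :: real assume y: "y \<in> {-1..1}"
    have "integral {- ?s y..?s y} (\<lambda>x. (u (pt x y))\<^sup>2) \<le> integral {- ?s y..?s y} (\<lambda>x. f y)"
      by (rule Henstock_Kurzweil_Integration.integral_le) (use uf[OF y] line(1)[OF y cu2] in \<open>auto intro: integrable_continuous_interval\<close>)
    also have "\<dots> \<le> 2 * f y" using sq[OF y] fg0[of y] by (simp add: mult_left_le_one_le)
    finally show "integral {- ?s y..?s y} (\<lambda>x. (u (pt x y))\<^sup>2) \<le> 2 * f y" .
  qed
  then show ?S using fI by simp
  have cu4: "continuous_on disk (\<lambda>x. (u x)^4)" by (intro continuous_intros cu)
  have "disk_int (\<lambda>x. (u x)^4) \<le> integral {-1..1} (\<lambda>y. integral {-1..1} g * f y)"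
    unfolding disk_int_iterated(3)[OF cu4]
  proof (rule Henstock_Kurzweil_Integration.integral_le[OF disk_int_iterated(4)[OF cu4]])
    show "(\<lambda>y. integral {-1..1} g * f y) integrable_on {-1..1}" using integrable_cmul[OF fi] by simp
    fix y :: real assume y: "y \<in> {-1..1}"
    have sub: "{- ?s y..?s y} \<subseteq> {-1..1}" using sq[OF y] by auto
    have gs: "g integrable_on {- ?s y..?s y}" using integrable_subinterval_real[OF gi sub] .
    have "integral {- ?s y..?s y} (\<lambda>x. (u (pt x y))^4) \<le> integral {- ?s y..?s y} (\<lambda>x. f y * g x)"
    proof (rule Henstock_Kurzweil_Integration.integral_le)
      show "(\<lambda>x. (u (pt x y))^4) integrable_on {- ?s y..?s y}"
        using line(1)[OF y cu4] by (rule integrable_continuous_interval)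
      show "(\<lambda>x. f y * g x) integrable_on {- ?s y..?s y}" using integrable_cmul[OF gs] by simp
      fix x assume x: "x \<in> {- ?s y..?s y}"
      have "x \<in> {-1..1} \<and> y \<in> {- ?s x..?s x}"
      proof -
        have "x\<^sup>2 + y\<^sup>2 \<le> 1" using chord_in_disk(2)[OF _ x] y by (simp add: pt_in_disk abs_le_iff)
        then have "\<bar>y\<bar> \<le> ?s x" using real_sqrt_le_iff[of "y\<^sup>2" "1 - x\<^sup>2"] by simp
        moreover have "x \<in> {-1..1}" using x sub by blast
        ultimately show ?thesis by (auto simp: abs_le_iff)
      qed
      then have "(u (pt x y))\<^sup>2 * (u (pt x y))\<^sup>2 \<le> f y * g x"
        using uf[OF y x] ug[of x y] by (intro mult_mono) (auto intro: fg0)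
      then show "(u (pt x y))^4 \<le> f y * g x" by (simp add: power4_eq_xxxx power2_eq_square mult.assoc)
    qed
    also have "\<dots> = f y * integral {- ?s y..?s y} g" by simp
    also have "\<dots> \<le> f y * integral {-1..1} g"
      by (intro mult_left_mono integral_subset_le[OF sub gs gi] ballI fg0)
    finally show "integral {- ?s y..?s y} (\<lambda>x. (u (pt x y))^4) \<le> integral {-1..1} g * f y" by (simp add: mult.commute)
  qed
  also have "\<dots> = integral {-1..1} f * integral {-1..1} g" by simp
  also have "\<dots> \<le> (?B + 2 * (disk_norm u * disk_norm (partial 1 u))) * (?B + 2 * (disk_norm u * disk_norm (partial 2 u)))"
    by (intro mult_mono fI gI f_pos) (use fI f_pos in linarith)
  finally show ?Q .
qed

lemma H1_sq_bounds:
  assumes u: "smooth_on_disk u"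
  shows "(disk_norm (partial i u))\<^sup>2 \<le> H1_sq u" "circ_int (\<lambda>x. (u x)\<^sup>2) \<le> H1_sq u" "0 \<le> H1_sq u"
    and H1_sq_eq: "H1_sq u = (disk_norm (partial 1 u))\<^sup>2 + (disk_norm (partial 2 u))\<^sup>2 + circ_int (\<lambda>x. (u x)\<^sup>2)"
proof -
  have cp: "continuous_on disk (partial i u)" for i
    using u smooth_on_disk_continuous smooth_on_disk_partial by blast
  show eq: "H1_sq u = (disk_norm (partial 1 u))\<^sup>2 + (disk_norm (partial 2 u))\<^sup>2 + circ_int (\<lambda>x. (u x)\<^sup>2)"
    unfolding H1_sq_def disk_norm_sq using cp by (simp add: disk_int_add continuous_intros)
  have "0 \<le> circ_int (\<lambda>x. (u x)\<^sup>2)" by (intro circ_int_nonneg) simp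
  then show "(disk_norm (partial i u))\<^sup>2 \<le> H1_sq u" "circ_int (\<lambda>x. (u x)\<^sup>2) \<le> H1_sq u" "0 \<le> H1_sq u"
    using exhaust_2[of i] unfolding eq by auto
qed

theorem poincare_disk:
  assumes u: "smooth_on_disk u"
  shows "(disk_norm u)\<^sup>2 \<le> 20 * H1_sq u"
proof -
  let ?n = "disk_norm u" and ?N = "H1_sq u"
  have "?n\<^sup>2 \<le> 2 * circ_int (\<lambda>x. (u x)\<^sup>2) + 4 * (?n * disk_norm (partial 1 u))"
    using sobolev_aux(2)[OF u] by (simp add: disk_norm_sq)
  \<comment> \<open>The product is split so that half of \<open>?n\<close> squared is absorbed on
    the left; doubling gives 4 times the boundary term plus 16 times the gradient term, hence the
    constant 20.\<close>
  moreover have "4 * (?n * disk_norm (partial 1 u)) \<le> ?n\<^sup>2 / 2 + 8 * (disk_norm (partial 1 u))\<^sup>2"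
    using zero_le_power2[of "?n - 4 * disk_norm (partial 1 u)"] by (simp add: power2_eq_square algebra_simps)
  ultimately show ?thesis using H1_sq_bounds(1)[OF u, of 1] H1_sq_bounds(2)[OF u] by linarith
qed

theorem sobolev_disk:
  assumes u: "smooth_on_disk u"
  shows "disk_norm (\<lambda>x. (u x)\<^sup>2) \<le> 10 * H1_sq u"
proof -
  let ?n = "disk_norm u" and ?N = "H1_sq u"
  have N: "0 \<le> ?N" using H1_sq_bounds(3)[OF u] .
  \<comment> \<open>The 9 is twice the root of 20 rounded up, since 80 is at most 81; with the
    boundary term this becomes 10.\<close>
  have b: "2 * (?n * disk_norm (partial i u)) \<le> 9 * ?N" for i
  proof -
    have "(2 * (?n * disk_norm (partial i u)))\<^sup>2 = 4 * (?n\<^sup>2 * (disk_norm (partial i u))\<^sup>2)"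
      by (simp add: power_mult_distrib)
    also have "\<dots> \<le> 4 * ((20 * ?N) * ?N)"
      using poincare_disk[OF u] H1_sq_bounds(1)[OF u, of i] N by (intro mult_left_mono mult_mono) auto
    also have "\<dots> \<le> (9 * ?N)\<^sup>2" by (simp add: power2_eq_square)
    finally show ?thesis by (rule power2_le_imp_le) (use N in simp)
  qed
  have pos: "0 \<le> circ_int (\<lambda>x. (u x)\<^sup>2)" by (intro circ_int_nonneg) simp
  have "(disk_norm (\<lambda>x. (u x)\<^sup>2))\<^sup>2 = disk_int (\<lambda>x. (u x)^4)"
    by (simp add: disk_norm_sq flip: power_mult)
  also have "\<dots> \<le> (10 * ?N)\<^sup>2"
    unfolding power2_eq_square using b[of 1] b[of 2] H1_sq_bounds(2)[OF u] N pos
    by (intro order_trans[OF sobolev_aux(1)[OF u]] mult_mono) auto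
  finally show ?thesis by (rule power2_le_imp_le) (use N in simp)
qed

section \<open>Boundary calculus\<close>

text \<open>The rotation field applied to \<open>f\<close>; on the circle it is the tangential
  derivative.\<close>

definition dtheta :: "(real^2 \<Rightarrow> real) \<Rightarrow> real^2 \<Rightarrow> real" where
  "dtheta f x = x$1 * partial 2 f x - x$2 * partial 1 f x"

lemma smooth_on_disk_dtheta [smooth_intros]: "smooth_on_disk f \<Longrightarrow> smooth_on_disk (dtheta f)"
  unfolding dtheta_def[abs_def] by (intro smooth_intros)

lemma has_derivative_circ:
  assumes f: "smooth_on_disk f"
  shows "((\<lambda>t. f (circ t)) has_real_derivative dtheta f (circ t)) (at t)"
proof -
  have 1: "(f has_derivative (\<lambda>v. v$1 * partial 1 f (circ t) + v$2 * partial 2 f (circ t))) (at (circ t) within range circ)"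
    by (rule has_derivative_subset[OF has_derivative_partial[OF smooth_on_disk_differentiable[OF f]]]) auto
  have 2: "(circ has_derivative (\<lambda>s. s *\<^sub>R pt (- sin t) (cos t))) (at t)"
  proof -
    have "((\<lambda>t. cos t *\<^sub>R axis 1 1 + sin t *\<^sub>R axis 2 (1::real)) has_derivative
        (\<lambda>s. s *\<^sub>R ((- sin t) *\<^sub>R axis 1 1 + cos t *\<^sub>R axis 2 1))) (at t)"
      by (auto intro!: derivative_eq_intros simp: algebra_simps)
    then show ?thesis by (simp add: circ_pt[abs_def] pt_eq)
  qed
  show ?thesis
    using diff_chain_within[OF 2 1]
    unfolding has_field_derivative_def o_def
    by (rule has_derivative_eq_rhs) (auto simp: fun_eq_iff dtheta_def circ_pt algebra_simps)
qed

lemma circ_int_dtheta: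
  assumes f: "smooth_on_disk f"
  shows "circ_int (dtheta f) = 0"
proof -
  have "((\<lambda>t. dtheta f (circ t)) has_integral (f (circ (2*pi)) - f (circ 0))) {0..2*pi}"
    by (rule fundamental_theorem_of_calculus)
      (auto intro!: has_vector_derivative_at_within[OF has_derivative_circ[OF f, unfolded has_real_derivative_iff_has_vector_derivative]])
  then show ?thesis by (simp add: circ_int_def circ_pt integral_unique)
qed

lemma sphere_in_disk [simp]: "x \<in> sphere 0 1 \<Longrightarrow> x \<in> disk" for x :: "real^2"
  by (simp add: mem_cball mem_sphere)

lemma sphere_coords: "x \<in> sphere 0 1 \<Longrightarrow> x$1 * x$1 + x$2 * x$2 = 1" for x :: "real^2"
  by (simp add: mem_sphere norm_vec_def L2_set_def sum_2 real_sqrt_eq_1_iff power2_eq_square)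

lemma sphere_circ:
  fixes x :: "real^2"
  assumes "x \<in> sphere 0 1" obtains t where "x = circ t"
proof -
  have "(x$1)\<^sup>2 + (x$2)\<^sup>2 = 1" using sphere_coords[OF assms] by (simp add: power2_eq_square)
  then obtain t where "x$1 = cos t" "x$2 = sin t" using sincos_total_2pi by metis
  then have "x = circ t" by (simp add: circ_pt vec_eq_iff forall_2)
  then show ?thesis using that by blast
qed

lemma circ_in_sphere [simp]: "circ t \<in> sphere 0 1"
  by (simp add: circ_pt mem_sphere norm_vec_def L2_set_def sum_2)

text \<open>A tangential derivative sees only the values on the circle. This allows a function to be
  replaced, before differentiating, by an expression equal to it on the circle alone.\<close>

lemma dtheta_cong_sphere:
  assumes "smooth_on_disk f" "smooth_on_disk g" "\<And>x. x \<in> sphere 0 1 \<Longrightarrow> f x = g x" "x \<in> sphere 0 1"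
  shows "dtheta f x = dtheta g x"
proof -
  obtain t where t: "x = circ t" using sphere_circ[OF assms(4)] by blast
  have "(\<lambda>t. f (circ t)) = (\<lambda>t. g (circ t))" using assms(3)[OF circ_in_sphere] by blast
  then show ?thesis
    unfolding t using has_derivative_circ[OF assms(1), of t] has_derivative_circ[OF assms(2), of t] DERIV_unique by metis
qed

lemma partial_mult_smooth:
  assumes "smooth_on_disk f" "smooth_on_disk g" "x \<in> disk"
  shows "partial i (\<lambda>y. f y * g y) x = f x * partial i g x + partial i f x * g x"
  using assms by (intro partial_mult smooth_on_disk_differentiable)

lemma partial_add_smooth:
  assumes "smooth_on_disk f" "smooth_on_disk g" "x \<in> disk"
  shows "partial i (\<lambda>y. f y + g y) x = partial i f x + partial i g x"
  using assms by (intro partial_add smooth_on_disk_differentiable)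

lemma partial_minus_smooth:
  assumes "smooth_on_disk f" "x \<in> disk"
  shows "partial i (\<lambda>y. - f y) x = - partial i f x"
proof -
  have "(uminus has_real_derivative -1) (at y)" for y :: real
    by (auto intro!: derivative_eq_intros)
  from partial_compose[OF smooth_on_disk_differentiable[OF assms] this assms(2)] show ?thesis by simp
qed

lemma partial_diff_smooth:
  assumes "smooth_on_disk f" "smooth_on_disk g" "x \<in> disk"
  shows "partial i (\<lambda>y. f y - g y) x = partial i f x - partial i g x"
  using partial_add_smooth[of f "\<lambda>y. - g y" x i] partial_minus_smooth[of g x i] assms
  by (simp add: smooth_intros)

lemma partial_cmult_smooth:
  assumes "smooth_on_disk f" "x \<in> disk"
  shows "partial i (\<lambda>y. c * f y) x = c * partial i f x"
  using partial_mult_smooth[of "\<lambda>_. c" f x i] assms by (simp add: smooth_intros partial_const)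

lemmas partial_simps = partial_mult_smooth partial_add_smooth partial_minus_smooth partial_diff_smooth
  partial_cmult_smooth partial_const partial_coord

lemma divergence_smooth:
  assumes "smooth_on_disk f"
  shows "disk_int (partial i f) = circ_int (\<lambda>x. f x * x $ i)"
  by (rule divergence_disk)
    (use assms in \<open>auto intro: smooth_on_disk_differentiable smooth_on_disk_continuous smooth_on_disk_partial\<close>)

lemma divergence_smooth2:
  assumes f: "smooth_on_disk f" and g: "smooth_on_disk g"
  shows "disk_int (\<lambda>x. partial 1 f x + partial 2 g x) = circ_int (\<lambda>x. f x * x$1 + g x * x$2)"
  using divergence_smooth[OF f, of 1] divergence_smooth[OF g, of 2] f g
  by (simp add: disk_int_add circ_int_add smooth_on_disk_continuous smooth_intros)

definition dirichlet :: "(real^2 \<Rightarrow> real) \<Rightarrow> bool" where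
  "dirichlet \<psi> \<longleftrightarrow> smooth_on_disk \<psi> \<and> (\<forall>x\<in>sphere 0 1. \<psi> x = 0)"

text \<open>The tangential derivative of a function vanishing on the circle is zero, so its gradient
  there is normal.\<close>

lemma dirichlet_gradient_radial:
  assumes "dirichlet \<psi>" and x: "x \<in> sphere 0 1"
  shows "partial i \<psi> x = (x$1 * partial 1 \<psi> x + x$2 * partial 2 \<psi> x) * x$i"
proof -
  have "dtheta \<psi> x = dtheta (\<lambda>_. 0) x"
    by (rule dtheta_cong_sphere) (use assms in \<open>auto simp: dirichlet_def intro: smooth_intros\<close>)
  then have t: "x$1 * partial 2 \<psi> x = x$2 * partial 1 \<psi> x"
    using x by (simp add: dtheta_def partial_const)
  have n: "x$1 * x$1 + x$2 * x$2 = 1"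
    using sphere_coords[OF x] .
  have 1: "(x$1 * partial 1 \<psi> x + x$2 * partial 2 \<psi> x) * x$1 = partial 1 \<psi> x"
  proof -
    have "(x$1 * partial 1 \<psi> x + x$2 * partial 2 \<psi> x) * x$1 = x$1 * x$1 * partial 1 \<psi> x + x$2 * (x$1 * partial 2 \<psi> x)"
      by (simp add: algebra_simps)
    also have "\<dots> = (x$1 * x$1 + x$2 * x$2) * partial 1 \<psi> x" unfolding t by (simp add: algebra_simps)
    finally show ?thesis using n by simp
  qed
  have 2: "(x$1 * partial 1 \<psi> x + x$2 * partial 2 \<psi> x) * x$2 = partial 2 \<psi> x"
  proof -
    have "(x$1 * partial 1 \<psi> x + x$2 * partial 2 \<psi> x) * x$2 = x$1 * (x$2 * partial 1 \<psi> x) + x$2 * x$2 * partial 2 \<psi> x"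
      by (simp add: algebra_simps)
    also have "\<dots> = (x$1 * x$1 + x$2 * x$2) * partial 2 \<psi> x" unfolding t[symmetric] by (simp add: algebra_simps)
    finally show ?thesis using n by simp
  qed
  show ?thesis using 1 2 exhaust_2[of i] by auto
qed

text \<open>The Hessian determinant is a divergence, so only a boundary term is left. There the
  gradient is a multiple p of the normal, and up to a total angular derivative the flux equals p^2 /
  2. The sign comes from the convexity of the circle.\<close>

lemma integral_hessian_det:
  assumes d: "dirichlet \<psi>"
  shows "disk_int (\<lambda>x. partial 1 (partial 1 \<psi>) x * partial 2 (partial 2 \<psi>) x - (partial 1 (partial 2 \<psi>) x)\<^sup>2)
       = (1/2) * circ_int (\<lambda>x. (x$1 * partial 1 \<psi> x + x$2 * partial 2 \<psi> x)\<^sup>2)"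
proof -
  have s: "smooth_on_disk \<psi>" using d by (simp add: dirichlet_def)
  define p where "p = (\<lambda>x. x$1 * partial 1 \<psi> x + x$2 * partial 2 \<psi> x)"
  have sp: "smooth_on_disk p" unfolding p_def by (intro smooth_intros s)
  let ?d = "\<lambda>i j. partial i (partial j \<psi>)"
  have sd: "smooth_on_disk (?d i j)" "smooth_on_disk (partial i \<psi>)" for i j by (intro smooth_intros s)+
  have "disk_int (\<lambda>x. ?d 1 1 x * ?d 2 2 x - (?d 1 2 x)\<^sup>2)
     = disk_int (\<lambda>x. partial 1 (\<lambda>x. partial 1 \<psi> x * ?d 2 2 x) x + partial 2 (\<lambda>x. - (partial 1 \<psi> x * ?d 1 2 x)) x)"
  proof (rule disk_int_cong)
    fix x :: "real^2" assume x: "x \<in> disk"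
    have c1: "partial 1 (partial 2 (partial 2 \<psi>)) x = partial 2 (partial 1 (partial 2 \<psi>)) x"
      by (rule partial_commute[OF sd(2) x])
    have c2: "partial 2 (partial 1 \<psi>) x = partial 1 (partial 2 \<psi>) x"
      by (rule partial_commute[OF s x])
    show "?d 1 1 x * ?d 2 2 x - (?d 1 2 x)\<^sup>2 = partial 1 (\<lambda>x. partial 1 \<psi> x * ?d 2 2 x) x + partial 2 (\<lambda>x. - (partial 1 \<psi> x * ?d 1 2 x)) x"
      using x by (simp add: partial_simps smooth_intros s c1 c2 power2_eq_square algebra_simps)
  qed
  also have "\<dots> = circ_int (\<lambda>x. partial 1 \<psi> x * ?d 2 2 x * x$1 + - (partial 1 \<psi> x * ?d 1 2 x) * x$2)"
    by (rule divergence_smooth2) (intro smooth_intros s)+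
  also have "\<dots> = circ_int (\<lambda>x. partial 1 \<psi> x * dtheta (partial 2 \<psi>) x)"
    by (rule circ_int_cong) (simp add: dtheta_def algebra_simps)
  also have "\<dots> = circ_int (\<lambda>x. (1/2) * (p x)\<^sup>2 + (1/2) * dtheta (\<lambda>x. x$1 * x$2 * (p x)\<^sup>2) x)"
  proof (rule circ_int_cong)
    fix x :: "real^2" assume x: "x \<in> sphere 0 1"
    then have xd: "x \<in> disk" by simp
    have n: "x$1 * x$1 + x$2 * x$2 = 1"
      using sphere_coords[OF x] .
    have r: "partial i \<psi> x = p x * x$i" if "x \<in> sphere 0 1" for i x
      unfolding p_def by (rule dirichlet_gradient_radial[OF d that])
    have "dtheta (partial 2 \<psi>) x = dtheta (\<lambda>x. p x * x$2) x"
      by (rule dtheta_cong_sphere[OF _ _ r x]) (intro smooth_intros s sp)+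
    also have "\<dots> = x$2 * dtheta p x + p x * x$1"
      using xd by (simp add: dtheta_def partial_simps smooth_intros sp algebra_simps)
    finally have t: "dtheta (partial 2 \<psi>) x = x$2 * dtheta p x + p x * x$1" .
    have u: "dtheta (\<lambda>x. x$1 * x$2 * (p x)\<^sup>2) x = (x$1 * x$1 - x$2 * x$2) * (p x)\<^sup>2 + x$1 * x$2 * (2 * p x * dtheta p x)"
      using xd by (simp add: dtheta_def power2_eq_square partial_simps smooth_intros sp algebra_simps)
    have x22: "x$2 * x$2 = 1 - x$1 * x$1" using n by simp
    show "partial 1 \<psi> x * dtheta (partial 2 \<psi>) x = (1/2) * (p x)\<^sup>2 + (1/2) * dtheta (\<lambda>x. x$1 * x$2 * (p x)\<^sup>2) x"
      unfolding t u r[OF x] x22 by (simp add: power2_eq_square field_simps)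
  qed
  also have "\<dots> = (1/2) * circ_int (\<lambda>x. (p x)\<^sup>2)"
  proof -
    have "circ_int (dtheta (\<lambda>x. x$1 * x$2 * (p x)\<^sup>2)) = 0"
      by (rule circ_int_dtheta) (intro smooth_intros sp)
    then show ?thesis
      by (subst circ_int_add) (intro smooth_on_disk_continuous smooth_intros sp | simp only: circ_int_cmult; simp)+
  qed
  finally show ?thesis by (simp add: p_def)
qed

section \<open>The Dirichlet problem for divergence-form operators, with range dense in L2\<close>

section \<open>The a priori estimate\<close>

lemma psd_form:
  fixes p q s :: real
  assumes "\<And>v w. 0 \<le> p * v\<^sup>2 + 2 * q * v * w + s * w\<^sup>2"
  shows "0 \<le> p" "0 \<le> s" "q\<^sup>2 \<le> p * s"
proof -
  show p: "0 \<le> p" and s: "0 \<le> s" using assms[of 1 0] assms[of 0 1] by auto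
  show "q\<^sup>2 \<le> p * s"
  proof (cases "p = 0")
    case True
    have "q = 0"
    proof (rule ccontr)
      assume "q \<noteq> 0"
      \<comment> \<open>At this point the form has the value -1.\<close>
      then show False using assms[of "- (s + 1) / (2 * q)" 1] True by (simp add: field_simps)
    qed
    then show ?thesis using True by simp
  next
    case False
    have "0 \<le> p * (p * s - q\<^sup>2)" using assms[of "- q" p] by (simp add: power2_eq_square algebra_simps)
    then show ?thesis using p False by (simp add: zero_le_mult_iff)
  qed
qed

text \<open>With N = (p, q; q, s) and H = (x, y; y, z) the expression is the trace of the square of
  N H. It equals the trace of the square of a symmetric matrix, namely H multiplied on both sides by
  the root of N. The proof completes squares.\<close>

lemma trace_square_nonneg:
  fixes p q s x y z :: real
  assumes "0 \<le> p" "q\<^sup>2 \<le> p * s"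
  shows "0 \<le> (p * x + q * y)\<^sup>2 + 2 * (p * y + q * z) * (q * x + s * y) + (q * y + s * z)\<^sup>2"
proof (cases "p = 0")
  case True
  then have "q = 0" using assms(2) by simp
  then show ?thesis using True by simp
next
  case False
  define e where "e = s - q\<^sup>2 / p"
  have p: "p > 0" using False assms(1) by simp
  have e: "0 \<le> e" using assms(2) p by (simp add: e_def field_simps)
  have s: "s = q\<^sup>2 / p + e" by (simp add: e_def)
  have "(p * x + q * y)\<^sup>2 + 2 * (p * y + q * z) * (q * x + s * y) + (q * y + s * z)\<^sup>2
     = (p * x + 2 * q * y + q\<^sup>2 * z / p)\<^sup>2 + 2 * e * (p * y + q * z)\<^sup>2 / p + e\<^sup>2 * z\<^sup>2"
    unfolding s using p by (simp add: power2_eq_square field_simps)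
  also have "\<dots> \<ge> 0" using e p by simp
  finally show ?thesis .
qed

text \<open>For \<open>H = (x, y; y, z)\<close> the left-hand side is the trace of \<open>(a H)\<^sup>2\<close>.\<close>

lemma elliptic_hessian_bound:
  fixes a b c l x y z :: real
  assumes l: "0 \<le> l" and form: "\<And>v w. l * (v\<^sup>2 + w\<^sup>2) \<le> a * v\<^sup>2 + 2 * b * v * w + c * w\<^sup>2"
  shows "l\<^sup>2 * (x\<^sup>2 + 2 * y\<^sup>2 + z\<^sup>2) \<le> (a * x + 2 * b * y + c * z)\<^sup>2 - 2 * (a * c - b\<^sup>2) * (x * z - y\<^sup>2)"
proof -
  \<comment> \<open>The matrix (p, b; b, s) is what remains of the coefficients after removing
    \<open>l\<close> times the identity, and it is positive semidefinite. By Cayley-Hamilton the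
    right-hand side is the trace of the square of (a, b; b, c) times the Hessian; it is expanded
    about \<open>l\<close>, and the linear and quadratic remainders are nonnegative.\<close>
  define p s where "p = a - l" and "s = c - l"
  have f: "0 \<le> p * v\<^sup>2 + 2 * b * v * w + s * w\<^sup>2" for v w
    using form[of v w] by (simp add: p_def s_def algebra_simps)
  note ps = psd_form[OF f]
  have "(a * x + 2 * b * y + c * z)\<^sup>2 - 2 * (a * c - b\<^sup>2) * (x * z - y\<^sup>2)
     = l\<^sup>2 * (x\<^sup>2 + 2 * y\<^sup>2 + z\<^sup>2)
       + 2 * l * ((p * x\<^sup>2 + 2 * b * x * y + s * y\<^sup>2) + (p * y\<^sup>2 + 2 * b * y * z + s * z\<^sup>2))
       + ((p * x + b * y)\<^sup>2 + 2 * (p * y + b * z) * (b * x + s * y) + (b * y + s * z)\<^sup>2)"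
    by (simp add: p_def s_def power2_eq_square algebra_simps)
  moreover have "0 \<le> 2 * l * ((p * x\<^sup>2 + 2 * b * x * y + s * y\<^sup>2) + (p * y\<^sup>2 + 2 * b * y * z + s * z\<^sup>2))"
    using l add_nonneg_nonneg[OF f[of x y] f[of y z]] by simp
  ultimately show ?thesis using trace_square_nonneg[OF ps(1,3), of x y z] by linarith
qed

text \<open>Both eigenvalues are at least \<open>l\<close>.\<close>

lemma elliptic_det:
  fixes a b c l :: real
  assumes l: "0 \<le> l" and form: "\<And>v w. l * (v\<^sup>2 + w\<^sup>2) \<le> a * v\<^sup>2 + 2 * b * v * w + c * w\<^sup>2"
  shows "l\<^sup>2 \<le> a * c - b\<^sup>2"
proof -
  have f: "0 \<le> (a - l) * v\<^sup>2 + 2 * b * v * w + (c - l) * w\<^sup>2" for v w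
    using form[of v w] by (simp add: algebra_simps)
  note ps = psd_form[OF f]
  have "l * l \<le> l * a" "l * l \<le> l * c" using ps(1,2) l by (auto intro: mult_left_mono)
  then show ?thesis using ps(3) by (simp add: power2_eq_square algebra_simps)
qed

text \<open>The estimates depend on the operator only through \<open>l\<close> and \<open>M\<close>,
  so a family sharing these two numbers has a common estimate. The method of continuity rests on
  that.\<close>

definition elliptic :: "real \<Rightarrow> real \<Rightarrow> (real^2 \<Rightarrow> real) \<Rightarrow> (real^2 \<Rightarrow> real) \<Rightarrow> (real^2 \<Rightarrow> real) \<Rightarrow> bool" where
  "elliptic l M a b c \<longleftrightarrow> 0 < l \<and> 0 < M \<and> smooth_on_disk a \<and> smooth_on_disk b \<and> smooth_on_disk c \<and>
    (\<forall>x\<in>disk. (\<forall>v w. l * (v\<^sup>2 + w\<^sup>2) \<le> a x * v\<^sup>2 + 2 * b x * v * w + c x * w\<^sup>2) \<and>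
       \<bar>a x\<bar> \<le> M \<and> \<bar>b x\<bar> \<le> M \<and> \<bar>c x\<bar> \<le> M \<and>
       (\<forall>i. \<bar>partial i a x\<bar> \<le> M \<and> \<bar>partial i b x\<bar> \<le> M \<and> \<bar>partial i c x\<bar> \<le> M))"

definition divform :: "(real^2 \<Rightarrow> real) \<Rightarrow> (real^2 \<Rightarrow> real) \<Rightarrow> (real^2 \<Rightarrow> real) \<Rightarrow> (real^2 \<Rightarrow> real) \<Rightarrow> real^2 \<Rightarrow> real" where
  "divform a b c \<psi> x = partial 1 (\<lambda>y. a y * partial 1 \<psi> y + b y * partial 2 \<psi> y) x
     + partial 2 (\<lambda>y. b y * partial 1 \<psi> y + c y * partial 2 \<psi> y) x"

text \<open>There is no zeroth-order term, since the operators to be compared act on derivatives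
  only.\<close>

definition H2_norm :: "(real^2 \<Rightarrow> real) \<Rightarrow> real" where
  "H2_norm \<psi> = disk_norm (partial 1 \<psi>) + disk_norm (partial 2 \<psi>) + disk_norm (partial 1 (partial 1 \<psi>))
     + disk_norm (partial 1 (partial 2 \<psi>)) + disk_norm (partial 2 (partial 2 \<psi>))"

lemma smooth_on_disk_divform [smooth_intros]:
  "smooth_on_disk a \<Longrightarrow> smooth_on_disk b \<Longrightarrow> smooth_on_disk c \<Longrightarrow> smooth_on_disk \<psi> \<Longrightarrow> smooth_on_disk (divform a b c \<psi>)"
  unfolding divform_def[abs_def] by (intro smooth_intros)

lemma divform_expand:
  assumes "smooth_on_disk a" "smooth_on_disk b" "smooth_on_disk c" "smooth_on_disk \<psi>" and x: "x \<in> disk"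
  shows "divform a b c \<psi> x = a x * partial 1 (partial 1 \<psi>) x + 2 * b x * partial 1 (partial 2 \<psi>) x + c x * partial 2 (partial 2 \<psi>) x
    + (partial 1 a x + partial 2 b x) * partial 1 \<psi> x + (partial 1 b x + partial 2 c x) * partial 2 \<psi> x"
  using partial_commute[OF assms(4) x, of 2 1] assms
  by (simp add: divform_def partial_simps smooth_intros algebra_simps)

lemma H1_sq_dirichlet:
  assumes "dirichlet \<psi>"
  shows "H1_sq \<psi> = (disk_norm (partial 1 \<psi>))\<^sup>2 + (disk_norm (partial 2 \<psi>))\<^sup>2"
proof -
  have s: "smooth_on_disk \<psi>" using assms by (simp add: dirichlet_def)
  have "circ_int (\<lambda>x. (\<psi> x)\<^sup>2) = circ_int (\<lambda>x. 0)"
    by (rule circ_int_cong) (use assms in \<open>simp add: dirichlet_def\<close>)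
  then show ?thesis using H1_sq_eq[OF s] by simp
qed

lemma disk_norm_from_int:
  assumes "continuous_on disk f" "continuous_on disk g" "\<And>x. x \<in> disk \<Longrightarrow> (f x)\<^sup>2 \<le> g x" "disk_int g \<le> B\<^sup>2" "0 \<le> B"
  shows "disk_norm f \<le> B"
proof (rule power2_le_imp_le[OF _ assms(5)])
  have "(disk_norm f)\<^sup>2 \<le> disk_int g"
    unfolding disk_norm_sq by (intro disk_int_mono continuous_intros assms)
  then show "(disk_norm f)\<^sup>2 \<le> B\<^sup>2" using assms(4) by simp
qed

text \<open>The equation is tested with \<psi> itself. The factor 5 is the root of the Poincare
  constant 20, rounded up.\<close>

lemma gradient_estimate:
  assumes e: "elliptic l M a b c" and d: "dirichlet \<psi>"
  shows "disk_norm (partial i \<psi>) \<le> 5 / l * disk_norm (divform a b c \<psi>)"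
proof -
  have s: "smooth_on_disk a" "smooth_on_disk b" "smooth_on_disk c" "smooth_on_disk \<psi>" and l: "l > 0"
    using e d by (auto simp: elliptic_def dirichlet_def)
  let ?p = "\<lambda>i. partial i \<psi>" and ?L = "divform a b c \<psi>"
  define X where "X = (\<lambda>y. a y * ?p 1 y + b y * ?p 2 y)"
  define Y where "Y = (\<lambda>y. b y * ?p 1 y + c y * ?p 2 y)"
  have sXY: "smooth_on_disk X" "smooth_on_disk Y" unfolding X_def Y_def by (intro smooth_intros s)+
  have "disk_int (\<lambda>x. partial 1 (\<lambda>x. \<psi> x * X x) x + partial 2 (\<lambda>x. \<psi> x * Y x) x) = circ_int (\<lambda>x. \<psi> x * X x * x$1 + \<psi> x * Y x * x$2)"
    by (rule divergence_smooth2) (intro smooth_intros s sXY)+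
  also have "\<dots> = circ_int (\<lambda>x. 0)"
    by (rule circ_int_cong) (use d in \<open>simp add: dirichlet_def\<close>)
  finally have 0: "disk_int (\<lambda>x. partial 1 (\<lambda>x. \<psi> x * X x) x + partial 2 (\<lambda>x. \<psi> x * Y x) x) = 0" by simp
  have "disk_int (\<lambda>x. partial 1 (\<lambda>x. \<psi> x * X x) x + partial 2 (\<lambda>x. \<psi> x * Y x) x)
     = disk_int (\<lambda>x. (?p 1 x * X x + ?p 2 x * Y x) + \<psi> x * ?L x)"
    by (rule disk_int_cong) (simp add: partial_mult_smooth s sXY divform_def X_def[symmetric] Y_def[symmetric] algebra_simps)
  also have "\<dots> = disk_int (\<lambda>x. ?p 1 x * X x + ?p 2 x * Y x) + disk_int (\<lambda>x. \<psi> x * ?L x)"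
    by (rule disk_int_add) (intro smooth_on_disk_continuous smooth_intros s sXY)+
  finally have i: "disk_int (\<lambda>x. ?p 1 x * X x + ?p 2 x * Y x) = - disk_int (\<lambda>x. \<psi> x * ?L x)" using 0 by simp
  have "l * H1_sq \<psi> = disk_int (\<lambda>x. l * ((?p 1 x)\<^sup>2 + (?p 2 x)\<^sup>2))"
    unfolding H1_sq_dirichlet[OF d] disk_norm_sq disk_int_cmult
    by (subst disk_int_add) (intro refl smooth_on_disk_continuous smooth_intros s)+
  also have "\<dots> \<le> disk_int (\<lambda>x. ?p 1 x * X x + ?p 2 x * Y x)"
  proof (rule disk_int_mono)
    fix x :: "real^2" assume "x \<in> disk"
    then have "l * ((?p 1 x)\<^sup>2 + (?p 2 x)\<^sup>2) \<le> a x * (?p 1 x)\<^sup>2 + 2 * b x * ?p 1 x * ?p 2 x + c x * (?p 2 x)\<^sup>2"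
      using e unfolding elliptic_def by blast
    then show "l * ((?p 1 x)\<^sup>2 + (?p 2 x)\<^sup>2) \<le> ?p 1 x * X x + ?p 2 x * Y x"
      by (simp add: X_def Y_def power2_eq_square algebra_simps)
  qed (intro smooth_on_disk_continuous smooth_intros s sXY)+
  also have "\<dots> \<le> disk_norm \<psi> * disk_norm ?L"
    unfolding i using disk_cauchy_schwarz[of \<psi> ?L] s by (simp add: smooth_on_disk_continuous smooth_intros)
  finally have main: "l * H1_sq \<psi> \<le> disk_norm \<psi> * disk_norm ?L" .
  define G where "G = sqrt (H1_sq \<psi>)"
  have G: "G \<ge> 0" "G\<^sup>2 = H1_sq \<psi>" using H1_sq_bounds(3)[OF s(4)] by (simp_all add: G_def)
  have "disk_norm \<psi> \<le> 5 * G"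
    by (rule power2_le_imp_le) (use poincare_disk[OF s(4)] G H1_sq_bounds(3)[OF s(4)] in \<open>auto simp: power_mult_distrib\<close>)
  then have "l * G\<^sup>2 \<le> 5 * G * disk_norm ?L"
    using main mult_right_mono[of "disk_norm \<psi>" "5 * G" "disk_norm ?L"] G by simp
  then have "G * (l * G) \<le> G * (5 * disk_norm ?L)" by (simp add: power2_eq_square algebra_simps)
  then have "l * G \<le> 5 * disk_norm ?L"
    using G(1) by (cases "G = 0") auto
  then have "G \<le> 5 / l * disk_norm ?L" using l by (simp add: field_simps)
  moreover have "disk_norm (?p i) \<le> G"
    by (rule power2_le_imp_le) (use H1_sq_bounds(1)[OF s(4)] G in auto)
  ultimately show ?thesis by simp
qed

lemma hessian_estimate:
  assumes e: "elliptic l M a b c" and d: "dirichlet \<psi>"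
  shows "disk_norm (partial i (partial j \<psi>)) \<le> M / l\<^sup>2 * (1 + 20 * M / l) * disk_norm (divform a b c \<psi>)"
proof -
  have s: "smooth_on_disk a" "smooth_on_disk b" "smooth_on_disk c" "smooth_on_disk \<psi>" and l: "l > 0" and M: "M > 0"
    using e d by (auto simp: elliptic_def dirichlet_def)
  have el: "l * (v\<^sup>2 + w\<^sup>2) \<le> a x * v\<^sup>2 + 2 * b x * v * w + c x * w\<^sup>2"
    and bd: "\<bar>a x\<bar> \<le> M" "\<bar>b x\<bar> \<le> M" "\<bar>c x\<bar> \<le> M"
      "\<bar>partial i a x\<bar> \<le> M" "\<bar>partial i b x\<bar> \<le> M" "\<bar>partial i c x\<bar> \<le> M"
    if "x \<in> disk" for x v w i
    using e that unfolding elliptic_def by blast+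
  let ?d = "\<lambda>i j. partial i (partial j \<psi>)" and ?L = "divform a b c \<psi>" and ?n = "disk_norm (divform a b c \<psi>)"
  define P where "P = (\<lambda>x. a x * ?d 1 1 x + 2 * b x * ?d 1 2 x + c x * ?d 2 2 x)"
  define V where "V = (\<lambda>x. (partial 1 a x + partial 2 b x) * partial 1 \<psi> x)"
  define W where "W = (\<lambda>x. (partial 1 b x + partial 2 c x) * partial 2 \<psi> x)"
  have sP: "smooth_on_disk P" "smooth_on_disk V" "smooth_on_disk W"
    unfolding P_def V_def W_def by (intro smooth_intros s)+
  have cc: "continuous_on disk P" "continuous_on disk V" "continuous_on disk W" "continuous_on disk ?L"
    by (rule smooth_on_disk_continuous, (rule sP smooth_on_disk_divform[OF s]))+
  have g: "disk_norm (partial i \<psi>) \<le> 5 / l * ?n" for i by (rule gradient_estimate[OF e d])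
  have V: "disk_norm V \<le> 2 * M * (5 / l * ?n)"
  proof -
    have "disk_norm V \<le> 2 * M * disk_norm (partial 1 \<psi>)"
      unfolding V_def
      by (rule disk_norm_mult_bound, (intro smooth_on_disk_continuous smooth_intros s)+, use bd(4,5) abs_triangle_ineq in \<open>smt (verit)\<close>)
    also have "\<dots> \<le> 2 * M * (5 / l * ?n)" using g[of 1] M by (intro mult_left_mono) auto
    finally show ?thesis .
  qed
  have W: "disk_norm W \<le> 2 * M * (5 / l * ?n)"
  proof -
    have "disk_norm W \<le> 2 * M * disk_norm (partial 2 \<psi>)"
      unfolding W_def
      by (rule disk_norm_mult_bound, (intro smooth_on_disk_continuous smooth_intros s)+, use bd(5,6) abs_triangle_ineq in \<open>smt (verit)\<close>)
    also have "\<dots> \<le> 2 * M * (5 / l * ?n)" using g[of 2] M by (intro mult_left_mono) auto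
    finally show ?thesis .
  qed
  have "disk_norm P = disk_norm (\<lambda>x. (?L x - V x) - W x)"
    by (rule disk_norm_cong) (simp add: divform_expand s P_def V_def W_def algebra_simps)
  also have "\<dots> \<le> disk_norm (\<lambda>x. ?L x - V x) + disk_norm W"
    by (intro disk_norm_triangle_diff continuous_intros cc)
  also have "\<dots> \<le> ?n + disk_norm V + disk_norm W"
    using disk_norm_triangle_diff[OF cc(4,2)] by simp
  also have "\<dots> \<le> (1 + 20 * M / l) * ?n" using add_mono[OF V W] by (simp add: field_simps)
  finally have nP: "disk_norm P \<le> (1 + 20 * M / l) * ?n" .
  define h where "h = (\<lambda>x. (?d 1 1 x)\<^sup>2 + 2 * (?d 1 2 x)\<^sup>2 + (?d 2 2 x)\<^sup>2)"
  define D where "D = (\<lambda>x. ?d 1 1 x * ?d 2 2 x - (?d 1 2 x)\<^sup>2)"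
  have sh: "smooth_on_disk h" "smooth_on_disk D" unfolding h_def D_def by (intro smooth_intros s)+
  have pw: "l\<^sup>2 / M\<^sup>2 * h x + 2 * D x \<le> (1 / l\<^sup>2) * (P x)\<^sup>2" if x: "x \<in> disk" for x
  proof -
    \<comment> \<open>The coefficient determinant lies between \<open>l\<close> squared and
      \<open>M\<close> squared. It varies with the point, so it has to be divided out before
      integrating: only the bare Hessian determinant has an integral of known sign.\<close>
    let ?\<delta> = "a x * c x - (b x)\<^sup>2"
    have 1: "l\<^sup>2 * h x \<le> (P x)\<^sup>2 - 2 * ?\<delta> * D x"
      using elliptic_hessian_bound[OF less_imp_le[OF l] el[OF x]] unfolding h_def P_def D_def .
    have d1: "l\<^sup>2 \<le> ?\<delta>" by (rule elliptic_det[OF less_imp_le[OF l] el[OF x]])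
    have "a x * c x \<le> \<bar>a x\<bar> * \<bar>c x\<bar>" by (simp flip: abs_mult)
    also have "\<dots> \<le> M * M" using bd[OF x] by (intro mult_mono) auto
    finally have d2: "?\<delta> \<le> M\<^sup>2" by (simp add: power2_eq_square) (smt (verit) zero_le_square)
    have dp: "?\<delta> > 0" using d1 l by (smt (verit) zero_less_power)
    have h0: "0 \<le> h x" by (simp add: h_def)
    have "l\<^sup>2 / M\<^sup>2 * h x \<le> l\<^sup>2 * h x / ?\<delta>"
      using divide_left_mono[OF d2, of "l\<^sup>2 * h x"] dp h0 M by simp
    moreover have "l\<^sup>2 * h x / ?\<delta> + 2 * D x \<le> (P x)\<^sup>2 / ?\<delta>"
    proof -
      have "u \<le> v - 2 * d * w \<Longrightarrow> d > 0 \<Longrightarrow> u / d + 2 * w \<le> v / d" for u v d w :: real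
        using divide_right_mono[of u "v - 2 * d * w" d] by (simp add: diff_divide_distrib)
      then show ?thesis using 1 dp .
    qed
    moreover have "(P x)\<^sup>2 / ?\<delta> \<le> (P x)\<^sup>2 / l\<^sup>2"
      using d1 dp l by (intro divide_left_mono) auto
    ultimately show ?thesis by simp
  qed
  have "l\<^sup>2 / M\<^sup>2 * disk_int h + 2 * disk_int D = disk_int (\<lambda>x. l\<^sup>2 / M\<^sup>2 * h x + 2 * D x)"
    by (subst disk_int_add) (auto simp: disk_int_cmult simp del: times_divide_eq_left intro!: smooth_on_disk_continuous smooth_intros sh)
  also have "\<dots> \<le> disk_int (\<lambda>x. (1 / l\<^sup>2) * (P x)\<^sup>2)"
    by (intro disk_int_mono pw) (auto intro!: smooth_on_disk_continuous smooth_intros sh sP simp del: times_divide_eq_left)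
  also have "\<dots> = (1 / l\<^sup>2) * (disk_norm P)\<^sup>2" by (simp only: disk_int_cmult disk_norm_sq)
  finally have "l\<^sup>2 / M\<^sup>2 * disk_int h + 2 * disk_int D \<le> (1 / l\<^sup>2) * (disk_norm P)\<^sup>2" .
  moreover have "0 \<le> disk_int D"
    unfolding D_def integral_hessian_det[OF d] by (simp add: circ_int_nonneg)
  ultimately have "l\<^sup>2 / M\<^sup>2 * disk_int h \<le> (1 / l\<^sup>2) * (disk_norm P)\<^sup>2" by linarith
  then have "disk_int h \<le> (M / l\<^sup>2 * disk_norm P)\<^sup>2"
    using l M by (simp add: field_simps power_mult_distrib power_divide)
  also have "\<dots> \<le> (M / l\<^sup>2 * ((1 + 20 * M / l) * ?n))\<^sup>2"
    using nP M l by (intro power_mono mult_left_mono) auto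
  finally have hb: "disk_int h \<le> (M / l\<^sup>2 * (1 + 20 * M / l) * ?n)\<^sup>2" by (simp add: mult.assoc)
  have ptw: "(?d i j x)\<^sup>2 \<le> h x" if "x \<in> disk" for x
  proof -
    have "?d 2 1 x = ?d 1 2 x" by (rule partial_commute[OF s(4) that])
    then show ?thesis using exhaust_2[of i] exhaust_2[of j] by (auto simp: h_def)
  qed
  show ?thesis
    by (rule disk_norm_from_int[OF _ _ ptw hb])
      (use M l in \<open>auto intro!: smooth_on_disk_continuous smooth_intros s sh\<close>)
qed

theorem H2_estimate:
  assumes "0 < l" "0 < M"
  obtains C where "0 < C" "\<And>a b c \<psi>. elliptic l M a b c \<Longrightarrow> dirichlet \<psi> \<Longrightarrow> H2_norm \<psi> \<le> C * disk_norm (divform a b c \<psi>)"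
proof
  let ?C = "2 * (5 / l) + 3 * (M / l\<^sup>2 * (1 + 20 * M / l))"
  show "0 < ?C" using assms by (simp add: add_pos_pos)
  fix a b c \<psi> assume e: "elliptic l M a b c" and d: "dirichlet \<psi>"
  define k1 k2 n where "k1 = 5 / l" "k2 = M / l\<^sup>2 * (1 + 20 * M / l)" "n = disk_norm (divform a b c \<psi>)"
  have "H2_norm \<psi> \<le> 2 * (k1 * n) + 3 * (k2 * n)"
    using gradient_estimate[OF e d, of 1] gradient_estimate[OF e d, of 2]
      hessian_estimate[OF e d, of 1 1] hessian_estimate[OF e d, of 1 2] hessian_estimate[OF e d, of 2 2]
    unfolding H2_norm_def k1_k2_n_def[symmetric] by linarith
  also have "\<dots> = (2 * k1 + 3 * k2) * n" by (simp add: algebra_simps)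
  finally show "H2_norm \<psi> \<le> ?C * disk_norm (divform a b c \<psi>)"
    unfolding k1_k2_n_def .
qed

section \<open>The Dirichlet problem for polynomials\<close>

text \<open>The real part of c z^a cnj(z)^b. In these monomials the Laplacian acts by a single shift
  of the exponents, and on the circle only the difference of the exponents matters.\<close>

definition cpow :: "complex \<Rightarrow> nat \<Rightarrow> nat \<Rightarrow> real^2 \<Rightarrow> real" where
  "cpow c a b x = Re (c * Complex (x$1) (x$2) ^ a * cnj (Complex (x$1) (x$2)) ^ b)"

lemma cpow_Suc1: "cpow c (Suc a) b x = x$1 * cpow c a b x + x$2 * cpow (\<i> * c) a b x"
  by (simp add: cpow_def algebra_simps)

lemma cpow_Suc2: "cpow c a (Suc b) x = x$1 * cpow c a b x + x$2 * cpow (- \<i> * c) a b x"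
  by (simp add: cpow_def algebra_simps)

lemma smooth_on_disk_cpow [smooth_intros]: "smooth_on_disk (cpow c a b)"
proof (induction a arbitrary: c)
  case 0
  show ?case
  proof (induction b arbitrary: c)
    case 0
    then show ?case by (simp add: cpow_def[abs_def] smooth_intros)
  next
    case (Suc b)
    then show ?case unfolding cpow_Suc2[abs_def] by (intro smooth_intros)
  qed
next
  case (Suc a)
  then show ?case unfolding cpow_Suc1[abs_def] by (intro smooth_intros)
qed

lemma cpow_sphere:
  assumes "x \<in> sphere 0 1"
  shows "cpow c (Suc a) (Suc b) x = cpow c a b x"
proof -
  have u: "Complex (x$1) (x$2) * cnj (Complex (x$1) (x$2)) = 1"
    using sphere_coords[OF assms] by (simp add: complex_mult_cnj complex_eq_iff power2_eq_square)
  have "cpow c (Suc a) (Suc b) x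
      = Re ((Complex (x$1) (x$2) * cnj (Complex (x$1) (x$2))) * (c * Complex (x$1) (x$2) ^ a * cnj (Complex (x$1) (x$2)) ^ b))"
    unfolding cpow_def by (simp only: power_Suc mult_ac)
  then show ?thesis unfolding u by (simp add: cpow_def)
qed

lemma cpow_0 [simp]: "cpow 0 a b x = 0"
  by (simp add: cpow_def)

lemma cpow_scale: "cpow (of_real r * c) a b x = r * cpow c a b x"
  by (simp add: cpow_def algebra_simps)

text \<open>Where an exponent is 0 the truncated subtraction does no harm, because the coefficient
  vanishes.\<close>

lemma partial_cpow:
  assumes x: "x \<in> disk"
  shows "partial 1 (cpow c a b) x = cpow (of_nat a * c) (a - 1) b x + cpow (of_nat b * c) a (b - 1) x"
    and "partial 2 (cpow c a b) x = cpow (of_nat a * (\<i> * c)) (a - 1) b x - cpow (of_nat b * (\<i> * c)) a (b - 1) x"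
proof -
  define z where "z = (\<lambda>x::real^2. of_real (x$1) + \<i> * of_real (x$2))"
  define w where "w = (\<lambda>x::real^2. of_real (x$1) - \<i> * of_real (x$2))"
  have Cz: "Complex (x$1) (x$2) = z x" "cnj (Complex (x$1) (x$2)) = w x" "cnj (z x) = w x" for x
    by (simp_all add: z_def w_def complex_eq_iff)
  have dr: "((\<lambda>x. of_real (x$i)) has_derivative (\<lambda>v. of_real (v$i) :: complex)) (at x within disk)" for i
    by (rule has_derivative_of_real[OF bounded_linear_imp_has_derivative[OF bounded_linear_vec_nth]])
  have dz: "(z has_derivative (\<lambda>v. of_real (v$1) + \<i> * of_real (v$2))) (at x within disk)"
    unfolding z_def by (intro has_derivative_add has_derivative_mult_right dr)
  have dw: "(w has_derivative (\<lambda>v. of_real (v$1) - \<i> * of_real (v$2))) (at x within disk)"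
    unfolding w_def by (intro has_derivative_diff has_derivative_mult_right dr)
  have e: "cpow c a b = (\<lambda>x. Re (c * z x ^ a * w x ^ b))"
    by (simp add: cpow_def fun_eq_iff Cz del: complex_cnj)
  have d: "(cpow c a b has_derivative (\<lambda>v. Re (c * (of_nat a * (of_real (v$1) + \<i> * of_real (v$2)) * z x ^ (a - 1)) * w x ^ b
      + c * z x ^ a * (of_nat b * (of_real (v$1) - \<i> * of_real (v$2)) * w x ^ (b - 1))))) (at x within disk)"
    unfolding e by (auto intro!: derivative_eq_intros dz dw simp: algebra_simps)
  have e': "cpow c' a' b' x = Re (c' * z x ^ a' * w x ^ b')" for c' a' b'
    by (simp add: cpow_def Cz del: complex_cnj)
  show "partial 1 (cpow c a b) x = cpow (of_nat a * c) (a - 1) b x + cpow (of_nat b * c) a (b - 1) x"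
    unfolding partial_eq[OF d x] e' by (simp add: axis_def algebra_simps)
  show "partial 2 (cpow c a b) x = cpow (of_nat a * (\<i> * c)) (a - 1) b x - cpow (of_nat b * (\<i> * c)) a (b - 1) x"
    unfolding partial_eq[OF d x] e' by (simp add: axis_def algebra_simps)
qed

definition laplacian :: "(real^2 \<Rightarrow> real) \<Rightarrow> real^2 \<Rightarrow> real" where
  "laplacian \<psi> x = partial 1 (partial 1 \<psi>) x + partial 2 (partial 2 \<psi>) x"

lemma laplacian_add:
  assumes "smooth_on_disk f" "smooth_on_disk g" "x \<in> disk"
  shows "laplacian (\<lambda>x. f x + g x) x = laplacian f x + laplacian g x"
proof -
  have "partial i (partial i (\<lambda>x. f x + g x)) x = partial i (\<lambda>x. partial i f x + partial i g x) x" for i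
    by (rule partial_cong[OF _ assms(3)]) (simp add: partial_simps assms)
  then show ?thesis by (simp add: laplacian_def partial_simps assms smooth_intros)
qed

lemma laplacian_cmult:
  assumes "smooth_on_disk f" "x \<in> disk"
  shows "laplacian (\<lambda>x. c * f x) x = c * laplacian f x"
proof -
  have "partial i (partial i (\<lambda>x. c * f x)) x = partial i (\<lambda>x. c * partial i f x) x" for i
    by (rule partial_cong[OF _ assms(2)]) (simp add: partial_simps assms)
  then show ?thesis by (simp add: laplacian_def partial_simps assms smooth_intros algebra_simps)
qed

text \<open>The Laplacian is four times the mixed derivative in z and its conjugate, so both
  exponents drop together.\<close>

lemma laplacian_cpow:
  assumes x: "x \<in> disk"
  shows "laplacian (cpow c a b) x = 4 * of_nat (a * b) * cpow c (a - 1) (b - 1) x"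
proof -
  have 1: "partial 1 (partial 1 (cpow c a b)) x
     = partial 1 (\<lambda>x. cpow (of_nat a * c) (a - 1) b x + cpow (of_nat b * c) a (b - 1) x) x"
    by (rule partial_cong[OF _ x]) (simp add: partial_cpow)
  have 2: "partial 2 (partial 2 (cpow c a b)) x
     = partial 2 (\<lambda>x. cpow (of_nat a * (\<i> * c)) (a - 1) b x - cpow (of_nat b * (\<i> * c)) a (b - 1) x) x"
    by (rule partial_cong[OF _ x]) (simp add: partial_cpow)
  have n: "cpow (- c) a b x = - cpow c a b x" for c a b by (simp add: cpow_def)
  have s: "cpow (of_nat k * c) a b x = of_nat k * cpow c a b x" for k c a b
    using cpow_scale[of "of_nat k" c a b x] by simp
  have s': "cpow (c * (of_nat k * of_nat j)) a b x = of_nat k * (of_nat j * cpow c a b x)" for k j c a b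
    using cpow_scale[of "of_nat k * of_nat j" c a b x] by (simp add: mult_ac)
  have ii: "\<i> * (of_nat k * (\<i> * c)) = - (of_nat k * c)" for k c by (simp add: algebra_simps)
  show ?thesis
    unfolding laplacian_def 1 2 using x
    by (simp add: partial_simps smooth_intros partial_cpow ii n s s' algebra_simps)
qed

lemma dirichlet_combination:
  assumes "dirichlet \<psi>" "dirichlet \<xi>"
  shows "dirichlet (\<lambda>x. c * \<psi> x + d * \<xi> x)"
  using assms by (auto simp: dirichlet_def intro!: smooth_intros)

definition poisson_solvable :: "(real^2 \<Rightarrow> real) \<Rightarrow> bool" where
  "poisson_solvable p \<longleftrightarrow> (\<exists>\<psi>. dirichlet \<psi> \<and> (\<forall>x\<in>disk. laplacian \<psi> x = p x))"

lemma poisson_solvable_combination: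
  assumes "poisson_solvable p" "poisson_solvable q"
  shows "poisson_solvable (\<lambda>x. c * p x + d * q x)"
proof -
  obtain \<psi> \<xi> where 1: "dirichlet \<psi>" "\<forall>x\<in>disk. laplacian \<psi> x = p x" "dirichlet \<xi>" "\<forall>x\<in>disk. laplacian \<xi> x = q x"
    using assms unfolding poisson_solvable_def by blast
  have "laplacian (\<lambda>x. c * \<psi> x + d * \<xi> x) x = c * p x + d * q x" if "x \<in> disk" for x
    using 1 that by (simp add: dirichlet_def laplacian_add laplacian_cmult smooth_intros)
  then show ?thesis
    unfolding poisson_solvable_def using dirichlet_combination[OF 1(1,3)] by blast
qed

text \<open>The Laplacian of \<open>(1 - z cnj z) z^a cnj z^b\<close> is triangular in the monomials.\<close>

lemma poisson_solvable_cpow: "poisson_solvable (cpow c a b)"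
proof (induction a arbitrary: c b)
  define f where "f c a b = (\<lambda>x. cpow c a b x + (- 1) * cpow c (Suc a) (Suc b) x)" for c a b
  have d: "dirichlet (f c a b)" for c a b
    unfolding dirichlet_def f_def by (auto intro!: smooth_intros simp: cpow_sphere)
  have l: "laplacian (f c a b) x = 4 * real (a * b) * cpow c (a - 1) (b - 1) x - 4 * real (Suc a * Suc b) * cpow c a b x"
    if "x \<in> disk" for c a b x
  proof -
    have "laplacian (f c a b) x = laplacian (cpow c a b) x + (- 1) * laplacian (cpow c (Suc a) (Suc b)) x"
      unfolding f_def using laplacian_add[of "cpow c a b" "\<lambda>x. (- 1) * cpow c (Suc a) (Suc b) x", OF _ _ that]
        laplacian_cmult[of "cpow c (Suc a) (Suc b)", OF _ that, of "- 1"]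
      by (simp only: smooth_intros)
    then show ?thesis using that by (simp add: laplacian_cpow del: of_nat_mult of_nat_Suc)
  qed
  have pf: "poisson_solvable (laplacian (f c a b))" for c a b unfolding poisson_solvable_def using d by blast
  \<comment> \<open>The Laplacian of \<open>f c a b\<close> is the monomial itself, with nonzero
    factor, plus the one with both exponents lowered. Once the latter is solvable so is the former;
    for \<open>a = 0\<close> the lower term is zero, which starts the induction.\<close>
  have step: "poisson_solvable (cpow c a b)" if q: "poisson_solvable q"
    and eq: "\<And>x. x \<in> disk \<Longrightarrow> q x = 4 * real (a * b) * cpow c (a - 1) (b - 1) x" for q c a b
  proof -
    define k where "k = 4 * real (Suc a * Suc b)"
    have k: "k > 0" unfolding k_def by (simp del: of_nat_mult of_nat_Suc)
    obtain \<psi> where \<psi>: "dirichlet \<psi>" "\<forall>x\<in>disk. laplacian \<psi> x = (- 1 / k) * laplacian (f c a b) x + (1 / k) * q x"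
      using poisson_solvable_combination[OF pf q] unfolding poisson_solvable_def by blast
    have "laplacian \<psi> x = cpow c a b x" if "x \<in> disk" for x
    proof -
      have "laplacian (f c a b) x = q x - k * cpow c a b x"
        using l[OF that, of c a b] eq[OF that] unfolding k_def by linarith
      moreover have "k * laplacian \<psi> x + laplacian (f c a b) x = q x"
        using \<psi>(2) that k by (simp add: field_simps)
      ultimately have "k * laplacian \<psi> x = k * cpow c a b x" by linarith
      then show ?thesis using k by simp
    qed
    then show ?thesis using \<psi>(1) unfolding poisson_solvable_def by blast
  qed
  have zero: "poisson_solvable (\<lambda>_. 0)"
    using poisson_solvable_combination[OF pf pf, of 0 _ _ _ 0] by simp
  case 0
  show ?case by (rule step[OF zero]) simp
  case (Suc a)
  from poisson_solvable_combination[OF Suc.IH Suc.IH]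
  have "poisson_solvable (\<lambda>x. (4 * real (Suc a * b)) * cpow c a (b - 1) x + 0 * cpow c a (b - 1) x)" .
  then show ?case by (rule step) simp
qed

inductive zpoly :: "(real^2 \<Rightarrow> real) \<Rightarrow> bool" where
  zpoly_cpow: "zpoly (cpow c a b)"
| zpoly_add: "zpoly f \<Longrightarrow> zpoly g \<Longrightarrow> zpoly (\<lambda>x. f x + g x)"

text \<open>\<open>Re u * Re v\<close> is half of \<open>Re (u * v) + Re (u * cnj v)\<close>, so
  products of two monomials stay in the span.\<close>

lemma zpoly_mult: "zpoly f \<Longrightarrow> zpoly g \<Longrightarrow> zpoly (\<lambda>x. f x * g x)"
proof (induction arbitrary: g rule: zpoly.induct)
  case (zpoly_cpow c a b)
  then show ?case
  proof (induction rule: zpoly.induct)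
    case (zpoly_cpow d p q)
    have "(\<lambda>x. cpow c a b x * cpow d p q x) = (\<lambda>x. cpow (c * d / 2) (a + p) (b + q) x + cpow (c * cnj d / 2) (a + q) (b + p) x)"
    proof
      fix x :: "real^2"
      have 1: "Re u * Re v = Re (u * v / 2) + Re (u * cnj v / 2)" for u v by (simp add: field_simps)
      show "cpow c a b x * cpow d p q x = cpow (c * d / 2) (a + p) (b + q) x + cpow (c * cnj d / 2) (a + q) (b + p) x"
        unfolding cpow_def 1 by (simp add: power_add mult_ac)
    qed
    then show ?case using zpoly.zpoly_add zpoly.zpoly_cpow by simp
  next
    case (zpoly_add f g)
    then show ?case using zpoly.zpoly_add by (simp add: algebra_simps)
  qed
next
  case (zpoly_add f h)
  have "zpoly (\<lambda>x. f x * g x + h x * g x)"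
    by (intro zpoly.zpoly_add zpoly_add.IH zpoly_add.prems)
  then show ?case by (simp add: distrib_right)
qed

lemma zpoly_real_polynomial: "real_polynomial_function p \<Longrightarrow> zpoly p"
proof (induction rule: real_polynomial_function.induct)
  case (linear f)
  have "f x = cpow (Complex (f (axis 1 1)) (- f (axis 2 1))) 1 0 x" for x
    using linear_real2_eq[OF bounded_linear.linear[OF linear], of x] by (simp add: cpow_def)
  then have "f = cpow (Complex (f (axis 1 1)) (- f (axis 2 1))) 1 0" by blast
  then show ?case using zpoly_cpow by metis
next
  case (const c)
  have "(\<lambda>x. c) = cpow (of_real c) 0 0" by (simp add: cpow_def fun_eq_iff)
  then show ?case using zpoly_cpow by metis
qed (auto intro: zpoly_add zpoly_mult)

lemma zpoly_props: "zpoly p \<Longrightarrow> smooth_on_disk p \<and> poisson_solvable p"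
proof (induction rule: zpoly.induct)
  case (zpoly_add f g)
  then show ?case using poisson_solvable_combination[of f g 1 1] by (auto intro: smooth_intros)
qed (simp add: smooth_on_disk_cpow poisson_solvable_cpow)

lemma poisson_dense:
  assumes "continuous_on disk f" "e > 0"
  obtains \<psi> where "dirichlet \<psi>" "\<And>x. x \<in> disk \<Longrightarrow> \<bar>f x - laplacian \<psi> x\<bar> < e"
proof -
  obtain p where p: "real_polynomial_function p" "\<And>x. x \<in> disk \<Longrightarrow> \<bar>f x - p x\<bar> < e"
    using Stone_Weierstrass_real_polynomial_function[OF compact_cball assms] by blast
  then have "poisson_solvable p" using zpoly_props zpoly_real_polynomial by blast
  then show ?thesis using that p(2) unfolding poisson_solvable_def by fastforce
qed

section \<open>The method of continuity\<close>

text \<open>Density in L2 stands in for solvability. It survives small perturbations by a finite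
  iteration, where solvability in smooth functions would require passing to limits.\<close>

definition dense_range :: "((real^2 \<Rightarrow> real) \<Rightarrow> real^2 \<Rightarrow> real) \<Rightarrow> bool" where
  "dense_range L \<longleftrightarrow> (\<forall>f e. smooth_on_disk f \<longrightarrow> 0 < e \<longrightarrow> (\<exists>\<psi>. dirichlet \<psi> \<and> disk_norm (\<lambda>x. f x - L \<psi> x) < e))"

lemma disk_norm_1_pos: "0 < disk_norm (\<lambda>_. 1)"
proof -
  have "0 < measure lborel disk" by (simp add: content_cball_pos)
  then show ?thesis by (simp add: disk_norm_def disk_int_def set_lebesgue_integral_def)
qed

lemma dense_range_laplacian: "dense_range laplacian"
  unfolding dense_range_def
proof (intro allI impI)
  fix f :: "real^2 \<Rightarrow> real" and e :: real assume f: "smooth_on_disk f" and e: "0 < e"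
  define m where "m = disk_norm (\<lambda>_. 1)"
  have m: "m > 0" using disk_norm_1_pos by (simp add: m_def)
  obtain \<psi> where \<psi>: "dirichlet \<psi>" "\<And>x. x \<in> disk \<Longrightarrow> \<bar>f x - laplacian \<psi> x\<bar> < e / (2 * m)"
    using poisson_dense[OF smooth_on_disk_continuous[OF f], of "e / (2 * m)"] e m by auto
  have s: "smooth_on_disk (laplacian \<psi>)"
    using \<psi>(1) unfolding laplacian_def[abs_def] dirichlet_def by (intro smooth_intros) auto
  have "disk_norm (\<lambda>x. f x - laplacian \<psi> x) \<le> disk_norm (\<lambda>x. e / (2 * m) * 1)"
    by (rule disk_norm_mono) (use \<psi>(2) e m in \<open>auto intro!: smooth_on_disk_continuous smooth_intros f s less_imp_le\<close>)
  also have "\<dots> = e / 2" unfolding disk_norm_cmult m_def[symmetric] using e m by simp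
  finally show "\<exists>\<psi>. dirichlet \<psi> \<and> disk_norm (\<lambda>x. f x - laplacian \<psi> x) < e" using \<psi>(1) e by (intro exI[of _ \<psi>]) auto
qed

text \<open>Approximate inversion of \<open>L\<close> leaves an error of 1/8 of the norm of
  \<open>f\<close>, and replacing \<open>L\<close> by \<open>K\<close> costs at most half of 9/8 of
  it. The sum 11/16 is below 3/4, so repeating the step on the residual makes it decay
  geometrically. Additivity of \<open>K\<close> collects the successive corrections into one
  function.\<close>

lemma dense_range_perturb:
  fixes L K :: "(real^2 \<Rightarrow> real) \<Rightarrow> real^2 \<Rightarrow> real"
  assumes sm: "\<And>\<psi>. dirichlet \<psi> \<Longrightarrow> smooth_on_disk (L \<psi>)" "\<And>\<psi>. dirichlet \<psi> \<Longrightarrow> smooth_on_disk (K \<psi>)"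
    and add: "\<And>\<psi> \<xi> x. dirichlet \<psi> \<Longrightarrow> dirichlet \<xi> \<Longrightarrow> x \<in> disk \<Longrightarrow> K (\<lambda>x. \<psi> x + \<xi> x) x = K \<psi> x + K \<xi> x"
    and zero: "\<And>x. x \<in> disk \<Longrightarrow> K (\<lambda>_. 0) x = 0"
    and close: "\<And>\<psi>. dirichlet \<psi> \<Longrightarrow> disk_norm (\<lambda>x. L \<psi> x - K \<psi> x) \<le> 1/2 * disk_norm (L \<psi>)"
    and dense: "dense_range L"
  shows "dense_range K"
proof -
  have sc: "continuous_on disk g" if "smooth_on_disk g" for g using that by (rule smooth_on_disk_continuous)
  have step: "\<exists>\<psi>. dirichlet \<psi> \<and> disk_norm (\<lambda>x. f x - K \<psi> x) \<le> 3/4 * disk_norm f" if f: "smooth_on_disk f" for f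
  proof (cases "disk_norm f = 0")
    case True
    have "dirichlet (\<lambda>_. 0)" by (simp add: dirichlet_def smooth_intros)
    moreover have "disk_norm (\<lambda>x. f x - K (\<lambda>_. 0) x) = disk_norm f"
      by (rule disk_norm_cong) (simp add: zero)
    ultimately show ?thesis using True by (intro exI[of _ "\<lambda>_. 0"]) simp
  next
    case False
    then have n: "disk_norm f > 0" using disk_norm_nonneg[of f] by linarith
    then obtain \<psi> where \<psi>: "dirichlet \<psi>" "disk_norm (\<lambda>x. f x - L \<psi> x) < disk_norm f / 8"
      using dense f unfolding dense_range_def by (metis divide_pos_pos zero_less_numeral)
    have c: "continuous_on disk (L \<psi>)" "continuous_on disk (K \<psi>)" "continuous_on disk f"
      using sc sm \<psi>(1) f by auto
    have "disk_norm (L \<psi>) = disk_norm (\<lambda>x. f x - (f x - L \<psi> x))" by (rule disk_norm_cong) simp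
    also have "\<dots> \<le> disk_norm f + disk_norm (\<lambda>x. f x - L \<psi> x)"
      by (rule disk_norm_triangle_diff) (intro continuous_intros c)+
    finally have 1: "disk_norm (L \<psi>) \<le> disk_norm f + disk_norm (\<lambda>x. f x - L \<psi> x)" .
    have "disk_norm (\<lambda>x. f x - K \<psi> x) = disk_norm (\<lambda>x. (f x - L \<psi> x) + (L \<psi> x - K \<psi> x))" by (rule disk_norm_cong) simp
    also have "\<dots> \<le> disk_norm (\<lambda>x. f x - L \<psi> x) + disk_norm (\<lambda>x. L \<psi> x - K \<psi> x)"
      by (rule disk_norm_triangle) (intro continuous_intros c)+
    finally have "disk_norm (\<lambda>x. f x - K \<psi> x) \<le> 3/4 * disk_norm f" using 1 close[OF \<psi>(1)] \<psi>(2) n by linarith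
    then show ?thesis using \<psi>(1) by blast
  qed
  have iter: "\<exists>\<psi>. dirichlet \<psi> \<and> disk_norm (\<lambda>x. f x - K \<psi> x) \<le> (3/4)^n * disk_norm f" if f: "smooth_on_disk f" for f n
  proof (induction n)
    case 0
    have "dirichlet (\<lambda>_. 0)" by (simp add: dirichlet_def smooth_intros)
    moreover have "disk_norm (\<lambda>x. f x - K (\<lambda>_. 0) x) = disk_norm f"
      by (rule disk_norm_cong) (simp add: zero)
    ultimately show ?case by (intro exI[of _ "\<lambda>_. 0"]) simp
  next
    case (Suc n)
    then obtain \<psi> where \<psi>: "dirichlet \<psi>" "disk_norm (\<lambda>x. f x - K \<psi> x) \<le> (3/4)^n * disk_norm f" by blast
    have "smooth_on_disk (\<lambda>x. f x - K \<psi> x)" by (intro smooth_intros f sm \<psi>)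
    from step[OF this] obtain \<xi> where \<xi>: "dirichlet \<xi>"
      "disk_norm (\<lambda>x. (f x - K \<psi> x) - K \<xi> x) \<le> 3/4 * disk_norm (\<lambda>x. f x - K \<psi> x)" by blast
    have "disk_norm (\<lambda>x. f x - K (\<lambda>x. \<psi> x + \<xi> x) x) = disk_norm (\<lambda>x. (f x - K \<psi> x) - K \<xi> x)"
      by (rule disk_norm_cong) (simp add: add \<psi> \<xi>)
    then have "disk_norm (\<lambda>x. f x - K (\<lambda>x. \<psi> x + \<xi> x) x) \<le> (3/4)^Suc n * disk_norm f"
      using \<psi>(2) \<xi>(2) by simp
    moreover have "dirichlet (\<lambda>x. \<psi> x + \<xi> x)" using \<psi>(1) \<xi>(1) by (auto simp: dirichlet_def intro: smooth_intros)
    ultimately show ?case by blast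
  qed
  show ?thesis
    unfolding dense_range_def
  proof (intro allI impI)
    fix f :: "real^2 \<Rightarrow> real" and e :: real assume f: "smooth_on_disk f" and e: "0 < e"
    have "(\<lambda>n. (3/4)^n * disk_norm f) \<longlonglongrightarrow> 0 * disk_norm f"
      by (intro tendsto_mult tendsto_const LIMSEQ_realpow_zero) auto
    then have "\<forall>\<^sub>F n in sequentially. (3/4)^n * disk_norm f < e"
      using e by (intro order_tendstoD) auto
    then obtain n where "(3/4)^n * disk_norm f < e" by (auto simp: eventually_sequentially)
    then show "\<exists>\<psi>. dirichlet \<psi> \<and> disk_norm (\<lambda>x. f x - K \<psi> x) < e"
      using iter[OF f, of n] by force
  qed
qed

lemma divform_add:
  assumes "smooth_on_disk a" "smooth_on_disk b" "smooth_on_disk c" "smooth_on_disk \<psi>" "smooth_on_disk \<xi>" "x \<in> disk"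
  shows "divform a b c (\<lambda>x. \<psi> x + \<xi> x) x = divform a b c \<psi> x + divform a b c \<xi> x"
proof -
  have p: "partial i (partial j (\<lambda>x. \<psi> x + \<xi> x)) x = partial i (partial j \<psi>) x + partial i (partial j \<xi>) x" for i j
  proof -
    have "partial i (partial j (\<lambda>x. \<psi> x + \<xi> x)) x = partial i (\<lambda>x. partial j \<psi> x + partial j \<xi> x) x"
      by (rule partial_cong[OF _ assms(6)]) (simp add: partial_simps assms)
    then show ?thesis by (simp add: partial_simps assms smooth_intros)
  qed
  show ?thesis using assms by (simp add: divform_expand smooth_intros p partial_simps algebra_simps)
qed

lemma elliptic_interpolate:
  assumes e: "elliptic l M a b c" and t: "0 \<le> t" "t \<le> 1"
  shows "elliptic (min 1 l) (max 1 M) (\<lambda>x. (1 - t) + t * a x) (\<lambda>x. t * b x) (\<lambda>x. (1 - t) + t * c x)"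
proof -
  have s: "smooth_on_disk a" "smooth_on_disk b" "smooth_on_disk c" and l: "l > 0" and M: "M > 0"
    using e by (auto simp: elliptic_def)
  have cvx: "\<bar>(1 - t) + t * z\<bar> \<le> max 1 M" if "\<bar>z\<bar> \<le> M" for z
  proof -
    have "\<bar>(1 - t) + t * z\<bar> \<le> (1 - t) * 1 + t * \<bar>z\<bar>"
      using t by (metis abs_mult abs_of_nonneg abs_triangle_ineq diff_ge_0_iff_ge mult.right_neutral)
    also have "\<dots> \<le> (1 - t) * max 1 M + t * max 1 M"
      using t that by (intro add_mono mult_left_mono) auto
    also have "\<dots> = max 1 M" by (simp add: algebra_simps)
    finally show ?thesis .
  qed
  have sm: "\<bar>t * z\<bar> \<le> max 1 M" if "\<bar>z\<bar> \<le> M" for z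
  proof -
    have "\<bar>t * z\<bar> \<le> 1 * \<bar>z\<bar>" unfolding abs_mult using t by (intro mult_right_mono) auto
    then show ?thesis using that by simp
  qed
  have form: "min 1 l * (v\<^sup>2 + w\<^sup>2) \<le> ((1 - t) + t * a x) * v\<^sup>2 + 2 * (t * b x) * v * w + ((1 - t) + t * c x) * w\<^sup>2"
    if x: "x \<in> disk" for x v w
  proof -
    have 1: "min 1 l * (v\<^sup>2 + w\<^sup>2) \<le> 1 * (v\<^sup>2 + w\<^sup>2)" by (intro mult_right_mono) auto
    have "min 1 l * (v\<^sup>2 + w\<^sup>2) \<le> l * (v\<^sup>2 + w\<^sup>2)" by (intro mult_right_mono) auto
    also have "\<dots> \<le> a x * v\<^sup>2 + 2 * b x * v * w + c x * w\<^sup>2" using e x by (auto simp: elliptic_def)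
    finally have 2: "min 1 l * (v\<^sup>2 + w\<^sup>2) \<le> a x * v\<^sup>2 + 2 * b x * v * w + c x * w\<^sup>2" .
    have "(1 - t) * (min 1 l * (v\<^sup>2 + w\<^sup>2)) + t * (min 1 l * (v\<^sup>2 + w\<^sup>2))
      \<le> (1 - t) * (1 * (v\<^sup>2 + w\<^sup>2)) + t * (a x * v\<^sup>2 + 2 * b x * v * w + c x * w\<^sup>2)"
      using t by (intro add_mono mult_left_mono 1 2) auto
    then show ?thesis by (simp add: algebra_simps)
  qed
  have bd: "\<bar>a x\<bar> \<le> M" "\<bar>b x\<bar> \<le> M" "\<bar>c x\<bar> \<le> M"
      "\<bar>partial i a x\<bar> \<le> M" "\<bar>partial i b x\<bar> \<le> M" "\<bar>partial i c x\<bar> \<le> M"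
    if "x \<in> disk" for x i
    using e that unfolding elliptic_def by blast+
  have pt: "partial i (\<lambda>x. (1 - t) + t * a x) x = t * partial i a x" "partial i (\<lambda>x. t * b x) x = t * partial i b x"
    "partial i (\<lambda>x. (1 - t) + t * c x) x = t * partial i c x" if "x \<in> disk" for x i
    using that s by (simp_all add: partial_simps smooth_intros)
  show ?thesis
    unfolding elliptic_def
    by (intro conjI ballI allI form) (use l M in \<open>simp_all add: pt bd cvx sm s smooth_intros\<close>)
qed

text \<open>On the segment from the Laplacian to the operator all H2 estimates share one constant
  \<open>K\<close>, so the admissible step in the parameter is the same everywhere and finitely many
  steps reach the end. \<open>N\<close> is chosen so that a step of 1 / N is admissible.\<close>

theorem dense_range_divform:
  assumes e: "elliptic l M a b c"
  shows "dense_range (divform a b c)"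
proof -
  have s: "smooth_on_disk a" "smooth_on_disk b" "smooth_on_disk c" and l: "l > 0" and M: "M > 0"
    using e by (auto simp: elliptic_def)
  define A where "A t = (\<lambda>x. (1 - t) + t * a x)" for t :: real
  define B where "B t = (\<lambda>x. t * b x)" for t :: real
  define C where "C t = (\<lambda>x. (1 - t) + t * c x)" for t :: real
  have sABC: "smooth_on_disk (A t)" "smooth_on_disk (B t)" "smooth_on_disk (C t)" for t
    unfolding A_def B_def C_def by (intro smooth_intros s)+
  define L where "L t = divform (A t) (B t) (C t)" for t
  have eABC: "elliptic (min 1 l) (max 1 M) (A t) (B t) (C t)" if "0 \<le> t" "t \<le> 1" for t
    unfolding A_def B_def C_def by (rule elliptic_interpolate[OF e that])
  have "0 < min 1 l" "0 < max 1 M" using l M by auto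
  then obtain K where K: "0 < K" "\<And>a b c \<psi>. elliptic (min 1 l) (max 1 M) a b c \<Longrightarrow> dirichlet \<psi> \<Longrightarrow> H2_norm \<psi> \<le> K * disk_norm (divform a b c \<psi>)"
    using H2_estimate by blast
  have Lex: "L t \<psi> x = (1 - t) * laplacian \<psi> x + t * divform a b c \<psi> x" if "smooth_on_disk \<psi>" "x \<in> disk" for t \<psi> x
    using that s sABC unfolding L_def
    by (simp add: divform_expand A_def B_def C_def partial_simps smooth_intros laplacian_def algebra_simps)
  define P where "P = (\<lambda>\<psi> x. divform a b c \<psi> x - laplacian \<psi> x)"
  \<comment> \<open>A bound for all coefficients of \<open>P\<close>: those of second order are at
    most 1 + M or 2 M, those of first order at most 2 M.\<close>
  define Q where "Q = 1 + 4 * M"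
  have Q: "Q > 0" using M by (simp add: Q_def)
  have bd: "\<bar>a x\<bar> \<le> M" "\<bar>b x\<bar> \<le> M" "\<bar>c x\<bar> \<le> M"
      "\<bar>partial i a x\<bar> \<le> M" "\<bar>partial i b x\<bar> \<le> M" "\<bar>partial i c x\<bar> \<le> M"
    if "x \<in> disk" for x i
    using e that unfolding elliptic_def by blast+
  have sl: "smooth_on_disk (laplacian \<psi>)" if "smooth_on_disk \<psi>" for \<psi>
    using that unfolding laplacian_def[abs_def] by (intro smooth_intros)
  have nP: "disk_norm (P \<psi>) \<le> Q * H2_norm \<psi>" if \<psi>: "smooth_on_disk \<psi>" for \<psi>
  proof -
    let ?d = "\<lambda>i j. partial i (partial j \<psi>)" and ?p = "\<lambda>i. partial i \<psi>"
    define f1 f2 f3 f4 f5 where "f1 = (\<lambda>x. (a x - 1) * ?d 1 1 x)" "f2 = (\<lambda>x. (2 * b x) * ?d 1 2 x)"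
      "f3 = (\<lambda>x. (c x - 1) * ?d 2 2 x)" "f4 = (\<lambda>x. (partial 1 a x + partial 2 b x) * ?p 1 x)"
      "f5 = (\<lambda>x. (partial 1 b x + partial 2 c x) * ?p 2 x)"
    note fd = f1_f2_f3_f4_f5_def
    have c: "continuous_on disk f1" "continuous_on disk f2" "continuous_on disk f3" "continuous_on disk f4" "continuous_on disk f5"
      unfolding fd by (intro smooth_on_disk_continuous smooth_intros s \<psi>)+
    have n: "disk_norm f1 \<le> Q * disk_norm (?d 1 1)" "disk_norm f2 \<le> Q * disk_norm (?d 1 2)" "disk_norm f3 \<le> Q * disk_norm (?d 2 2)"
      "disk_norm f4 \<le> Q * disk_norm (?p 1)" "disk_norm f5 \<le> Q * disk_norm (?p 2)"
    proof -
      have q: "\<bar>a x - 1\<bar> \<le> Q" "\<bar>2 * b x\<bar> \<le> Q" "\<bar>c x - 1\<bar> \<le> Q"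
        "\<bar>partial 1 a x + partial 2 b x\<bar> \<le> Q" "\<bar>partial 1 b x + partial 2 c x\<bar> \<le> Q" if "x \<in> disk" for x
        using bd(1-3)[OF that] bd(4)[OF that, of 1] bd(5)[OF that, of 2] bd(5)[OF that, of 1] bd(6)[OF that, of 2] M
        unfolding Q_def by linarith+
      show "disk_norm f1 \<le> Q * disk_norm (?d 1 1)" "disk_norm f2 \<le> Q * disk_norm (?d 1 2)" "disk_norm f3 \<le> Q * disk_norm (?d 2 2)"
        "disk_norm f4 \<le> Q * disk_norm (?p 1)" "disk_norm f5 \<le> Q * disk_norm (?p 2)"
        unfolding fd
        by (rule disk_norm_mult_bound, (intro smooth_on_disk_continuous smooth_intros s \<psi>)+, erule q)+
    qed
    have "disk_norm (P \<psi>) = disk_norm (\<lambda>x. (((f1 x + f2 x) + f3 x) + f4 x) + f5 x)"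
      by (rule disk_norm_cong) (simp add: P_def divform_expand s \<psi> laplacian_def fd algebra_simps)
    also have "\<dots> \<le> disk_norm (\<lambda>x. ((f1 x + f2 x) + f3 x) + f4 x) + disk_norm f5"
      by (rule disk_norm_triangle) (intro continuous_intros c)+
    also have "disk_norm (\<lambda>x. ((f1 x + f2 x) + f3 x) + f4 x) \<le> disk_norm (\<lambda>x. (f1 x + f2 x) + f3 x) + disk_norm f4"
      by (rule disk_norm_triangle) (intro continuous_intros c)+
    also have "disk_norm (\<lambda>x. (f1 x + f2 x) + f3 x) \<le> disk_norm (\<lambda>x. f1 x + f2 x) + disk_norm f3"
      by (rule disk_norm_triangle) (intro continuous_intros c)+
    also have "disk_norm (\<lambda>x. f1 x + f2 x) \<le> disk_norm f1 + disk_norm f2"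
      by (rule disk_norm_triangle) (intro continuous_intros c)+
    finally show ?thesis using n unfolding H2_norm_def distrib_left by linarith
  qed
  have step: "dense_range (L t)" if r: "dense_range (L r)" and t: "0 \<le> t" "t \<le> 1" "0 \<le> r" "r \<le> 1" "\<bar>t - r\<bar> * (Q * K) \<le> 1/2" for r t
  proof (rule dense_range_perturb[OF _ _ _ _ _ r])
    show "smooth_on_disk (L r \<psi>)" "smooth_on_disk (L t \<psi>)" if "dirichlet \<psi>" for \<psi>
      using that unfolding L_def dirichlet_def by (intro smooth_intros sABC; simp)+
    show "L t (\<lambda>x. \<psi> x + \<xi> x) x = L t \<psi> x + L t \<xi> x" if "dirichlet \<psi>" "dirichlet \<xi>" "x \<in> disk" for \<psi> \<xi> x
      using that sABC unfolding L_def dirichlet_def by (simp add: divform_add)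
    show "L t (\<lambda>_. 0) x = 0" if "x \<in> disk" for x
    proof -
      have "L t (\<lambda>_. 0) x = L t (\<lambda>x. 0 + 0) x" by simp
      also have "\<dots> = L t (\<lambda>_. 0) x + L t (\<lambda>_. 0) x"
        unfolding L_def by (rule divform_add) (intro sABC smooth_intros that)+
      finally show ?thesis by simp
    qed
    fix \<psi> assume d: "dirichlet \<psi>"
    then have \<psi>: "smooth_on_disk \<psi>" by (simp add: dirichlet_def)
    have "disk_norm (\<lambda>x. L r \<psi> x - L t \<psi> x) = disk_norm (\<lambda>x. (r - t) * P \<psi> x)"
      by (rule disk_norm_cong) (simp add: Lex \<psi> P_def algebra_simps)
    also have "\<dots> = \<bar>t - r\<bar> * disk_norm (P \<psi>)" by (simp add: disk_norm_cmult abs_minus_commute)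
    also have "\<dots> \<le> \<bar>t - r\<bar> * (Q * (K * disk_norm (L r \<psi>)))"
    proof (intro mult_left_mono)
      have "disk_norm (P \<psi>) \<le> Q * H2_norm \<psi>" by (rule nP[OF \<psi>])
      also have "\<dots> \<le> Q * (K * disk_norm (L r \<psi>))"
        unfolding L_def using K(2)[OF eABC[OF t(3,4)] d] Q by (intro mult_left_mono) auto
      finally show "disk_norm (P \<psi>) \<le> Q * (K * disk_norm (L r \<psi>))" .
    qed simp
    also have "\<dots> = (\<bar>t - r\<bar> * (Q * K)) * disk_norm (L r \<psi>)" by simp
    also have "\<dots> \<le> 1/2 * disk_norm (L r \<psi>)" using t(5) by (intro mult_right_mono) auto
    finally show "disk_norm (\<lambda>x. L r \<psi> x - L t \<psi> x) \<le> 1/2 * disk_norm (L r \<psi>)" .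
  qed
  obtain N :: nat where N: "2 * (Q * K) \<le> real N" using real_arch_simple by blast
  have N0: "N > 0" using N Q K(1) by (metis mult_pos_pos not_gr_zero not_less of_nat_0 zero_less_numeral)
  have all: "k \<le> N \<Longrightarrow> dense_range (L (real k / real N))" for k
  proof (induction k)
    case 0
    have "L 0 \<psi> x = laplacian \<psi> x" if "dirichlet \<psi>" "x \<in> disk" for \<psi> x
      using that Lex[of \<psi> x 0] by (simp add: dirichlet_def)
    then have "disk_norm (\<lambda>x. f x - L 0 \<psi> x) = disk_norm (\<lambda>x. f x - laplacian \<psi> x)" if "dirichlet \<psi>" for \<psi> f
      using that by (intro disk_norm_cong) simp
    then show ?case using dense_range_laplacian unfolding dense_range_def by (metis div_by_0 divide_eq_0_iff of_nat_0)
  next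
    case (Suc k)
    show ?case
    proof (rule step)
      show "dense_range (L (real k / real N))" using Suc by simp
      have "\<bar>real (Suc k) / real N - real k / real N\<bar> = 1 / real N"
        using N0 by (simp add: field_simps)
      then show "\<bar>real (Suc k) / real N - real k / real N\<bar> * (Q * K) \<le> 1/2"
        using N N0 by (simp add: field_simps)
    qed (use Suc.prems N0 in \<open>auto simp: field_simps\<close>)
  qed
  have "A 1 = a" "B 1 = b" "C 1 = c" by (auto simp: A_def B_def C_def)
  then show ?thesis using all[of N] N0 by (simp add: L_def)
qed

section \<open>A countable supply of potentials, and approximation of nearly curl-free fields by
  their gradients\<close>

section \<open>Polynomials with rational coefficients\<close>

fun monomial :: "rat \<times> nat \<times> nat \<Rightarrow> real^2 \<Rightarrow> real" where
  "monomial (c, i, j) x = of_rat c * (x$1) ^ i * (x$2) ^ j"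

text \<open>Lists over a countable type can be enumerated, and \<open>factor\<close> later runs
  through all these polynomials.\<close>

definition rpoly :: "(rat \<times> nat \<times> nat) list \<Rightarrow> real^2 \<Rightarrow> real" where
  "rpoly ms x = (\<Sum>m\<leftarrow>ms. monomial m x)"

lemma rpoly_Nil [simp]: "rpoly [] = (\<lambda>x. 0)"
  and rpoly_Cons: "rpoly (m # ms) = (\<lambda>x. monomial m x + rpoly ms x)"
  and rpoly_append: "rpoly (ms @ ns) = (\<lambda>x. rpoly ms x + rpoly ns x)"
  by (auto simp: rpoly_def fun_eq_iff)

lemma smooth_on_disk_monomial [smooth_intros]: "smooth_on_disk (monomial m)"
  by (cases m) (auto simp: fun_eq_iff intro!: smooth_on_disk_cong[OF _ sym[OF monomial.simps]] smooth_intros)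

lemma smooth_on_disk_rpoly [smooth_intros]: "smooth_on_disk (rpoly ms)"
proof (induction ms)
  case Nil
  then show ?case by (simp add: smooth_intros)
next
  case (Cons m ms)
  then show ?case unfolding rpoly_Cons by (intro smooth_intros)
qed

lemma partial_power:
  assumes "x \<in> disk"
  shows "partial i (\<lambda>y. (y$j) ^ n) x = (if i = j then of_nat n * (x$j) ^ (n - 1) else 0)"
  using partial_compose[OF smooth_on_disk_differentiable[OF smooth_on_disk_coord assms] DERIV_pow assms, of i j n] assms
  by (simp add: partial_coord)

lemma partial_monomial:
  assumes "x \<in> disk"
  shows "partial 1 (monomial (c, i, j)) x = monomial (c * of_nat i, i - 1, j) x"
    and "partial 2 (monomial (c, i, j)) x = monomial (c * of_nat j, i, j - 1) x"
proof -
  have e: "monomial (c, i, j) = (\<lambda>x. of_rat c * ((x$1) ^ i * (x$2) ^ j))" by (simp add: fun_eq_iff)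
  show "partial 1 (monomial (c, i, j)) x = monomial (c * of_nat i, i - 1, j) x"
    "partial 2 (monomial (c, i, j)) x = monomial (c * of_nat j, i, j - 1) x"
    unfolding e using assms by (simp_all add: partial_simps partial_power smooth_intros of_rat_mult)
qed

text \<open>Differentiation term by term. The second point \<open>y\<close> covers primitives whose
  derivative at \<open>x\<close> is a polynomial evaluated at the projection of \<open>x\<close> to
  an axis.\<close>

lemma partial_rpoly_map:
  assumes "\<And>m. partial k (monomial (f m)) x = monomial (g m) y" "x \<in> disk"
  shows "partial k (rpoly (map f ms)) x = rpoly (map g ms) y"
proof (induction ms)
  case Nil
  then show ?case using assms(2) by (simp add: partial_const)
next
  case (Cons m ms)
  have "partial k (rpoly (map f (m # ms))) x = partial k (monomial (f m)) x + partial k (rpoly (map f ms)) x"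
    by (simp add: rpoly_Cons partial_add_smooth smooth_intros assms(2))
  then show ?case using Cons assms(1) by (simp add: rpoly_Cons)
qed

lemma rpoly_mult: "\<exists>ps. rpoly ps = (\<lambda>x. rpoly ms x * rpoly ns x)"
proof (induction ms)
  case Nil
  have "rpoly [] = (\<lambda>x. rpoly [] x * rpoly ns x)" by simp
  then show ?case by blast
next
  case (Cons m ms)
  obtain ps where ps: "rpoly ps = (\<lambda>x. rpoly ms x * rpoly ns x)" using Cons by blast
  have "\<exists>qs. rpoly qs = (\<lambda>x. monomial m x * rpoly ns x)"
  proof (induction ns)
    case Nil
    have "rpoly [] = (\<lambda>x. monomial m x * rpoly [] x)" by simp
    then show ?case by blast
  next
    case (Cons n ns)
    then obtain qs where qs: "rpoly qs = (\<lambda>x. monomial m x * rpoly ns x)" by blast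
    obtain c i j where m: "m = (c, i, j)" by (cases m)
    obtain d k l where n: "n = (d, k, l)" by (cases n)
    have "rpoly ((c * d, i + k, j + l) # qs) = (\<lambda>x. monomial m x * rpoly (n # ns) x)"
      by (simp add: rpoly_Cons qs m n fun_eq_iff of_rat_mult power_add algebra_simps)
    then show ?case by blast
  qed
  then obtain qs where "rpoly qs = (\<lambda>x. monomial m x * rpoly ns x)" by blast
  then have "rpoly (qs @ ps) = (\<lambda>x. rpoly (m # ms) x * rpoly ns x)"
    by (simp add: rpoly_append rpoly_Cons ps fun_eq_iff algebra_simps)
  then show ?case by blast
qed

definition rpoly_approximable :: "(real^2 \<Rightarrow> real) \<Rightarrow> bool" where
  "rpoly_approximable f \<longleftrightarrow> (\<forall>e>0. \<exists>ms. \<forall>x\<in>disk. \<bar>f x - rpoly ms x\<bar> < e)"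

lemma rpoly_approximable_rpoly: "rpoly_approximable (rpoly ms)"
  unfolding rpoly_approximable_def by (intro allI impI exI[of _ ms]) simp

lemma rpoly_approximable_const: "rpoly_approximable (\<lambda>x. c)"
  unfolding rpoly_approximable_def
proof (intro allI impI)
  fix e :: real assume "e > 0"
  then obtain q where "c - e < of_rat q" "of_rat q < c" using of_rat_dense[of "c - e" c] by auto
  then show "\<exists>ms. \<forall>x\<in>disk. \<bar>c - rpoly ms x\<bar> < e"
    by (intro exI[of _ "[(q, 0, 0)]"]) (simp add: rpoly_Cons)
qed

lemma rpoly_approximable_add:
  assumes "rpoly_approximable f" "rpoly_approximable g"
  shows "rpoly_approximable (\<lambda>x. f x + g x)"
  unfolding rpoly_approximable_def
proof (intro allI impI)
  fix e :: real assume e: "e > 0"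
  obtain ms where 1: "\<forall>x\<in>disk. \<bar>f x - rpoly ms x\<bar> < e / 2"
    using assms(1) e unfolding rpoly_approximable_def by (meson half_gt_zero)
  obtain ns where 2: "\<forall>x\<in>disk. \<bar>g x - rpoly ns x\<bar> < e / 2"
    using assms(2) e unfolding rpoly_approximable_def by (meson half_gt_zero)
  have "\<bar>f x + g x - rpoly (ms @ ns) x\<bar> < e" if "x \<in> disk" for x
    using 1[rule_format, OF that] 2[rule_format, OF that] unfolding rpoly_append by linarith
  then show "\<exists>ms. \<forall>x\<in>disk. \<bar>f x + g x - rpoly ms x\<bar> < e" by blast
qed

lemma rpoly_approximable_bounded:
  assumes "rpoly_approximable f"
  obtains M where "M > 0" "\<And>x. x \<in> disk \<Longrightarrow> \<bar>f x\<bar> \<le> M"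
proof -
  obtain ms where 1: "\<forall>x\<in>disk. \<bar>f x - rpoly ms x\<bar> < 1"
    using assms unfolding rpoly_approximable_def by (meson zero_less_one)
  obtain M where M: "M > 0" "\<And>x. x \<in> disk \<Longrightarrow> \<bar>rpoly ms x\<bar> \<le> M"
    using smooth_on_disk_bounded[OF smooth_on_disk_rpoly] by blast
  show ?thesis
  proof
    show "M + 1 > 0" using M by simp
    show "\<bar>f x\<bar> \<le> M + 1" if "x \<in> disk" for x
      using 1[rule_format, OF that] M(2)[OF that] by linarith
  qed
qed

lemma rpoly_approximable_mult:
  assumes f: "rpoly_approximable f" and g: "rpoly_approximable g"
  shows "rpoly_approximable (\<lambda>x. f x * g x)"
  unfolding rpoly_approximable_def
proof (intro allI impI)
  fix e :: real assume e: "e > 0"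
  obtain M where M: "M > 0" "\<And>x. x \<in> disk \<Longrightarrow> \<bar>f x\<bar> \<le> M" using rpoly_approximable_bounded[OF f] by blast
  obtain N where N: "N > 0" "\<And>x. x \<in> disk \<Longrightarrow> \<bar>g x\<bar> \<le> N" using rpoly_approximable_bounded[OF g] by blast
  \<comment> \<open>The error of the product is at most \<open>d * N + (M + 1) * d\<close>; the
    bound \<open>d \<le> 1\<close> keeps the first approximant below \<open>M + 1\<close>.\<close>
  define d where "d = min 1 (e / (2 * (M + N + 1)))"
  have d: "d > 0" "d \<le> 1" "d * (M + N + 1) \<le> e / 2"
  proof -
    show "d > 0" "d \<le> 1" using e M(1) N(1) by (auto simp: d_def)
    have "d * (M + N + 1) \<le> e / (2 * (M + N + 1)) * (M + N + 1)"
      using M(1) N(1) by (intro mult_right_mono) (auto simp: d_def)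
    also have "\<dots> = e / 2"
    proof -
      have "e / (2 * k) * k = e / 2" if "k > 0" for k using that by simp
      then show ?thesis using M(1) N(1) by (simp only: add_pos_pos zero_less_one)
    qed
    finally show "d * (M + N + 1) \<le> e / 2" .
  qed
  obtain ms where 1: "\<forall>x\<in>disk. \<bar>f x - rpoly ms x\<bar> < d"
    using f d unfolding rpoly_approximable_def by meson
  obtain ns where 2: "\<forall>x\<in>disk. \<bar>g x - rpoly ns x\<bar> < d"
    using g d unfolding rpoly_approximable_def by meson
  obtain ps where ps: "rpoly ps = (\<lambda>x. rpoly ms x * rpoly ns x)" using rpoly_mult by blast
  have "\<bar>f x * g x - rpoly ps x\<bar> < e" if x: "x \<in> disk" for x
  proof -
    have a: "\<bar>f x - rpoly ms x\<bar> \<le> d" "\<bar>g x - rpoly ns x\<bar> \<le> d" using 1 2 x by (auto intro: less_imp_le)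
    have b: "\<bar>rpoly ms x\<bar> \<le> M + 1" using a(1) M(2)[OF x] d(2) by linarith
    have "f x * g x - rpoly ps x = (f x - rpoly ms x) * g x + rpoly ms x * (g x - rpoly ns x)"
      by (simp add: ps algebra_simps)
    then have "\<bar>f x * g x - rpoly ps x\<bar> \<le> \<bar>f x - rpoly ms x\<bar> * \<bar>g x\<bar> + \<bar>rpoly ms x\<bar> * \<bar>g x - rpoly ns x\<bar>"
      by (metis abs_mult abs_triangle_ineq)
    also have "\<dots> \<le> d * N + (M + 1) * d"
      using a b N(2)[OF x] d M(1) by (intro add_mono mult_mono) auto
    also have "\<dots> = d * (M + N + 1)" by (simp add: algebra_simps)
    also have "\<dots> < e" using d(3) e by linarith
    finally show ?thesis .
  qed
  then show "\<exists>ms. \<forall>x\<in>disk. \<bar>f x * g x - rpoly ms x\<bar> < e" by blast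
qed

lemma rpoly_approximable_real_polynomial: "real_polynomial_function p \<Longrightarrow> rpoly_approximable p"
  for p :: "real^2 \<Rightarrow> real"
proof (induction rule: real_polynomial_function.induct)
  case (linear f)
  have c: "rpoly_approximable (\<lambda>x. x$1)" "rpoly_approximable (\<lambda>x. x$2)"
    using rpoly_approximable_rpoly[of "[(1, 1, 0)]"] rpoly_approximable_rpoly[of "[(1, 0, 1)]"]
    by (simp_all add: rpoly_Cons)
  have "f = (\<lambda>x. x$1 * f (axis 1 1) + x$2 * f (axis 2 1))"
    using linear_real2_eq[OF bounded_linear.linear[OF linear]] by blast
  moreover have "rpoly_approximable (\<lambda>x. x$1 * f (axis 1 1) + x$2 * f (axis 2 1))"
    by (intro rpoly_approximable_add rpoly_approximable_mult rpoly_approximable_const c)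
  ultimately show ?case by metis
qed (auto intro: rpoly_approximable_const rpoly_approximable_add rpoly_approximable_mult)

lemma rpoly_dense:
  assumes "continuous_on disk f" "e > 0"
  obtains ms where "\<And>x. x \<in> disk \<Longrightarrow> \<bar>f x - rpoly ms x\<bar> < e"
proof -
  obtain p where p: "real_polynomial_function p" "\<And>x. x \<in> disk \<Longrightarrow> \<bar>f x - p x\<bar> < e / 2"
    using Stone_Weierstrass_real_polynomial_function[OF compact_cball assms(1), of "e / 2"] assms(2) by auto
  obtain ms where ms: "\<forall>x\<in>disk. \<bar>p x - rpoly ms x\<bar> < e / 2"
    using rpoly_approximable_real_polynomial[OF p(1)] assms(2) unfolding rpoly_approximable_def by (meson half_gt_zero)
  have "\<bar>f x - rpoly ms x\<bar> < e" if "x \<in> disk" for x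
    using p(2)[OF that] ms[rule_format, OF that] by linarith
  then show ?thesis using that by blast
qed

text \<open>The segment from \<open>x\<close> to its projection along the \<open>i\<close>-th axis
  stays in the disk and has length at most 1.\<close>

lemma disk_coordinate_bound:
  assumes G: "smooth_on_disk G" and B: "\<And>x. x \<in> disk \<Longrightarrow> \<bar>partial i G x\<bar> \<le> B" and x: "x \<in> disk"
  shows "\<bar>G x - G (x - (x$i) *\<^sub>R axis i 1)\<bar> \<le> B"
proof -
  let ?y = "x - (x$i) *\<^sub>R axis i 1"
  define S where "S = closed_segment 0 (x$i)"
  have ind: "?y + s *\<^sub>R axis i 1 \<in> disk" if "s \<in> S" for s
  proof -
    have s: "\<bar>s\<bar> \<le> \<bar>x$i\<bar>" using that by (auto simp: S_def closed_segment_eq_real_ivl split: if_splits)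
    have "norm (?y + s *\<^sub>R axis i 1) \<le> norm x"
      by (rule norm_le_componentwise_cart) (use s in \<open>auto simp: axis_def\<close>)
    then show ?thesis using x by (simp add: mem_cball)
  qed
  have D: "((\<lambda>s. G (?y + s *\<^sub>R axis i 1)) has_field_derivative partial i G (?y + s *\<^sub>R axis i 1)) (at s within S)" if "s \<in> S" for s
    unfolding has_real_derivative_iff_has_vector_derivative
    by (rule has_derivative_disk_line[OF smooth_on_disk_differentiable[OF G] ind that]) auto
  have "norm (G (?y + (x$i) *\<^sub>R axis i 1) - G (?y + 0 *\<^sub>R axis i 1)) \<le> B * norm (x$i - 0)"
    by (rule field_differentiable_bound[OF _ D]) (auto simp: S_def B ind[unfolded S_def])
  moreover have "B * norm (x$i - 0) \<le> B * 1"
  proof (rule mult_left_mono)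
    have "\<bar>x$i\<bar> \<le> norm x" by (rule component_le_norm_cart)
    then show "norm (x$i - 0) \<le> 1" using x by (simp add: mem_cball)
    show "0 \<le> B" using B[OF x] by linarith
  qed
  ultimately show ?thesis by simp
qed

text \<open>The approximating primitive integrates an approximation of the mixed derivative;
  smallness of the curl is what makes both of its partial derivatives close to the field.\<close>

theorem gradient_approximation:
  assumes F: "smooth_on_disk F1" "smooth_on_disk F2" and e: "e > 0"
    and curl: "\<And>x. x \<in> disk \<Longrightarrow> \<bar>partial 1 F2 x - partial 2 F1 x\<bar> \<le> e"
  obtains ms where "\<And>x. x \<in> disk \<Longrightarrow> \<bar>partial 1 (rpoly ms) x - F1 x\<bar> \<le> 3 * e"
    "\<And>x. x \<in> disk \<Longrightarrow> \<bar>partial 2 (rpoly ms) x - F2 x\<bar> \<le> 3 * e"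
proof -
  obtain as where as: "\<And>x. x \<in> disk \<Longrightarrow> \<bar>F1 x - rpoly as x\<bar> < e"
    using rpoly_dense[OF smooth_on_disk_continuous[OF F(1)] e] by blast
  obtain bs where bs: "\<And>x. x \<in> disk \<Longrightarrow> \<bar>F2 x - rpoly bs x\<bar> < e"
    using rpoly_dense[OF smooth_on_disk_continuous[OF F(2)] e] by blast
  obtain qs where qs: "\<And>x. x \<in> disk \<Longrightarrow> \<bar>partial 1 F2 x - rpoly qs x\<bar> < e"
    using rpoly_dense[OF smooth_on_disk_continuous[OF smooth_on_disk_partial[OF F(2)]] e] by blast
  \<comment> \<open>The primitive is the integral of \<open>as\<close> along the first axis plus
    that of \<open>bs\<close> along the second plus the double integral of \<open>qs\<close>.
    \<open>A\<close>, \<open>B\<close> and \<open>Q\<close> perform these integrations on monomials,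
    dropping those that vanish on the axis; \<open>Q1\<close> and \<open>Q2\<close> integrate in one
    variable only.\<close>
  define A :: "rat \<times> nat \<times> nat \<Rightarrow> _" where "A = (\<lambda>(c, i, j). (if j = 0 then c / of_nat (Suc i) else 0, Suc i, 0::nat))"
  define B :: "rat \<times> nat \<times> nat \<Rightarrow> _" where "B = (\<lambda>(c, i, j). (if i = 0 then c / of_nat (Suc j) else 0, 0::nat, Suc j))"
  define Q :: "rat \<times> nat \<times> nat \<Rightarrow> _" where "Q = (\<lambda>(c, i, j). (c / of_nat (Suc i * Suc j), Suc i, Suc j))"
  define Q1 :: "rat \<times> nat \<times> nat \<Rightarrow> _" where "Q1 = (\<lambda>(c, i, j). (c / of_nat (Suc i), Suc i, j))"
  define Q2 :: "rat \<times> nat \<times> nat \<Rightarrow> _" where "Q2 = (\<lambda>(c, i, j). (c / of_nat (Suc j), i, Suc j))"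
  have n0: "(of_nat (Suc k) :: rat) \<noteq> 0" for k using of_nat_neq_0 by blast
  have dA: "partial 1 (monomial (A m)) x = monomial m (pt (x$1) 0)" "partial 2 (monomial (A m)) x = 0" if "x \<in> disk" for m x
    using that n0 by (cases m; simp add: A_def partial_monomial del: of_nat_Suc)+
  have dB: "partial 2 (monomial (B m)) x = monomial m (pt 0 (x$2))" "partial 1 (monomial (B m)) x = 0" if "x \<in> disk" for m x
    using that n0 by (cases m; simp add: B_def partial_monomial del: of_nat_Suc)+
  have dQ: "partial 1 (monomial (Q m)) x = monomial (Q2 m) x" "partial 2 (monomial (Q m)) x = monomial (Q1 m) x"
    "partial 1 (monomial (Q1 m)) x = monomial m x" "partial 2 (monomial (Q2 m)) x = monomial m x" if "x \<in> disk" for m x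
  proof -
    obtain c i j where m: "m = (c, i, j)" by (cases m)
    have r: "c / of_nat (Suc i * Suc j) * of_nat (Suc i) = c / of_nat (Suc j)"
      "c / of_nat (Suc i * Suc j) * of_nat (Suc j) = c / of_nat (Suc i)"
      "c / of_nat (Suc i) * of_nat (Suc i) = c" "c / of_nat (Suc j) * of_nat (Suc j) = c"
      using n0[of i] n0[of j] by (simp_all only: of_nat_mult nonzero_mult_divide_mult_cancel_left nonzero_mult_divide_mult_cancel_right
          times_divide_eq_left times_divide_eq_right nonzero_mult_div_cancel_right, simp_all add: field_simps del: of_nat_Suc)
    show "partial 1 (monomial (Q m)) x = monomial (Q2 m) x" "partial 2 (monomial (Q m)) x = monomial (Q1 m) x"
      "partial 1 (monomial (Q1 m)) x = monomial m x" "partial 2 (monomial (Q2 m)) x = monomial m x"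
      unfolding m Q_def Q1_def Q2_def split partial_monomial[OF that] r diff_Suc_1 by (rule refl)+
  qed
  define zero :: "rat \<times> nat \<times> nat" where "zero = (0, 0, 0)"
  have m0: "monomial zero x = 0" for x by (simp add: zero_def)
  have r0: "rpoly (map (\<lambda>m. zero) ms) x = 0" for ms x by (induction ms) (simp_all add: rpoly_Cons m0)
  have pA: "partial 1 (rpoly (map A ms)) x = rpoly ms (pt (x$1) 0)" "partial 2 (rpoly (map A ms)) x = 0" if "x \<in> disk" for ms x
    using partial_rpoly_map[of 1 A x "\<lambda>m. m" "pt (x$1) 0" ms] partial_rpoly_map[of 2 A x "\<lambda>m. zero" x ms] dA[OF that] that
    by (simp_all add: m0 r0)
  have pB: "partial 2 (rpoly (map B ms)) x = rpoly ms (pt 0 (x$2))" "partial 1 (rpoly (map B ms)) x = 0" if "x \<in> disk" for ms x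
    using partial_rpoly_map[of 2 B x "\<lambda>m. m" "pt 0 (x$2)" ms] partial_rpoly_map[of 1 B x "\<lambda>m. zero" x ms] dB[OF that] that
    by (simp_all add: m0 r0)
  have pQ: "partial 1 (rpoly (map Q ms)) x = rpoly (map Q2 ms) x" "partial 2 (rpoly (map Q ms)) x = rpoly (map Q1 ms) x"
    "partial 1 (rpoly (map Q1 ms)) x = rpoly ms x" "partial 2 (rpoly (map Q2 ms)) x = rpoly ms x" if "x \<in> disk" for ms x
    using partial_rpoly_map[of 1 Q x Q2 x ms] partial_rpoly_map[of 2 Q x Q1 x ms]
      partial_rpoly_map[of 1 Q1 x "\<lambda>m. m" x ms] partial_rpoly_map[of 2 Q2 x "\<lambda>m. m" x ms] dQ[OF that] that
    by simp_all
  have z2: "rpoly (map Q2 ms) (pt a 0) = 0" "rpoly (map Q1 ms) (pt 0 a) = 0" for ms a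
  proof -
    have "monomial (Q2 m) (pt a 0) = 0" "monomial (Q1 m) (pt 0 a) = 0" for m by (cases m; simp add: Q2_def Q1_def)+
    then show "rpoly (map Q2 ms) (pt a 0) = 0" "rpoly (map Q1 ms) (pt 0 a) = 0" by (induction ms) (simp_all add: rpoly_Cons)
  qed
  have proj: "x - (x$2) *\<^sub>R axis 2 1 = pt (x$1) 0" "x - (x$1) *\<^sub>R axis 1 1 = pt 0 (x$2)" for x :: "real^2"
    by (simp_all add: vec_eq_iff forall_2 axis_def)
  have proj_in: "pt (x$1) 0 \<in> disk" "pt 0 (x$2) \<in> disk" if "x \<in> disk" for x
  proof -
    have "(x$1)\<^sup>2 + (x$2)\<^sup>2 \<le> 1" using that pt_in_disk pt_coords by metis
    then show "pt (x$1) 0 \<in> disk" "pt 0 (x$2) \<in> disk"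
      using zero_le_power2[of "x$1"] zero_le_power2[of "x$2"] unfolding pt_in_disk by (simp_all, linarith+)
  qed
  let ?P = "map A as @ map B bs @ map Q qs"
  have P1: "partial 1 (rpoly ?P) x = rpoly as (pt (x$1) 0) + rpoly (map Q2 qs) x"
    "partial 2 (rpoly ?P) x = rpoly bs (pt 0 (x$2)) + rpoly (map Q1 qs) x" if "x \<in> disk" for x
    unfolding rpoly_append using that by (simp_all add: partial_add_smooth smooth_intros pA pB pQ)
  show ?thesis
  proof
    fix x :: "real^2" assume x: "x \<in> disk"
    \<comment> \<open>On the axis the error is at most \<open>e\<close>. Off the axis it grows at
      rate at most \<open>2 * e\<close>: \<open>qs\<close> is within \<open>e\<close> of
      \<open>partial 1 F2\<close>, and that is within \<open>e\<close> of
      \<open>partial 2 F1\<close>.\<close>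
    have "\<bar>(rpoly (map Q2 qs) x - F1 x) - (rpoly (map Q2 qs) (pt (x$1) 0) - F1 (pt (x$1) 0))\<bar> \<le> 2 * e"
      unfolding proj(1)[symmetric]
    proof (rule disk_coordinate_bound[of "\<lambda>x. rpoly (map Q2 qs) x - F1 x", OF _ _ x])
      show "\<bar>partial 2 (\<lambda>x. rpoly (map Q2 qs) x - F1 x) x\<bar> \<le> 2 * e" if "x \<in> disk" for x
        using that curl[OF that] qs[OF that] by (simp add: partial_diff_smooth smooth_intros F pQ)
    qed (intro smooth_intros F)
    then show "\<bar>partial 1 (rpoly ?P) x - F1 x\<bar> \<le> 3 * e"
      using as[OF proj_in(1)[OF x]] by (simp add: P1 x z2)
    have "\<bar>(rpoly (map Q1 qs) x - F2 x) - (rpoly (map Q1 qs) (pt 0 (x$2)) - F2 (pt 0 (x$2)))\<bar> \<le> e"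
      unfolding proj(2)[symmetric]
    proof (rule disk_coordinate_bound[of "\<lambda>x. rpoly (map Q1 qs) x - F2 x", OF _ _ x])
      show "\<bar>partial 1 (\<lambda>x. rpoly (map Q1 qs) x - F2 x) x\<bar> \<le> e" if "x \<in> disk" for x
        using that qs[OF that] by (simp add: partial_diff_smooth smooth_intros F pQ)
    qed (intro smooth_intros F)
    then show "\<bar>partial 2 (rpoly ?P) x - F2 x\<bar> \<le> 3 * e"
      using bs[OF proj_in(2)[OF x]] e by (simp add: P1 x z2)
  qed
qed

section \<open>Curvature of a metric and its energy as a first-order quadratic form\<close>

section \<open>Metrics in coordinates\<close>

text \<open>The coefficients of the first fundamental form; \<open>gD\<close> is the area
  density.\<close>

definition gE :: "metric_field \<Rightarrow> real^2 \<Rightarrow> real" where "gE h x = h x $ 1 $ 1"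
definition gF :: "metric_field \<Rightarrow> real^2 \<Rightarrow> real" where "gF h x = h x $ 1 $ 2"
definition gG :: "metric_field \<Rightarrow> real^2 \<Rightarrow> real" where "gG h x = h x $ 2 $ 2"
definition gD :: "metric_field \<Rightarrow> real^2 \<Rightarrow> real" where "gD h x = sqrt (gE h x * gG h x - gF h x * gF h x)"

lemma inner_real2: "v \<bullet> w = v$1 * w$1 + v$2 * w$2" for v w :: "real^2"
  by (simp add: inner_vec_def sum_2)

lemma matrix_vector_real2: "((A::real^2^2) *v w) $ i = A$i$1 * w$1 + A$i$2 * w$2"
  by (simp add: matrix_vector_mult_def sum_2)

context
  fixes h :: metric_field
  assumes h: "h \<in> riemannian_metrics"
begin

lemma metric_sym: "x \<in> disk \<Longrightarrow> h x $ 2 $ 1 = gF h x"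
proof -
  assume "x \<in> disk"
  then have "transpose (h x) = h x" using h by (auto simp: riemannian_metrics_def)
  then have "transpose (h x) $ 2 $ 1 = h x $ 2 $ 1" by simp
  then show "h x $ 2 $ 1 = gF h x" by (simp add: transpose_def gF_def)
qed

lemma metric_form_pos:
  assumes "x \<in> disk" "(v, w) \<noteq> (0, 0)"
  shows "0 < gE h x * v\<^sup>2 + 2 * gF h x * v * w + gG h x * w\<^sup>2"
proof -
  have "pt v w \<noteq> 0" using assms(2) by (auto simp: vec_eq_iff forall_2)
  then have "0 < pt v w \<bullet> (h x *v pt v w)" using h assms(1) by (auto simp: riemannian_metrics_def)
  then show ?thesis
    using metric_sym[OF assms(1)]
    by (simp add: inner_real2 matrix_vector_real2 gE_def gF_def gG_def power2_eq_square algebra_simps)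
qed

lemma metric_pos:
  assumes "x \<in> disk"
  shows gE_pos: "0 < gE h x" and gG_pos: "0 < gG h x"
    and gdet_pos: "0 < gE h x * gG h x - gF h x * gF h x" and gD_pos: "0 < gD h x"
proof -
  show 1: "0 < gE h x" "0 < gG h x" using metric_form_pos[OF assms, of 1 0] metric_form_pos[OF assms, of 0 1] by auto
  have "0 < gE h x * (gE h x * gG h x - gF h x * gF h x)"
    using metric_form_pos[OF assms, of "- gF h x" "gE h x"] 1 by (simp add: power2_eq_square algebra_simps)
  then show 2: "0 < gE h x * gG h x - gF h x * gF h x" using 1 by (simp add: zero_less_mult_iff)
  then show "0 < gD h x" by (simp add: gD_def)
qed

lemma gD_sq: "x \<in> disk \<Longrightarrow> gD h x * gD h x = gE h x * gG h x - gF h x * gF h x"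
  using gdet_pos by (simp add: gD_def less_imp_le)

lemma smooth_metric [smooth_intros]:
  shows "smooth_on_disk (gE h)" "smooth_on_disk (gF h)" "smooth_on_disk (gG h)" "smooth_on_disk (gD h)"
proof -
  have s: "smooth_on_disk (\<lambda>x. h x $ i $ j)" for i j using h by (auto simp: riemannian_metrics_def)
  show 1: "smooth_on_disk (gE h)" "smooth_on_disk (gF h)" "smooth_on_disk (gG h)"
    unfolding gE_def[abs_def] gF_def[abs_def] gG_def[abs_def] by (rule s)+
  show "smooth_on_disk (gD h)" unfolding gD_def[abs_def]
    by (intro smooth_intros 1 gdet_pos)
qed

lemma det_metric: "x \<in> disk \<Longrightarrow> det (h x) = gE h x * gG h x - gF h x * gF h x"
  by (simp add: det_2 metric_sym gE_def gF_def gG_def)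

lemma sqrt_det_metric: "x \<in> disk \<Longrightarrow> sqrt (det (h x)) = gD h x"
  by (simp add: det_metric gD_def)

lemma cometric_coords:
  assumes x: "x \<in> disk"
  shows "cometric h x $ 1 $ 1 = gG h x / (gE h x * gG h x - gF h x * gF h x)"
    "cometric h x $ 1 $ 2 = - gF h x / (gE h x * gG h x - gF h x * gF h x)"
    "cometric h x $ 2 $ 1 = - gF h x / (gE h x * gG h x - gF h x * gF h x)"
    "cometric h x $ 2 $ 2 = gE h x / (gE h x * gG h x - gF h x * gF h x)"
proof -
  let ?d = "gE h x * gG h x - gF h x * gF h x"
  define k where "k = 1 / ?d"
  define B :: "real^2^2" where "B = vector [vector [gG h x * k, - gF h x * k], vector [- gF h x * k, gE h x * k]]"
  have kk: "gE h x * (gG h x * k) = 1 + gF h x * (gF h x * k)"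
    using gdet_pos[OF x] by (simp add: k_def field_simps)
  have AB: "h x ** B = mat 1" and BA: "B ** h x = mat 1"
    using metric_sym[OF x] kk
    by (auto simp: vec_eq_iff forall_2 matrix_matrix_mult_def sum_2 mat_def B_def gE_def gF_def gG_def algebra_simps)
  have inv: "matrix_inv (h x) ** h x = mat 1"
    unfolding matrix_inv_def using someI[of "\<lambda>A. h x ** A = mat 1 \<and> A ** h x = mat 1" B] AB BA by blast
  have "matrix_inv (h x) = matrix_inv (h x) ** (h x ** B)" by (simp add: AB)
  also have "\<dots> = (matrix_inv (h x) ** h x) ** B" by (simp add: matrix_mul_assoc)
  also have "\<dots> = B" by (simp add: inv)
  finally have "cometric h x = B" by (simp add: cometric_def)
  then show "cometric h x $ 1 $ 1 = gG h x / ?d" "cometric h x $ 1 $ 2 = - gF h x / ?d"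
    "cometric h x $ 2 $ 1 = - gF h x / ?d" "cometric h x $ 2 $ 2 = gE h x / ?d"
    by (simp_all add: B_def k_def)
qed

lemma christoffel_coords:
  assumes x: "x \<in> disk"
  defines "d \<equiv> 2 * (gE h x * gG h x - gF h x * gF h x)"
  defines "E i \<equiv> partial i (gE h) x" and "F i \<equiv> partial i (gF h) x" and "G i \<equiv> partial i (gG h) x"
  shows "christoffel h 1 1 1 x = (gG h x * E 1 - 2 * gF h x * F 1 + gF h x * E 2) / d"
    "christoffel h 2 1 1 x = (2 * gE h x * F 1 - gE h x * E 2 - gF h x * E 1) / d"
    "christoffel h 1 1 2 x = (gG h x * E 2 - gF h x * G 1) / d"
    "christoffel h 2 1 2 x = (gE h x * G 1 - gF h x * E 2) / d"
    "christoffel h 1 2 1 x = (gG h x * E 2 - gF h x * G 1) / d"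
    "christoffel h 2 2 1 x = (gE h x * G 1 - gF h x * E 2) / d"
    "christoffel h 1 2 2 x = (2 * gG h x * F 2 - gG h x * G 1 - gF h x * G 2) / d"
    "christoffel h 2 2 2 x = (gE h x * G 2 - 2 * gF h x * F 2 + gF h x * G 1) / d"
proof -
  have p: "partial i (\<lambda>y. h y $ 1 $ 1) x = E i" "partial i (\<lambda>y. h y $ 1 $ 2) x = F i"
     "partial i (\<lambda>y. h y $ 2 $ 2) x = G i" "partial i (\<lambda>y. h y $ 2 $ 1) x = F i" for i
    unfolding E_def F_def G_def gE_def[abs_def] gG_def[abs_def]
    by (auto simp: gF_def[abs_def] intro!: partial_cong[OF _ x] metric_sym[unfolded gF_def])
  have d0: "gE h x * gG h x - gF h x * gF h x \<noteq> 0" using gdet_pos[OF x] by simp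
  define k where "k = 1 / (gE h x * gG h x - gF h x * gF h x)"
  have c: "cometric h x $ 1 $ 1 = gG h x * k" "cometric h x $ 1 $ 2 = - gF h x * k"
    "cometric h x $ 2 $ 1 = - gF h x * k" "cometric h x $ 2 $ 2 = gE h x * k"
    by (simp_all add: cometric_coords[OF x] k_def)
  have dk: "y / d = y * k / 2" for y by (simp add: d_def k_def)
  show "christoffel h 1 1 1 x = (gG h x * E 1 - 2 * gF h x * F 1 + gF h x * E 2) / d"
    "christoffel h 2 1 1 x = (2 * gE h x * F 1 - gE h x * E 2 - gF h x * E 1) / d"
    "christoffel h 1 1 2 x = (gG h x * E 2 - gF h x * G 1) / d"
    "christoffel h 2 1 2 x = (gE h x * G 1 - gF h x * E 2) / d"
    "christoffel h 1 2 1 x = (gG h x * E 2 - gF h x * G 1) / d"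
    "christoffel h 2 2 1 x = (gE h x * G 1 - gF h x * E 2) / d"
    "christoffel h 1 2 2 x = (2 * gG h x * F 2 - gG h x * G 1 - gF h x * G 2) / d"
    "christoffel h 2 2 2 x = (gE h x * G 2 - 2 * gF h x * F 2 + gF h x * G 1) / d"
    unfolding christoffel_def sum_2 p c dk by (simp_all add: algebra_simps)
qed

abbreviation (input) "Ch i j k \<equiv> christoffel h i j k"

lemma smooth_christoffel [smooth_intros]: "smooth_on_disk (christoffel h k i j)"
proof -
  have nz: "2 * (gE h x * gG h x - gF h x * gF h x) \<noteq> 0" if "x \<in> disk" for x
    using gdet_pos[OF that] by simp
  have "smooth_on_disk (Ch 1 1 1)"
    by (rule smooth_on_disk_cong[OF _ christoffel_coords(1)[symmetric]]) (intro smooth_intros nz)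
  moreover have "smooth_on_disk (Ch 2 1 1)"
    by (rule smooth_on_disk_cong[OF _ christoffel_coords(2)[symmetric]]) (intro smooth_intros nz)
  moreover have "smooth_on_disk (Ch 1 1 2)"
    by (rule smooth_on_disk_cong[OF _ christoffel_coords(3)[symmetric]]) (intro smooth_intros nz)
  moreover have "smooth_on_disk (Ch 2 1 2)"
    by (rule smooth_on_disk_cong[OF _ christoffel_coords(4)[symmetric]]) (intro smooth_intros nz)
  moreover have "smooth_on_disk (Ch 1 2 1)"
    by (rule smooth_on_disk_cong[OF _ christoffel_coords(5)[symmetric]]) (intro smooth_intros nz)
  moreover have "smooth_on_disk (Ch 2 2 1)"
    by (rule smooth_on_disk_cong[OF _ christoffel_coords(6)[symmetric]]) (intro smooth_intros nz)
  moreover have "smooth_on_disk (Ch 1 2 2)"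
    by (rule smooth_on_disk_cong[OF _ christoffel_coords(7)[symmetric]]) (intro smooth_intros nz)
  moreover have "smooth_on_disk (Ch 2 2 2)"
    by (rule smooth_on_disk_cong[OF _ christoffel_coords(8)[symmetric]]) (intro smooth_intros nz)
  ultimately show ?thesis using exhaust_2[of k] exhaust_2[of i] exhaust_2[of j] by auto
qed

lemma christoffel_sym: "x \<in> disk \<Longrightarrow> christoffel h k 2 1 x = christoffel h k 1 2 x"
  using exhaust_2[of k] by (auto simp: christoffel_coords)

text \<open>Compatibility of the connection with the metric. Writing derivatives of the metric
  through Christoffel symbols, rather than conversely, keeps the curvature identities
  polynomial.\<close>

lemma metric_derivatives:
  assumes x: "x \<in> disk"
  shows "partial 1 (gE h) x = 2 * (gE h x * Ch 1 1 1 x + gF h x * Ch 2 1 1 x)"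
    "partial 2 (gE h) x = 2 * (gE h x * Ch 1 1 2 x + gF h x * Ch 2 1 2 x)"
    "partial 1 (gF h) x = gE h x * Ch 1 1 2 x + gF h x * Ch 2 1 2 x + gF h x * Ch 1 1 1 x + gG h x * Ch 2 1 1 x"
    "partial 2 (gF h) x = gE h x * Ch 1 2 2 x + gF h x * Ch 2 2 2 x + gF h x * Ch 1 1 2 x + gG h x * Ch 2 1 2 x"
    "partial 1 (gG h) x = 2 * (gF h x * Ch 1 1 2 x + gG h x * Ch 2 1 2 x)"
    "partial 2 (gG h) x = 2 * (gF h x * Ch 1 2 2 x + gG h x * Ch 2 2 2 x)"
proof -
  define k where "k = 1 / (2 * (gE h x * gG h x - gF h x * gF h x))"
  have dk: "y / (2 * (gE h x * gG h x - gF h x * gF h x)) = y * k" for y by (simp add: k_def)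
  have kk: "2 * (gE h x * gG h x - gF h x * gF h x) * k = 1"
    using gdet_pos[OF x] by (simp add: k_def)
  note c = christoffel_coords[OF x, unfolded dk]
  show "partial 1 (gE h) x = 2 * (gE h x * Ch 1 1 1 x + gF h x * Ch 2 1 1 x)"
    "partial 2 (gE h) x = 2 * (gE h x * Ch 1 1 2 x + gF h x * Ch 2 1 2 x)"
    "partial 1 (gF h) x = gE h x * Ch 1 1 2 x + gF h x * Ch 2 1 2 x + gF h x * Ch 1 1 1 x + gG h x * Ch 2 1 1 x"
    "partial 2 (gF h) x = gE h x * Ch 1 2 2 x + gF h x * Ch 2 2 2 x + gF h x * Ch 1 1 2 x + gG h x * Ch 2 1 2 x"
    "partial 1 (gG h) x = 2 * (gF h x * Ch 1 1 2 x + gG h x * Ch 2 1 2 x)"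
    "partial 2 (gG h) x = 2 * (gF h x * Ch 1 2 2 x + gG h x * Ch 2 2 2 x)"
    unfolding c using kk by algebra+
qed

text \<open>The logarithmic derivative of the area density is the trace of the Christoffel symbols.
  Differentiating the square of the density avoids the root.\<close>

lemma partial_gD:
  assumes x: "x \<in> disk"
  shows "partial 1 (gD h) x = gD h x * (Ch 1 1 1 x + Ch 2 1 2 x)"
    "partial 2 (gD h) x = gD h x * (Ch 1 1 2 x + Ch 2 2 2 x)"
proof -
  have "partial i (\<lambda>x. gD h x * gD h x) x = partial i (\<lambda>x. gE h x * gG h x - gF h x * gF h x) x" for i
    by (rule partial_cong[OF _ x]) (simp add: gD_sq)
  then have e: "2 * gD h x * partial i (gD h) x = gE h x * partial i (gG h) x + partial i (gE h) x * gG h x - 2 * gF h x * partial i (gF h) x" for i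
    using x by (simp add: partial_simps smooth_intros algebra_simps)
  have d: "gD h x \<noteq> 0" using gD_pos[OF x] by simp
  have "gD h x * partial 1 (gD h) x = (gD h x * gD h x) * (Ch 1 1 1 x + Ch 2 1 2 x)"
    using e[of 1] unfolding metric_derivatives[OF x] gD_sq[OF x] by (simp add: algebra_simps)
  then show "partial 1 (gD h) x = gD h x * (Ch 1 1 1 x + Ch 2 1 2 x)" using d by simp
  have "gD h x * partial 2 (gD h) x = (gD h x * gD h x) * (Ch 1 1 2 x + Ch 2 2 2 x)"
    using e[of 2] unfolding metric_derivatives[OF x] gD_sq[OF x] by (simp add: algebra_simps)
  then show "partial 2 (gD h) x = gD h x * (Ch 1 1 2 x + Ch 2 2 2 x)" using d by simp
qed

lemma ricci_coords:
  assumes x: "x \<in> disk"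
  shows "ricci h 1 1 x = partial 2 (Ch 2 1 1) x - partial 1 (Ch 2 1 2) x
      + Ch 1 1 1 x * Ch 2 1 2 x + Ch 2 1 1 x * Ch 2 2 2 x - Ch 2 1 1 x * Ch 1 1 2 x - Ch 2 1 2 x * Ch 2 1 2 x"
    "ricci h 1 2 x = partial 1 (Ch 1 1 2) x - partial 2 (Ch 1 1 1) x
      + Ch 1 1 2 x * Ch 2 1 2 x - Ch 2 1 1 x * Ch 1 2 2 x"
    "ricci h 2 1 x = partial 2 (Ch 2 1 2) x - partial 1 (Ch 2 2 2) x
      + Ch 1 1 2 x * Ch 2 1 2 x - Ch 2 1 1 x * Ch 1 2 2 x"
    "ricci h 2 2 x = partial 1 (Ch 1 2 2) x - partial 2 (Ch 1 1 2) x
      + Ch 1 2 2 x * Ch 1 1 1 x + Ch 2 2 2 x * Ch 1 1 2 x - Ch 1 1 2 x * Ch 1 1 2 x - Ch 1 2 2 x * Ch 2 1 2 x"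
proof -
  have ps: "partial i (christoffel h k 2 1) x = partial i (christoffel h k 1 2) x" for i k
    by (rule partial_cong[OF christoffel_sym x])
  show "ricci h 1 1 x = partial 2 (Ch 2 1 1) x - partial 1 (Ch 2 1 2) x
      + Ch 1 1 1 x * Ch 2 1 2 x + Ch 2 1 1 x * Ch 2 2 2 x - Ch 2 1 1 x * Ch 1 1 2 x - Ch 2 1 2 x * Ch 2 1 2 x"
    "ricci h 1 2 x = partial 1 (Ch 1 1 2) x - partial 2 (Ch 1 1 1) x
      + Ch 1 1 2 x * Ch 2 1 2 x - Ch 2 1 1 x * Ch 1 2 2 x"
    "ricci h 2 1 x = partial 2 (Ch 2 1 2) x - partial 1 (Ch 2 2 2) x
      + Ch 1 1 2 x * Ch 2 1 2 x - Ch 2 1 1 x * Ch 1 2 2 x"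
    "ricci h 2 2 x = partial 1 (Ch 1 2 2) x - partial 2 (Ch 1 1 2) x
      + Ch 1 2 2 x * Ch 1 1 1 x + Ch 2 2 2 x * Ch 1 1 2 x - Ch 1 1 2 x * Ch 1 1 2 x - Ch 1 2 2 x * Ch 2 1 2 x"
    unfolding ricci_def sum_2 ps by (simp_all add: christoffel_sym[OF x] algebra_simps)
qed

text \<open>The Ricci tensor of a surface is a multiple of the metric; the three relations are the symmetry
  of the mixed second derivatives of the three coefficients.\<close>

lemma ricci_proportional:
  assumes x: "x \<in> disk"
  shows "gE h x * ricci h 1 2 x = gF h x * ricci h 1 1 x"
    and "gE h x * ricci h 2 1 x = gF h x * ricci h 1 1 x"
    and "gE h x * ricci h 2 2 x = gG h x * ricci h 1 1 x"
proof -
  let ?E = "gE h x" and ?F = "gF h x" and ?G = "gG h x"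
  have cong: "partial j (partial 1 (gE h)) x = partial j (\<lambda>x. 2 * (gE h x * Ch 1 1 1 x + gF h x * Ch 2 1 1 x)) x"
    "partial j (partial 2 (gE h)) x = partial j (\<lambda>x. 2 * (gE h x * Ch 1 1 2 x + gF h x * Ch 2 1 2 x)) x"
    "partial j (partial 1 (gF h)) x = partial j (\<lambda>x. gE h x * Ch 1 1 2 x + gF h x * Ch 2 1 2 x + gF h x * Ch 1 1 1 x + gG h x * Ch 2 1 1 x) x"
    "partial j (partial 2 (gF h)) x = partial j (\<lambda>x. gE h x * Ch 1 2 2 x + gF h x * Ch 2 2 2 x + gF h x * Ch 1 1 2 x + gG h x * Ch 2 1 2 x) x"
    "partial j (partial 1 (gG h)) x = partial j (\<lambda>x. 2 * (gF h x * Ch 1 1 2 x + gG h x * Ch 2 1 2 x)) x"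
    "partial j (partial 2 (gG h)) x = partial j (\<lambda>x. 2 * (gF h x * Ch 1 2 2 x + gG h x * Ch 2 2 2 x)) x" for j
    by (rule partial_cong[OF _ x], erule metric_derivatives)+
  note dd = partial_simps smooth_intros x
  have E12: "partial 2 (partial 1 (gE h)) x = partial 1 (partial 2 (gE h)) x"
    and F12: "partial 2 (partial 1 (gF h)) x = partial 1 (partial 2 (gF h)) x"
    and G12: "partial 2 (partial 1 (gG h)) x = partial 1 (partial 2 (gG h)) x"
    by (rule partial_commute[OF _ x], intro smooth_intros)+
  show 1: "?E * ricci h 1 2 x = ?F * ricci h 1 1 x"
    using E12 unfolding cong ricci_coords[OF x]
    by (simp add: dd metric_derivatives[OF x] algebra_simps)
  have 2: "?F * ricci h 2 2 x = ?G * ricci h 2 1 x"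
    using G12 unfolding cong ricci_coords[OF x]
    by (simp add: dd metric_derivatives[OF x] algebra_simps)
  have 3: "?E * ricci h 2 2 x = ?F * ricci h 2 1 x - ?F * ricci h 1 2 x + ?G * ricci h 1 1 x"
    using F12 unfolding cong ricci_coords[OF x]
    by (simp add: dd metric_derivatives[OF x] algebra_simps)
  have E: "?E > 0" and G: "?G > 0" and D: "?E * ?G - ?F * ?F > 0" using metric_pos[OF x] by auto
  \<comment> \<open>Eliminating the mixed components leaves both sides multiplied by the determinant
    of the metric, which is positive.\<close>
  have "?G * ?E * (?E * ricci h 2 2 x) = ?F * ?E * (?G * ricci h 2 1 x) - ?F * ?G * (?E * ricci h 1 2 x) + ?G * ?E * ?G * ricci h 1 1 x"
    unfolding 3 by (simp add: algebra_simps)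
  also have "\<dots> = ?F * ?F * (?E * ricci h 2 2 x) - ?F * ?F * ?G * ricci h 1 1 x + ?G * ?E * ?G * ricci h 1 1 x"
    unfolding 1 2[symmetric] by (simp add: algebra_simps)
  finally have "(?E * ?G - ?F * ?F) * (?E * ricci h 2 2 x) = (?E * ?G - ?F * ?F) * (?G * ricci h 1 1 x)"
    by (simp add: algebra_simps)
  then show 4: "?E * ricci h 2 2 x = ?G * ricci h 1 1 x" using D by simp
  have "?G * (?E * ricci h 2 1 x) = ?E * (?F * ricci h 2 2 x)" unfolding 2 by (simp add: algebra_simps)
  also have "\<dots> = ?F * (?E * ricci h 2 2 x)" by (simp add: algebra_simps)
  also have "\<dots> = ?G * (?F * ricci h 1 1 x)" unfolding 4 by (simp add: algebra_simps)
  finally show "?E * ricci h 2 1 x = ?F * ricci h 1 1 x" using G by simp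
qed

lemma scalar_curvature_ricci:
  assumes x: "x \<in> disk"
  shows "scalar_curvature h x = 2 * ricci h 1 1 x / gE h x"
proof -
  let ?E = "gE h x" and ?F = "gF h x" and ?G = "gG h x" and ?d = "gE h x * gG h x - gF h x * gF h x"
  have E: "?E > 0" and D: "?d > 0" using metric_pos[OF x] by auto
  have r: "ricci h 1 2 x = ?F * ricci h 1 1 x / ?E" "ricci h 2 1 x = ?F * ricci h 1 1 x / ?E" "ricci h 2 2 x = ?G * ricci h 1 1 x / ?E"
    using ricci_proportional[OF x] E by (simp_all add: field_simps)
  have "scalar_curvature h x = (?G * ricci h 1 1 x - ?F * ricci h 1 2 x - ?F * ricci h 2 1 x + ?E * ricci h 2 2 x) / ?d"
    unfolding scalar_curvature_def sum_2 cometric_coords[OF x] by (simp add: diff_divide_distrib add_divide_distrib)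
  also have "?G * ricci h 1 1 x - ?F * ricci h 1 2 x - ?F * ricci h 2 1 x + ?E * ricci h 2 2 x = ?d * (2 * ricci h 1 1 x / ?E)"
    unfolding r using E by (simp add: field_simps)
  finally show ?thesis using D by simp
qed

text \<open>The connection form of the Gram-Schmidt frame, rotated so that its divergence is the curvature.\<close>

definition "conn1 x = - (gD h x / gE h x * Ch 2 1 2 x)"
definition "conn2 x = gD h x / gE h x * Ch 2 1 1 x"

lemma smooth_b [smooth_intros]: "smooth_on_disk conn1" "smooth_on_disk conn2"
proof -
  have "gE h x \<noteq> 0" if "x \<in> disk" for x using gE_pos[OF that] by simp
  then show "smooth_on_disk conn1" "smooth_on_disk conn2"
    unfolding conn1_def[abs_def] conn2_def[abs_def] by (intro smooth_intros; simp)+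
qed

text \<open>The structure equation: the curvature form is the exterior derivative of the connection
  form of an orthonormal frame. Differentiating the quotient \<open>gD h x / gE h x\<close> yields
  exactly the quadratic Christoffel terms of \<open>ricci h 1 1\<close>.\<close>

lemma curvature_divergence:
  assumes x: "x \<in> disk"
  shows "(1/2) * scalar_curvature h x * gD h x = partial 1 conn1 x + partial 2 conn2 x"
proof -
  let ?q = "\<lambda>x. gD h x / gE h x"
  have E: "gE h x > 0" "\<And>y. y \<in> disk \<Longrightarrow> gE h y \<noteq> 0" using gE_pos x by (auto simp: less_imp_neq[symmetric])
  have sq: "smooth_on_disk ?q" by (intro smooth_intros E)
  have "partial i ?q x * gE h x = partial i (gD h) x - ?q x * partial i (gE h) x" for i
  proof -
    have "partial i (\<lambda>x. ?q x * gE h x) x = partial i (gD h) x"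
      by (rule partial_cong[OF _ x]) (simp add: E)
    moreover have "partial i (\<lambda>x. ?q x * gE h x) x = ?q x * partial i (gE h) x + partial i ?q x * gE h x"
      by (rule partial_mult_smooth[OF sq _ x]) (intro smooth_intros)
    ultimately show ?thesis by linarith
  qed
  then have q: "partial i ?q x = (partial i (gD h) x - ?q x * partial i (gE h) x) / gE h x" for i
    using E(1) by (simp add: eq_divide_eq)
  have q1: "partial 1 ?q x = ?q x * (Ch 2 1 2 x - Ch 1 1 1 x) - 2 * ?q x * gF h x * Ch 2 1 1 x / gE h x"
    unfolding q partial_gD[OF x] metric_derivatives[OF x] using E(1) by (simp add: field_simps)
  have q2: "partial 2 ?q x = ?q x * (Ch 2 2 2 x - Ch 1 1 2 x) - 2 * ?q x * gF h x * Ch 2 1 2 x / gE h x"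
    unfolding q partial_gD[OF x] metric_derivatives[OF x] using E(1) by (simp add: field_simps)
  have "partial 1 conn1 x + partial 2 conn2 x = - (?q x * partial 1 (Ch 2 1 2) x + partial 1 ?q x * Ch 2 1 2 x)
      + (?q x * partial 2 (Ch 2 1 1) x + partial 2 ?q x * Ch 2 1 1 x)"
    unfolding conn1_def[abs_def] conn2_def[abs_def]
    using partial_minus_smooth[OF smooth_on_disk_mult[OF sq smooth_christoffel] x, of 1 2 1 2]
      partial_mult_smooth[OF sq smooth_christoffel x, of 1 2 1 2] partial_mult_smooth[OF sq smooth_christoffel x, of 2 2 1 1]
    by simp
  also have "\<dots> = ?q x * ricci h 1 1 x"
    unfolding q1 q2 ricci_coords[OF x] by (simp add: algebra_simps)
  also have "\<dots> = (1/2) * scalar_curvature h x * gD h x"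
    unfolding scalar_curvature_ricci[OF x] by simp
  finally show ?thesis by simp
qed

end

section \<open>The boundary term\<close>

text \<open>The derivative along the circle of the angle of \<open>f + \<i> g\<close>.\<close>

definition dlog :: "(real^2 \<Rightarrow> real) \<Rightarrow> (real^2 \<Rightarrow> real) \<Rightarrow> real^2 \<Rightarrow> real" where
  "dlog f g x = (f x * dtheta g x - g x * dtheta f x) / (f x * f x + g x * g x)"

lemma dtheta_simps:
  assumes "x \<in> disk"
  shows "smooth_on_disk f \<Longrightarrow> smooth_on_disk g \<Longrightarrow> dtheta (\<lambda>x. f x * g x) x = f x * dtheta g x + dtheta f x * g x"
    "smooth_on_disk f \<Longrightarrow> smooth_on_disk g \<Longrightarrow> dtheta (\<lambda>x. f x + g x) x = dtheta f x + dtheta g x"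
    "smooth_on_disk f \<Longrightarrow> smooth_on_disk g \<Longrightarrow> dtheta (\<lambda>x. f x - g x) x = dtheta f x - dtheta g x"
    "smooth_on_disk f \<Longrightarrow> dtheta (\<lambda>x. - f x) x = - dtheta f x"
    "dtheta (\<lambda>x. c) x = 0" "dtheta (\<lambda>x. x$1) x = - x$2" "dtheta (\<lambda>x. x$2) x = x$1"
  using assms by (simp_all add: dtheta_def partial_simps algebra_simps)

text \<open>The argument of a product of complex numbers is the sum of the arguments. At the level
  of derivatives no branch has to be chosen.\<close>

lemma dlog_mult:
  assumes "smooth_on_disk f" "smooth_on_disk g" "smooth_on_disk a" "smooth_on_disk b" "x \<in> disk"
    and nz: "f x * f x + g x * g x \<noteq> 0" "a x * a x + b x * b x \<noteq> 0"
  shows "dlog (\<lambda>x. f x * a x - g x * b x) (\<lambda>x. f x * b x + g x * a x) x = dlog f g x + dlog a b x"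
proof -
  have gen: "((f*a - g*b) * (f*b' + f'*b + (g*a' + g'*a)) - (f*b + g*a) * (f*a' + f'*a - (g*b' + g'*b)))
      / ((f*a - g*b)*(f*a - g*b) + (f*b + g*a)*(f*b + g*a)) = (f*g' - g*f') / (f*f + g*g) + (a*b' - b*a') / (a*a + b*b)"
    if "f*f + g*g \<noteq> 0" "a*a + b*b \<noteq> 0" for f g a b f' g' a' b' :: real
  proof -
    have "(f*a - g*b)*(f*a - g*b) + (f*b + g*a)*(f*b + g*a) = (f*f + g*g) * (a*a + b*b)" by (simp add: algebra_simps)
    moreover have "(f*a - g*b) * (f*b' + f'*b + (g*a' + g'*a)) - (f*b + g*a) * (f*a' + f'*a - (g*b' + g'*b))
      = (f*g' - g*f') * (a*a + b*b) + (a*b' - b*a') * (f*f + g*g)" by (simp add: algebra_simps)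
    ultimately show ?thesis using that by (simp add: add_frac_eq)
  qed
  show ?thesis
    unfolding dlog_def using assms by (simp only: dtheta_simps smooth_intros gen[OF nz])
qed

lemma partial_divide_smooth:
  assumes "smooth_on_disk f" "smooth_on_disk g" "\<And>x. x \<in> disk \<Longrightarrow> g x \<noteq> 0" "x \<in> disk"
  shows "partial i (\<lambda>x. f x / g x) x = (partial i f x * g x - f x * partial i g x) / (g x * g x)"
proof -
  have s: "smooth_on_disk (\<lambda>x. f x / g x)" by (intro smooth_intros assms)
  have "partial i (\<lambda>x. f x / g x * g x) x = partial i f x"
    by (rule partial_cong[OF _ assms(4)]) (simp add: assms(3))
  moreover have "partial i (\<lambda>x. f x / g x * g x) x = f x / g x * partial i g x + partial i (\<lambda>x. f x / g x) x * g x"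
    by (rule partial_mult_smooth[OF s assms(2,4)])
  ultimately have "partial i (\<lambda>x. f x / g x) x * g x = partial i f x - f x / g x * partial i g x" by linarith
  then have e: "partial i (\<lambda>x. f x / g x) x = (partial i f x - f x / g x * partial i g x) / g x"
    by (subst nonzero_eq_divide_eq[OF assms(3)[OF assms(4)]])
  have "(a - f / g * b) / g = (a * g - f * b) / (g * g)" if "g \<noteq> 0" for a b f g :: real
    using that by (simp add: field_simps)
  from this[OF assms(3)[OF assms(4)]] show ?thesis unfolding e .
qed

text \<open>Where the real part \<open>g\<close> has no zero, arctan of the quotient is a smooth
  branch of the angle of g + i f, up to a constant, on the whole disk.\<close>

lemma dtheta_arctan_quotient:
  assumes "smooth_on_disk f" "smooth_on_disk g" and nz: "\<And>x. x \<in> disk \<Longrightarrow> g x \<noteq> 0" and x: "x \<in> disk"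
  shows "dtheta (\<lambda>x. arctan (f x / g x)) x = dlog g f x"
proof -
  have s: "smooth_on_disk (\<lambda>x. f x / g x)" by (intro smooth_intros assms)
  have q: "1 + (f x / g x)\<^sup>2 = (g x * g x + f x * f x) / (g x * g x)"
    using nz[OF x] by (simp add: power2_eq_square field_simps)
  have p: "partial i (\<lambda>x. arctan (f x / g x)) x = (partial i f x * g x - f x * partial i g x) / (g x * g x + f x * f x)" for i
  proof -
    have "partial i (\<lambda>x. arctan (f x / g x)) x = inverse (1 + (f x / g x)\<^sup>2) * partial i (\<lambda>x. f x / g x) x"
      by (rule partial_compose[OF smooth_on_disk_differentiable[OF s x] DERIV_arctan x])
    also have "\<dots> = (g x * g x) / (g x * g x + f x * f x) * ((partial i f x * g x - f x * partial i g x) / (g x * g x))"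
    proof -
      have pd: "partial i (\<lambda>x. f x / g x) x = (partial i f x * g x - f x * partial i g x) / (g x * g x)"
        by (rule partial_divide_smooth[OF assms(1,2) nz x])
      show ?thesis unfolding q pd by simp
    qed
    finally show ?thesis using nz[OF x] by simp
  qed
  show ?thesis unfolding dtheta_def dlog_def p by (simp add: diff_divide_distrib algebra_simps add_divide_distrib)
qed

text \<open>The inverse metric times the area density: the matrix of the Dirichlet integral. It
  depends only on the conformal class and has determinant 1.\<close>

definition a11 :: "metric_field \<Rightarrow> real^2 \<Rightarrow> real" where "a11 h x = gG h x / gD h x"
definition a12 :: "metric_field \<Rightarrow> real^2 \<Rightarrow> real" where "a12 h x = - gF h x / gD h x"
definition a22 :: "metric_field \<Rightarrow> real^2 \<Rightarrow> real" where "a22 h x = gE h x / gD h x"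

text \<open>The angle of the symmetric square root of the metric, applied to the tangent of the circle,
  against that tangent; minus the angle between the symmetric and the Gram-Schmidt frame.\<close>

definition turn :: "metric_field \<Rightarrow> real^2 \<Rightarrow> real" where
  "turn h x = arctan ((a12 h x * (x$1 * x$1 - x$2 * x$2) - (a11 h x - a22 h x) * x$1 * x$2)
      / (1 + a11 h x * x$1 * x$1 + 2 * a12 h x * x$1 * x$2 + a22 h x * x$2 * x$2))
    - arctan (- a12 h x / (a22 h x + 1))"

context
  fixes h :: metric_field
  assumes h: "h \<in> riemannian_metrics"
begin

lemma smooth_a [smooth_intros]: "smooth_on_disk (a11 h)" "smooth_on_disk (a12 h)" "smooth_on_disk (a22 h)"
proof -
  have "gD h x \<noteq> 0" if "x \<in> disk" for x using gD_pos[OF h that] by simp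
  then show "smooth_on_disk (a11 h)" "smooth_on_disk (a12 h)" "smooth_on_disk (a22 h)"
    unfolding a11_def[abs_def] a12_def[abs_def] a22_def[abs_def] by (intro smooth_intros smooth_metric[OF h]; simp)+
qed

lemma a_form_pos:
  assumes "x \<in> disk" "(v, w) \<noteq> (0, 0)"
  shows "0 < a11 h x * v\<^sup>2 + 2 * a12 h x * v * w + a22 h x * w\<^sup>2"
proof -
  have "0 < gE h x * (- w)\<^sup>2 + 2 * gF h x * (- w) * v + gG h x * v\<^sup>2"
    by (rule metric_form_pos[OF h assms(1)]) (use assms(2) in auto)
  then have "0 < (gE h x * (- w)\<^sup>2 + 2 * gF h x * (- w) * v + gG h x * v\<^sup>2) / gD h x"
    using gD_pos[OF h assms(1)] by simp
  also have "\<dots> = a11 h x * v\<^sup>2 + 2 * a12 h x * v * w + a22 h x * w\<^sup>2"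
    by (simp add: a11_def a12_def a22_def add_divide_distrib diff_divide_distrib algebra_simps)
  finally show ?thesis .
qed

lemma a_form_nonneg: "x \<in> disk \<Longrightarrow> 0 \<le> a11 h x * v\<^sup>2 + 2 * a12 h x * v * w + a22 h x * w\<^sup>2"
  using a_form_pos[of x v w] by (cases "(v, w) = (0, 0)") (auto simp: less_imp_le)

lemma a_det: "x \<in> disk \<Longrightarrow> a11 h x * a22 h x - a12 h x * a12 h x = 1"
  using gD_sq[OF h, of x] gD_pos[OF h, of x] by (simp add: a11_def a12_def a22_def field_simps)

text \<open>A positive definite matrix turns no vector by a right angle or more. This is why
  comparing with the symmetric square root gives angles that arctan defines on the whole
  disk.\<close>

lemma turn_denominators:
  assumes "x \<in> disk"
  shows "1 + a11 h x * x$1 * x$1 + 2 * a12 h x * x$1 * x$2 + a22 h x * x$2 * x$2 > 0" "a22 h x + 1 > 0"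
  using a_form_nonneg[OF assms, of "x$1" "x$2"] a_form_pos[OF assms, of 0 1]
  by (simp_all add: power2_eq_square mult.assoc)

lemma smooth_turn [smooth_intros]: "smooth_on_disk (turn h)"
  unfolding turn_def[abs_def] by (intro smooth_intros smooth_a; use turn_denominators in force)

text \<open>The right-hand side is the turning of the tangent of the circle in the Gram-Schmidt
  frame. In the symmetric frame the tangent stays within a right angle of its Euclidean direction,
  which turns at unit speed; \<open>turn h\<close> contains the deviation from that direction and
  the angle between the two frames.\<close>

lemma dtheta_turn:
  assumes x: "x \<in> sphere 0 1"
  shows "1 + dtheta (turn h) x
    = dlog (\<lambda>x. gF h x * x$1 - gE h x * x$2) (\<lambda>x. gD h x * x$1) x"
proof -
  let ?E = "gE h" and ?F = "gF h" and ?G = "gG h" and ?D = "gD h"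
  have xd: "x \<in> disk" using x by simp
  define M where "M = (\<lambda>x. ?D x + ?G x * x$1 * x$1 - 2 * ?F x * x$1 * x$2 + ?E x * x$2 * x$2)"
  define N where "N = (\<lambda>x. ?F x * (x$2 * x$2 - x$1 * x$1) - (?G x - ?E x) * x$1 * x$2)"
  define S where "S = (\<lambda>x. ?E x + ?D x)"
  define X where "X = (\<lambda>x. ?F x * x$1 - ?E x * x$2)"
  define Y where "Y = (\<lambda>x. ?D x * x$1)"
  define P where "P = (\<lambda>x. ?F x * x$1 - (?E x + ?D x) * x$2)"
  define R where "R = (\<lambda>x. (?G x + ?D x) * x$1 - ?F x * x$2)"
  note sm = smooth_metric[OF h]
  have s: "smooth_on_disk M" "smooth_on_disk N" "smooth_on_disk S" "smooth_on_disk X" "smooth_on_disk Y" "smooth_on_disk P" "smooth_on_disk R"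
    unfolding M_def N_def S_def X_def Y_def P_def R_def by (intro smooth_intros sm)+
  have Mx: "M y = ?D y * (1 + a11 h y * y$1 * y$1 + 2 * a12 h y * y$1 * y$2 + a22 h y * y$2 * y$2)" if "y \<in> disk" for y
    using gD_pos[OF h that] by (simp add: M_def a11_def a12_def a22_def distrib_left right_diff_distrib)
  have Nx: "N y = ?D y * (a12 h y * (y$1 * y$1 - y$2 * y$2) - (a11 h y - a22 h y) * y$1 * y$2)" if "y \<in> disk" for y
    using gD_pos[OF h that] by (simp add: N_def a11_def a12_def a22_def distrib_left right_diff_distrib diff_divide_distrib algebra_simps)
  have Mpos: "M y > 0" if "y \<in> disk" for y
    unfolding Mx[OF that] using gD_pos[OF h that] turn_denominators[OF that] by simp
  have Spos: "S y > 0" if "y \<in> disk" for y using metric_pos[OF h that] by (simp add: S_def)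
  have "dtheta (turn h) x = dtheta (\<lambda>y. arctan (N y / M y) - arctan (?F y / S y)) x"
  proof (rule dtheta_cong_sphere[OF smooth_turn _ _ x])
    show "smooth_on_disk (\<lambda>y. arctan (N y / M y) - arctan (?F y / S y))"
      by (intro smooth_intros s sm; use Mpos Spos in force)
    fix y :: "real^2" assume "y \<in> sphere 0 1"
    then have y: "y \<in> disk" by simp
    have D: "?D y > 0" using gD_pos[OF h y] .
    have "N y / M y = (a12 h y * (y$1 * y$1 - y$2 * y$2) - (a11 h y - a22 h y) * y$1 * y$2)
      / (1 + a11 h y * y$1 * y$1 + 2 * a12 h y * y$1 * y$2 + a22 h y * y$2 * y$2)"
      unfolding Mx[OF y] Nx[OF y] using D by simp
    moreover have "?F y / S y = - a12 h y / (a22 h y + 1)"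
      using D by (simp add: S_def a12_def a22_def field_simps)
    ultimately show "turn h y = arctan (N y / M y) - arctan (?F y / S y)" by (simp add: turn_def)
  qed
  also have "\<dots> = dtheta (\<lambda>y. arctan (N y / M y)) x - dtheta (\<lambda>y. arctan (?F y / S y)) x"
    by (rule dtheta_simps(3)[OF xd]) (intro smooth_intros s sm; use Mpos Spos in force)+
  also have "dtheta (\<lambda>y. arctan (N y / M y)) x = dlog M N x"
    by (rule dtheta_arctan_quotient[OF s(2,1) _ xd]) (use Mpos in force)
  also have "dtheta (\<lambda>y. arctan (?F y / S y)) x = dlog S ?F x"
    by (rule dtheta_arctan_quotient[OF sm(2) s(3) _ xd]) (use Spos in force)
  finally have t: "dtheta (turn h) x = dlog M N x - dlog S ?F x" .
  have dlog_cong: "dlog f g x = dlog f' g' x"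
    if "smooth_on_disk f" "smooth_on_disk g" "smooth_on_disk f'" "smooth_on_disk g'"
      "\<And>y. y \<in> sphere 0 1 \<Longrightarrow> f y = f' y \<and> g y = g' y" for f g f' g'
  proof -
    have "dtheta f x = dtheta f' x" "dtheta g x = dtheta g' x"
      by (rule dtheta_cong_sphere[OF _ _ _ x], use that in auto)+
    then show ?thesis using that(5)[OF x] by (simp add: dlog_def)
  qed
  have c: "y$1 * y$1 + y$2 * y$2 = 1" if "y \<in> sphere 0 1" for y :: "real^2" using sphere_coords[OF that] .
  have MN: "M x * M x + N x * N x \<noteq> 0" using Mpos[OF xd] by (metis add_pos_nonneg less_irrefl mult_pos_pos zero_le_square)
  have Ex: "?E x > 0" using gE_pos[OF h xd] .
  \<comment> \<open>The vector (P, R) is the metric plus \<open>gD h\<close> times the identity,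
    applied to the tangent, hence a positive multiple of the symmetric square root applied to it. In
    complex notation it is M + i N times the tangent -x_2 + i x_1.\<close>
  have "dlog P R x = dlog (\<lambda>y. M y * (- y$2) - N y * y$1) (\<lambda>y. M y * y$1 + N y * (- y$2)) x"
  proof (rule dlog_cong)
    fix y :: "real^2" assume y: "y \<in> sphere 0 1"
    have "P y = M y * (- y$2) - N y * y$1" unfolding P_def M_def N_def using c[OF y] by algebra
    moreover have "R y = M y * y$1 + N y * (- y$2)" unfolding R_def M_def N_def using c[OF y] by algebra
    ultimately show "P y = M y * (- y$2) - N y * y$1 \<and> R y = M y * y$1 + N y * (- y$2)" ..
  qed (intro s smooth_intros)+
  also have "\<dots> = dlog M N x + dlog (\<lambda>y. - y$2) (\<lambda>y. y$1) x"
    by (rule dlog_mult[OF s(1,2) _ _ xd MN]) (intro smooth_intros | use c[OF x] in \<open>simp add: add.commute\<close>)+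
  also have "dlog (\<lambda>y. - y$2) (\<lambda>y. y$1) x = 1"
    using xd c[OF x] by (simp add: dlog_def dtheta_simps smooth_intros add.commute)
  finally have 1: "dlog P R x = dlog M N x + 1" .
  have PR: "P x * P x + R x * R x \<noteq> 0"
  proof -
    have eq: "P x = M x * (- x$2) - N x * x$1" "R x = M x * x$1 + N x * (- x$2)"
      unfolding P_def R_def M_def N_def using c[OF x] by algebra+
    have "P x * P x + R x * R x = (M x * M x + N x * N x) * (x$1 * x$1 + x$2 * x$2)" unfolding eq by algebra
    then show ?thesis using MN c[OF x] by simp
  qed
  \<comment> \<open>The positive factor \<open>?E\<close> does not affect the angle and clears the
    denominator in the passage to the Gram-Schmidt frame, where the tangent is proportional to (X,
    Y).\<close>
  have "dlog (\<lambda>y. ?E y * P y - 0 * R y) (\<lambda>y. ?E y * R y + 0 * P y) x = dlog ?E (\<lambda>_. 0) x + dlog P R x"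
    by (rule dlog_mult[OF sm(1) _ s(6,7) xd _ PR]) (use Ex in \<open>auto intro: smooth_intros\<close>)
  also have "dlog ?E (\<lambda>_. 0) x = 0" using xd by (simp add: dlog_def dtheta_simps)
  finally have 2: "dlog (\<lambda>y. ?E y * P y - 0 * R y) (\<lambda>y. ?E y * R y + 0 * P y) x = dlog P R x" by simp
  have n: "X x * X x + Y x * Y x = ?E x * (?E x * (x$2 * x$2) - 2 * ?F x * x$1 * x$2 + ?G x * (x$1 * x$1))"
    using gD_sq[OF h xd] unfolding X_def Y_def by algebra
  have "0 < ?E x * (- x$2)\<^sup>2 + 2 * ?F x * (- x$2) * x$1 + ?G x * (x$1)\<^sup>2"
    by (rule metric_form_pos[OF h xd]) (use c[OF x] in auto)
  then have "0 < ?E x * (x$2 * x$2) - 2 * ?F x * x$1 * x$2 + ?G x * (x$1 * x$1)"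
    by (simp add: power2_eq_square algebra_simps)
  from mult_pos_pos[OF Ex this] have XY: "X x * X x + Y x * Y x \<noteq> 0"
    unfolding n by (rule less_imp_neq[THEN not_sym])
  have "dlog (\<lambda>y. ?E y * P y - 0 * R y) (\<lambda>y. ?E y * R y + 0 * P y) x
    = dlog (\<lambda>y. X y * S y - Y y * ?F y) (\<lambda>y. X y * ?F y + Y y * S y) x"
  proof (rule dlog_cong)
    fix y :: "real^2" assume "y \<in> sphere 0 1"
    then have y: "y \<in> disk" by simp
    have "?E y * P y - 0 * R y = X y * S y - Y y * ?F y" unfolding P_def X_def Y_def S_def by algebra
    moreover have "?E y * R y + 0 * P y = X y * ?F y + Y y * S y"
      unfolding P_def R_def X_def Y_def S_def using gD_sq[OF h y] by algebra
    ultimately show "?E y * P y - 0 * R y = X y * S y - Y y * ?F y \<and> ?E y * R y + 0 * P y = X y * ?F y + Y y * S y" ..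
  qed (intro s sm smooth_intros)+
  also have "\<dots> = dlog X Y x + dlog S ?F x"
  proof (rule dlog_mult[OF s(4,5,3) sm(2) xd XY])
    show "S x * S x + ?F x * ?F x \<noteq> 0" using Spos[OF xd] by (metis add_pos_nonneg less_irrefl mult_pos_pos zero_le_square)
  qed
  finally have "dlog M N x + 1 = dlog X Y x + dlog S ?F x" using 1 2 by simp
  then show ?thesis using t by (simp add: X_def Y_def)
qed

lemma tangent_length:
  assumes x: "x = circ t"
  shows "inner_at h x (circ' t) (circ' t) = gE h x * x$2 * x$2 - 2 * gF h x * x$1 * x$2 + gG h x * x$1 * x$1"
    and "0 < inner_at h x (circ' t) (circ' t)"
proof -
  have xd: "x \<in> disk" by (simp add: x)
  have c': "circ' t $ 1 = - x$2" "circ' t $ 2 = x$1" by (simp_all add: x circ'_def circ_pt)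
  show e: "inner_at h x (circ' t) (circ' t) = gE h x * x$2 * x$2 - 2 * gF h x * x$1 * x$2 + gG h x * x$1 * x$1"
    unfolding inner_at_def inner_real2 matrix_vector_real2 c' metric_sym[OF h xd]
    by (simp add: gE_def gF_def gG_def algebra_simps)
  have "x \<in> sphere 0 1" by (simp add: x)
  then have "x$1 * x$1 + x$2 * x$2 = 1" by (rule sphere_coords)
  then have "0 < gE h x * (- x$2)\<^sup>2 + 2 * gF h x * (- x$2) * x$1 + gG h x * (x$1)\<^sup>2"
    by (intro metric_form_pos[OF h xd]) auto
  then show "0 < inner_at h x (circ' t) (circ' t)" unfolding e by (simp add: power2_eq_square algebra_simps)
qed

text \<open>Liouville's formula: the geodesic curvature, per unit of the angle parameter, is the
  rate at which the tangent turns against the frame minus the connection form on the tangent. The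
  latter is here the normal component of the rotated connection form.\<close>

lemma mean_curvature_formula:
  assumes x: "x = circ t"
  shows "mean_curvature h t * sqrt (inner_at h x (circ' t) (circ' t))
    = 1 + dtheta (turn h) x - (conn1 h x * x$1 + conn2 h x * x$2)"
proof -
  let ?E = "gE h x" and ?F = "gF h x" and ?G = "gG h x" and ?D = "gD h x"
  define p q r s u w where "p = christoffel h 1 1 1 x" "q = christoffel h 2 1 1 x" "r = christoffel h 1 1 2 x"
    "s = christoffel h 2 1 2 x" "u = christoffel h 1 2 2 x" "w = christoffel h 2 2 2 x"
  note ch = p_q_r_s_u_w_def
  have xs: "x \<in> sphere 0 1" and xd: "x \<in> disk" by (simp_all add: x)
  have c: "x$1 * x$1 + x$2 * x$2 = 1" using sphere_coords[OF xs] .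
  have c': "circ' t $ 1 = - x$2" "circ' t $ 2 = x$1" by (simp_all add: x circ'_def circ_pt)
  have E: "?E > 0" and D: "?D > 0" and D2: "?D * ?D = ?E * ?G - ?F * ?F" using metric_pos[OF h xd] gD_sq[OF h xd] by auto
  define n where "n = ?E * x$2 * x$2 - 2 * ?F * x$1 * x$2 + ?G * x$1 * x$1"
  have n: "inner_at h x (circ' t) (circ' t) = n" and n0: "n > 0"
    using tangent_length[OF x] by (simp_all add: n_def)
  define \<gamma> where "\<gamma> = x$1 * (p * x$2 * x$2 - 2 * r * x$1 * x$2 + u * x$1 * x$1) + x$2 * (q * x$2 * x$2 - 2 * s * x$1 * x$2 + w * x$1 * x$1)"
  have acc: "circ_acceleration h t \<bullet> x = \<gamma> - 1"
  proof -
    have a: "circ_acceleration h t $ k = - x$k + (christoffel h k 1 1 x * x$2 * x$2 - 2 * christoffel h k 1 2 x * x$1 * x$2 + christoffel h k 2 2 x * x$1 * x$1)" for k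
      unfolding circ_acceleration_def x[symmetric] sum_2 by (simp add: c' christoffel_sym[OF h xd] algebra_simps)
    have "circ_acceleration h t \<bullet> x = \<gamma> - (x$1 * x$1 + x$2 * x$2)"
      unfolding inner_real2 a \<gamma>_def ch[symmetric] by (simp add: algebra_simps)
    then show ?thesis using c by simp
  qed
  define k where "k = 1 / (?D * ?D)"
  have k: "k * (?E * ?G - ?F * ?F) = 1" using D unfolding D2[symmetric] by (simp add: k_def)
  have co: "cometric h x $ 1 $ 1 = ?G * k" "cometric h x $ 1 $ 2 = - ?F * k"
    "cometric h x $ 2 $ 1 = - ?F * k" "cometric h x $ 2 $ 2 = ?E * k"
    unfolding cometric_coords[OF h xd] k_def D2 by simp_all
  have cx: "x \<bullet> (cometric h x *v x) = n / (?D * ?D)"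
    unfolding inner_real2 matrix_vector_real2 co n_def by (simp add: k_def diff_divide_distrib add_divide_distrib algebra_simps)
  have sq: "sqrt (x \<bullet> (cometric h x *v x)) = sqrt n / ?D"
    unfolding cx using D by (simp add: real_sqrt_divide)
  \<comment> \<open>The normal is a multiple of the vector dual to \<open>x\<close>, so pairing with
    it in the metric is the Euclidean product with \<open>x\<close>.\<close>
  have hc: "v \<bullet> (h x *v (cometric h x *v x)) = v \<bullet> x" for v
  proof -
    have "(h x *v (cometric h x *v x)) $ 1 = x$1" "(h x *v (cometric h x *v x)) $ 2 = x$2"
      unfolding matrix_vector_real2 co metric_sym[OF h xd] gE_def[of h x, symmetric] gF_def[of h x, symmetric] gG_def[of h x, symmetric]
      using k by algebra+
    then show ?thesis by (simp add: inner_real2)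
  qed
  have "inner_at h x (circ_acceleration h t) (outward_normal h x) = (?D / sqrt n) * (\<gamma> - 1)"
    unfolding inner_at_def outward_normal_def sq
    by (simp add: matrix_vector_mult_scaleR hc acc)
  then have H: "mean_curvature h t * sqrt n = ?D * (1 - \<gamma>) / n"
    unfolding mean_curvature_def x[symmetric] n using n0 by (simp add: field_simps)
  define E' F' D' where "E' = dtheta (gE h) x" "F' = dtheta (gF h) x" "D' = dtheta (gD h) x"
  have d: "E' = 2 * x$1 * (?E * r + ?F * s) - 2 * x$2 * (?E * p + ?F * q)"
    "F' = x$1 * (?E * u + ?F * w + ?F * r + ?G * s) - x$2 * (?E * r + ?F * s + ?F * p + ?G * q)"
    "D' = ?D * (x$1 * (r + w) - x$2 * (p + s))"
    unfolding E'_F'_D'_def dtheta_def metric_derivatives[OF h xd] partial_gD[OF h xd] ch by (simp_all add: algebra_simps)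
  note sm = smooth_metric[OF h]
  have "dlog (\<lambda>x. gF h x * x$1 - gE h x * x$2) (\<lambda>x. gD h x * x$1) x
    = ((?F * x$1 - ?E * x$2) * (D' * x$1 - ?D * x$2) - ?D * x$1 * (F' * x$1 - ?F * x$2 - E' * x$2 - ?E * x$1)) / (?E * n)"
  proof -
    have "(?F * x$1 - ?E * x$2) * (?F * x$1 - ?E * x$2) + (?D * x$1) * (?D * x$1) = ?E * n"
      using D2 unfolding n_def by algebra
    then show ?thesis
      unfolding dlog_def using xd by (simp add: dtheta_simps smooth_intros sm E'_F'_D'_def algebra_simps)
  qed
  also have "(?F * x$1 - ?E * x$2) * (D' * x$1 - ?D * x$2) - ?D * x$1 * (F' * x$1 - ?F * x$2 - E' * x$2 - ?E * x$1)
    = ?D * (?E * (1 - \<gamma>) + n * (q * x$2 - s * x$1))"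
    unfolding d \<gamma>_def n_def using c by algebra
  also have "?D * (?E * (1 - \<gamma>) + n * (q * x$2 - s * x$1)) / (?E * n) = ?D * (1 - \<gamma>) / n + ?D / ?E * (q * x$2 - s * x$1)"
    using E n0 by (simp add: field_simps)
  also have "?D / ?E * (q * x$2 - s * x$1) = conn1 h x * x$1 + conn2 h x * x$2"
    unfolding conn1_def[OF h] conn2_def[OF h] ch by (simp add: algebra_simps)
  finally show ?thesis unfolding n H dtheta_turn[OF xs] by simp
qed

end

section \<open>The energy as a first-order form\<close>

text \<open>The connection field as seen from the frame rotated by \<open>turn h\<close>. The added
  rotated gradient is divergence free, and it makes the boundary density equal to 1 minus the normal
  component of the new field.\<close>

definition beta1 :: "metric_field \<Rightarrow> real^2 \<Rightarrow> real" where
  "beta1 h x = conn1 h x - partial 2 (turn h) x"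
definition beta2 :: "metric_field \<Rightarrow> real^2 \<Rightarrow> real" where
  "beta2 h x = conn2 h x + partial 1 (turn h) x"

definition aform :: "metric_field \<Rightarrow> (real^2 \<Rightarrow> real) \<Rightarrow> real^2 \<Rightarrow> real" where
  "aform h u x = a11 h x * (partial 1 u x)\<^sup>2 + 2 * a12 h x * partial 1 u x * partial 2 u x + a22 h x * (partial 2 u x)\<^sup>2"

lemma smooth_beta [smooth_intros]:
  assumes "h \<in> riemannian_metrics"
  shows "smooth_on_disk (beta1 h)" "smooth_on_disk (beta2 h)"
  unfolding beta1_def[abs_def] beta2_def[abs_def]
  by (intro smooth_intros smooth_b[OF assms] smooth_turn[OF assms])+

lemma smooth_aform [smooth_intros]:
  assumes "h \<in> riemannian_metrics" "smooth_on_disk u"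
  shows "smooth_on_disk (aform h u)"
  unfolding aform_def[abs_def] by (intro smooth_intros smooth_a[OF assms(1)] assms(2))

lemma area_integral_disk_int:
  assumes "h \<in> riemannian_metrics"
  shows "area_integral h f = disk_int (\<lambda>x. f x * gD h x)"
  unfolding area_integral_def disk_int_def
  by (rule set_lebesgue_integral_cong) (auto simp: sqrt_det_metric[OF assms])

lemma grad_norm2_aform:
  assumes h: "h \<in> riemannian_metrics" and x: "x \<in> disk"
  shows "grad_norm2 h u x * gD h x = aform h u x"
proof -
  have D: "gD h x > 0" and D2: "gD h x * gD h x = gE h x * gG h x - gF h x * gF h x"
    using gD_pos[OF h x] gD_sq[OF h x] by auto
  show ?thesis
    unfolding grad_norm2_def sum_2 cometric_coords[OF h x] D2[symmetric] aform_def a11_def a12_def a22_def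
    using D by (simp add: field_simps power2_eq_square)
qed

lemma boundary_integral_circ_int:
  assumes h: "h \<in> riemannian_metrics" and u: "smooth_on_disk u"
  shows "boundary_integral h (\<lambda>t. mean_curvature h t * (u (circ t))\<^sup>2)
    = circ_int (\<lambda>x. (1 + dtheta (turn h) x - (conn1 h x * x$1 + conn2 h x * x$2)) * (u x)\<^sup>2)"
proof -
  let ?f = "\<lambda>x. (1 + dtheta (turn h) x - (conn1 h x * x$1 + conn2 h x * x$2)) * (u x)\<^sup>2"
  have c: "continuous_on disk ?f"
    by (intro smooth_on_disk_continuous smooth_intros smooth_turn[OF h] smooth_b[OF h] u)
  have cc: "continuous_on {0..2*pi} (\<lambda>t. ?f (circ t))"
    by (rule continuous_on_compose2[OF c]) (auto intro: continuous_intros)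
  have "boundary_integral h (\<lambda>t. mean_curvature h t * (u (circ t))\<^sup>2) = (LINT t:{0..2*pi}|lborel. ?f (circ t))"
    unfolding boundary_integral_def
    by (rule set_lebesgue_integral_cong) (simp_all add: mean_curvature_formula[OF h refl, symmetric])
  also have "\<dots> = integral {0..2*pi} (\<lambda>t. ?f (circ t))"
    by (rule set_borel_integral_eq_integral) (unfold set_integrable_def, rule borel_integrable_compact, use cc in auto)
  finally show ?thesis by (simp add: circ_int_def)
qed

lemma partial_square:
  assumes "smooth_on_disk u" "x \<in> disk"
  shows "partial i (\<lambda>x. (u x)\<^sup>2) x = 2 * (u x * partial i u x)"
  using partial_mult_smooth[OF assms(1) assms(1) assms(2), of i] by (simp add: power2_eq_square)

text \<open>Half the scalar curvature times the area density is the divergence of the field (beta1,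
  beta2), and the boundary density is 1 minus its normal component. Integration by parts therefore
  cancels the normal component and leaves only first derivatives of the metric. The calculation
  treats the connection field and the rotated gradient of \<open>turn h\<close> separately.\<close>

theorem energy_formula:
  assumes h: "h \<in> riemannian_metrics" and u: "smooth_on_disk u"
  shows "energy h u = disk_int (\<lambda>x. aform h u x - 2 * (u x * (beta1 h x * partial 1 u x + beta2 h x * partial 2 u x)))
    + circ_int (\<lambda>x. (u x)\<^sup>2)"
proof -
  let ?T = "turn h" and ?v = "\<lambda>x. (u x)\<^sup>2"
  note s = u smooth_turn[OF h] smooth_b[OF h] smooth_a[OF h]
  have "area_integral h (\<lambda>x. grad_norm2 h u x + (1/2) * scalar_curvature h x * (u x)\<^sup>2)
    = disk_int (\<lambda>x. (aform h u x - 2 * (u x * (conn1 h x * partial 1 u x + conn2 h x * partial 2 u x)))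
       + (partial 1 (\<lambda>x. conn1 h x * ?v x) x + partial 2 (\<lambda>x. conn2 h x * ?v x) x))"
    unfolding area_integral_disk_int[OF h]
  proof (rule disk_int_cong)
    fix x :: "real^2" assume x: "x \<in> disk"
    have "(grad_norm2 h u x + (1/2) * scalar_curvature h x * ?v x) * gD h x
      = grad_norm2 h u x * gD h x + (1/2) * scalar_curvature h x * gD h x * ?v x" by (simp add: algebra_simps)
    also have "\<dots> = aform h u x + (partial 1 (conn1 h) x + partial 2 (conn2 h) x) * ?v x"
      unfolding grad_norm2_aform[OF h x] curvature_divergence[OF h x] ..
    finally show "(grad_norm2 h u x + (1/2) * scalar_curvature h x * ?v x) * gD h x
      = (aform h u x - 2 * (u x * (conn1 h x * partial 1 u x + conn2 h x * partial 2 u x)))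
       + (partial 1 (\<lambda>x. conn1 h x * ?v x) x + partial 2 (\<lambda>x. conn2 h x * ?v x) x)"
      using x by (simp add: partial_mult_smooth s smooth_intros partial_square algebra_simps)
  qed
  also have "\<dots> = disk_int (\<lambda>x. aform h u x - 2 * (u x * (conn1 h x * partial 1 u x + conn2 h x * partial 2 u x)))
       + disk_int (\<lambda>x. partial 1 (\<lambda>x. conn1 h x * ?v x) x + partial 2 (\<lambda>x. conn2 h x * ?v x) x)"
    by (rule disk_int_add) (intro smooth_on_disk_continuous smooth_intros h s)+
  also have "disk_int (\<lambda>x. partial 1 (\<lambda>x. conn1 h x * ?v x) x + partial 2 (\<lambda>x. conn2 h x * ?v x) x)
    = circ_int (\<lambda>x. conn1 h x * ?v x * x$1 + conn2 h x * ?v x * x$2)"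
    by (rule divergence_smooth2) (intro smooth_intros s)+
  finally have 1: "area_integral h (\<lambda>x. grad_norm2 h u x + (1/2) * scalar_curvature h x * (u x)\<^sup>2)
    = disk_int (\<lambda>x. aform h u x - 2 * (u x * (conn1 h x * partial 1 u x + conn2 h x * partial 2 u x)))
      + circ_int (\<lambda>x. conn1 h x * ?v x * x$1 + conn2 h x * ?v x * x$2)" .
  have "disk_int (\<lambda>x. partial 1 (\<lambda>x. ?v x * partial 2 ?T x) x + partial 2 (\<lambda>x. - (?v x * partial 1 ?T x)) x)
    = circ_int (\<lambda>x. ?v x * partial 2 ?T x * x$1 + - (?v x * partial 1 ?T x) * x$2)"
    by (rule divergence_smooth2) (intro smooth_intros s)+
  also have "\<dots> = circ_int (\<lambda>x. dtheta ?T x * ?v x)"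
    by (rule circ_int_cong) (simp add: dtheta_def algebra_simps)
  also have "disk_int (\<lambda>x. partial 1 (\<lambda>x. ?v x * partial 2 ?T x) x + partial 2 (\<lambda>x. - (?v x * partial 1 ?T x)) x)
    = disk_int (\<lambda>x. 2 * (u x * (partial 1 u x * partial 2 ?T x - partial 2 u x * partial 1 ?T x)))"
  proof (rule disk_int_cong)
    fix x :: "real^2" assume x: "x \<in> disk"
    have "partial 1 (partial 2 ?T) x = partial 2 (partial 1 ?T) x" by (rule partial_commute[OF s(2) x])
    then show "partial 1 (\<lambda>x. ?v x * partial 2 ?T x) x + partial 2 (\<lambda>x. - (?v x * partial 1 ?T x)) x
      = 2 * (u x * (partial 1 u x * partial 2 ?T x - partial 2 u x * partial 1 ?T x))"
      using x by (simp add: partial_mult_smooth partial_minus_smooth s smooth_intros partial_square algebra_simps)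
  qed
  finally have 2: "circ_int (\<lambda>x. dtheta ?T x * ?v x) = disk_int (\<lambda>x. 2 * (u x * (partial 1 u x * partial 2 ?T x - partial 2 u x * partial 1 ?T x)))" ..
  have "circ_int (\<lambda>x. (1 + dtheta ?T x - (conn1 h x * x$1 + conn2 h x * x$2)) * ?v x)
     = circ_int (\<lambda>x. (?v x + dtheta ?T x * ?v x) - (conn1 h x * ?v x * x$1 + conn2 h x * ?v x * x$2))"
    by (rule circ_int_cong) (simp add: algebra_simps)
  also have "\<dots> = circ_int (\<lambda>x. ?v x + dtheta ?T x * ?v x) - circ_int (\<lambda>x. conn1 h x * ?v x * x$1 + conn2 h x * ?v x * x$2)"
    by (rule circ_int_diff) (intro smooth_on_disk_continuous smooth_intros s)+
  also have "circ_int (\<lambda>x. ?v x + dtheta ?T x * ?v x) = circ_int ?v + circ_int (\<lambda>x. dtheta ?T x * ?v x)"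
    by (rule circ_int_add) (intro smooth_on_disk_continuous smooth_intros s)+
  finally have "energy h u = disk_int (\<lambda>x. aform h u x - 2 * (u x * (conn1 h x * partial 1 u x + conn2 h x * partial 2 u x)))
     + disk_int (\<lambda>x. 2 * (u x * (partial 1 u x * partial 2 ?T x - partial 2 u x * partial 1 ?T x))) + circ_int ?v"
    unfolding energy_def boundary_integral_circ_int[OF h u] 1 2 by simp
  also have "disk_int (\<lambda>x. aform h u x - 2 * (u x * (conn1 h x * partial 1 u x + conn2 h x * partial 2 u x)))
     + disk_int (\<lambda>x. 2 * (u x * (partial 1 u x * partial 2 ?T x - partial 2 u x * partial 1 ?T x)))
    = disk_int (\<lambda>x. (aform h u x - 2 * (u x * (conn1 h x * partial 1 u x + conn2 h x * partial 2 u x)))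
       + 2 * (u x * (partial 1 u x * partial 2 ?T x - partial 2 u x * partial 1 ?T x)))"
    by (rule disk_int_add[symmetric]) (intro smooth_on_disk_continuous smooth_intros h s)+
  also have "\<dots> = disk_int (\<lambda>x. aform h u x - 2 * (u x * (beta1 h x * partial 1 u x + beta2 h x * partial 2 u x)))"
    by (rule disk_int_cong) (simp add: beta1_def beta2_def algebra_simps)
  finally show ?thesis .
qed

section \<open>Conformal changes and existence of a positive metric in every conformal class\<close>

section \<open>Conformal changes\<close>

definition conformal :: "(real^2 \<Rightarrow> real) \<Rightarrow> metric_field \<Rightarrow> metric_field" where
  "conformal \<phi> h = (\<lambda>x\<in>disk. exp (2 * \<phi> x) *\<^sub>R h x)"

lemma conformal_metric:
  assumes h: "h \<in> riemannian_metrics" and \<phi>: "smooth_on_disk \<phi>"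
  shows "conformal \<phi> h \<in> riemannian_metrics"
  unfolding riemannian_metrics_def
proof (intro CollectI conjI allI ballI impI)
  show "conformal \<phi> h \<in> extensional disk" by (simp add: conformal_def)
  have s: "smooth_on_disk (\<lambda>x. h x $ i $ j)" for i j using h by (simp add: riemannian_metrics_def)
  show "smooth_on_disk (\<lambda>x. conformal \<phi> h x $ i $ j)" for i j
    by (rule smooth_on_disk_cong[of "\<lambda>x. exp (2 * \<phi> x) * h x $ i $ j"])
      (auto intro!: smooth_intros \<phi> s simp: conformal_def)
  fix x :: "real^2" assume x: "x \<in> disk"
  then have hx: "transpose (h x) = h x" "\<And>v. v \<noteq> 0 \<Longrightarrow> 0 < v \<bullet> (h x *v v)"
    using h by (auto simp: riemannian_metrics_def)
  have "conformal \<phi> h x $ j $ i = conformal \<phi> h x $ i $ j" for i j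
    using x arg_cong[OF hx(1), of "\<lambda>A. A $ i $ j"] by (simp add: conformal_def transpose_def)
  then show "transpose (conformal \<phi> h x) = conformal \<phi> h x" by (simp add: vec_eq_iff transpose_def)
  show "0 < v \<bullet> (conformal \<phi> h x *v v)" if "v \<noteq> 0" for v
    using x hx(2)[OF that] by (simp add: conformal_def scaleR_matrix_vector_assoc[symmetric])
qed

lemma conformal_coords:
  assumes "h \<in> riemannian_metrics" "x \<in> disk"
  shows "gE (conformal \<phi> h) x = exp (2 * \<phi> x) * gE h x" "gF (conformal \<phi> h) x = exp (2 * \<phi> x) * gF h x"
    "gG (conformal \<phi> h) x = exp (2 * \<phi> x) * gG h x" "gD (conformal \<phi> h) x = exp (2 * \<phi> x) * gD h x"
proof -
  show *: "gE (conformal \<phi> h) x = exp (2 * \<phi> x) * gE h x" "gF (conformal \<phi> h) x = exp (2 * \<phi> x) * gF h x"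
    "gG (conformal \<phi> h) x = exp (2 * \<phi> x) * gG h x"
    using assms(2) by (simp_all add: gE_def gF_def gG_def conformal_def)
  have "gE (conformal \<phi> h) x * gG (conformal \<phi> h) x - gF (conformal \<phi> h) x * gF (conformal \<phi> h) x
    = (exp (2 * \<phi> x))\<^sup>2 * (gE h x * gG h x - gF h x * gF h x)"
    unfolding * by (simp add: power2_eq_square algebra_simps)
  then show "gD (conformal \<phi> h) x = exp (2 * \<phi> x) * gD h x"
    by (simp add: gD_def real_sqrt_mult)
qed

lemma conformal_a:
  assumes "h \<in> riemannian_metrics" "x \<in> disk"
  shows "a11 (conformal \<phi> h) x = a11 h x" "a12 (conformal \<phi> h) x = a12 h x" "a22 (conformal \<phi> h) x = a22 h x"
    "turn (conformal \<phi> h) x = turn h x" "aform (conformal \<phi> h) u x = aform h u x"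
proof -
  show *: "a11 (conformal \<phi> h) x = a11 h x" "a12 (conformal \<phi> h) x = a12 h x" "a22 (conformal \<phi> h) x = a22 h x"
    by (simp_all add: a11_def a12_def a22_def conformal_coords[OF assms])
  show "turn (conformal \<phi> h) x = turn h x" "aform (conformal \<phi> h) u x = aform h u x"
    by (simp_all add: turn_def aform_def *)
qed

lemma conn_formula:
  assumes h: "h \<in> riemannian_metrics" and x: "x \<in> disk"
  shows "conn1 h x = - (gE h x * partial 1 (gG h) x - gF h x * partial 2 (gE h) x) / (2 * gE h x * gD h x)"
    "conn2 h x = (2 * gE h x * partial 1 (gF h) x - gE h x * partial 2 (gE h) x - gF h x * partial 1 (gE h) x) / (2 * gE h x * gD h x)"
proof -
  have D: "gD h x > 0" and E: "gE h x > 0" and D2: "gE h x * gG h x - gF h x * gF h x = gD h x * gD h x"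
    using metric_pos[OF h x] gD_sq[OF h x] by auto
  have g: "D / E * (y / (2 * (D * D))) = y / (2 * E * D)" if "D > 0" "E > 0" for D E y :: real
    using that by (simp add: field_simps)
  show "conn1 h x = - (gE h x * partial 1 (gG h) x - gF h x * partial 2 (gE h) x) / (2 * gE h x * gD h x)"
    "conn2 h x = (2 * gE h x * partial 1 (gF h) x - gE h x * partial 2 (gE h) x - gF h x * partial 1 (gE h) x) / (2 * gE h x * gD h x)"
    unfolding conn1_def[OF h] conn2_def[OF h] christoffel_coords[OF h x] D2 g[OF D E] by (rule minus_divide_left, rule refl)
qed

text \<open>The angle \<open>turn h\<close> depends on the conformal class alone, so the whole
  change comes from the connection form. That form is a logarithmic derivative in the scale and
  hence affine in the gradient of \<phi>.\<close>

lemma conformal_beta: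
  assumes h: "h \<in> riemannian_metrics" and \<phi>: "smooth_on_disk \<phi>" and x: "x \<in> disk"
  shows "beta1 (conformal \<phi> h) x = beta1 h x - (a11 h x * partial 1 \<phi> x + a12 h x * partial 2 \<phi> x)"
    "beta2 (conformal \<phi> h) x = beta2 h x - (a12 h x * partial 1 \<phi> x + a22 h x * partial 2 \<phi> x)"
proof -
  have c: "conformal \<phi> h \<in> riemannian_metrics" by (rule conformal_metric[OF h \<phi>])
  define e where "e = exp (2 * \<phi> x)"
  have e: "e > 0" by (simp add: e_def)
  have pe: "partial i (\<lambda>x. exp (2 * \<phi> x)) x = e * (2 * partial i \<phi> x)" for i
  proof -
    have "partial i (\<lambda>x. exp (2 * \<phi> x)) x = exp (2 * \<phi> x) * partial i (\<lambda>x. 2 * \<phi> x) x"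
      by (rule partial_compose[OF smooth_on_disk_differentiable[OF _ x] DERIV_exp x]) (intro smooth_intros \<phi>)
    then show ?thesis using x by (simp add: partial_cmult_smooth \<phi> e_def)
  qed
  have pm: "partial i (\<lambda>x. exp (2 * \<phi> x) * f x) x = e * (partial i f x + 2 * partial i \<phi> x * f x)" if "smooth_on_disk f" for i f
  proof -
    have "partial i (\<lambda>x. exp (2 * \<phi> x) * f x) x = exp (2 * \<phi> x) * partial i f x + partial i (\<lambda>x. exp (2 * \<phi> x)) x * f x"
      by (rule partial_mult_smooth[OF _ that x]) (intro smooth_intros \<phi>)
    then show ?thesis unfolding pe e_def[symmetric] by (simp add: algebra_simps)
  qed
  have p: "partial i (gE (conformal \<phi> h)) x = e * (partial i (gE h) x + 2 * partial i \<phi> x * gE h x)"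
    "partial i (gF (conformal \<phi> h)) x = e * (partial i (gF h) x + 2 * partial i \<phi> x * gF h x)"
    "partial i (gG (conformal \<phi> h)) x = e * (partial i (gG h) x + 2 * partial i \<phi> x * gG h x)" for i
  proof -
    have "partial i (gE (conformal \<phi> h)) x = partial i (\<lambda>x. exp (2 * \<phi> x) * gE h x) x"
      "partial i (gF (conformal \<phi> h)) x = partial i (\<lambda>x. exp (2 * \<phi> x) * gF h x) x"
      "partial i (gG (conformal \<phi> h)) x = partial i (\<lambda>x. exp (2 * \<phi> x) * gG h x) x"
      by (rule partial_cong[OF _ x], erule conformal_coords[OF h])+
    then show "partial i (gE (conformal \<phi> h)) x = e * (partial i (gE h) x + 2 * partial i \<phi> x * gE h x)"
      "partial i (gF (conformal \<phi> h)) x = e * (partial i (gF h) x + 2 * partial i \<phi> x * gF h x)"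
      "partial i (gG (conformal \<phi> h)) x = e * (partial i (gG h) x + 2 * partial i \<phi> x * gG h x)"
      by (simp_all only: pm smooth_metric[OF h])
  qed
  have pt: "partial i (turn (conformal \<phi> h)) x = partial i (turn h) x" for i
    by (rule partial_cong[OF conformal_a(4)[OF h] x])
  have D: "gD h x > 0" and E: "gE h x > 0" using metric_pos[OF h x] by auto
  have g1: "- (e * E * (e * (G1 + 2 * f1 * G)) - e * F * (e * (E2 + 2 * f2 * E))) / (2 * (e * E) * (e * D))
     = - (E * G1 - F * E2) / (2 * E * D) - (G / D * f1 + - F / D * f2)"
    if "D > 0" "E > 0" "e > 0" for E F G D G1 E2 f1 f2 e :: real
    using that by (simp add: field_simps)
  have g2: "(2 * (e * E) * (e * (F1 + 2 * f1 * F)) - e * E * (e * (E2 + 2 * f2 * E)) - e * F * (e * (E1 + 2 * f1 * E))) / (2 * (e * E) * (e * D))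
     = (2 * E * F1 - E * E2 - F * E1) / (2 * E * D) - (- F / D * f1 + E / D * f2)"
    if "D > 0" "E > 0" "e > 0" for E F D E1 F1 E2 f1 f2 e :: real
    using that by (simp add: field_simps)
  have "conn1 (conformal \<phi> h) x = conn1 h x - (a11 h x * partial 1 \<phi> x + a12 h x * partial 2 \<phi> x)"
    unfolding conn_formula[OF c x] conn_formula[OF h x] p conformal_coords[OF h x] e_def[symmetric] a11_def a12_def
    by (rule g1[OF D E e])
  moreover have "conn2 (conformal \<phi> h) x = conn2 h x - (a12 h x * partial 1 \<phi> x + a22 h x * partial 2 \<phi> x)"
    unfolding conn_formula[OF c x] conn_formula[OF h x] p conformal_coords[OF h x] e_def[symmetric] a12_def a22_def
    by (rule g2[OF D E e])
  ultimately show "beta1 (conformal \<phi> h) x = beta1 h x - (a11 h x * partial 1 \<phi> x + a12 h x * partial 2 \<phi> x)"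
    "beta2 (conformal \<phi> h) x = beta2 h x - (a12 h x * partial 1 \<phi> x + a22 h x * partial 2 \<phi> x)"
    by (simp_all add: beta1_def beta2_def pt)
qed

text \<open>Half of the conformally invariant Dirichlet pairing of \<phi> with the square of
  u.\<close>

definition flux :: "metric_field \<Rightarrow> (real^2 \<Rightarrow> real) \<Rightarrow> (real^2 \<Rightarrow> real) \<Rightarrow> real^2 \<Rightarrow> real" where
  "flux h \<phi> u x = (a11 h x * partial 1 \<phi> x + a12 h x * partial 2 \<phi> x) * (u x * partial 1 u x)
     + (a12 h x * partial 1 \<phi> x + a22 h x * partial 2 \<phi> x) * (u x * partial 2 u x)"

lemma smooth_flux [smooth_intros]:
  assumes "h \<in> riemannian_metrics" "smooth_on_disk \<phi>" "smooth_on_disk u"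
  shows "smooth_on_disk (flux h \<phi> u)"
  unfolding flux_def[abs_def] by (intro smooth_intros smooth_a[OF assms(1)] assms)

text \<open>The conformal factor enters linearly; this is why the good conformal factors form a convex set.\<close>

theorem energy_conformal:
  assumes h: "h \<in> riemannian_metrics" and \<phi>: "smooth_on_disk \<phi>" and u: "smooth_on_disk u"
  shows "energy (conformal \<phi> h) u = energy h u + 2 * disk_int (flux h \<phi> u)"
proof -
  let ?b = "\<lambda>x. aform h u x - 2 * (u x * (beta1 h x * partial 1 u x + beta2 h x * partial 2 u x))"
  have "disk_int (\<lambda>x. aform (conformal \<phi> h) u x - 2 * (u x * (beta1 (conformal \<phi> h) x * partial 1 u x + beta2 (conformal \<phi> h) x * partial 2 u x)))
    = disk_int (\<lambda>x. ?b x + 2 * flux h \<phi> u x)"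
    by (rule disk_int_cong) (simp add: conformal_a[OF h] conformal_beta[OF h \<phi>] flux_def algebra_simps)
  also have "\<dots> = disk_int ?b + disk_int (\<lambda>x. 2 * flux h \<phi> u x)"
    by (rule disk_int_add) (intro smooth_on_disk_continuous smooth_intros h u \<phi>)+
  finally show ?thesis
    unfolding energy_formula[OF conformal_metric[OF h \<phi>] u] energy_formula[OF h u] by (simp add: disk_int_cmult)
qed

lemma flux_combination:
  assumes "finite J" "\<And>j. j \<in> J \<Longrightarrow> smooth_on_disk (\<phi> j)" "x \<in> disk"
  shows "flux h (\<lambda>x. \<Sum>j\<in>J. w j * \<phi> j x) u x = (\<Sum>j\<in>J. w j * flux h (\<phi> j) u x)"
proof -
  have p: "partial i (\<lambda>x. \<Sum>j\<in>J. w j * \<phi> j x) x = (\<Sum>j\<in>J. w j * partial i (\<phi> j) x)" for i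
    using assms(1,2)
  proof (induction J)
    case empty
    then show ?case using assms(3) by (simp add: partial_const)
  next
    case (insert j J)
    then show ?case using assms(3)
      by (simp add: partial_add_smooth partial_cmult_smooth smooth_intros)
  qed
  show ?thesis unfolding flux_def p
    by (simp add: sum_distrib_left sum_distrib_right sum.distrib[symmetric] algebra_simps)
qed

section \<open>Positivity of the first eigenvalue\<close>

lemma disk_int_square_pos:
  assumes u: "continuous_on disk u" and x: "x \<in> disk" "u x \<noteq> 0"
  shows "0 < disk_int (\<lambda>x. (u x)\<^sup>2)"
proof (rule ccontr)
  assume "\<not> 0 < disk_int (\<lambda>x. (u x)\<^sup>2)"
  then have 0: "disk_int (\<lambda>x. (u x)\<^sup>2) = 0" using disk_int_nonneg[of "\<lambda>x. (u x)\<^sup>2"] by simp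
  have i: "integrable lborel (\<lambda>x. indicat_real disk x *\<^sub>R (u x)\<^sup>2)"
    using disk_set_integrable[of "\<lambda>x. (u x)\<^sup>2"] u by (simp add: set_integrable_def continuous_intros)
  have "AE x in lborel. indicat_real disk x *\<^sub>R (u x)\<^sup>2 = 0"
    using 0 integral_nonneg_eq_0_iff_AE[OF i] by (simp add: disk_int_def set_lebesgue_integral_def)
  then have ae: "AE x in lborel. x \<in> disk \<longrightarrow> u x = 0" by eventually_elim (auto simp: indicator_def split: if_splits)
  define U where "U = {y \<in> ball 0 1. u y \<in> - {0}}"
  have oU: "open U"
  proof -
    have "continuous_on (ball 0 1) u" using u ball_subset_cball continuous_on_subset by blast
    moreover have "U = ball 0 1 \<inter> u -` (- {0})" by (auto simp: U_def)
    ultimately show ?thesis by (metis continuous_open_preimage open_ball open_Compl closed_singleton)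
  qed
  have "AE x in lborel. x \<notin> U"
    using ae by eventually_elim (auto simp: U_def mem_cball)
  then have "emeasure lborel U = 0"
    using oU by (subst (asm) AE_iff_measurable[of U]) auto
  have "U = {}"
  proof (rule ccontr)
    assume "U \<noteq> {}"
    then obtain y e where y: "e > 0" "ball y e \<subseteq> U" using oU openE by blast
    have "emeasure lborel (ball y e) \<le> emeasure lborel U" using y(2) oU by (intro emeasure_mono) auto
    then have "measure lborel (ball y e) = 0" using \<open>emeasure lborel U = 0\<close> by (simp add: measure_def)
    then show False using content_ball_pos[OF y(1), of y] by simp
  qed
  then have "u y = 0" if "y \<in> ball 0 1" for y using that by (auto simp: U_def)
  then have "u x = 0"
    using continuous_constant_on_closure[of "ball 0 1" u 0 x] u x(1) by simp
  then show False using x(2) by simp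
qed

text \<open>The area density lies between positive constants, so the weighted L2 norm of the
  Rayleigh quotient may be replaced by the Euclidean one. Positivity becomes coercivity on smooth
  functions in a norm common to all metrics.\<close>

lemma lambda1_pos_iff:
  assumes h: "h \<in> riemannian_metrics"
  shows "0 < lambda1 h \<longleftrightarrow> (\<exists>c>0. \<forall>u. smooth_on_disk u \<longrightarrow> c * disk_int (\<lambda>x. (u x)\<^sup>2) \<le> energy h u)"
proof -
  have cD: "continuous_on disk (gD h)" by (rule smooth_on_disk_continuous[OF smooth_metric(4)[OF h]])
  have "\<exists>x\<in>disk. \<forall>y\<in>disk. gD h x \<le> gD h y"
    by (rule continuous_attains_inf[OF compact_cball _ cD]) auto
  then obtain m where m: "m > 0" "\<And>x. x \<in> disk \<Longrightarrow> m \<le> gD h x" using gD_pos[OF h] by blast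
  obtain M where M: "M > 0" "\<And>x. x \<in> disk \<Longrightarrow> \<bar>gD h x\<bar> \<le> M"
    using smooth_on_disk_bounded[OF smooth_metric(4)[OF h]] by blast
  let ?I = "\<lambda>u. disk_int (\<lambda>x. (u x)\<^sup>2)" and ?A = "\<lambda>u. area_integral h (\<lambda>x. (u x)\<^sup>2)"
  have A: "m * ?I u \<le> ?A u" "?A u \<le> M * ?I u" if u: "smooth_on_disk u" for u
  proof -
    have c: "continuous_on disk u" by (rule smooth_on_disk_continuous[OF u])
    have "disk_int (\<lambda>x. m * (u x)\<^sup>2) \<le> disk_int (\<lambda>x. (u x)\<^sup>2 * gD h x)"
      using m(2) by (intro disk_int_mono continuous_intros c cD) (simp add: mult.commute mult_right_mono)
    moreover have "disk_int (\<lambda>x. (u x)\<^sup>2 * gD h x) \<le> disk_int (\<lambda>x. M * (u x)\<^sup>2)"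
      using M(2) by (intro disk_int_mono continuous_intros c cD) (simp add: mult.commute mult_right_mono abs_le_iff)
    ultimately show "m * ?I u \<le> ?A u" "?A u \<le> M * ?I u"
      by (simp_all add: area_integral_disk_int[OF h] disk_int_cmult)
  qed
  show ?thesis
  proof
    assume "0 < lambda1 h"
    then obtain c where c: "0 < ereal c" "ereal c < lambda1 h" using ereal_dense2 by blast
    show "\<exists>c>0. \<forall>u. smooth_on_disk u \<longrightarrow> c * ?I u \<le> energy h u"
    proof (intro exI[of _ "c * m"] conjI allI impI)
      show "c * m > 0" using c m by simp
      fix u assume u: "smooth_on_disk u"
      show "c * m * ?I u \<le> energy h u"
      proof (cases "\<exists>x\<in>disk. u x \<noteq> 0")
        case True
        then have I: "?I u > 0" using disk_int_square_pos smooth_on_disk_continuous[OF u] by blast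
        have Ap: "?A u > 0" using A(1)[OF u] mult_pos_pos[OF m(1) I] by linarith
        have "lambda1 h \<le> ereal (energy h u / ?A u)"
          unfolding lambda1_def by (rule INF_lower) (use u True in auto)
        then have "ereal c < ereal (energy h u / ?A u)" using c(2) by order
        then have "c * ?A u \<le> energy h u" using Ap by (simp add: field_simps)
        moreover have "c * (m * ?I u) \<le> c * ?A u" using A(1)[OF u] c(1) by (intro mult_left_mono) auto
        ultimately show ?thesis by (simp add: mult.assoc)
      next
        case False
        then have z: "u x = 0" if "x \<in> disk" for x using that by blast
        have pz: "partial i u x = 0" if "x \<in> disk" for i x
          using partial_cong[of u "\<lambda>_. 0", OF z that] partial_const[OF that] by simp
        have 1: "?I u = disk_int (\<lambda>x. 0)" by (rule disk_int_cong) (simp add: z)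
        have 2: "disk_int (\<lambda>x. aform h u x - 2 * (u x * (beta1 h x * partial 1 u x + beta2 h x * partial 2 u x))) = disk_int (\<lambda>x. 0)"
          by (rule disk_int_cong) (simp add: z pz aform_def)
        have 3: "circ_int (\<lambda>x. (u x)\<^sup>2) = circ_int (\<lambda>x. 0)" by (rule circ_int_cong) (simp add: z)
        show ?thesis unfolding energy_formula[OF h u] 1 2 3 by simp
      qed
    qed
  next
    assume "\<exists>c>0. \<forall>u. smooth_on_disk u \<longrightarrow> c * ?I u \<le> energy h u"
    then obtain c where c: "c > 0" "\<And>u. smooth_on_disk u \<Longrightarrow> c * ?I u \<le> energy h u" by blast
    have "ereal (c / M) \<le> lambda1 h"
      unfolding lambda1_def
    proof (rule INF_greatest)
      fix u assume "u \<in> {u. smooth_on_disk u \<and> (\<exists>x\<in>disk. u x \<noteq> 0)}"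
      then have u: "smooth_on_disk u" and nz: "\<exists>x\<in>disk. u x \<noteq> 0" by auto
      have I: "?I u > 0" using nz disk_int_square_pos smooth_on_disk_continuous[OF u] by blast
      have Ap: "?A u > 0" using A(1)[OF u] mult_pos_pos[OF m(1) I] by linarith
      have "c / M * ?A u \<le> c / M * (M * ?I u)" using A(2)[OF u] c(1) M(1) by (intro mult_left_mono) auto
      also have "\<dots> = c * ?I u" using M(1) by simp
      also have "\<dots> \<le> energy h u" by (rule c(2)[OF u])
      finally show "ereal (c / M) \<le> ereal (energy h u / ?A u)" using Ap by (simp add: le_divide_eq)
    qed
    moreover have "0 < ereal (c / M)" using c(1) M(1) by simp
    ultimately show "0 < lambda1 h" by order
  qed
qed

section \<open>Every conformal class contains a positive metric\<close>

text \<open>Because the determinant is 1, the smaller eigenvalue is the inverse of the larger one,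
  which is at most the trace and hence at most 2 M. This is the origin of the ellipticity constant 1
  / (2 M).\<close>

lemma metric_elliptic:
  assumes h: "h \<in> riemannian_metrics"
  obtains l M where "elliptic l M (a11 h) (a12 h) (a22 h)"
proof -
  note s = smooth_a[OF h]
  have sp: "smooth_on_disk (partial i (a11 h))" "smooth_on_disk (partial i (a12 h))" "smooth_on_disk (partial i (a22 h))" for i
    using s by (auto intro: smooth_intros)
  have "\<exists>M>0. \<forall>f\<in>S. \<forall>x\<in>disk. \<bar>f x\<bar> \<le> M" if "finite S" "\<forall>f\<in>S. smooth_on_disk f" for S
    using that
  proof (induction S)
    case empty
    then show ?case by (auto intro: exI[of _ 1])
  next
    case (insert f S)
    then obtain M where M: "M > 0" "\<forall>f\<in>S. \<forall>x\<in>disk. \<bar>f x\<bar> \<le> M" by auto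
    obtain K where K: "K > 0" "\<And>x. x \<in> disk \<Longrightarrow> \<bar>f x\<bar> \<le> K" using insert.prems smooth_on_disk_bounded[of f] by auto
    show ?case
    proof (intro exI[of _ "max M K"] conjI ballI)
      show "0 < max M K" using M by simp
      fix g x assume "g \<in> insert f S" "x \<in> disk"
      then show "\<bar>g x\<bar> \<le> max M K" using M(2) K(2)[of x] by (auto simp: le_max_iff_disj)
    qed
  qed
  from this[of "{a11 h, a12 h, a22 h, partial 1 (a11 h), partial 1 (a12 h), partial 1 (a22 h),
      partial 2 (a11 h), partial 2 (a12 h), partial 2 (a22 h)}"]
  obtain M where M: "M > 0" "\<And>x. x \<in> disk \<Longrightarrow> \<bar>a11 h x\<bar> \<le> M \<and> \<bar>a12 h x\<bar> \<le> M \<and> \<bar>a22 h x\<bar> \<le> M \<and>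
      \<bar>partial 1 (a11 h) x\<bar> \<le> M \<and> \<bar>partial 1 (a12 h) x\<bar> \<le> M \<and> \<bar>partial 1 (a22 h) x\<bar> \<le> M \<and>
      \<bar>partial 2 (a11 h) x\<bar> \<le> M \<and> \<bar>partial 2 (a12 h) x\<bar> \<le> M \<and> \<bar>partial 2 (a22 h) x\<bar> \<le> M"
    using s sp by auto
  have "1 / (2 * M) * (v\<^sup>2 + w\<^sup>2) \<le> a11 h x * v\<^sup>2 + 2 * a12 h x * v * w + a22 h x * w\<^sup>2" if x: "x \<in> disk" for x v w
  proof -
    let ?a = "a11 h x" and ?b = "a12 h x" and ?c = "a22 h x"
    define q where "q = ?a * v\<^sup>2 + 2 * ?b * v * w + ?c * w\<^sup>2"
    have q: "0 \<le> q" unfolding q_def by (rule a_form_nonneg[OF h x])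
    have "(?a + ?c) * q = (?a * ?c - ?b * ?b) * (v\<^sup>2 + w\<^sup>2) + (?a * v + ?b * w)\<^sup>2 + (?b * v + ?c * w)\<^sup>2"
      by (simp add: q_def power2_eq_square algebra_simps)
    then have "v\<^sup>2 + w\<^sup>2 \<le> (?a + ?c) * q" using a_det[OF h x] by simp
    also have "\<dots> \<le> (2 * M) * q" using M(2)[OF x] q by (intro mult_right_mono) linarith+
    finally have "1 / (2 * M) * (v\<^sup>2 + w\<^sup>2) \<le> q" using M(1) by (simp add: field_simps)
    then show ?thesis unfolding q_def .
  qed
  then have "elliptic (1 / (2 * M)) M (a11 h) (a12 h) (a22 h)"
    unfolding elliptic_def using M s by (auto simp: forall_2)
  then show ?thesis using that by blast
qed

lemma aform_lower:
  assumes "elliptic l M (a11 h) (a12 h) (a22 h)" "x \<in> disk"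
  shows "l * ((partial 1 u x)\<^sup>2 + (partial 2 u x)\<^sup>2) \<le> aform h u x"
  using assms unfolding elliptic_def aform_def by blast

text \<open>The rotated gradient of \<psi> is divergence free, and its normal component on the
  circle is a tangential derivative of \<psi>, hence zero. So it pairs to zero with the gradient of
  the square of u.\<close>

lemma dirichlet_flux_zero:
  assumes \<psi>: "dirichlet \<psi>" and u: "smooth_on_disk u"
  shows "disk_int (\<lambda>x. u x * (partial 1 \<psi> x * partial 2 u x - partial 2 \<psi> x * partial 1 u x)) = 0"
proof -
  have s: "smooth_on_disk \<psi>" using \<psi> by (simp add: dirichlet_def)
  have "disk_int (\<lambda>x. 2 * (u x * (partial 1 \<psi> x * partial 2 u x - partial 2 \<psi> x * partial 1 u x)))
    = disk_int (\<lambda>x. partial 1 (\<lambda>x. - ((u x)\<^sup>2 * partial 2 \<psi> x)) x + partial 2 (\<lambda>x. (u x)\<^sup>2 * partial 1 \<psi> x) x)"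
  proof (rule disk_int_cong)
    fix x :: "real^2" assume x: "x \<in> disk"
    have "partial 1 (partial 2 \<psi>) x = partial 2 (partial 1 \<psi>) x" by (rule partial_commute[OF s x])
    then show "2 * (u x * (partial 1 \<psi> x * partial 2 u x - partial 2 \<psi> x * partial 1 u x))
      = partial 1 (\<lambda>x. - ((u x)\<^sup>2 * partial 2 \<psi> x)) x + partial 2 (\<lambda>x. (u x)\<^sup>2 * partial 1 \<psi> x) x"
      using x by (simp add: partial_mult_smooth partial_minus_smooth s u smooth_intros partial_square algebra_simps)
  qed
  also have "\<dots> = circ_int (\<lambda>x. - ((u x)\<^sup>2 * partial 2 \<psi> x) * x$1 + (u x)\<^sup>2 * partial 1 \<psi> x * x$2)"
    by (rule divergence_smooth2) (intro smooth_intros s u)+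
  also have "\<dots> = circ_int (\<lambda>x. 0)"
  proof (rule circ_int_cong)
    fix x :: "real^2" assume x: "x \<in> sphere 0 1"
    have "dtheta \<psi> x = dtheta (\<lambda>_. 0) x"
      by (rule dtheta_cong_sphere[OF s _ _ x]) (use \<psi> in \<open>auto simp: dirichlet_def intro: smooth_intros\<close>)
    then have "x$1 * partial 2 \<psi> x = x$2 * partial 1 \<psi> x" using x by (simp add: dtheta_def partial_const)
    then show "- ((u x)\<^sup>2 * partial 2 \<psi> x) * x$1 + (u x)\<^sup>2 * partial 1 \<psi> x * x$2 = 0" by algebra
  qed
  finally show ?thesis by (simp add: disk_int_cmult)
qed

text \<open>The \<open>L\<^sup>4\<close> size of the gradient of a solution of the flat Dirichlet problem is controlled by the
  \<open>L\<^sup>2\<close> size of the right-hand side.\<close>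

lemma dirichlet_gradient_H1:
  obtains K where "K > 0" "\<And>\<psi> i. dirichlet \<psi> \<Longrightarrow> H1_sq (partial i \<psi>) \<le> (K * disk_norm (laplacian \<psi>))\<^sup>2"
proof -
  obtain K where K: "0 < K" "\<And>a b c \<psi>. elliptic 1 1 a b c \<Longrightarrow> dirichlet \<psi> \<Longrightarrow> H2_norm \<psi> \<le> K * disk_norm (divform a b c \<psi>)"
    using H2_estimate[of 1 1] by auto
  have e: "elliptic 1 1 (\<lambda>_. 1) (\<lambda>_. 0) (\<lambda>_. 1)" by (auto simp: elliptic_def partial_const intro: smooth_intros)
  show ?thesis
  proof
    show "2 * K > 0" using K by simp
    fix \<psi> i assume d: "dirichlet \<psi>"
    then have s: "smooth_on_disk \<psi>" by (simp add: dirichlet_def)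
    let ?d = "\<lambda>i j. partial i (partial j \<psi>)" and ?H = "H2_norm \<psi>"
    have "disk_norm (divform (\<lambda>_. 1) (\<lambda>_. 0) (\<lambda>_. 1) \<psi>) = disk_norm (laplacian \<psi>)"
      by (rule disk_norm_cong) (simp add: divform_expand smooth_intros s laplacian_def partial_const)
    then have H: "?H \<le> K * disk_norm (laplacian \<psi>)" using K(2)[OF e d] by simp
    have H0: "0 \<le> ?H" by (simp add: H2_norm_def)
    have n: "disk_norm (?d i j) \<le> ?H" for i j
    proof -
      have "disk_norm (?d 2 1) = disk_norm (?d 1 2)" by (rule disk_norm_cong) (rule partial_commute[OF s])
      then show ?thesis
        unfolding H2_norm_def using exhaust_2[of i] exhaust_2[of j] disk_norm_nonneg[of "partial 1 \<psi>"] disk_norm_nonneg[of "partial 2 \<psi>"]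
          disk_norm_nonneg[of "?d 1 1"] disk_norm_nonneg[of "?d 1 2"] disk_norm_nonneg[of "?d 2 2"] by auto
    qed
    let ?p = "\<lambda>x. x$1 * partial 1 \<psi> x + x$2 * partial 2 \<psi> x"
    \<comment> \<open>The boundary part of \<open>H1_sq\<close> is not controlled by interior L2
      norms of first derivatives alone. Here \<open>integral_hessian_det\<close> is used as an
      identity: the squared normal derivative integrates to twice the Hessian determinant.\<close>
    have "circ_int (\<lambda>x. (partial i \<psi> x)\<^sup>2) = circ_int (\<lambda>x. (?p x)\<^sup>2 * (x$i)\<^sup>2)"
      by (rule circ_int_cong) (subst dirichlet_gradient_radial[OF d], assumption, simp add: power_mult_distrib)
    also have "\<dots> \<le> circ_int (\<lambda>x. (?p x)\<^sup>2)"
    proof (rule circ_int_mono)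
      fix x :: "real^2" assume "x \<in> disk"
      then have "\<bar>x$i\<bar> \<le> 1" using component_le_norm_cart[of x i] by (simp add: mem_cball)
      then have "(x$i)\<^sup>2 \<le> 1" by (simp add: abs_square_le_1)
      then show "(?p x)\<^sup>2 * (x$i)\<^sup>2 \<le> (?p x)\<^sup>2" by (simp add: mult_left_le)
    qed (intro smooth_on_disk_continuous smooth_intros s)+
    also have "\<dots> = 2 * disk_int (\<lambda>x. ?d 1 1 x * ?d 2 2 x - (?d 1 2 x)\<^sup>2)"
      using integral_hessian_det[OF d] by simp
    also have "disk_int (\<lambda>x. ?d 1 1 x * ?d 2 2 x - (?d 1 2 x)\<^sup>2) \<le> disk_int (\<lambda>x. ?d 1 1 x * ?d 2 2 x)"
      by (rule disk_int_mono) (auto intro!: smooth_on_disk_continuous smooth_intros s)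
    also have "\<dots> \<le> disk_norm (?d 1 1) * disk_norm (?d 2 2)"
      using disk_cauchy_schwarz[of "?d 1 1" "?d 2 2"] by (simp add: smooth_on_disk_continuous smooth_intros s abs_le_iff)
    also have "\<dots> \<le> ?H * ?H" by (intro mult_mono n H0) simp
    finally have c: "circ_int (\<lambda>x. (partial i \<psi> x)\<^sup>2) \<le> 2 * (?H * ?H)" by simp
    have sq: "(disk_norm (?d j i))\<^sup>2 \<le> ?H * ?H" for j
      unfolding power2_eq_square by (intro mult_mono n H0) simp
    have "H1_sq (partial i \<psi>) \<le> 4 * (?H * ?H)"
      using H1_sq_eq[of "partial i \<psi>"] sq[of 1] sq[of 2] c by (simp add: smooth_intros s)
    also have "\<dots> = (2 * ?H)\<^sup>2" by (simp add: power2_eq_square)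
    also have "\<dots> \<le> (2 * (K * disk_norm (laplacian \<psi>)))\<^sup>2" using H H0 by (intro power_mono) auto
    finally show "H1_sq (partial i \<psi>) \<le> (2 * K * disk_norm (laplacian \<psi>))\<^sup>2" by (simp add: mult.assoc)
  qed
qed

text \<open>Both factors are bounded in L4 by \<open>sobolev_disk\<close>, and Cauchy-Schwarz
  applied to their squares puts the product in L2.\<close>

lemma product_estimate:
  assumes k: "smooth_on_disk k" and u: "smooth_on_disk u" and B: "H1_sq k \<le> B\<^sup>2" "0 \<le> B"
  shows "disk_norm (\<lambda>x. k x * u x) \<le> 10 * B * sqrt (H1_sq u)"
proof (rule power2_le_imp_le)
  have N: "0 \<le> H1_sq u" "0 \<le> H1_sq k" using H1_sq_bounds(3) u k by auto
  have "(disk_norm (\<lambda>x. k x * u x))\<^sup>2 = disk_int (\<lambda>x. (k x)\<^sup>2 * (u x)\<^sup>2)"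
    unfolding disk_norm_sq by (simp add: power_mult_distrib)
  also have "\<dots> \<le> disk_norm (\<lambda>x. (k x)\<^sup>2) * disk_norm (\<lambda>x. (u x)\<^sup>2)"
    using disk_cauchy_schwarz[of "\<lambda>x. (k x)\<^sup>2" "\<lambda>x. (u x)\<^sup>2"] k u
    by (simp add: smooth_on_disk_continuous smooth_intros abs_le_iff)
  also have "\<dots> \<le> (10 * H1_sq k) * (10 * H1_sq u)"
    by (intro mult_mono sobolev_disk k u) (use N in auto)
  also have "\<dots> \<le> (10 * B\<^sup>2) * (10 * H1_sq u)" using B N by (intro mult_right_mono) auto
  also have "\<dots> = (10 * B * sqrt (H1_sq u))\<^sup>2" using N by (simp add: power_mult_distrib)
  finally show "(disk_norm (\<lambda>x. k x * u x))\<^sup>2 \<le> (10 * B * sqrt (H1_sq u))\<^sup>2" .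
qed (use B H1_sq_bounds(3)[OF u] in simp)

text \<open>With \<open>A\<close> the conformal cometric, \<open>\<beta>\<close> the first-order coefficient and \<open>J\<close> the rotation, one wants
  \<open>\<phi>\<close> with \<open>A \<nabla>\<phi> - \<beta> = J \<nabla>\<psi>\<close>, \<open>\<psi>\<close> vanishing on the boundary, since such a field does not
  contribute to the energy. The Dirichlet problem for \<open>\<psi>\<close> is solved up to an \<open>L\<^sup>2\<close>-small error, which is
  removed by the gradient of a solution \<open>\<xi>\<close> of a flat Dirichlet problem.\<close>

theorem good_factor_exists:
  assumes h: "h \<in> riemannian_metrics"
  obtains ms c where "c > 0" "\<And>u. smooth_on_disk u \<Longrightarrow> c * H1_sq u \<le> energy (conformal (rpoly ms) h) u"
proof -
  obtain l M where e: "elliptic l M (a11 h) (a12 h) (a22 h)" using metric_elliptic[OF h] by blast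
  then have l: "l > 0" and M: "M > 0" by (auto simp: elliptic_def)
  have aM: "\<bar>a11 h x\<bar> \<le> M" "\<bar>a12 h x\<bar> \<le> M" "\<bar>a22 h x\<bar> \<le> M" if "x \<in> disk" for x
    using e that by (auto simp: elliptic_def)
  obtain K where K: "K > 0" "\<And>\<psi> i. dirichlet \<psi> \<Longrightarrow> H1_sq (partial i \<psi>) \<le> (K * disk_norm (laplacian \<psi>))\<^sup>2"
    using dirichlet_gradient_H1 by blast
  define m where "m = disk_norm (\<lambda>_. 1)"
  have m: "m > 0" using disk_norm_1_pos by (simp add: m_def)
  define c where "c = min l 1"
  have c: "c > 0" "c \<le> l" "c \<le> 1" using l by (auto simp: c_def)
  \<comment> \<open>The 15 is 3 from the approximation by polynomials times 5 from Poincare; the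
    rest comes from \<open>product_estimate\<close> applied to the derivatives of \<xi>.\<close>
  define C where "C = 15 + 10 * (K * (1 + m))"
  have C: "C > 0" using K m by (simp add: C_def add_pos_pos)
  \<comment> \<open>Four error terms of size M * C * \<epsilon>, counted twice in the energy, then
    use up half of the coercivity constant \<open>c\<close>.\<close>
  define \<epsilon> where "\<epsilon> = c / (16 * M * C)"
  have \<epsilon>: "\<epsilon> > 0" using c M C by (simp add: \<epsilon>_def)
  note sa = smooth_a[OF h] and sb = smooth_beta[OF h]
  \<comment> \<open>The inverse of the matrix (a11, a12; a12, a22) applied to \<beta>; with
    determinant 1 the inverse is the cofactor matrix.\<close>
  define W1 where "W1 = (\<lambda>x. a22 h x * beta1 h x - a12 h x * beta2 h x)"
  define W2 where "W2 = (\<lambda>x. a11 h x * beta2 h x - a12 h x * beta1 h x)"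
  have sW: "smooth_on_disk W1" "smooth_on_disk W2" unfolding W1_def W2_def by (intro smooth_intros sa sb)+
  \<comment> \<open>The gradient of \<phi> should be the inverse matrix applied to \<beta> + J grad
    \<psi>, which is the field (F1, F2) introduced further on. Its curl is the residual
    \<open>r\<close> of this equation, because determinant 1 lets the inverse matrix pass to the
    other side of the rotation J.\<close>
  obtain \<psi> where \<psi>: "dirichlet \<psi>" "disk_norm (\<lambda>x. (partial 2 W1 x - partial 1 W2 x) - divform (a11 h) (a12 h) (a22 h) \<psi> x) < \<epsilon>"
    using dense_range_divform[OF e] \<epsilon> sW unfolding dense_range_def
    by (metis smooth_on_disk_diff smooth_on_disk_partial)
  have s\<psi>: "smooth_on_disk \<psi>" using \<psi>(1) by (simp add: dirichlet_def)
  define r where "r = (\<lambda>x. divform (a11 h) (a12 h) (a22 h) \<psi> x - (partial 2 W1 x - partial 1 W2 x))"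
  have sr: "smooth_on_disk r" unfolding r_def by (intro smooth_intros sa sW s\<psi>)
  have nr: "disk_norm r < \<epsilon>"
  proof -
    have "disk_norm r = disk_norm (\<lambda>x. (partial 2 W1 x - partial 1 W2 x) - divform (a11 h) (a12 h) (a22 h) \<psi> x)"
      unfolding disk_norm_def r_def by (simp add: power2_commute)
    then show ?thesis using \<psi>(2) by simp
  qed
  obtain \<xi> where \<xi>: "dirichlet \<xi>" "\<And>x. x \<in> disk \<Longrightarrow> \<bar>r x - laplacian \<xi> x\<bar> < \<epsilon>"
    using poisson_dense[OF smooth_on_disk_continuous[OF sr] \<epsilon>] by blast
  have s\<xi>: "smooth_on_disk \<xi>" using \<xi>(1) by (simp add: dirichlet_def)
  have sl: "smooth_on_disk (laplacian \<xi>)" unfolding laplacian_def[abs_def] by (intro smooth_intros s\<xi>)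
  have "disk_norm (laplacian \<xi>) \<le> (1 + m) * \<epsilon>"
  proof -
    have "disk_norm (laplacian \<xi>) = disk_norm (\<lambda>x. r x - (r x - laplacian \<xi> x))" by (rule disk_norm_cong) simp
    also have "\<dots> \<le> disk_norm r + disk_norm (\<lambda>x. r x - laplacian \<xi> x)"
      by (rule disk_norm_triangle_diff) (intro smooth_on_disk_continuous smooth_intros sr sl)+
    also have "disk_norm (\<lambda>x. r x - laplacian \<xi> x) \<le> disk_norm (\<lambda>x. \<epsilon> * 1)"
      by (rule disk_norm_mono) (use \<xi>(2) \<epsilon> in \<open>auto intro!: smooth_on_disk_continuous smooth_intros sr sl less_imp_le\<close>)
    also have "\<dots> = \<epsilon> * m" using \<epsilon> unfolding disk_norm_cmult m_def by simp
    finally show ?thesis using nr by (simp add: algebra_simps)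
  qed
  then have "(K * disk_norm (laplacian \<xi>))\<^sup>2 \<le> (K * ((1 + m) * \<epsilon>))\<^sup>2"
    using K(1) by (intro power_mono mult_left_mono) auto
  then have kx: "H1_sq (partial i \<xi>) \<le> (K * ((1 + m) * \<epsilon>))\<^sup>2" for i
    using K(2)[OF \<xi>(1), of i] by linarith
  define F1 where "F1 = (\<lambda>x. W1 x - (a12 h x * partial 1 \<psi> x + a22 h x * partial 2 \<psi> x))"
  define F2 where "F2 = (\<lambda>x. W2 x + (a11 h x * partial 1 \<psi> x + a12 h x * partial 2 \<psi> x))"
  have sF: "smooth_on_disk F1" "smooth_on_disk F2" unfolding F1_def F2_def by (intro smooth_intros sa sW s\<psi>)+
  \<comment> \<open>Removing the rotated gradient of \<xi> lowers the curl by
    \<open>laplacian \<xi>\<close>. The remaining curl is uniformly small, as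
    \<open>gradient_approximation\<close> requires, at the price of an error that is small only in
    H1.\<close>
  define G1 where "G1 = (\<lambda>x. F1 x + partial 2 \<xi> x)"
  define G2 where "G2 = (\<lambda>x. F2 x - partial 1 \<xi> x)"
  have sG: "smooth_on_disk G1" "smooth_on_disk G2" unfolding G1_def G2_def by (intro smooth_intros sF s\<xi>)+
  have "\<bar>partial 1 G2 x - partial 2 G1 x\<bar> \<le> \<epsilon>" if x: "x \<in> disk" for x
  proof -
    have F: "partial 1 F2 x - partial 2 F1 x = r x"
    proof -
      have "partial 1 F2 x = partial 1 W2 x + partial 1 (\<lambda>x. a11 h x * partial 1 \<psi> x + a12 h x * partial 2 \<psi> x) x"
        unfolding F2_def by (rule partial_add_smooth[OF _ _ x]) (intro smooth_intros sa sW s\<psi>)+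
      moreover have "partial 2 F1 x = partial 2 W1 x - partial 2 (\<lambda>x. a12 h x * partial 1 \<psi> x + a22 h x * partial 2 \<psi> x) x"
        unfolding F1_def by (rule partial_diff_smooth[OF _ _ x]) (intro smooth_intros sa sW s\<psi>)+
      ultimately show ?thesis by (simp add: r_def divform_def)
    qed
    have "partial 1 G2 x = partial 1 F2 x - partial 1 (partial 1 \<xi>) x" "partial 2 G1 x = partial 2 F1 x + partial 2 (partial 2 \<xi>) x"
      unfolding G1_def G2_def using x by (simp_all add: partial_diff_smooth partial_add_smooth sF s\<xi> smooth_intros)
    then have "partial 1 G2 x - partial 2 G1 x = r x - laplacian \<xi> x" using F by (simp add: laplacian_def)
    then show ?thesis using \<xi>(2)[OF x] by simp
  qed
  then obtain ms where ms: "\<And>x. x \<in> disk \<Longrightarrow> \<bar>partial 1 (rpoly ms) x - G1 x\<bar> \<le> 3 * \<epsilon>"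
    "\<And>x. x \<in> disk \<Longrightarrow> \<bar>partial 2 (rpoly ms) x - G2 x\<bar> \<le> 3 * \<epsilon>"
    using gradient_approximation[OF sG \<epsilon>] by blast
  define \<phi> where "\<phi> = rpoly ms"
  have s\<phi>: "smooth_on_disk \<phi>" unfolding \<phi>_def by (rule smooth_on_disk_rpoly)
  define k where "k i = (if i = (1::2) then (\<lambda>x. partial 1 \<phi> x - F1 x) else (\<lambda>x. partial 2 \<phi> x - F2 x))" for i
  have k: "k 1 = (\<lambda>x. partial 1 \<phi> x - F1 x)" "k 2 = (\<lambda>x. partial 2 \<phi> x - F2 x)" by (simp_all add: k_def)
  have sk: "smooth_on_disk (k i)" for i unfolding k_def using s\<phi> sF by (auto intro: smooth_intros)
  have ku: "disk_norm (\<lambda>x. k i x * u x) \<le> C * \<epsilon> * sqrt (H1_sq u)" if u: "smooth_on_disk u" for i u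
  proof -
    have N: "0 \<le> H1_sq u" by (rule H1_sq_bounds(3)[OF u])
    \<comment> \<open>The error field splits into a uniformly small part \<open>g\<close>, from the
      polynomial approximation, and a derivative of \<xi>.\<close>
    have "\<exists>j g. smooth_on_disk g \<and> (\<forall>x\<in>disk. \<bar>g x\<bar> \<le> 3 * \<epsilon>) \<and> (\<forall>x\<in>disk. \<bar>k i x - g x\<bar> = \<bar>partial j \<xi> x\<bar>)"
    proof (cases "i = 1")
      case True
      show ?thesis
        by (rule exI[of _ 2], rule exI[of _ "\<lambda>x. partial 1 \<phi> x - G1 x"])
          (use ms(1) in \<open>auto simp: True k \<phi>_def[symmetric] G1_def[symmetric] intro!: smooth_intros s\<phi> sG, simp add: G1_def\<close>)
    next
      case False
      then have i: "i = 2" using exhaust_2[of i] by auto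
      show ?thesis
        by (rule exI[of _ 1], rule exI[of _ "\<lambda>x. partial 2 \<phi> x - G2 x"])
          (use ms(2) in \<open>auto simp: i k \<phi>_def[symmetric] G2_def[symmetric] intro!: smooth_intros s\<phi> sG, simp add: G2_def\<close>)
    qed
    then obtain j g where g: "smooth_on_disk g" "\<And>x. x \<in> disk \<Longrightarrow> \<bar>g x\<bar> \<le> 3 * \<epsilon>" "\<And>x. x \<in> disk \<Longrightarrow> \<bar>k i x - g x\<bar> = \<bar>partial j \<xi> x\<bar>" by blast
    have "disk_norm (\<lambda>x. k i x * u x) = disk_norm (\<lambda>x. g x * u x + (k i x - g x) * u x)"
      by (rule disk_norm_cong) (simp add: algebra_simps)
    also have "\<dots> \<le> disk_norm (\<lambda>x. g x * u x) + disk_norm (\<lambda>x. (k i x - g x) * u x)"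
      by (rule disk_norm_triangle) (intro smooth_on_disk_continuous smooth_intros sk g(1) u)+
    also have "disk_norm (\<lambda>x. (k i x - g x) * u x) \<le> disk_norm (\<lambda>x. partial j \<xi> x * u x)"
      by (rule disk_norm_mono, (intro smooth_on_disk_continuous smooth_intros sk g(1) u s\<xi>)+) (simp add: abs_mult g(3))
    also have "\<dots> \<le> 10 * (K * ((1 + m) * \<epsilon>)) * sqrt (H1_sq u)"
      by (rule product_estimate[OF _ u kx]) (use K m \<epsilon> s\<xi> in \<open>auto intro: smooth_intros\<close>)
    also have "disk_norm (\<lambda>x. g x * u x) \<le> 3 * \<epsilon> * disk_norm u"
      by (rule disk_norm_mult_bound[OF _ _ g(2)]) (intro smooth_on_disk_continuous g(1) u)+
    also have "disk_norm u \<le> 5 * sqrt (H1_sq u)"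
      by (rule power2_le_imp_le) (use poincare_disk[OF u] N in \<open>auto simp: power_mult_distrib\<close>)
    finally show ?thesis using \<epsilon> by (simp add: C_def algebra_simps)
  qed
  have main: "c / 2 * H1_sq u \<le> energy (conformal \<phi> h) u" if u: "smooth_on_disk u" for u
  proof -
    let ?p = "\<lambda>i. partial i u" and ?N = "H1_sq u"
    have N: "0 \<le> ?N" by (rule H1_sq_bounds(3)[OF u])
    define T where "T a i j = (\<lambda>x. a x * ((k i x * u x) * ?p j x))" for a :: "real^2 \<Rightarrow> real" and i j
    have T: "\<bar>disk_int (T a i j)\<bar> \<le> M * C * \<epsilon> * ?N" if a: "smooth_on_disk a" "\<And>x. x \<in> disk \<Longrightarrow> \<bar>a x\<bar> \<le> M" for a i j
    proof -
      have "disk_int (T a i j) = disk_int (\<lambda>x. (a x * (k i x * u x)) * ?p j x)"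
        by (rule disk_int_cong) (simp add: T_def)
      then have "\<bar>disk_int (T a i j)\<bar> \<le> disk_norm (\<lambda>x. a x * (k i x * u x)) * disk_norm (?p j)"
        using disk_cauchy_schwarz[of "\<lambda>x. a x * (k i x * u x)" "?p j"] a(1) sk u
        by (simp add: smooth_on_disk_continuous smooth_intros)
      also have "\<dots> \<le> (M * (C * \<epsilon> * sqrt ?N)) * sqrt ?N"
      proof (rule mult_mono)
        have "disk_norm (\<lambda>x. a x * (k i x * u x)) \<le> M * disk_norm (\<lambda>x. k i x * u x)"
          by (rule disk_norm_mult_bound[OF _ _ a(2)]) (intro smooth_on_disk_continuous smooth_intros a(1) sk u)+
        also have "\<dots> \<le> M * (C * \<epsilon> * sqrt ?N)" using ku[OF u] M by (intro mult_left_mono) auto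
        finally show "disk_norm (\<lambda>x. a x * (k i x * u x)) \<le> M * (C * \<epsilon> * sqrt ?N)" .
        show "disk_norm (?p j) \<le> sqrt ?N" by (rule real_le_rsqrt[OF H1_sq_bounds(1)[OF u]])
      qed (use M C \<epsilon> N in auto)
      also have "\<dots> = M * C * \<epsilon> * (sqrt ?N * sqrt ?N)" by (simp add: algebra_simps)
      finally show ?thesis using N by simp
    qed
    have sT: "continuous_on disk (T (a11 h) i j)" "continuous_on disk (T (a12 h) i j)" "continuous_on disk (T (a22 h) i j)" for i j
      unfolding T_def by (intro smooth_on_disk_continuous smooth_intros sa sk u)+
    let ?J = "\<lambda>x. u x * (partial 1 \<psi> x * partial 2 u x - partial 2 \<psi> x * partial 1 u x)"
    have sJ: "continuous_on disk ?J" by (intro smooth_on_disk_continuous smooth_intros u s\<psi>)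
    let ?E = "\<lambda>x. (T (a11 h) 1 1 x + T (a12 h) 2 1 x) + (T (a12 h) 1 2 x + T (a22 h) 2 2 x)"
    have ET: "disk_int ?E = (disk_int (T (a11 h) 1 1) + disk_int (T (a12 h) 2 1)) + (disk_int (T (a12 h) 1 2) + disk_int (T (a22 h) 2 2))"
      by (simp add: disk_int_add continuous_intros sT)
    have "\<bar>disk_int ?E\<bar> \<le> 4 * (M * C * \<epsilon> * ?N)"
      unfolding ET using T[OF sa(1) aM(1), of 1 1] T[OF sa(2) aM(2), of 2 1] T[OF sa(2) aM(2), of 1 2] T[OF sa(3) aM(3), of 2 2]
      by linarith
    also have "4 * (M * C * \<epsilon> * ?N) = c / 4 * ?N" using M C by (simp add: \<epsilon>_def field_simps)
    finally have E: "\<bar>disk_int ?E\<bar> \<le> c / 4 * ?N" .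
    have "energy (conformal \<phi> h) u = disk_int (\<lambda>x. aform h u x - 2 * (u x * (beta1 (conformal \<phi> h) x * ?p 1 x + beta2 (conformal \<phi> h) x * ?p 2 x)))
        + circ_int (\<lambda>x. (u x)\<^sup>2)"
      unfolding energy_formula[OF conformal_metric[OF h s\<phi>] u]
      by (rule arg_cong2[where f = "(+)", OF disk_int_cong refl]) (simp add: conformal_a[OF h])
    also have "disk_int (\<lambda>x. aform h u x - 2 * (u x * (beta1 (conformal \<phi> h) x * ?p 1 x + beta2 (conformal \<phi> h) x * ?p 2 x)))
      = disk_int (\<lambda>x. aform h u x + (2 * ?J x + 2 * ?E x))"
    proof (rule disk_int_cong)
      fix x :: "real^2" assume x: "x \<in> disk"
      have d: "a11 h x * a22 h x - a12 h x * a12 h x = 1" by (rule a_det[OF h x])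
      have "a11 h x * F1 x + a12 h x * F2 x = beta1 h x - partial 2 \<psi> x"
        unfolding F1_def F2_def W1_def W2_def using d by algebra
      moreover have "a12 h x * F1 x + a22 h x * F2 x = beta2 h x + partial 1 \<psi> x"
        unfolding F1_def F2_def W1_def W2_def using d by algebra
      moreover have "partial 1 \<phi> x = F1 x + k 1 x" "partial 2 \<phi> x = F2 x + k 2 x" by (simp_all add: k)
      ultimately have b: "beta1 (conformal \<phi> h) x = partial 2 \<psi> x - (a11 h x * k 1 x + a12 h x * k 2 x)"
        "beta2 (conformal \<phi> h) x = - partial 1 \<psi> x - (a12 h x * k 1 x + a22 h x * k 2 x)"
        unfolding conformal_beta[OF h s\<phi> x] by algebra+
      show "aform h u x - 2 * (u x * (beta1 (conformal \<phi> h) x * ?p 1 x + beta2 (conformal \<phi> h) x * ?p 2 x)) = aform h u x + (2 * ?J x + 2 * ?E x)"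
        unfolding b T_def by (simp add: algebra_simps)
    qed
    also have "\<dots> = disk_int (aform h u) + (2 * disk_int ?J + 2 * disk_int ?E)"
      by (simp add: disk_int_add disk_int_cmult continuous_intros sT sJ smooth_on_disk_continuous[OF smooth_aform[OF h u]])
    also have "disk_int ?J = 0" by (rule dirichlet_flux_zero[OF \<psi>(1) u])
    finally have en: "energy (conformal \<phi> h) u = disk_int (aform h u) + 2 * disk_int ?E + circ_int (\<lambda>x. (u x)\<^sup>2)" by simp
    have "disk_int (\<lambda>x. c * ((?p 1 x)\<^sup>2 + (?p 2 x)\<^sup>2)) \<le> disk_int (aform h u)"
    proof (rule disk_int_mono)
      fix x :: "real^2" assume x: "x \<in> disk"
      have "c * ((?p 1 x)\<^sup>2 + (?p 2 x)\<^sup>2) \<le> l * ((?p 1 x)\<^sup>2 + (?p 2 x)\<^sup>2)" using c by (intro mult_right_mono) auto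
      also have "\<dots> \<le> aform h u x" by (rule aform_lower[OF e x])
      finally show "c * ((?p 1 x)\<^sup>2 + (?p 2 x)\<^sup>2) \<le> aform h u x" .
    qed (intro smooth_on_disk_continuous smooth_intros h u)+
    moreover have "0 \<le> circ_int (\<lambda>x. (u x)\<^sup>2)" by (intro circ_int_nonneg) simp
    then have "c * circ_int (\<lambda>x. (u x)\<^sup>2) \<le> circ_int (\<lambda>x. (u x)\<^sup>2)" using c by (simp add: mult_left_le_one_le)
    ultimately have "c * ?N \<le> disk_int (aform h u) + circ_int (\<lambda>x. (u x)\<^sup>2)"
      unfolding H1_sq_def disk_int_cmult by (simp add: distrib_left)
    then show ?thesis unfolding en using E by linarith
  qed
  show ?thesis by (rule that[of "c / 2" ms]) (use c main in \<open>simp_all add: \<phi>_def\<close>)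
qed

section \<open>Continuous dependence on the metric, the choice of conformal factors, and the
  contraction\<close>

section \<open>Convergence of metrics\<close>

text \<open>Convergence in the smooth topology along an arbitrary filter. In this form continuity of
  a map on metrics reduces to the closure rules collected in \<open>smooth_intros\<close>.\<close>

definition metric_limit :: "'a filter \<Rightarrow> ('a \<Rightarrow> metric_field) \<Rightarrow> metric_field \<Rightarrow> bool" where
  "metric_limit F g g0 \<longleftrightarrow> (\<forall>\<^sub>F a in F. g a \<in> riemannian_metrics) \<and> g0 \<in> riemannian_metrics \<and>
     (\<forall>i j. smooth_limit F (\<lambda>a x. g a x $ i $ j) (\<lambda>x. g0 x $ i $ j))"

text \<open>A radius \<open>d\<close> strictly below \<open>e\<close> builds in the slack needed for
  the triangle inequality, which the pointwise strict bounds of \<open>Ck_close\<close> do not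
  provide by themselves.\<close>

lemma openin_Ck_ball:
  "openin metrics_topology {h \<in> riemannian_metrics. \<exists>d<e. Ck_close k d g0 h}" (is "openin _ ?N")
  unfolding openin_metrics_topology Cinf_open_def
proof (intro conjI ballI)
  show "?N \<subseteq> riemannian_metrics" by auto
  fix g assume "g \<in> ?N"
  then obtain d where d: "d < e" "Ck_close k d g0 g" by auto
  have "h \<in> ?N" if h: "h \<in> riemannian_metrics" "Ck_close k ((e - d) / 2) g h" for h
  proof -
    have "Ck_close k (d + (e - d) / 2) g0 h"
      unfolding Ck_close_def
    proof (intro allI ballI impI)
      fix "is" :: "2 list" and i j :: 2 and x :: "real^2"
      assume "x \<in> disk" "length is \<le> k"
      then have "\<bar>partials is (\<lambda>x. g0 x $ i $ j) x - partials is (\<lambda>x. g x $ i $ j) x\<bar> < d"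
        "\<bar>partials is (\<lambda>x. g x $ i $ j) x - partials is (\<lambda>x. h x $ i $ j) x\<bar> < (e - d) / 2"
        using d(2) h(2) unfolding Ck_close_def by blast+
      then show "\<bar>partials is (\<lambda>x. g0 x $ i $ j) x - partials is (\<lambda>x. h x $ i $ j) x\<bar> < d + (e - d) / 2"
        by linarith
    qed
    moreover have "d + (e - d) / 2 < e" using d(1) by (simp add: field_simps)
    ultimately show ?thesis using h(1) by blast
  qed
  then show "\<exists>k e. 0 < e \<and> (\<forall>h\<in>riemannian_metrics. Ck_close k e g h \<longrightarrow> h \<in> ?N)"
    using d(1) by (intro exI[of _ k] exI[of _ "(e - d) / 2"]) auto
qed

lemma limitin_metrics_topology:
  "limitin metrics_topology g g0 F \<longleftrightarrow> metric_limit F g g0"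
proof
  assume L: "limitin metrics_topology g g0 F"
  then have g0: "g0 \<in> riemannian_metrics" by (simp add: limitin_def topspace_metrics_topology)
  have ev: "\<forall>\<^sub>F a in F. g a \<in> riemannian_metrics \<and> Ck_close k e g0 (g a)" if "e > 0" for k e
  proof -
    let ?N = "{h \<in> riemannian_metrics. \<exists>d<e. Ck_close k d g0 h}"
    have "Ck_close k (e/2) g0 g0" using that by (simp add: Ck_close_def)
    then have "g0 \<in> ?N" using g0 that by (auto intro!: exI[of _ "e/2"])
    then have "\<forall>\<^sub>F a in F. g a \<in> ?N" using L openin_Ck_ball unfolding limitin_def by blast
    then show ?thesis
    proof eventually_elim
      case (elim a)
      then show ?case using Ck_close_mono[of k _ g0 "g a" k e] by auto
    qed
  qed
  have "C0_limit F (\<lambda>a. partials is (\<lambda>x. g a x $ i $ j)) (partials is (\<lambda>x. g0 x $ i $ j))" for "is" i j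
    unfolding C0_limit_def
  proof (intro conjI)
    have sm: "\<forall>x\<in>disk. partials is (\<lambda>x. h x $ i $ j) differentiable at x within disk" if "h \<in> riemannian_metrics" for h
      using that by (auto simp: riemannian_metrics_def smooth_on_disk_def)
    show "\<forall>\<^sub>F a in F. \<forall>x\<in>disk. partials is (\<lambda>x. g a x $ i $ j) differentiable at x within disk"
      using ev[OF zero_less_one] by eventually_elim (use sm in blast)
    show "\<forall>x\<in>disk. partials is (\<lambda>x. g0 x $ i $ j) differentiable at x within disk" by (rule sm[OF g0])
    show "uniform_limit disk (\<lambda>a. partials is (\<lambda>x. g a x $ i $ j)) (partials is (\<lambda>x. g0 x $ i $ j)) F"
      unfolding uniform_limit_iff
    proof (intro allI impI)
      fix e :: real assume "e > 0"
      from ev[OF this, of "length is"] show "\<forall>\<^sub>F a in F. \<forall>x\<in>disk. dist (partials is (\<lambda>x. g a x $ i $ j) x) (partials is (\<lambda>x. g0 x $ i $ j) x) < e"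
        by eventually_elim (auto simp: Ck_close_def dist_real_def abs_minus_commute)
    qed
  qed
  moreover have "\<forall>\<^sub>F a in F. g a \<in> riemannian_metrics"
    using ev[OF zero_less_one, of 0] by (rule eventually_mono) simp
  ultimately show "metric_limit F g g0"
    unfolding metric_limit_def smooth_limit_iff using g0 by blast
next
  assume L: "metric_limit F g g0"
  show "limitin metrics_topology g g0 F"
    unfolding limitin_def topspace_metrics_topology
  proof (intro conjI allI impI)
    show "g0 \<in> riemannian_metrics" using L by (simp add: metric_limit_def)
    fix U assume U: "openin metrics_topology U \<and> g0 \<in> U"
    then obtain k e where e: "e > 0" "\<And>h. h \<in> riemannian_metrics \<Longrightarrow> Ck_close k e g0 h \<Longrightarrow> h \<in> U"
      unfolding openin_metrics_topology Cinf_open_def by blast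
    define I where "I = {is :: 2 list. set is \<subseteq> UNIV \<and> length is \<le> k} \<times> (UNIV :: (2 \<times> 2) set)"
    have fin: "finite I" unfolding I_def by (intro finite_cartesian_product finite_lists_length_le) auto
    have "\<forall>\<^sub>F a in F. \<forall>p\<in>I. \<forall>x\<in>disk. \<bar>partials (fst p) (\<lambda>x. g a x $ fst (snd p) $ snd (snd p)) x
       - partials (fst p) (\<lambda>x. g0 x $ fst (snd p) $ snd (snd p)) x\<bar> < e"
      using fin
    proof (rule eventually_ball_finite, intro ballI)
      fix p assume "p \<in> I"
      have "smooth_limit F (\<lambda>a x. g a x $ fst (snd p) $ snd (snd p)) (\<lambda>x. g0 x $ fst (snd p) $ snd (snd p))"
        using L by (simp add: metric_limit_def)
      then have "uniform_limit disk (\<lambda>a. partials (fst p) (\<lambda>x. g a x $ fst (snd p) $ snd (snd p))) (partials (fst p) (\<lambda>x. g0 x $ fst (snd p) $ snd (snd p))) F"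
        unfolding smooth_limit_iff C0_limit_def by blast
      from uniform_limitD[OF this e(1)]
      show "\<forall>\<^sub>F a in F. \<forall>x\<in>disk. \<bar>partials (fst p) (\<lambda>x. g a x $ fst (snd p) $ snd (snd p)) x
       - partials (fst p) (\<lambda>x. g0 x $ fst (snd p) $ snd (snd p)) x\<bar> < e"
        by (simp add: dist_real_def)
    qed
    moreover have "\<forall>\<^sub>F a in F. g a \<in> riemannian_metrics" using L by (simp add: metric_limit_def)
    ultimately show "\<forall>\<^sub>F a in F. g a \<in> U"
    proof eventually_elim
      case (elim a)
      have "Ck_close k e g0 (g a)"
        unfolding Ck_close_def
      proof (intro allI ballI impI)
        fix "is" :: "2 list" and i j :: 2 and x :: "real^2"
        assume "x \<in> disk" "length is \<le> k"
        then show "\<bar>partials is (\<lambda>x. g0 x $ i $ j) x - partials is (\<lambda>x. g a x $ i $ j) x\<bar> < e"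
          using elim(1)[rule_format, of "(is, i, j)" x] by (simp add: I_def abs_minus_commute)
      qed
      then show ?case using e(2) elim(2) by blast
    qed
  qed
qed

lemma metric_limit_const: "g0 \<in> riemannian_metrics \<Longrightarrow> metric_limit F (\<lambda>a. g0) g0"
  by (auto simp: metric_limit_def riemannian_metrics_def intro: smooth_limit_self)

lemma metric_limit_conformal:
  assumes g: "metric_limit F g g0" and \<phi>: "smooth_limit F \<phi> \<phi>0" "\<forall>\<^sub>F a in F. smooth_on_disk (\<phi> a)"
  shows "metric_limit F (\<lambda>a. conformal (\<phi> a) (g a)) (conformal \<phi>0 g0)"
  unfolding metric_limit_def
proof (intro conjI allI)
  have ge: "\<forall>\<^sub>F a in F. g a \<in> riemannian_metrics" and g0: "g0 \<in> riemannian_metrics"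
    and gl: "\<And>i j. smooth_limit F (\<lambda>a x. g a x $ i $ j) (\<lambda>x. g0 x $ i $ j)"
    using g by (auto simp: metric_limit_def)
  show "\<forall>\<^sub>F a in F. conformal (\<phi> a) (g a) \<in> riemannian_metrics"
    using ge \<phi>(2) by eventually_elim (rule conformal_metric)
  show "conformal \<phi>0 g0 \<in> riemannian_metrics"
    by (rule conformal_metric[OF g0 smooth_limit_imp_smooth[OF \<phi>(1)]])
  have "smooth_limit F (\<lambda>a x. exp (2 * \<phi> a x) * g a x $ i $ j) (\<lambda>x. exp (2 * \<phi>0 x) * g0 x $ i $ j)" for i j
    by (intro smooth_intros gl \<phi>(1)) auto
  then show "smooth_limit F (\<lambda>a x. conformal (\<phi> a) (g a) x $ i $ j) (\<lambda>x. conformal \<phi>0 g0 x $ i $ j)" for i j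
    by (rule smooth_limit_cong) (auto simp: conformal_def)
qed

definition flat_metric :: metric_field where "flat_metric = (\<lambda>x\<in>disk. mat 1)"

definition metric_path :: "real \<Rightarrow> metric_field \<Rightarrow> metric_field" where
  "metric_path t h = (\<lambda>x\<in>disk. (1 - t) *\<^sub>R h x + t *\<^sub>R mat 1)"

lemma metric_path_metric:
  assumes h: "h \<in> riemannian_metrics" and t: "0 \<le> t" "t \<le> 1"
  shows "metric_path t h \<in> riemannian_metrics"
  unfolding riemannian_metrics_def
proof (intro CollectI conjI allI ballI impI)
  show "metric_path t h \<in> extensional disk" by (simp add: metric_path_def)
  have s: "smooth_on_disk (\<lambda>x. h x $ i $ j)" for i j using h by (simp add: riemannian_metrics_def)
  show "smooth_on_disk (\<lambda>x. metric_path t h x $ i $ j)" for i j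
    by (rule smooth_on_disk_cong[of "\<lambda>x. (1 - t) * h x $ i $ j + t * mat 1 $ i $ j"])
      (auto intro!: smooth_intros s simp: metric_path_def)
  fix x :: "real^2" assume x: "x \<in> disk"
  then have hx: "transpose (h x) = h x" "\<And>v. v \<noteq> 0 \<Longrightarrow> 0 < v \<bullet> (h x *v v)"
    using h by (auto simp: riemannian_metrics_def)
  have "metric_path t h x $ j $ i = metric_path t h x $ i $ j" for i j
    using x arg_cong[OF hx(1), of "\<lambda>A. A $ i $ j"] by (simp add: metric_path_def transpose_def mat_def)
  then show "transpose (metric_path t h x) = metric_path t h x" by (simp add: vec_eq_iff transpose_def)
  fix v :: "real^2" assume v: "v \<noteq> 0"
  have "v \<bullet> (metric_path t h x *v v) = (1 - t) * (v \<bullet> (h x *v v)) + t * (v \<bullet> v)"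
    using x by (simp add: metric_path_def matrix_vector_mult_add_rdistrib scaleR_matrix_vector_assoc[symmetric] inner_add_right)
  moreover have "0 < (1 - t) * (v \<bullet> (h x *v v)) + t * (v \<bullet> v)"
  proof (cases "t = 1")
    case False
    then have "0 < (1 - t) * (v \<bullet> (h x *v v))" using hx(2)[OF v] t by simp
    moreover have "0 \<le> t * (v \<bullet> v)" using t by simp
    ultimately show ?thesis by linarith
  qed (use v in simp)
  ultimately show "0 < v \<bullet> (metric_path t h x *v v)" by simp
qed

lemma metric_path_0: "h \<in> riemannian_metrics \<Longrightarrow> metric_path 0 h = h"
  by (auto simp: metric_path_def riemannian_metrics_def fun_eq_iff extensional_def)

lemma metric_path_1: "metric_path 1 h = flat_metric"
  by (simp add: metric_path_def flat_metric_def)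

lemma metric_limit_path:
  assumes g: "metric_limit F g g0" and t: "(t \<longlongrightarrow> t0) F" "\<forall>\<^sub>F a in F. t a \<in> {0..1}" "t0 \<in> {0..1}"
  shows "metric_limit F (\<lambda>a. metric_path (t a) (g a)) (metric_path t0 g0)"
  unfolding metric_limit_def
proof (intro conjI allI)
  have ge: "\<forall>\<^sub>F a in F. g a \<in> riemannian_metrics" and g0: "g0 \<in> riemannian_metrics"
    and gl: "\<And>i j. smooth_limit F (\<lambda>a x. g a x $ i $ j) (\<lambda>x. g0 x $ i $ j)"
    using g by (auto simp: metric_limit_def)
  show "\<forall>\<^sub>F a in F. metric_path (t a) (g a) \<in> riemannian_metrics"
    using ge t(2) by eventually_elim (auto intro: metric_path_metric)
  show "metric_path t0 g0 \<in> riemannian_metrics" using t(3) by (auto intro: metric_path_metric g0)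
  have "smooth_limit F (\<lambda>a x. (1 - t a) * g a x $ i $ j + t a * mat 1 $ i $ j) (\<lambda>x. (1 - t0) * g0 x $ i $ j + t0 * mat 1 $ i $ j)" for i j
    by (intro smooth_intros gl tendsto_intros t(1))
  then show "smooth_limit F (\<lambda>a x. metric_path (t a) (g a) x $ i $ j) (\<lambda>x. metric_path t0 g0 x $ i $ j)" for i j
    by (rule smooth_limit_cong) (auto simp: metric_path_def)
qed

section \<open>Continuity of the energy\<close>

lemma smooth_limit_coefficients:
  assumes g: "metric_limit F g g0"
  shows "smooth_limit F (\<lambda>a. a11 (g a)) (a11 g0)" "smooth_limit F (\<lambda>a. a12 (g a)) (a12 g0)" "smooth_limit F (\<lambda>a. a22 (g a)) (a22 g0)"
    "smooth_limit F (\<lambda>a. beta1 (g a)) (beta1 g0)" "smooth_limit F (\<lambda>a. beta2 (g a)) (beta2 g0)"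
proof -
  have ge: "\<forall>\<^sub>F a in F. g a \<in> riemannian_metrics" and g0: "g0 \<in> riemannian_metrics"
    and gl: "\<And>i j. smooth_limit F (\<lambda>a x. g a x $ i $ j) (\<lambda>x. g0 x $ i $ j)"
    using g by (auto simp: metric_limit_def)
  have EFG: "smooth_limit F (\<lambda>a x. gE (g a) x) (\<lambda>x. gE g0 x)" "smooth_limit F (\<lambda>a x. gF (g a) x) (\<lambda>x. gF g0 x)" "smooth_limit F (\<lambda>a x. gG (g a) x) (\<lambda>x. gG g0 x)"
    unfolding gE_def gF_def gG_def by (rule gl)+
  have pos: "gE g0 x * gG g0 x - gF g0 x * gF g0 x > 0" "gE g0 x \<noteq> 0" "gD g0 x \<noteq> 0" if "x \<in> disk" for x
    using metric_pos[OF g0 that] by auto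
  have D: "smooth_limit F (\<lambda>a x. gD (g a) x) (\<lambda>x. gD g0 x)"
    unfolding gD_def by (intro smooth_intros EFG pos)
  show A: "smooth_limit F (\<lambda>a. a11 (g a)) (a11 g0)" "smooth_limit F (\<lambda>a. a12 (g a)) (a12 g0)" "smooth_limit F (\<lambda>a. a22 (g a)) (a22 g0)"
    unfolding a11_def[abs_def] a12_def[abs_def] a22_def[abs_def] by (intro smooth_intros EFG D pos; simp)+
  have x: "smooth_limit F (\<lambda>a x. x $ i) (\<lambda>x. x $ i)" for i
    by (rule smooth_limit_self[OF smooth_on_disk_coord])
  have dn: "1 + a11 g0 x * x$1 * x$1 + 2 * a12 g0 x * x$1 * x$2 + a22 g0 x * x$2 * x$2 \<noteq> 0" "a22 g0 x + 1 \<noteq> 0" if "x \<in> disk" for x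
    using turn_denominators[OF g0 that] by auto
  have T: "smooth_limit F (\<lambda>a x. turn (g a) x) (\<lambda>x. turn g0 x)"
    unfolding turn_def by (intro smooth_intros A x tendsto_const dn)
  have nz: "2 * gE g0 x * gD g0 x \<noteq> 0" if "x \<in> disk" for x using pos[OF that] by simp
  have "smooth_limit F (\<lambda>a x. - (gE (g a) x * partial 1 (gG (g a)) x - gF (g a) x * partial 2 (gE (g a)) x) / (2 * gE (g a) x * gD (g a) x))
    (\<lambda>x. - (gE g0 x * partial 1 (gG g0) x - gF g0 x * partial 2 (gE g0) x) / (2 * gE g0 x * gD g0 x))"
    by (intro smooth_intros EFG D tendsto_const nz)
  then have c1: "smooth_limit F (\<lambda>a x. conn1 (g a) x) (\<lambda>x. conn1 g0 x)"
    by (rule smooth_limit_cong) (use ge in \<open>auto simp: conn_formula g0 elim!: eventually_mono\<close>)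
  have "smooth_limit F (\<lambda>a x. (2 * gE (g a) x * partial 1 (gF (g a)) x - gE (g a) x * partial 2 (gE (g a)) x - gF (g a) x * partial 1 (gE (g a)) x) / (2 * gE (g a) x * gD (g a) x))
    (\<lambda>x. (2 * gE g0 x * partial 1 (gF g0) x - gE g0 x * partial 2 (gE g0) x - gF g0 x * partial 1 (gE g0) x) / (2 * gE g0 x * gD g0 x))"
    by (intro smooth_intros EFG D tendsto_const nz)
  then have c2: "smooth_limit F (\<lambda>a x. conn2 (g a) x) (\<lambda>x. conn2 g0 x)"
    by (rule smooth_limit_cong) (use ge in \<open>auto simp: conn_formula g0 elim!: eventually_mono\<close>)
  show "smooth_limit F (\<lambda>a. beta1 (g a)) (beta1 g0)" "smooth_limit F (\<lambda>a. beta2 (g a)) (beta2 g0)"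
    unfolding beta1_def[abs_def] beta2_def[abs_def] by (intro smooth_intros c1 c2 T)+
qed

lemma smooth_limit_uniform: "smooth_limit F f f0 \<Longrightarrow> uniform_limit disk f f0 F"
  unfolding smooth_limit_iff C0_limit_def by (auto dest: spec[of _ "[]"] simp: partials_def)

text \<open>The estimate is uniform in \<open>u\<close> because the energy is a quadratic form in
  \<open>u\<close> and its gradient whose five coefficients converge uniformly, while its boundary
  term is the same for all metrics.\<close>

lemma energy_close:
  assumes g: "metric_limit F g g0" and \<delta>: "\<delta> > 0"
  shows "\<forall>\<^sub>F a in F. \<forall>u. smooth_on_disk u \<longrightarrow> \<bar>energy (g a) u - energy g0 u\<bar> \<le> \<delta> * H1_sq u"
proof -
  \<comment> \<open>43 = 3 + 2 * 20: the pointwise bound carries the weights 3 and 2 on gradient and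
    function, and 20 is the Poincare constant.\<close>
  define \<eta> where "\<eta> = \<delta> / 43"
  have \<eta>: "\<eta> > 0" using \<delta> by (simp add: \<eta>_def)
  have g0: "g0 \<in> riemannian_metrics" and ge: "\<forall>\<^sub>F a in F. g a \<in> riemannian_metrics" using g by (auto simp: metric_limit_def)
  note ul = smooth_limit_coefficients[OF g, THEN smooth_limit_uniform, THEN uniform_limitD, OF \<eta>]
  from ge ul show ?thesis
  proof eventually_elim
    case (elim a)
    show ?case
    proof (intro allI impI)
      fix u assume u: "smooth_on_disk u"
      let ?p = "\<lambda>i. partial i u"
      let ?e = "\<lambda>h x. aform h u x - 2 * (u x * (beta1 h x * ?p 1 x + beta2 h x * ?p 2 x))"
      let ?b = "\<lambda>x. \<eta> * (3 * ((?p 1 x)\<^sup>2 + (?p 2 x)\<^sup>2) + 2 * (u x)\<^sup>2)"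
      have s: "continuous_on disk (?e h)" if "h \<in> riemannian_metrics" for h
        by (intro smooth_on_disk_continuous smooth_intros that u)
      have sb: "continuous_on disk ?b" by (intro smooth_on_disk_continuous smooth_intros u)
      have "energy (g a) u - energy g0 u = disk_int (\<lambda>x. ?e (g a) x - ?e g0 x)"
        unfolding energy_formula[OF elim(1) u] energy_formula[OF g0 u] by (simp add: disk_int_diff s elim(1) g0)
      moreover have pw: "\<bar>?e (g a) x - ?e g0 x\<bar> \<le> ?b x" if x: "x \<in> disk" for x
      proof -
        define d1 d2 d3 d4 d5 where "d1 = a11 (g a) x - a11 g0 x" "d2 = a12 (g a) x - a12 g0 x" "d3 = a22 (g a) x - a22 g0 x"
          "d4 = beta1 (g a) x - beta1 g0 x" "d5 = beta2 (g a) x - beta2 g0 x"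
        note dd = d1_d2_d3_d4_d5_def
        have d: "\<bar>d1\<bar> \<le> \<eta>" "\<bar>d2\<bar> \<le> \<eta>" "\<bar>d3\<bar> \<le> \<eta>" "\<bar>d4\<bar> \<le> \<eta>" "\<bar>d5\<bar> \<le> \<eta>"
          unfolding dd using elim(2-6) x by (auto simp: dist_real_def intro: less_imp_le)
        have q: "\<bar>2 * (v * w)\<bar> \<le> v\<^sup>2 + w\<^sup>2" for v w :: real
          using zero_le_power2[of "v - w"] zero_le_power2[of "v + w"] by (simp add: power2_eq_square abs_le_iff algebra_simps)
        have m: "\<bar>d * y\<bar> \<le> \<eta> * z" if "\<bar>d\<bar> \<le> \<eta>" "\<bar>y\<bar> \<le> z" for d y z
          unfolding abs_mult using that \<eta> by (intro mult_mono) auto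
        have "?e (g a) x - ?e g0 x = d1 * (?p 1 x)\<^sup>2 + d2 * (2 * (?p 1 x * ?p 2 x)) + d3 * (?p 2 x)\<^sup>2
            - d4 * (2 * (u x * ?p 1 x)) - d5 * (2 * (u x * ?p 2 x))"
          unfolding aform_def dd by (simp add: algebra_simps)
        moreover have "\<bar>d1 * (?p 1 x)\<^sup>2\<bar> \<le> \<eta> * (?p 1 x)\<^sup>2" "\<bar>d3 * (?p 2 x)\<^sup>2\<bar> \<le> \<eta> * (?p 2 x)\<^sup>2"
          by (rule m[OF d(1)], simp) (rule m[OF d(3)], simp)
        moreover have "\<bar>d2 * (2 * (?p 1 x * ?p 2 x))\<bar> \<le> \<eta> * ((?p 1 x)\<^sup>2 + (?p 2 x)\<^sup>2)"
          "\<bar>d4 * (2 * (u x * ?p 1 x))\<bar> \<le> \<eta> * ((u x)\<^sup>2 + (?p 1 x)\<^sup>2)" "\<bar>d5 * (2 * (u x * ?p 2 x))\<bar> \<le> \<eta> * ((u x)\<^sup>2 + (?p 2 x)\<^sup>2)"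
          by (rule m[OF d(2) q], rule m[OF d(4) q], rule m[OF d(5) q])
        ultimately show ?thesis by (simp add: distrib_left)
      qed
      ultimately have "\<bar>energy (g a) u - energy g0 u\<bar> \<le> disk_int ?b"
      proof -
        have c: "continuous_on disk (\<lambda>x. ?e (g a) x - ?e g0 x)" by (intro continuous_on_diff s elim(1) g0)
        have "disk_int (\<lambda>x. ?e (g a) x - ?e g0 x) \<le> disk_int ?b"
          by (rule disk_int_mono[OF c sb]) (use pw in \<open>simp add: abs_le_iff\<close>)
        moreover have "disk_int (\<lambda>x. - ?b x) \<le> disk_int (\<lambda>x. ?e (g a) x - ?e g0 x)"
        proof (rule disk_int_mono[OF _ c])
          show "continuous_on disk (\<lambda>x. - ?b x)" using sb by (rule continuous_on_minus)
          show "- ?b x \<le> ?e (g a) x - ?e g0 x" if "x \<in> disk" for x using pw[OF that] by linarith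
        qed
        ultimately show ?thesis
          using \<open>energy (g a) u - energy g0 u = disk_int (\<lambda>x. ?e (g a) x - ?e g0 x)\<close> by (simp add: disk_int_minus abs_le_iff)
      qed
      also have "disk_int ?b = \<eta> * (3 * disk_int (\<lambda>x. (?p 1 x)\<^sup>2 + (?p 2 x)\<^sup>2) + 2 * (disk_norm u)\<^sup>2)"
      proof -
        have "disk_int (\<lambda>x. 3 * ((?p 1 x)\<^sup>2 + (?p 2 x)\<^sup>2) + 2 * (u x)\<^sup>2)
          = disk_int (\<lambda>x. 3 * ((?p 1 x)\<^sup>2 + (?p 2 x)\<^sup>2)) + disk_int (\<lambda>x. 2 * (u x)\<^sup>2)"
          by (rule disk_int_add) (intro smooth_on_disk_continuous smooth_intros u)+
        then show ?thesis by (simp only: disk_int_cmult disk_norm_sq)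
      qed
      also have "\<dots> \<le> \<eta> * (3 * H1_sq u + 2 * (20 * H1_sq u))"
      proof (intro mult_left_mono add_mono)
        have "0 \<le> circ_int (\<lambda>x. (u x)\<^sup>2)" by (intro circ_int_nonneg) simp
        then show "disk_int (\<lambda>x. (?p 1 x)\<^sup>2 + (?p 2 x)\<^sup>2) \<le> H1_sq u" by (simp add: H1_sq_def)
      qed (use poincare_disk[OF u] \<eta> in auto)
      finally show "\<bar>energy (g a) u - energy g0 u\<bar> \<le> \<delta> * H1_sq u" by (simp add: \<eta>_def)
    qed
  qed
qed

section \<open>A continuous choice of good conformal factors\<close>

definition factor :: "nat \<Rightarrow> real^2 \<Rightarrow> real" where "factor n = rpoly (from_nat n)"

lemma smooth_factor [smooth_intros]: "smooth_on_disk (factor n)"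
  unfolding factor_def by (rule smooth_on_disk_rpoly)

text \<open>Admitting 0 and capping at 1 makes the supremum exist whatever the sign of the energy.
  It is 0 exactly when no positive coercivity constant exists.\<close>

definition margins :: "nat \<Rightarrow> metric_field \<Rightarrow> real set" where
  "margins n h = {c. 0 \<le> c \<and> c \<le> 1 \<and>
     (c = 0 \<or> (\<forall>u. smooth_on_disk u \<longrightarrow> c * H1_sq u \<le> energy (conformal (factor n) h) u))}"

definition margin :: "nat \<Rightarrow> metric_field \<Rightarrow> real" where "margin n h = Sup (margins n h)"

lemma margins_bdd: "bdd_above (margins n h)" "0 \<in> margins n h"
  by (rule bdd_aboveI[of _ 1]) (simp_all add: margins_def)

lemma margin_bounds: "0 \<le> margin n h" "margin n h \<le> 1"
proof -
  show "0 \<le> margin n h" unfolding margin_def by (rule cSup_upper[OF margins_bdd(2,1)])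
  show "margin n h \<le> 1" unfolding margin_def
    by (rule cSup_least) (use margins_bdd(2) in blast, simp add: margins_def)
qed

lemma margin_pos:
  assumes "0 < margin n h"
  obtains c where "c > 0" "\<And>u. smooth_on_disk u \<Longrightarrow> c * H1_sq u \<le> energy (conformal (factor n) h) u"
proof -
  obtain c where "c \<in> margins n h" "0 < c"
    using assms less_cSup_iff[OF _ margins_bdd(1), of n h 0] margins_bdd(2)[of n h] unfolding margin_def by blast
  then show ?thesis using that[of c] by (auto simp: margins_def)
qed

lemma exists_margin_pos:
  assumes "h \<in> riemannian_metrics"
  obtains n where "0 < margin n h"
proof -
  obtain ms c where c: "c > 0" "\<And>u. smooth_on_disk u \<Longrightarrow> c * H1_sq u \<le> energy (conformal (rpoly ms) h) u"
    using good_factor_exists[OF assms] by blast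
  have f: "factor (to_nat ms) = rpoly ms" by (simp add: factor_def)
  have "min c 1 \<in> margins (to_nat ms) h"
    unfolding margins_def f
  proof (intro CollectI conjI disjI2 allI impI)
    fix u assume u: "smooth_on_disk u"
    have "min c 1 * H1_sq u \<le> c * H1_sq u" using H1_sq_bounds(3)[OF u] by (intro mult_right_mono) auto
    then show "min c 1 * H1_sq u \<le> energy (conformal (rpoly ms) h) u" using c(2)[OF u] by linarith
  qed (use c in auto)
  then have "min c 1 \<le> margin (to_nat ms) h" unfolding margin_def by (rule cSup_upper[OF _ margins_bdd(1)])
  then show ?thesis using c(1) that[of "to_nat ms"] by simp
qed

text \<open>A constant \<open>c\<close> valid for \<open>h\<close> leaves
  \<open>c - \<delta>\<close> for \<open>k\<close>; if that is not positive, nonnegativity of the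
  margin suffices.\<close>

lemma margin_lipschitz:
  assumes "\<And>u. smooth_on_disk u \<Longrightarrow> \<bar>energy (conformal (factor n) h) u - energy (conformal (factor n) k) u\<bar> \<le> \<delta> * H1_sq u"
    and "0 \<le> \<delta>"
  shows "margin n h \<le> margin n k + \<delta>"
  unfolding margin_def[of n h]
proof (rule cSup_least)
  show "margins n h \<noteq> {}" using margins_bdd(2) by auto
  fix c assume c: "c \<in> margins n h"
  show "c \<le> margin n k + \<delta>"
  proof (cases "c \<le> \<delta>")
    case True
    then show ?thesis using margin_bounds(1)[of n k] by simp
  next
    case False
    have "c - \<delta> \<in> margins n k"
      unfolding margins_def
    proof (intro CollectI conjI disjI2 allI impI)
      show "0 \<le> c - \<delta>" "c - \<delta> \<le> 1" using False c assms(2) by (auto simp: margins_def)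
      fix u assume u: "smooth_on_disk u"
      have "c * H1_sq u \<le> energy (conformal (factor n) h) u" using c False assms(2) u by (auto simp: margins_def)
      then show "(c - \<delta>) * H1_sq u \<le> energy (conformal (factor n) k) u"
        using assms(1)[OF u] by (simp add: left_diff_distrib)
    qed
    then have "c - \<delta> \<le> margin n k" unfolding margin_def by (rule cSup_upper[OF _ margins_bdd(1)])
    then show ?thesis by simp
  qed
qed

lemma tendsto_margin:
  assumes g: "metric_limit F g g0"
  shows "((\<lambda>a. margin n (g a)) \<longlongrightarrow> margin n g0) F"
  unfolding tendsto_iff
proof (intro allI impI)
  fix e :: real assume e: "e > 0"
  have "metric_limit F (\<lambda>a. conformal (factor n) (g a)) (conformal (factor n) g0)"
    by (rule metric_limit_conformal[OF g smooth_limit_self[OF smooth_factor]]) (simp add: smooth_factor)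
  from energy_close[OF this, of "e/2"] e
  have "\<forall>\<^sub>F a in F. \<forall>u. smooth_on_disk u \<longrightarrow> \<bar>energy (conformal (factor n) (g a)) u - energy (conformal (factor n) g0) u\<bar> \<le> e/2 * H1_sq u" by simp
  then show "\<forall>\<^sub>F a in F. dist (margin n (g a)) (margin n g0) < e"
  proof eventually_elim
    case (elim a)
    have "margin n (g a) \<le> margin n g0 + e/2" by (rule margin_lipschitz) (use elim e in auto)
    moreover have "margin n g0 \<le> margin n (g a) + e/2"
      by (rule margin_lipschitz) (use elim e in \<open>auto simp: abs_minus_commute\<close>)
    ultimately show ?case using e by (simp add: dist_real_def)
  qed
qed

text \<open>Subtracting \<open>n\<close> times the earlier margins makes the family locally finite.\<close>

definition weight :: "nat \<Rightarrow> metric_field \<Rightarrow> real" where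
  "weight n h = max 0 (margin n h - real n * (\<Sum>k<n. margin k h))"

definition total_weight :: "metric_field \<Rightarrow> real" where
  "total_weight h = (\<Sum>n | weight n h \<noteq> 0. weight n h)"

definition good_factor :: "metric_field \<Rightarrow> real^2 \<Rightarrow> real" where
  "good_factor h x = (\<Sum>n | weight n h \<noteq> 0. weight n h / total_weight h * factor n x)"

lemma weight_nonneg: "0 \<le> weight n h"
  by (simp add: weight_def)

lemma weight_le_margin: "weight n h \<le> margin n h"
  by (simp add: weight_def margin_bounds sum_nonneg)

lemma tendsto_weight: "metric_limit F g g0 \<Longrightarrow> ((\<lambda>a. weight n (g a)) \<longlongrightarrow> weight n g0) F"
  unfolding weight_def by (intro tendsto_intros tendsto_max tendsto_margin)

text \<open>Once an earlier margin exceeds \<open>d\<close>, the amount subtracted from the margin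
  of index \<open>n\<close> is at least \<open>n * d\<close>, which from \<open>N\<close> on exceeds
  the cap 1. The threshold depends only on \<open>d\<close> and \<open>k\<close>, hence serves a
  whole neighbourhood.\<close>

lemma weight_eventually_0:
  assumes "d < margin k h" "d > 0" "real N * d \<ge> 1" "k < N" "N \<le> n"
  shows "weight n h = 0"
proof -
  have "margin k h \<le> (\<Sum>j<n. margin j h)"
    using assms by (intro member_le_sum margin_bounds) auto
  then have "real n * d \<le> real n * (\<Sum>j<n. margin j h)" using assms(1) by (intro mult_left_mono) auto
  moreover have "real N * d \<le> real n * d" using assms by (intro mult_right_mono) auto
  ultimately show ?thesis using margin_bounds(2)[of n h] assms(3) by (simp add: weight_def)
qed

text \<open>Local finiteness: one \<open>N\<close> works for \<open>g0\<close> and eventually along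
  the filter, so \<open>good_factor\<close> is there a quotient of sums over a fixed finite index
  set.\<close>

lemma weight_support:
  assumes g: "metric_limit F g g0"
  obtains N where "\<forall>\<^sub>F a in F. {n. weight n (g a) \<noteq> 0} \<subseteq> {..<N}" "{n. weight n g0 \<noteq> 0} \<subseteq> {..<N}"
proof -
  have "g0 \<in> riemannian_metrics" using g by (simp add: metric_limit_def)
  then obtain k where k: "0 < margin k g0" using exists_margin_pos by blast
  define d where "d = margin k g0 / 2"
  have d: "0 < d" "d < margin k g0" using k by (auto simp: d_def)
  obtain M :: nat where M: "1 / d \<le> real M" using real_arch_simple by blast
  define N where "N = max M (Suc k)"
  have N: "real N * d \<ge> 1" "k < N"
  proof -
    have "1 \<le> real M * d" using M d by (simp add: field_simps)
    also have "\<dots> \<le> real N * d" using d by (intro mult_right_mono) (auto simp: N_def)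
    finally show "real N * d \<ge> 1" .
  qed (simp add: N_def)
  have z: "{n. weight n h \<noteq> 0} \<subseteq> {..<N}" if "d < margin k h" for h
    using weight_eventually_0[OF that d(1) N] by (auto simp: not_less[symmetric])
  have "\<forall>\<^sub>F a in F. d < margin k (g a)" by (rule order_tendstoD(1)[OF tendsto_margin[OF g] d(2)])
  then have "\<forall>\<^sub>F a in F. {n. weight n (g a) \<noteq> 0} \<subseteq> {..<N}" by eventually_elim (rule z)
  then show ?thesis using that z[OF d(2)] by blast
qed

lemma weight_finite:
  assumes "h \<in> riemannian_metrics"
  shows "finite {n. weight n h \<noteq> 0}"
proof -
  obtain N where "{n. weight n h \<noteq> 0} \<subseteq> {..<N}"
    using weight_support[OF metric_limit_const[OF assms, of "bot :: unit filter"]] by blast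
  then show ?thesis by (rule finite_subset) simp
qed

lemma total_weight_pos:
  assumes h: "h \<in> riemannian_metrics"
  shows "0 < total_weight h"
proof -
  obtain n where n: "0 < margin n h" using exists_margin_pos[OF h] by blast
  \<comment> \<open>At the least index with positive margin nothing is subtracted, so this weight is
    positive.\<close>
  define m where "m = (LEAST n. 0 < margin n h)"
  have m: "0 < margin m h" unfolding m_def using n by (rule LeastI)
  have z: "margin k h = 0" if "k < m" for k
  proof -
    have "\<not> 0 < margin k h" using not_less_Least[of k "\<lambda>n. 0 < margin n h"] that unfolding m_def by blast
    then show ?thesis using margin_bounds(1)[of k h] by linarith
  qed
  have w: "weight m h = margin m h" using m by (simp add: weight_def z)
  have "weight m h \<le> total_weight h"
    unfolding total_weight_def using m w by (intro member_le_sum weight_finite[OF h]) (auto simp: weight_nonneg)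
  then show ?thesis using m w by linarith
qed

lemma smooth_good_factor [smooth_intros]: "smooth_on_disk (good_factor h)"
  unfolding good_factor_def[abs_def] by (intro smooth_intros)

lemma good_factor_eq:
  assumes "{n. weight n h \<noteq> 0} \<subseteq> {..<N}"
  shows "good_factor h = (\<lambda>x. (\<Sum>n<N. weight n h * factor n x) / (\<Sum>n<N. weight n h))"
proof
  fix x
  have t: "total_weight h = (\<Sum>n<N. weight n h)"
    unfolding total_weight_def using assms by (intro sum.mono_neutral_left) auto
  have "good_factor h x = (\<Sum>n<N. weight n h / total_weight h * factor n x)"
    unfolding good_factor_def using assms by (intro sum.mono_neutral_left) auto
  then show "good_factor h x = (\<Sum>n<N. weight n h * factor n x) / (\<Sum>n<N. weight n h)"
    by (simp add: t sum_divide_distrib)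
qed

lemma good_factor_limit:
  assumes g: "metric_limit F g g0"
  shows "smooth_limit F (\<lambda>a. good_factor (g a)) (good_factor g0)"
proof -
  have g0: "g0 \<in> riemannian_metrics" using g by (simp add: metric_limit_def)
  obtain N where N: "\<forall>\<^sub>F a in F. {n. weight n (g a) \<noteq> 0} \<subseteq> {..<N}" "{n. weight n g0 \<noteq> 0} \<subseteq> {..<N}"
    using weight_support[OF g] by blast
  have "total_weight g0 = (\<Sum>n<N. weight n g0)"
    unfolding total_weight_def using N(2) by (intro sum.mono_neutral_left) auto
  then have nz: "(\<Sum>n<N. weight n g0) \<noteq> 0" using total_weight_pos[OF g0] by simp
  have "smooth_limit F (\<lambda>a x. (\<Sum>n<N. weight n (g a) * factor n x) / (\<Sum>n<N. weight n (g a)))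
      (\<lambda>x. (\<Sum>n<N. weight n g0 * factor n x) / (\<Sum>n<N. weight n g0))"
    by (intro smooth_limit_divide smooth_limit_sum smooth_limit_mult smooth_limit_const tendsto_sum tendsto_weight g
        smooth_limit_self smooth_factor nz)
  then show ?thesis
  proof (rule smooth_limit_cong)
    show "\<forall>\<^sub>F a in F. \<forall>x\<in>disk. (\<Sum>n<N. weight n (g a) * factor n x) / (\<Sum>n<N. weight n (g a)) = good_factor (g a) x"
      using N(1) by eventually_elim (simp add: good_factor_eq)
  qed (simp add: good_factor_eq[OF N(2)])
qed

lemma energy_conformal_sum:
  assumes h: "h \<in> riemannian_metrics" and J: "finite J" "\<And>j. j \<in> J \<Longrightarrow> smooth_on_disk (\<phi> j)"
    and w: "(\<Sum>j\<in>J. w j) = 1" and u: "smooth_on_disk u"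
  shows "energy (conformal (\<lambda>x. \<Sum>j\<in>J. w j * \<phi> j x) h) u = (\<Sum>j\<in>J. w j * energy (conformal (\<phi> j) h) u)"
proof -
  have "disk_int (\<lambda>x. \<Sum>j\<in>K. w j * flux h (\<phi> j) u x) = (\<Sum>j\<in>K. w j * disk_int (flux h (\<phi> j) u))" if "K \<subseteq> J" "finite K" for K
    using that(2,1)
  proof (induction K)
    case (insert j K)
    have "disk_int (\<lambda>x. w j * flux h (\<phi> j) u x + (\<Sum>j\<in>K. w j * flux h (\<phi> j) u x))
      = disk_int (\<lambda>x. w j * flux h (\<phi> j) u x) + disk_int (\<lambda>x. \<Sum>j\<in>K. w j * flux h (\<phi> j) u x)"
      by (rule disk_int_add) (intro smooth_on_disk_continuous smooth_intros h u J(2); use insert.prems in auto)+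
    then show ?case using insert by (simp add: disk_int_cmult)
  qed simp
  from this[OF subset_refl J(1)]
  have "disk_int (\<lambda>x. flux h (\<lambda>x. \<Sum>j\<in>J. w j * \<phi> j x) u x) = (\<Sum>j\<in>J. w j * disk_int (flux h (\<phi> j) u))"
    by (subst disk_int_cong[OF flux_combination[OF J]]) auto
  then have "energy (conformal (\<lambda>x. \<Sum>j\<in>J. w j * \<phi> j x) h) u = energy h u + 2 * (\<Sum>j\<in>J. w j * disk_int (flux h (\<phi> j) u))"
    using energy_conformal[OF h _ u, of "\<lambda>x. \<Sum>j\<in>J. w j * \<phi> j x"] J by (simp add: smooth_intros)
  \<comment> \<open>Since the weights sum to 1, the constant part of the affine dependence can be
    distributed over the summands.\<close>
  also have "\<dots> = (\<Sum>j\<in>J. w j) * energy h u + (\<Sum>j\<in>J. w j * (2 * disk_int (flux h (\<phi> j) u)))"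
    by (simp add: w sum_distrib_left algebra_simps)
  also have "\<dots> = (\<Sum>j\<in>J. w j * (energy h u + 2 * disk_int (flux h (\<phi> j) u)))"
    by (simp only: sum_distrib_right sum.distrib[symmetric] distrib_left)
  also have "\<dots> = (\<Sum>j\<in>J. w j * energy (conformal (\<phi> j) h) u)"
    by (rule sum.cong) (simp_all add: energy_conformal[OF h J(2) u])
  finally show ?thesis .
qed

lemma good_factor_positive:
  assumes h: "h \<in> riemannian_metrics"
  shows "conformal (good_factor h) h \<in> positive_metrics"
proof -
  let ?J = "{n. weight n h \<noteq> 0}" and ?W = "total_weight h"
  have J: "finite ?J" by (rule weight_finite[OF h])
  have W: "?W > 0" by (rule total_weight_pos[OF h])
  have wp: "weight n h > 0" if "n \<in> ?J" for n using that weight_nonneg[of n h] by auto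
  have "\<forall>n. \<exists>c. n \<in> ?J \<longrightarrow> c > 0 \<and> (\<forall>u. smooth_on_disk u \<longrightarrow> c * H1_sq u \<le> energy (conformal (factor n) h) u)"
  proof
    fix n
    show "\<exists>c. n \<in> ?J \<longrightarrow> c > 0 \<and> (\<forall>u. smooth_on_disk u \<longrightarrow> c * H1_sq u \<le> energy (conformal (factor n) h) u)"
    proof (cases "n \<in> ?J")
      case True
      then have "0 < margin n h" using wp[OF True] weight_le_margin[of n h] by linarith
      then show ?thesis by (rule margin_pos) blast
    qed blast
  qed
  then obtain c where c: "\<And>n. n \<in> ?J \<Longrightarrow> c n > 0" "\<And>n u. n \<in> ?J \<Longrightarrow> smooth_on_disk u \<Longrightarrow> c n * H1_sq u \<le> energy (conformal (factor n) h) u"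
    by metis
  define w where "w n = weight n h / ?W" for n
  have w: "w n > 0" if "n \<in> ?J" for n using wp[OF that] W by (simp add: w_def)
  have w1: "(\<Sum>n\<in>?J. w n) = 1" using W unfolding w_def by (simp flip: sum_divide_distrib add: total_weight_def)
  then have ne: "?J \<noteq> {}" by (metis sum.empty zero_neq_one)
  define C where "C = (\<Sum>n\<in>?J. w n * c n)"
  have C: "C > 0" unfolding C_def using J ne w c(1) by (intro sum_pos) auto
  have gf: "good_factor h = (\<lambda>x. \<Sum>n\<in>?J. w n * factor n x)" by (simp add: good_factor_def[abs_def] w_def)
  \<comment> \<open>Poincare converts the lower bound in \<open>H1_sq\<close> into the L2 bound that
    characterises positivity.\<close>
  have "C / 20 * disk_int (\<lambda>x. (u x)\<^sup>2) \<le> energy (conformal (good_factor h) h) u" if u: "smooth_on_disk u" for u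
  proof -
    have "C / 20 * disk_int (\<lambda>x. (u x)\<^sup>2) \<le> C / 20 * (20 * H1_sq u)"
      using poincare_disk[OF u] C by (intro mult_left_mono) (auto simp: disk_norm_sq)
    also have "\<dots> = C * H1_sq u" by simp
    also have "\<dots> = (\<Sum>n\<in>?J. w n * (c n * H1_sq u))" unfolding C_def sum_distrib_right by (simp only: mult.assoc)
    also have "\<dots> \<le> (\<Sum>n\<in>?J. w n * energy (conformal (factor n) h) u)"
      using w c(2)[OF _ u] by (intro sum_mono mult_left_mono) (auto intro: less_imp_le)
    also have "\<dots> = energy (conformal (good_factor h) h) u"
      unfolding gf by (rule energy_conformal_sum[OF h J _ w1 u, symmetric]) (rule smooth_factor)
    finally show ?thesis .
  qed
  then have "0 < lambda1 (conformal (good_factor h) h)"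
    unfolding lambda1_pos_iff[OF conformal_metric[OF h smooth_good_factor]] using C by (intro exI[of _ "C / 20"]) auto
  then show ?thesis using conformal_metric[OF h smooth_good_factor] by (simp add: positive_metrics_def)
qed

text \<open>The energy is affine in \<open>t\<close>, so the smaller of the two coercivity constants
  at the ends serves throughout.\<close>

lemma conformal_segment_positive:
  assumes h: "h \<in> positive_metrics" and \<phi>: "smooth_on_disk \<phi>" "conformal \<phi> h \<in> positive_metrics" and t: "0 \<le> t" "t \<le> 1"
  shows "conformal (\<lambda>x. t * \<phi> x) h \<in> positive_metrics"
proof -
  have hm: "h \<in> riemannian_metrics" and cm: "conformal \<phi> h \<in> riemannian_metrics"
    and s: "smooth_on_disk (\<lambda>x. t * \<phi> x)"
    using h \<phi> by (auto simp: positive_metrics_def intro: smooth_intros)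
  obtain c where c: "c > 0" "\<And>u. smooth_on_disk u \<Longrightarrow> c * disk_int (\<lambda>x. (u x)\<^sup>2) \<le> energy h u"
    using h lambda1_pos_iff[OF hm] by (auto simp: positive_metrics_def)
  obtain d where d: "d > 0" "\<And>u. smooth_on_disk u \<Longrightarrow> d * disk_int (\<lambda>x. (u x)\<^sup>2) \<le> energy (conformal \<phi> h) u"
    using \<phi>(2) lambda1_pos_iff[OF cm] by (auto simp: positive_metrics_def)
  have "min c d * disk_int (\<lambda>x. (u x)\<^sup>2) \<le> energy (conformal (\<lambda>x. t * \<phi> x) h) u" if u: "smooth_on_disk u" for u
  proof -
    let ?I = "disk_int (\<lambda>x. (u x)\<^sup>2)"
    have I: "0 \<le> ?I" by (intro disk_int_nonneg) simp
    have f: "disk_int (flux h (\<lambda>x. t * \<phi> x) u) = t * disk_int (flux h \<phi> u)"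
      unfolding disk_int_cmult[symmetric]
      by (rule disk_int_cong) (simp add: flux_def partial_cmult_smooth \<phi> algebra_simps)
    have "energy (conformal (\<lambda>x. t * \<phi> x) h) u = (1 - t) * energy h u + t * energy (conformal \<phi> h) u"
      unfolding energy_conformal[OF hm s u] energy_conformal[OF hm \<phi>(1) u] f by (simp add: algebra_simps)
    moreover have "min c d * ?I \<le> energy h u" "min c d * ?I \<le> energy (conformal \<phi> h) u"
      using c(2)[OF u] d(2)[OF u] mult_right_mono[of "min c d" c ?I] mult_right_mono[of "min c d" d ?I] I by auto
    then have "(1 - t) * (min c d * ?I) + t * (min c d * ?I) \<le> (1 - t) * energy h u + t * energy (conformal \<phi> h) u"
      using t by (intro add_mono mult_left_mono) auto
    ultimately show ?thesis by (simp add: algebra_simps)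
  qed
  then have "0 < lambda1 (conformal (\<lambda>x. t * \<phi> x) h)"
    unfolding lambda1_pos_iff[OF conformal_metric[OF hm s]] using c(1) d(1) by (intro exI[of _ "min c d"]) auto
  then show ?thesis using conformal_metric[OF hm s] by (simp add: positive_metrics_def)
qed

section \<open>The contraction\<close>

lemma flat_metric_metric: "flat_metric \<in> riemannian_metrics"
  unfolding riemannian_metrics_def
proof (intro CollectI conjI allI ballI impI)
  show "flat_metric \<in> extensional disk" by (simp add: flat_metric_def)
  show "smooth_on_disk (\<lambda>x. flat_metric x $ i $ j)" for i j
    by (rule smooth_on_disk_cong[OF smooth_on_disk_const[of "mat 1 $ i $ j"]]) (simp add: flat_metric_def)
qed (auto simp: flat_metric_def transpose_mat)

lemma topspace_positive_metrics_space: "topspace positive_metrics_space = positive_metrics"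
  by (auto simp: positive_metrics_space_def topspace_metrics_topology positive_metrics_def)

text \<open>Continuity is tested along the punctured point filters of the product, so compatibility
  with \<open>metric_limit\<close> is enough. The filters live on pairs because the family tested is
  \<open>H\<close> itself, with the two projections as arguments.\<close>

lemma continuous_map_homotopy:
  fixes H :: "real \<times> metric_field \<Rightarrow> metric_field"
  assumes im: "\<And>t h. t \<in> {0..1} \<Longrightarrow> h \<in> positive_metrics \<Longrightarrow> H (t, h) \<in> positive_metrics"
    and lim: "\<And>F t h t0 h0. (t \<longlongrightarrow> t0) F \<Longrightarrow> metric_limit F h h0 \<Longrightarrow> \<forall>\<^sub>F a in F. t a \<in> {0..1} \<Longrightarrow> t0 \<in> {0..1}
       \<Longrightarrow> metric_limit (F :: (real \<times> metric_field) filter) (\<lambda>a. H (t a, h a)) (H (t0, h0))"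
  shows "continuous_map (prod_topology (top_of_set {0..1}) positive_metrics_space) positive_metrics_space H"
proof -
  let ?X = "prod_topology (top_of_set {0..1::real}) positive_metrics_space"
  have top: "topspace ?X = {0..1} \<times> positive_metrics" by (simp add: topspace_positive_metrics_space)
  have "continuous_map ?X metrics_topology H"
    unfolding continuous_map_atin
  proof
    fix p assume p: "p \<in> topspace ?X"
    obtain t0 h0 where p': "p = (t0, h0)" by (cases p)
    have t0: "t0 \<in> {0..1}" using p p' top by auto
    let ?F = "atin ?X p"
    have "continuous_map ?X euclideanreal fst"
      using continuous_map_fst[of "top_of_set {0..1::real}" positive_metrics_space] continuous_map_into_fulltopology by blast
    then have 1: "(fst \<longlongrightarrow> t0) ?F" using p unfolding continuous_map_atin by (simp add: p')
    have "continuous_map ?X metrics_topology snd"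
      using continuous_map_snd[of "top_of_set {0..1::real}" positive_metrics_space] continuous_map_into_fulltopology
      unfolding positive_metrics_space_def by blast
    then have 2: "metric_limit ?F snd h0"
      using p unfolding continuous_map_atin limitin_metrics_topology[symmetric] by (simp add: p')
    have 3: "\<forall>\<^sub>F a in ?F. fst a \<in> {0..1}"
      unfolding eventually_atin
      by (rule disjI2, rule exI[of _ "topspace ?X"], intro conjI openin_topspace p) (use top in auto)
    from lim[OF 1 2 3 t0] show "limitin metrics_topology H (H p) ?F"
      unfolding limitin_metrics_topology by (simp add: p')
  qed
  then show ?thesis
    unfolding positive_metrics_space_def[of] using im top
    by (auto simp: continuous_map_in_subtopology positive_metrics_space_def)
qed

theorem theorem4p4:
  shows "topspace positive_metrics_space \<noteq> {} \<and> contractible_space positive_metrics_space"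
proof
  let ?X = positive_metrics_space
  \<comment> \<open>The empty space counts as contractible, so nonemptiness has content of its own;
    the conformal class of the flat metric supplies a point.\<close>
  show "topspace ?X \<noteq> {}"
    using good_factor_positive[OF flat_metric_metric] by (auto simp: topspace_positive_metrics_space)
  have pm: "h \<in> riemannian_metrics" if "h \<in> positive_metrics" for h using that by (simp add: positive_metrics_def)
  define H1 where "H1 = (\<lambda>(t, h). conformal (\<lambda>x. t * good_factor h x) h)"
  \<comment> \<open>The metrics on the segment need not be positive, so each is equipped with its
    own factor. At time 0 this is the end of \<open>H1\<close>; at time 1 it no longer depends on
    the metric.\<close>
  define H2 where "H2 = (\<lambda>(t, h). conformal (good_factor (metric_path t h)) (metric_path t h))"
  have c1: "continuous_map (prod_topology (top_of_set {0..1}) ?X) ?X H1"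
  proof (rule continuous_map_homotopy)
    show "H1 (t, h) \<in> positive_metrics" if "t \<in> {0..1}" "h \<in> positive_metrics" for t h
      unfolding H1_def using that
      by (auto intro: conformal_segment_positive smooth_good_factor good_factor_positive pm)
    fix F :: "(real \<times> metric_field) filter" and t :: "real \<times> metric_field \<Rightarrow> real" and h t0 h0
    assume t: "(t \<longlongrightarrow> t0) F" and h: "metric_limit F h h0"
    show "metric_limit F (\<lambda>a. H1 (t a, h a)) (H1 (t0, h0))"
      unfolding H1_def split
      by (intro metric_limit_conformal h smooth_intros t good_factor_limit always_eventually allI)
  qed
  have c2: "continuous_map (prod_topology (top_of_set {0..1}) ?X) ?X H2"
  proof (rule continuous_map_homotopy)
    show "H2 (t, h) \<in> positive_metrics" if "t \<in> {0..1}" "h \<in> positive_metrics" for t h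
      unfolding H2_def using that by (auto intro: good_factor_positive metric_path_metric pm)
    fix F :: "(real \<times> metric_field) filter" and t :: "real \<times> metric_field \<Rightarrow> real" and h t0 h0
    assume t: "(t \<longlongrightarrow> t0) F" and h: "metric_limit F h h0" and t01: "\<forall>\<^sub>F a in F. t a \<in> {0..1}" "t0 \<in> {0..1}"
    show "metric_limit F (\<lambda>a. H2 (t a, h a)) (H2 (t0, h0))"
      unfolding H2_def split
      by (intro metric_limit_conformal metric_limit_path h t t01 good_factor_limit smooth_good_factor always_eventually allI)
  qed
  have conf0: "conformal (\<lambda>x. 0 * good_factor h x) h = h" if "h \<in> positive_metrics" for h
    using pm[OF that] by (auto simp: conformal_def riemannian_metrics_def fun_eq_iff extensional_def)
  have h1: "homotopic_with (\<lambda>_. True) ?X ?X id (\<lambda>h. conformal (good_factor h) h)"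
    by (subst homotopic_with)
      (auto intro!: exI[of _ H1] c1 conf0[simplified] simp: H1_def topspace_positive_metrics_space)
  have h2: "homotopic_with (\<lambda>_. True) ?X ?X (\<lambda>h. conformal (good_factor h) h) (\<lambda>h. conformal (good_factor flat_metric) flat_metric)"
    by (subst homotopic_with)
      (auto intro!: exI[of _ H2] c2 simp: H2_def topspace_positive_metrics_space metric_path_0 metric_path_1 pm)
  show "contractible_space ?X"
    unfolding contractible_space_def using homotopic_with_trans[OF h1 h2] by blast
qed

end
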